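(* Let $\mathbf{k}$ be an algebraically closed field and let $n,k$ be integers with $1\le k\le\frac{n+1}{2}$. For $r\in\mathbb{Z}$ let $M_r=H^0(Y,\psi^*\mathcal{O}_{\mathbf{P}^k}(r))$, where $\psi\colon Y\to\mathbf{P}^k$ is as in the context, viewed as a graded module over the coordinate ring $B=H^0(Y,\mathcal{O}_Y)$ of the affine cone over the $k$-secant variety of the rational normal curve of degree $n$. The graded modules $M_{-1}$ and $M_{n-2k+1}$ are each generated in a single degree, with spaces of minimal generators $$\bigwedge^k(\mathrm{Sym}^{n-k}U) \quad\text{and}\quad \mathrm{Sym}^{n-2k+1}(\mathrm{D}^k U)$$ respectively. There is an isomorphism $M_{-1}\simeq M_{n-2k+1}$ (up to a shift in grading) which restricts on the spaces of minimal generators to the Hermite reciprocity isomorphism $\bigwedge^k(\mathrm{Sym}^{n-k}U)\cong \mathrm{Sym}^{n-2k+1}(\mathrm{D}^kU)$.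
   Context: $U$ is a $2$-dimensional $\mathbf{k}$-vector space with basis $\{1,x\}$, identified with its dual via a volume form; $\mathrm{D}^j$ is the $j$-th divided power (symmetric tensors). $\mathbf{P}^k=\mathrm{Proj}(\mathrm{Sym}(\mathrm{D}^kU))$ (points: nonzero $g\in\mathrm{Sym}^kU$ up to scaling), with tautological inclusion $\mathcal{O}_{\mathbf{P}^k}(-1)\to\mathrm{Sym}^kU\otimes\mathcal{O}_{\mathbf{P}^k}$. The Schwarzenberger bundle $\mathcal{E}=\mathcal{E}^k_{n-k}$ is the rank $k$ bundle on $\mathbf{P}^k$ defined by $$0\to\mathrm{Sym}^{n-k}U\otimes\mathcal{O}_{\mathbf{P}^k}(-1)\to\mathrm{Sym}^nU\otimes\mathcal{O}_{\mathbf{P}^k}\to\mathcal{E}\to0,$$ the first map being the tautological inclusion followed by multiplication. $Y=\underline{\mathrm{Spec}}_{\mathbf{P}^k}(\mathrm{Sym}(\mathcal{E}))$, with structure map $\psi\colon Y\to\mathbf{P}^k$, is a closed subscheme of $\mathbf{A}^{n+1}\times\mathbf{P}^k$, $\mathbf{A}^{n+1}=\mathrm{Spec}(\mathrm{Sym}(\mathrm{Sym}^nU))$; the projection $Y\to\mathbf{A}^{n+1}$ has image $\widehat{\Sigma}_k$, the affine cone over the $k$-secant variety $\Sigma_k$, and $B=\mathcal{O}_{\widehat\Sigma_k}=H^0(Y,\mathcal{O}_Y)$. Here $\Sigma_k\subset\mathbf{P}^n=\mathrm{Proj}(\mathrm{Sym}(\mathrm{Sym}^nU))$ is the Zariski closure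 of the union of the spans of $k$ points of the rational normal curve $\{[u\otimes\cdots\otimes u]:[u]\in\mathbf{P}^1\}$. Since $M_r=\bigoplus_{d}H^0(\mathbf{P}^k,\mathrm{Sym}^d\mathcal{E}\otimes\mathcal{O}(r))$, the modules are graded; the gradings are normalized by $(M_{n-2k+1})_d=H^0(\mathbf{P}^k,\mathrm{Sym}^d\mathcal{E}\otimes\mathcal{O}(n-2k+1))$ and $(M_{-1})_d=H^0(\mathbf{P}^k,\mathrm{Sym}^{d+k}\mathcal{E}\otimes\mathcal{O}(-1))$, so that the generators are in degree $0$. The identifications are $(M_{n-2k+1})_0=H^0(\mathbf{P}^k,\mathcal{O}(n-2k+1))=\mathrm{Sym}^{n-2k+1}(\mathrm{D}^kU)$, and $(M_{-1})_0=H^0(\mathbf{P}^k,\mathrm{Sym}^k\mathcal{E}(-1))\cong H^k(\mathbf{P}^k,\bigwedge^k(\mathrm{Sym}^{n-k}U)\otimes\mathcal{O}(-k-1))=\bigwedge^k(\mathrm{Sym}^{n-k}U)$, the middle isomorphism coming from the resolution of $\mathrm{Sym}^k\mathcal{E}$ with terms $\bigwedge^i(\mathrm{Sym}^{n-k}U)\otimes\mathrm{Sym}^{k-i}(\mathrm{Sym}^nU)\otimes\mathcal{O}(-i)$, $0\le i\le k$. Hermite reciprocity isomorphism: the maps $\mathrm{D}^kU\otimes\bigwedge^k(\mathrm{Sym}^dU)\to\bigwedge^k(U\otimes\mathrm{Sym}^dU)\to\bigwedge^k(\mathrm{Sym}^{d+1}U)$, where the first sends $(\sum_\alpha a_{\alpha_1}\otimes\cdots\otimes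 a_{\alpha_k})\otimes(b_1\wedge\cdots\wedge b_k)$ to $\sum_\alpha(a_{\alpha_1}\otimes b_1)\wedge\cdots\wedge(a_{\alpha_k}\otimes b_k)$ and the second is $\bigwedge^k$ of multiplication, make $\bigoplus_{d\ge0}\bigwedge^k(\mathrm{Sym}^dU)$ a $\mathrm{Sym}(\mathrm{D}^kU)$-module (action denoted $*$), free of rank one on $x^{k-1}\wedge\cdots\wedge x\wedge1$. The Hermite isomorphism $\bigwedge^k(\mathrm{Sym}^{n-k}U)\cong\mathrm{Sym}^{n-2k+1}(\mathrm{D}^kU)$ is the inverse of $f\mapsto f*(x^{k-1}\wedge\cdots\wedge x\wedge1)$. *)

theory Defs
  imports
    "HOL-Library.Poly_Mapping"
    "HOL-Library.Product_Plus"
    "HOL-Combinatorics.Permutations"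
    "HOL-Computational_Algebra.Polynomial"
    "HOL-Algebra.QuotRing"
    "HOL-Algebra.Module"
begin

section \<open>Linear algebra of binary forms\<close>

text \<open>
  \<open>U\<close> has basis \<open>1, x\<close>, so \<open>Sym\<^sup>d U\<close> is the space of polynomials in \<open>x\<close> of degree at most \<open>d\<close>.

  An element of \<open>\<And>\<^sup>k(Sym\<^sup>d U)\<close> is given by its coordinates in the basis consisting of
  \<open>e\<^sub>T = x\<^bsup>t\<^sub>0\<^esup> \<and> ... \<and> x\<^bsup>t\<^sub>k\<^sub>-\<^sub>1\<^esup>\<close> for \<open>T = {t\<^sub>0 < ... < t\<^sub>k\<^sub>-\<^sub>1}\<close>, a \<open>k\<close>-element subset of \<open>{0..d}\<close>.
\<close>

text \<open>The ring operations \<open>mult\<close> and \<open>one\<close> in a module record carry no meaning.\<close>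

definition ext_module :: "nat \<Rightarrow> nat \<Rightarrow> ('a::field, nat set \<Rightarrow> 'a) module" where
  "ext_module k d =
    \<lparr>carrier = {w. \<forall>T. w T \<noteq> 0 \<longrightarrow> T \<subseteq> {0..d} \<and> card T = k},
     mult = undefined, one = undefined,
     zero = (\<lambda>T. 0), add = (\<lambda>v w T. v T + w T), smult = (\<lambda>c w T. c * w T)\<rparr>"

text \<open>The coordinates of \<open>v\<^sub>0 \<and> ... \<and> v\<^sub>k\<^sub>-\<^sub>1\<close> are the maximal minors of the coefficient matrix.\<close>

definition wedge :: "nat \<Rightarrow> (nat \<Rightarrow> 'a::field poly) \<Rightarrow> nat set \<Rightarrow> 'a" where
  "wedge k v T =
    (if finite T \<and> card T = k
     then \<Sum>p | p permutes {0..<k}.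
            of_int (sign p) * (\<Prod>j<k. poly.coeff (v j) (sorted_list_of_set T ! p j))
     else 0)"

text \<open>
  A tensor in \<open>U\<^bsup>\<otimes>k\<^esup>\<close> is given by its coordinates \<open>t J\<close>, for \<open>J \<subseteq> {0..<k}\<close>, in the basis of pure
  tensors having \<open>x\<close> in the positions belonging to \<open>J\<close> and \<open>1\<close> elsewhere. It lies in the
  divided power \<open>D\<^sup>k U\<close> if it is symmetric.
\<close>

definition tensor_factor :: "nat set \<Rightarrow> nat \<Rightarrow> 'a::field poly" where
  "tensor_factor J j = (if j \<in> J then monom 1 1 else 1)"

definition divided_power :: "nat \<Rightarrow> (nat set \<Rightarrow> 'a::field) set" where
  "divided_power k =
    {t. (\<forall>J. t J \<noteq> 0 \<longrightarrow> J \<subseteq> {0..<k}) \<and> (\<forall>p J. p permutes {0..<k} \<longrightarrow> t (p ` J) = t J)}"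

text \<open>
  The volume form on \<open>U\<close> with \<open>vol 1 x = 1\<close> identifies \<open>U\<close> with its dual, and hence \<open>D\<^sup>k U\<close> with
  the dual of \<open>Sym\<^sup>k U\<close>.
\<close>

definition vol :: "'a::field poly \<Rightarrow> 'a poly \<Rightarrow> 'a" where
  "vol a b = poly.coeff a 0 * poly.coeff b 1 - poly.coeff a 1 * poly.coeff b 0"

text \<open>The pairing of a symmetric tensor \<open>t\<close> with the product \<open>b\<^sub>0 \<cdots> b\<^sub>k\<^sub>-\<^sub>1\<close> of elements of \<open>U\<close>.\<close>

definition tensor_pairing :: "nat \<Rightarrow> (nat set \<Rightarrow> 'a::field) \<Rightarrow> (nat \<Rightarrow> 'a poly) \<Rightarrow> 'a" where
  "tensor_pairing k t b = (\<Sum>J\<in>Pow {0..<k}. t J * (\<Prod>j<k. vol (tensor_factor J j) (b j)))"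

text \<open>
  The basis \<open>z\<^sub>0, ..., z\<^sub>k\<close> of \<open>D\<^sup>k U\<close> dual to the basis \<open>1, x, ..., x\<^sup>k\<close> of \<open>Sym\<^sup>k U\<close>; duality is
  lemma \<open>tensor_pairing_coord_tensor\<close> below.
\<close>

definition coord_tensor :: "nat \<Rightarrow> nat \<Rightarrow> nat set \<Rightarrow> 'a::field" where
  "coord_tensor k i J = (if J \<subseteq> {0..<k} \<and> card J = k - i then (- 1) ^ (k - i) else 0)"

lemma coord_tensor_divided_power: "coord_tensor k i \<in> divided_power k"
proof -
  have "p ` J \<subseteq> {0..<k} \<longleftrightarrow> J \<subseteq> {0..<k}" "card (p ` J) = card J"
    if p: "p permutes {0..<k}" for p and J :: "nat set"
  proof -
    have "p ` J \<subseteq> p ` {0..<k} \<longleftrightarrow> J \<subseteq> {0..<k}"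
      using permutes_inj[OF p] by (simp add: inj_image_subset_iff)
    then show "p ` J \<subseteq> {0..<k} \<longleftrightarrow> J \<subseteq> {0..<k}" by (simp add: permutes_image[OF p])
    show "card (p ` J) = card J"
      using permutes_inj[OF p] by (simp add: card_image inj_on_subset)
  qed
  then show ?thesis by (auto simp: divided_power_def coord_tensor_def)
qed

lemma tensor_pairing_coord_tensor:
  assumes "I \<subseteq> {0..<k}" and "i \<le> k"
  shows "tensor_pairing k (coord_tensor k i :: nat set \<Rightarrow> 'a::field) (tensor_factor I)
           = (if i = card I then 1 else 0)"
proof -
  have vol: "vol (tensor_factor J j) (tensor_factor I j :: 'a poly)
      = (if j \<in> I then if j \<in> J then 0 else 1 else if j \<in> J then - 1 else 0)" for J j
    by (auto simp: vol_def tensor_factor_def)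
  have fin: "finite I" and cardI: "card I \<le> k"
    using assms(1) finite_subset card_mono[of "{0..<k}" I] by auto
  have zero: "(\<Prod>j<k. vol (tensor_factor J j) (tensor_factor I j :: 'a poly)) = 0"
    if J: "J \<in> Pow {0..<k}" "J \<noteq> {0..<k} - I" for J
  proof -
    have "\<exists>j<k. (j \<in> I \<longleftrightarrow> j \<in> J)" using J assms(1) by auto
    then show ?thesis by (auto simp: vol intro!: prod_zero)
  qed
  have "(\<Prod>j<k. vol (tensor_factor ({0..<k} - I) j) (tensor_factor I j :: 'a poly))
      = (\<Prod>j<k. if j \<in> I then 1 else - 1)"
    by (intro prod.cong) (auto simp: vol)
  also have "\<dots> = (\<Prod>j\<in>{..<k} - I. - 1)"
    by (intro prod.mono_neutral_cong_right) auto
  also have "\<dots> = (- 1) ^ (k - card I)"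
    using assms(1) fin by (simp add: card_Diff_subset atLeast0LessThan)
  finally have main: "(\<Prod>j<k. vol (tensor_factor ({0..<k} - I) j) (tensor_factor I j :: 'a poly))
      = (- 1) ^ (k - card I)" .
  have "tensor_pairing k (coord_tensor k i :: nat set \<Rightarrow> 'a) (tensor_factor I)
      = (\<Sum>J\<in>{{0..<k} - I}. coord_tensor k i J
           * (\<Prod>j<k. vol (tensor_factor J j) (tensor_factor I j :: 'a poly)))"
    unfolding tensor_pairing_def by (intro sum.mono_neutral_right) (auto simp: zero)
  also have "\<dots> = coord_tensor k i ({0..<k} - I) * (- 1) ^ (k - card I)"
    by (simp add: main)
  also have "\<dots> = (if i = card I then 1 else 0)"
    using assms fin cardI
    by (auto simp: coord_tensor_def card_Diff_subset simp flip: power_add mult_2)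
  finally show ?thesis .
qed

text \<open>
  The action of \<open>D\<^sup>k U\<close>, namely
  \<open>D\<^sup>k U \<otimes> \<And>\<^sup>k(Sym\<^sup>d U) \<rightarrow> \<And>\<^sup>k(U \<otimes> Sym\<^sup>d U) \<rightarrow> \<And>\<^sup>k(Sym\<^bsup>d+1\<^esup> U)\<close>, computed on the basis vectors \<open>e\<^sub>T\<close>.
\<close>

definition tensor_act ::
    "nat \<Rightarrow> (nat set \<Rightarrow> 'a::field) \<Rightarrow> (nat set \<Rightarrow> 'a) \<Rightarrow> nat set \<Rightarrow> 'a" where
  "tensor_act k t w S =
    (\<Sum>T | w T \<noteq> 0. \<Sum>J\<in>Pow {0..<k}.
       w T * t J * wedge k (\<lambda>j. tensor_factor J j * monom 1 (sorted_list_of_set T ! j)) S)"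


section \<open>The scheme \<open>Y\<close> and its line bundles\<close>

text \<open>
  All coordinate rings below are quotients of subrings of the ring of polynomials in
  \<open>y\<^sub>0, y\<^sub>1, ...\<close> and Laurent polynomials in \<open>z\<^sub>0, z\<^sub>1, ...\<close>. The key \<open>(a, b)\<close> stands for the monomial
  \<open>z\<^sup>a y\<^sup>b\<close>. Here \<open>y\<^sub>i\<close> is the basis element \<open>x\<^sup>i\<close> of \<open>Sym\<^sup>n U\<close>, and \<open>z\<^sub>i\<close> the basis element
  \<open>coord_tensor k i\<close> of \<open>D\<^sup>k U\<close>; the latter are the homogeneous coordinates on \<open>P\<^sup>k\<close>, so that the
  tautological element of \<open>Sym\<^sup>k U \<otimes> D\<^sup>k U\<close> is \<open>\<Sum>i\<le>k. z\<^sub>i x\<^sup>i\<close>.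
\<close>

type_synonym 'a bipoly = "((nat \<Rightarrow>\<^sub>0 int) \<times> (nat \<Rightarrow>\<^sub>0 nat)) \<Rightarrow>\<^sub>0 'a"

definition zvar :: "nat \<Rightarrow> 'a::field bipoly" where
  "zvar i = Poly_Mapping.single (Poly_Mapping.single i 1, 0) 1"

definition yvar :: "nat \<Rightarrow> 'a::field bipoly" where
  "yvar i = Poly_Mapping.single (0, Poly_Mapping.single i 1) 1"

definition deg_z :: "(nat \<Rightarrow>\<^sub>0 int) \<Rightarrow> int" where
  "deg_z a = (\<Sum>i\<in>Poly_Mapping.keys a. Poly_Mapping.lookup a i)"

definition deg_y :: "(nat \<Rightarrow>\<^sub>0 nat) \<Rightarrow> int" where
  "deg_y b = (\<Sum>i\<in>Poly_Mapping.keys b. int (Poly_Mapping.lookup b i))"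

definition homog_z :: "int \<Rightarrow> 'a::field bipoly set" where
  "homog_z r = {p. \<forall>(a, b)\<in>Poly_Mapping.keys p. deg_z a = r}"

definition homog_y :: "int \<Rightarrow> 'a::field bipoly set" where
  "homog_y d = {p. \<forall>(a, b)\<in>Poly_Mapping.keys p. deg_y b = d}"

text \<open>\<open>Sym\<^sup>m(D\<^sup>k U)\<close>: the forms of degree \<open>m\<close> in \<open>z\<^sub>0, ..., z\<^sub>k\<close>.\<close>

definition sym_divided_module :: "nat \<Rightarrow> nat \<Rightarrow> ('a::field, 'a bipoly) module" where
  "sym_divided_module k m =
    \<lparr>carrier = {f. \<forall>(a, b)\<in>Poly_Mapping.keys f.
                   Poly_Mapping.keys a \<subseteq> {0..k} \<and> (\<forall>i. Poly_Mapping.lookup a i \<ge> 0) \<and> b = 0}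
                 \<inter> homog_z (int m),
     mult = undefined, one = undefined,
     zero = 0, add = (+), smult = (\<lambda>c f. Poly_Mapping.single 0 c * f)\<rparr>"

text \<open>
  \<open>S\<^sub>I[y\<^sub>0, ..., y\<^sub>n]\<close>, where \<open>S\<^sub>I\<close> is the localization of \<open>S = Sym(D\<^sup>k U)\<close> at \<open>\<Prod>i\<in>I. z\<^sub>i\<close>.
\<close>

definition loc_ring :: "nat \<Rightarrow> nat \<Rightarrow> nat set \<Rightarrow> 'a::field bipoly ring" where
  "loc_ring n k I =
    \<lparr>carrier = {p. \<forall>(a, b)\<in>Poly_Mapping.keys p.
                   Poly_Mapping.keys a \<subseteq> {0..k} \<and> Poly_Mapping.keys b \<subseteq> {0..n} \<and>
                   (\<forall>i. Poly_Mapping.lookup a i < 0 \<longrightarrow> i \<in> I)},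
     mult = (*), one = 1, zero = 0, add = (+)\<rparr>"

text \<open>
  The image of the basis element \<open>x\<^sup>j\<close> of \<open>Sym\<^bsup>n-k\<^esup> U\<close> under
  \<open>Sym\<^bsup>n-k\<^esup> U \<otimes> O(-1) \<rightarrow> Sym\<^sup>n U \<otimes> O\<close>, i.e. the product of \<open>\<Sum>i\<le>k. z\<^sub>i x\<^sup>i\<close> and \<open>x\<^sup>j\<close>.
\<close>

definition lin_form :: "nat \<Rightarrow> nat \<Rightarrow> 'a::field bipoly" where
  "lin_form k j = (\<Sum>i\<le>k. zvar i * yvar (i + j))"

definition rel_ideal :: "nat \<Rightarrow> nat \<Rightarrow> nat set \<Rightarrow> 'a::field bipoly set" where
  "rel_ideal n k I = Idl\<^bsub>loc_ring n k I\<^esub> (lin_form k ` {0..n - k})"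

text \<open>
  Let \<open>D\<^sub>I\<close> be the standard open subset of \<open>P\<^sup>k\<close> where \<open>z\<^sub>i \<noteq> 0\<close> for all \<open>i \<in> I\<close>. As \<open>E\<close> is the
  cokernel of \<open>Sym\<^bsup>n-k\<^esup> U \<otimes> O(-1) \<rightarrow> Sym\<^sup>n U \<otimes> O\<close>, the sheaf \<open>Sym E\<close> is the quotient of
  \<open>Sym(Sym\<^sup>n U) \<otimes> O\<close> by the ideal generated by the image. Hence, for nonempty \<open>I\<close>, the following ring
  is the direct sum over all integers \<open>r\<close> of the sections of \<open>\<psi>\<^sup>*O(r)\<close> on the affine open set
  \<open>\<psi>\<^bsup>-1\<^esup>(D\<^sub>I)\<close> of \<open>Y\<close>, that is, of the sections of \<open>Sym E \<otimes> O(r)\<close> on \<open>D\<^sub>I\<close>.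
\<close>

definition sec_ring :: "nat \<Rightarrow> nat \<Rightarrow> nat set \<Rightarrow> 'a::field bipoly set ring" where
  "sec_ring n k I = loc_ring n k I Quot rel_ideal n k I"

definition sections :: "nat \<Rightarrow> nat \<Rightarrow> int \<Rightarrow> nat set \<Rightarrow> 'a::field bipoly set set" where
  "sections n k r I = {X \<in> carrier (sec_ring n k I). X \<inter> homog_z r \<noteq> {}}"

definition restr :: "nat \<Rightarrow> nat \<Rightarrow> nat set \<Rightarrow> 'a::field bipoly set \<Rightarrow> 'a bipoly set" where
  "restr n k I X = X <+>\<^bsub>loc_ring n k I\<^esub> rel_ideal n k I"

text \<open>
  Global sections: families of sections on the sets \<open>\<psi>\<^bsup>-1\<^esup>(D\<^bsub>{i}\<^esub>)\<close>, which cover \<open>Y\<close>, agreeing on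
  the overlaps.
\<close>

type_synonym 'a gsection = "nat \<Rightarrow> 'a bipoly set"

definition global_sections :: "nat \<Rightarrow> nat \<Rightarrow> int \<Rightarrow> 'a::field gsection set" where
  "global_sections n k r =
    {s \<in> (\<Pi>\<^sub>E i\<in>{0..k}. sections n k r {i}).
       \<forall>i\<in>{0..k}. \<forall>j\<in>{0..k}. restr n k {i, j} (s i) = restr n k {i, j} (s j)}"

definition gmult :: "nat \<Rightarrow> nat \<Rightarrow> 'a::field gsection \<Rightarrow> 'a gsection \<Rightarrow> 'a gsection" where
  "gmult n k s t = (\<lambda>i\<in>{0..k}. s i \<otimes>\<^bsub>sec_ring n k {i}\<^esub> t i)"

definition gadd :: "nat \<Rightarrow> nat \<Rightarrow> 'a::field gsection \<Rightarrow> 'a gsection \<Rightarrow> 'a gsection" where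
  "gadd n k s t = (\<lambda>i\<in>{0..k}. s i \<oplus>\<^bsub>sec_ring n k {i}\<^esub> t i)"

text \<open>The family of sections defined by a polynomial.\<close>

definition gpoly :: "nat \<Rightarrow> nat \<Rightarrow> 'a::field bipoly \<Rightarrow> 'a gsection" where
  "gpoly n k f = (\<lambda>i\<in>{0..k}. rel_ideal n k {i} +>\<^bsub>loc_ring n k {i}\<^esub> f)"

text \<open>\<open>B = H\<^sup>0(Y, O\<^sub>Y)\<close>, the coordinate ring of the affine cone over the \<open>k\<close>-secant variety.\<close>

definition B_ring :: "nat \<Rightarrow> nat \<Rightarrow> 'a::field gsection ring" where
  "B_ring n k =
    \<lparr>carrier = global_sections n k 0, mult = gmult n k, one = gpoly n k 1,
     zero = gpoly n k 0, add = gadd n k\<rparr>"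

text \<open>\<open>M\<^sub>r = H\<^sup>0(Y, \<psi>\<^sup>*O(r))\<close> as a \<open>B\<close>-module.\<close>

definition M_module :: "nat \<Rightarrow> nat \<Rightarrow> int \<Rightarrow> ('a::field gsection, 'a gsection) module" where
  "M_module n k r =
    \<lparr>carrier = global_sections n k r, mult = undefined, one = undefined,
     zero = gpoly n k 0, add = gadd n k, smult = gmult n k\<rparr>"

text \<open>
  \<open>H\<^sup>0(P\<^sup>k, Sym\<^sup>d E \<otimes> O(r))\<close> as a vector space; it is zero for \<open>d < 0\<close>. For \<open>r = 0\<close> these are the
  graded pieces of \<open>B\<close>.
\<close>

definition M_piece :: "nat \<Rightarrow> nat \<Rightarrow> int \<Rightarrow> int \<Rightarrow> ('a::field, 'a gsection) module" where
  "M_piece n k r d =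
    \<lparr>carrier = {s \<in> global_sections n k r. \<forall>i\<in>{0..k}. s i \<inter> homog_z r \<inter> homog_y d \<noteq> {}},
     mult = undefined, one = undefined,
     zero = gpoly n k 0, add = gadd n k,
     smult = (\<lambda>c. gmult n k (gpoly n k (Poly_Mapping.single 0 c)))\<rparr>"


text \<open>For \<open>k \<le> n\<close> these structures are indeed a commutative ring and modules over it.\<close>

lemma deg_z_add: "deg_z (a + b) = deg_z a + deg_z b"
proof -
  have *: "deg_z c = (\<Sum>i\<in>A. Poly_Mapping.lookup c i)"
    if "finite A" "Poly_Mapping.keys c \<subseteq> A" for A c
    unfolding deg_z_def using that by (intro sum.mono_neutral_left) (auto simp: in_keys_iff)
  let ?A = "Poly_Mapping.keys a \<union> Poly_Mapping.keys b"
  show ?thesis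
    using Poly_Mapping.keys_add[of a b]
    by (simp add: *[of ?A a] *[of ?A b] *[of ?A "a + b"] lookup_add sum.distrib)
qed

lemma homog_z_0: "0 \<in> homog_z r"
  and homog_z_1: "1 \<in> homog_z 0"
  and homog_z_uminus: "p \<in> homog_z r \<Longrightarrow> - p \<in> homog_z r"
  by (auto simp: homog_z_def deg_z_def zero_prod_def)

lemma homog_z_add: "p \<in> homog_z r \<Longrightarrow> q \<in> homog_z r \<Longrightarrow> p + q \<in> homog_z r"
  using Poly_Mapping.keys_add[of p q] unfolding homog_z_def by blast

lemma homog_z_mult: "p \<in> homog_z r \<Longrightarrow> q \<in> homog_z s \<Longrightarrow> p * q \<in> homog_z (r + s)"
proof -
  assume p: "p \<in> homog_z r" and q: "q \<in> homog_z s"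
  have "deg_z (fst w) = r + s" if w: "w \<in> Poly_Mapping.keys (p * q)" for w :: "(nat \<Rightarrow>\<^sub>0 int) \<times> (nat \<Rightarrow>\<^sub>0 nat)"
  proof -
    obtain u v where "w = u + v" "u \<in> Poly_Mapping.keys p" "v \<in> Poly_Mapping.keys q"
      using Poly_Mapping.keys_mult[of p q] w by blast
    then show ?thesis using p q by (cases u; cases v) (auto simp: homog_z_def deg_z_add)
  qed
  then show ?thesis by (auto simp: homog_z_def)
qed

lemma loc_ring_cring: "cring (loc_ring n k I :: 'a::field bipoly ring)"
proof -
  let ?L = "loc_ring n k I :: 'a bipoly ring"
  define mon :: "((nat \<Rightarrow>\<^sub>0 int) \<times> (nat \<Rightarrow>\<^sub>0 nat)) set" where "mon = {(a, b). Poly_Mapping.keys a \<subseteq> {0..k} \<and> Poly_Mapping.keys b \<subseteq> {0..n}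
      \<and> (\<forall>i. Poly_Mapping.lookup a i < 0 \<longrightarrow> i \<in> I)}"
  have carr: "p \<in> carrier ?L \<longleftrightarrow> Poly_Mapping.keys p \<subseteq> mon" for p
    by (auto simp: loc_ring_def mon_def)
  have mon: "u + v \<in> mon" if u: "u \<in> mon" and v: "v \<in> mon" for u v :: "(nat \<Rightarrow>\<^sub>0 int) \<times> (nat \<Rightarrow>\<^sub>0 nat)"
  proof -
    obtain a b c d where eq: "u = (a, b)" "v = (c, d)" by (metis surj_pair)
    have "i \<in> I" if "Poly_Mapping.lookup a i + Poly_Mapping.lookup c i < 0" for i
    proof -
      have "Poly_Mapping.lookup a i < 0 \<or> Poly_Mapping.lookup c i < 0" using that by linarith
      then show ?thesis using u v eq by (auto simp: mon_def)
    qed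
    then show ?thesis
      using u v Poly_Mapping.keys_add[of a c] Poly_Mapping.keys_add[of b d]
      unfolding eq by (auto simp: lookup_add mon_def)
  qed
  have m: "p * q \<in> carrier ?L" if "p \<in> carrier ?L" "q \<in> carrier ?L" for p q
    unfolding carr
  proof
    fix w assume "w \<in> Poly_Mapping.keys (p * q)"
    then obtain u v where "w = u + v" "u \<in> Poly_Mapping.keys p" "v \<in> Poly_Mapping.keys q"
      using Poly_Mapping.keys_mult[of p q] by blast
    then show "w \<in> mon" using mon[of u v] that unfolding carr by blast
  qed
  have a: "p + q \<in> carrier ?L" if "p \<in> carrier ?L" "q \<in> carrier ?L" for p q
    using that Poly_Mapping.keys_add[of p q] unfolding carr by blast
  have u: "- p \<in> carrier ?L" if "p \<in> carrier ?L" for p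
    using that unfolding carr by simp
  have c0: "0 \<in> carrier ?L" and c1: "1 \<in> carrier ?L"
    unfolding carr by (simp_all add: zero_prod_def mon_def)
  have ops: "x \<otimes>\<^bsub>?L\<^esub> y = x * y" "x \<oplus>\<^bsub>?L\<^esub> y = x + y" "\<one>\<^bsub>?L\<^esub> = 1" "\<zero>\<^bsub>?L\<^esub> = 0" for x y
    by (simp_all add: loc_ring_def)
  have "abelian_group ?L"
  proof (rule abelian_groupI)
    show "\<exists>y\<in>carrier ?L. y \<oplus>\<^bsub>?L\<^esub> p = \<zero>\<^bsub>?L\<^esub>" if "p \<in> carrier ?L" for p
      using u[OF that] by (intro bexI[of _ "- p"]) (simp_all add: ops)
  qed (use a c0 in \<open>simp_all add: ops add_ac\<close>)
  moreover have "comm_monoid ?L"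
    by (rule comm_monoidI) (use m c1 in \<open>simp_all add: ops mult_ac\<close>)
  ultimately show ?thesis
    by (rule cringI) (simp add: ops distrib_right)
qed


lemma loc_ring_mono: "I \<subseteq> I' \<Longrightarrow> carrier (loc_ring n k I) \<subseteq> carrier (loc_ring n k I')"
  by (auto simp: loc_ring_def split: prod.splits)

lemma lin_form_loc:
  assumes "k \<le> n" "j \<le> n - k"
  shows "(lin_form k j :: 'a::field bipoly) \<in> carrier (loc_ring n k I)"
proof -
  have "Poly_Mapping.keys (lin_form k j :: 'a bipoly)
      \<subseteq> (\<Union>i\<le>k. {(Poly_Mapping.single i 1, Poly_Mapping.single (i + j) 1)})"
    unfolding lin_form_def
    by (rule order_trans[OF Poly_Mapping.keys_sum])
      (auto simp: zvar_def yvar_def mult_single split: if_splits)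
  then show ?thesis
    using assms by (fastforce simp: loc_ring_def lookup_single when_def split: if_splits)
qed

lemma rel_ideal_ideal:
  assumes "k \<le> n"
  shows "ideal (rel_ideal n k I :: 'a::field bipoly set) (loc_ring n k I)"
  unfolding rel_ideal_def using assms
  by (intro ring.genideal_ideal cring.axioms(1) loc_ring_cring) (auto intro: lin_form_loc)

lemma rel_ideal_mono:
  assumes "k \<le> n" "I \<subseteq> I'"
  shows "(rel_ideal n k I :: 'a::field bipoly set) \<subseteq> rel_ideal n k I'"
proof -
  let ?L = "loc_ring n k I :: 'a bipoly ring" and ?L' = "loc_ring n k I' :: 'a bipoly ring"
  interpret L: cring ?L by (rule loc_ring_cring)
  interpret L': cring ?L' by (rule loc_ring_cring)
  have sub: "carrier ?L \<subseteq> carrier ?L'" by (rule loc_ring_mono[OF assms(2)])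
  have "(\<lambda>p. p) \<in> ring_hom ?L ?L'"
  proof (rule ring_hom_memI)
    show "p \<in> carrier ?L'" if "p \<in> carrier ?L" for p using that sub by blast
  qed (simp_all add: loc_ring_def)
  then have "ring_hom_ring ?L ?L' (\<lambda>p. p)"
    by (rule ring_hom_ringI2[OF L.ring_axioms L'.ring_axioms])
  then have I: "ideal {p \<in> carrier ?L. p \<in> rel_ideal n k I'} ?L"
    by (rule ring_hom_ring.ideal_vimage[OF _ rel_ideal_ideal[OF assms(1)]])
  have lin: "lin_form k ` {0..n - k} \<subseteq> carrier (loc_ring n k A)" for A
    using assms(1) by (auto intro: lin_form_loc)
  have gens: "lin_form k ` {0..n - k} \<subseteq> {p \<in> carrier ?L. p \<in> rel_ideal n k I'}"
    using L'.genideal_self[OF lin] lin unfolding rel_ideal_def by blast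
  have "rel_ideal n k I \<subseteq> {p \<in> carrier ?L. p \<in> rel_ideal n k I'}"
    using L.genideal_minimal[OF I gens] by (simp add: rel_ideal_def)
  then show ?thesis by blast
qed

definition sec_coset :: "nat \<Rightarrow> nat \<Rightarrow> nat set \<Rightarrow> 'a::field bipoly \<Rightarrow> 'a bipoly set" where
  "sec_coset n k I f = rel_ideal n k I +>\<^bsub>loc_ring n k I\<^esub> f"

lemma gpoly_sec_coset: "gpoly n k f = (\<lambda>i\<in>{0..k}. sec_coset n k {i} f)"
  by (simp add: gpoly_def sec_coset_def)

lemma sec_ring_cring: "k \<le> n \<Longrightarrow> cring (sec_ring n k I)"
  unfolding sec_ring_def by (intro ideal.quotient_is_cring rel_ideal_ideal loc_ring_cring)

lemma sec_coset_hom: "k \<le> n \<Longrightarrow> sec_coset n k I \<in> ring_hom (loc_ring n k I) (sec_ring n k I)"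
  unfolding sec_ring_def sec_coset_def[abs_def] by (intro ideal.rcos_ring_hom rel_ideal_ideal)

lemma sec_coset_simps:
  assumes "k \<le> n"
  shows "f \<in> carrier (loc_ring n k I) \<Longrightarrow> sec_coset n k I f \<in> carrier (sec_ring n k I)"
    and "f \<in> carrier (loc_ring n k I) \<Longrightarrow> g \<in> carrier (loc_ring n k I) \<Longrightarrow>
      sec_coset n k I f \<oplus>\<^bsub>sec_ring n k I\<^esub> sec_coset n k I g = sec_coset n k I (f + g)"
    and "f \<in> carrier (loc_ring n k I) \<Longrightarrow> g \<in> carrier (loc_ring n k I) \<Longrightarrow>
      sec_coset n k I f \<otimes>\<^bsub>sec_ring n k I\<^esub> sec_coset n k I g = sec_coset n k I (f * g)"
    and "\<one>\<^bsub>sec_ring n k I\<^esub> = sec_coset n k I 1"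
    and "\<zero>\<^bsub>sec_ring n k I\<^esub> = sec_coset n k I 0"
proof -
  note h = sec_coset_hom[OF assms, of I]
  show "f \<in> carrier (loc_ring n k I) \<Longrightarrow> sec_coset n k I f \<in> carrier (sec_ring n k I)"
    by (rule ring_hom_closed[OF h])
  show "f \<in> carrier (loc_ring n k I) \<Longrightarrow> g \<in> carrier (loc_ring n k I) \<Longrightarrow>
      sec_coset n k I f \<oplus>\<^bsub>sec_ring n k I\<^esub> sec_coset n k I g = sec_coset n k I (f + g)"
    using ring_hom_add[OF h, of f g] by (simp add: loc_ring_def)
  show "f \<in> carrier (loc_ring n k I) \<Longrightarrow> g \<in> carrier (loc_ring n k I) \<Longrightarrow>
      sec_coset n k I f \<otimes>\<^bsub>sec_ring n k I\<^esub> sec_coset n k I g = sec_coset n k I (f * g)"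
    using ring_hom_mult[OF h, of f g] by (simp add: loc_ring_def)
  show "\<one>\<^bsub>sec_ring n k I\<^esub> = sec_coset n k I 1"
    using ring_hom_one[OF h, symmetric] by (simp add: loc_ring_def)
  show "\<zero>\<^bsub>sec_ring n k I\<^esub> = sec_coset n k I 0"
    using ring_hom_zero[OF h cring.axioms(1)[OF loc_ring_cring]
        cring.axioms(1)[OF sec_ring_cring[OF assms]], symmetric]
    by (simp add: loc_ring_def)
qed

lemma sec_coset_eqI:
  assumes "k \<le> n" "X \<in> carrier (sec_ring n k I)" "p \<in> X"
  shows "p \<in> carrier (loc_ring n k I)" "X = sec_coset n k I p"
proof -
  interpret L: cring "loc_ring n k I" by (rule loc_ring_cring)
  interpret J: ideal "rel_ideal n k I" "loc_ring n k I" using assms(1) by (rule rel_ideal_ideal)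
  obtain g where g: "g \<in> carrier (loc_ring n k I)"
      "X = rel_ideal n k I +>\<^bsub>loc_ring n k I\<^esub> g"
    using assms(2) by (auto simp: sec_ring_def FactRing_def A_RCOSETS_def')
  show "X = sec_coset n k I p"
    using L.a_repr_independence[of p "rel_ideal n k I" g] g assms(3) J.a_subgroup
    by (simp add: sec_coset_def)
  show "p \<in> carrier (loc_ring n k I)"
    using L.a_r_coset_subset_G[OF J.a_subset g(1)] g assms(3) by auto
qed

lemma sec_coset_self:
  assumes "k \<le> n" "f \<in> carrier (loc_ring n k I)"
  shows "f \<in> sec_coset n k I f"
proof -
  interpret J: ideal "rel_ideal n k I" "loc_ring n k I" using assms(1) by (rule rel_ideal_ideal)
  show ?thesis using J.a_rcos_self[OF assms(2)] by (simp add: sec_coset_def)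
qed

lemma restr_sec_coset:
  assumes "k \<le> n" "I \<subseteq> I'"
  shows "restr n k I' (sec_coset n k I f) = sec_coset n k I' (f :: 'a::field bipoly)"
proof -
  let ?J = "rel_ideal n k I :: 'a bipoly set" and ?J' = "rel_ideal n k I' :: 'a bipoly set"
  interpret J: ideal ?J "loc_ring n k I" using assms(1) by (rule rel_ideal_ideal)
  interpret J': ideal ?J' "loc_ring n k I'" using assms(1) by (rule rel_ideal_ideal)
  have closed: "p + q \<in> ?J'" if "p \<in> ?J'" "q \<in> ?J'" for p q
    using additive_subgroup.a_closed[OF J'.additive_subgroup_axioms that] by (simp add: loc_ring_def)
  have zero: "0 \<in> ?J"
    using J.additive_subgroup_axioms additive_subgroup.zero_closed[of ?J "loc_ring n k I"]
    by (simp add: loc_ring_def)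
  have sub: "?J \<subseteq> ?J'" by (rule rel_ideal_mono[OF assms])
  have "restr n k I' (sec_coset n k I f) = {(h + f) + h' | h h'. h \<in> ?J \<and> h' \<in> ?J'}"
    by (auto simp: restr_def sec_coset_def a_r_coset_def' set_add_def' loc_ring_def)
  also have "\<dots> = {h' + f | h'. h' \<in> ?J'}"
  proof (intro equalityI subsetI)
    fix p assume "p \<in> {(h + f) + h' | h h'. h \<in> ?J \<and> h' \<in> ?J'}"
    then obtain h h' where "p = (h + h') + f" "h \<in> ?J" "h' \<in> ?J'" by (auto simp: algebra_simps)
    with closed sub show "p \<in> {h' + f | h'. h' \<in> ?J'}" by blast
  next
    fix p assume "p \<in> {h' + f | h'. h' \<in> ?J'}"
    then obtain h' where "p = (0 + f) + h'" "h' \<in> ?J'" by (auto simp: algebra_simps)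
    with zero show "p \<in> {(h + f) + h' | h h'. h \<in> ?J \<and> h' \<in> ?J'}" by blast
  qed
  also have "\<dots> = sec_coset n k I' f"
    by (auto simp: sec_coset_def a_r_coset_def' loc_ring_def)
  finally show ?thesis .
qed

text \<open>Global sections in terms of local representatives.\<close>

lemma global_sections_iff:
  assumes "k \<le> n"
  shows "s \<in> global_sections n k r \<longleftrightarrow>
    (\<exists>f. (\<forall>i\<in>{0..k}. f i \<in> carrier (loc_ring n k {i}) \<inter> homog_z r)
       \<and> s = (\<lambda>i\<in>{0..k}. sec_coset n k {i} (f i))
       \<and> (\<forall>i\<in>{0..k}. \<forall>j\<in>{0..k}. sec_coset n k {i, j} (f i) = sec_coset n k {i, j} (f j)))"
    (is "_ \<longleftrightarrow> (\<exists>f. ?P f)")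
proof
  assume s: "s \<in> global_sections n k r"
  then have "\<forall>i\<in>{0..k}. \<exists>p. p \<in> s i \<inter> homog_z r" and
    car: "\<And>i. i \<in> {0..k} \<Longrightarrow> s i \<in> carrier (sec_ring n k {i})" and
    ext: "s \<in> extensional {0..k}"
    by (auto simp: global_sections_def sections_def PiE_iff)
  then obtain f where f: "\<And>i. i \<in> {0..k} \<Longrightarrow> f i \<in> s i \<inter> homog_z r" by metis
  have eq: "s i = sec_coset n k {i} (f i)" "f i \<in> carrier (loc_ring n k {i})" if "i \<in> {0..k}" for i
    using sec_coset_eqI[OF assms car[OF that]] f[OF that] by auto
  have agree: "sec_coset n k {i, j} (f i) = sec_coset n k {i, j} (f j)"
    if "i \<in> {0..k}" "j \<in> {0..k}" for i j
  proof -
    have "restr n k {i, j} (s i) = restr n k {i, j} (s j)"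
      using s that unfolding global_sections_def by blast
    then show ?thesis
      unfolding eq(1)[OF that(1)] eq(1)[OF that(2)] by (simp add: restr_sec_coset[OF assms])
  qed
  have "s = (\<lambda>i\<in>{0..k}. sec_coset n k {i} (f i))"
    by (rule extensionalityI[of _ "{0..k}"]) (use ext eq(1) in simp_all)
  moreover have "\<forall>i\<in>{0..k}. f i \<in> carrier (loc_ring n k {i}) \<inter> homog_z r"
    using eq(2) f by blast
  ultimately show "\<exists>f. ?P f" using agree by blast
next
  assume "\<exists>f. ?P f"
  then obtain f where f: "\<And>i. i \<in> {0..k} \<Longrightarrow> f i \<in> carrier (loc_ring n k {i}) \<inter> homog_z r"
    and s: "s = (\<lambda>i\<in>{0..k}. sec_coset n k {i} (f i))"
    and agree: "\<And>i j. i \<in> {0..k} \<Longrightarrow> j \<in> {0..k} \<Longrightarrow>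
      sec_coset n k {i, j} (f i) = sec_coset n k {i, j} (f j)" by blast
  have "sec_coset n k {i} (f i) \<in> sections n k r {i}" if "i \<in> {0..k}" for i
    using f[OF that] sec_coset_self[OF assms, of "f i" "{i}"] sec_coset_simps(1)[OF assms, of "f i" "{i}"]
    by (auto simp: sections_def)
  moreover have "restr n k {i, j} (s i) = restr n k {i, j} (s j)"
    if "i \<in> {0..k}" "j \<in> {0..k}" for i j
    using agree[OF that] that by (simp add: s restr_sec_coset[OF assms])
  moreover have "s \<in> extensional {0..k}" by (simp add: s)
  ultimately show "s \<in> global_sections n k r"
    unfolding global_sections_def PiE_iff by (intro CollectI conjI ballI) (simp_all add: s)
qed

lemma global_sectionsI:
  assumes "k \<le> n"
    and "\<And>i. i \<in> {0..k} \<Longrightarrow> f i \<in> carrier (loc_ring n k {i}) \<inter> homog_z r"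
    and "\<And>i j. i \<in> {0..k} \<Longrightarrow> j \<in> {0..k} \<Longrightarrow> sec_coset n k {i, j} (f i) = sec_coset n k {i, j} (f j)"
  shows "(\<lambda>i\<in>{0..k}. sec_coset n k {i} (f i)) \<in> global_sections n k r"
  unfolding global_sections_iff[OF assms(1)]
  by (rule exI[of _ f]) (use assms(2,3) in blast)

lemma global_sectionsE:
  assumes "k \<le> n" "s \<in> global_sections n k r"
  obtains f where "\<And>i. i \<in> {0..k} \<Longrightarrow> f i \<in> carrier (loc_ring n k {i}) \<inter> homog_z r"
    and "s = (\<lambda>i\<in>{0..k}. sec_coset n k {i} (f i))"
    and "\<And>i j. i \<in> {0..k} \<Longrightarrow> j \<in> {0..k} \<Longrightarrow> sec_coset n k {i, j} (f i) = sec_coset n k {i, j} (f j)"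
proof -
  obtain f where f: "\<forall>i\<in>{0..k}. f i \<in> carrier (loc_ring n k {i}) \<inter> homog_z r"
    "s = (\<lambda>i\<in>{0..k}. sec_coset n k {i} (f i))"
    "\<forall>i\<in>{0..k}. \<forall>j\<in>{0..k}. sec_coset n k {i, j} (f i) = sec_coset n k {i, j} (f j)"
    using assms(2) unfolding global_sections_iff[OF assms(1)] by (elim exE conjE)
  show ?thesis by (rule that[of f]) (use f in blast)+
qed

lemma loc_ring_closed:
  "p \<in> carrier (loc_ring n k I) \<Longrightarrow> q \<in> carrier (loc_ring n k I) \<Longrightarrow> p + q \<in> carrier (loc_ring n k I)"
  "p \<in> carrier (loc_ring n k I) \<Longrightarrow> q \<in> carrier (loc_ring n k I) \<Longrightarrow> p * q \<in> carrier (loc_ring n k I)"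
  "p \<in> carrier (loc_ring n k I) \<Longrightarrow> - p \<in> carrier (loc_ring n k I)"
  "0 \<in> carrier (loc_ring n k I)"
  "1 \<in> carrier (loc_ring n k I)"
proof -
  interpret L: cring "loc_ring n k I" by (rule loc_ring_cring)
  show "p \<in> carrier (loc_ring n k I) \<Longrightarrow> q \<in> carrier (loc_ring n k I) \<Longrightarrow> p + q \<in> carrier (loc_ring n k I)"
    "p \<in> carrier (loc_ring n k I) \<Longrightarrow> q \<in> carrier (loc_ring n k I) \<Longrightarrow> p * q \<in> carrier (loc_ring n k I)"
    using L.a_closed[of p q] L.m_closed[of p q] by (simp_all add: loc_ring_def)
  show "0 \<in> carrier (loc_ring n k I)" "1 \<in> carrier (loc_ring n k I)"
    using L.zero_closed L.one_closed by (simp_all add: loc_ring_def)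
  show "p \<in> carrier (loc_ring n k I) \<Longrightarrow> - p \<in> carrier (loc_ring n k I)"
    by (simp add: loc_ring_def)
qed

lemma sec_coset_cong:
  fixes f f' g g' :: "'a::field bipoly"
  assumes "k \<le> n"
    and "f \<in> carrier (loc_ring n k I)" "f' \<in> carrier (loc_ring n k I)"
    and "g \<in> carrier (loc_ring n k I)" "g' \<in> carrier (loc_ring n k I)"
    and "sec_coset n k I f = sec_coset n k I f'" "sec_coset n k I g = sec_coset n k I g'"
  shows "sec_coset n k I (f + g) = sec_coset n k I (f' + g')"
    and "sec_coset n k I (f * g) = sec_coset n k I (f' * g')"
    and "sec_coset n k I (- f) = sec_coset n k I (- f')"
proof -
  note s = sec_coset_simps(2,3)[OF assms(1), symmetric] and l = loc_ring_closed
  show "sec_coset n k I (f + g) = sec_coset n k I (f' + g')"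
    and "sec_coset n k I (f * g) = sec_coset n k I (f' * g')"
    using assms by (simp_all add: s)
  have neg: "sec_coset n k I (- h) = sec_coset n k I (- 1) \<otimes>\<^bsub>sec_ring n k I\<^esub> sec_coset n k I h"
    if "h \<in> carrier (loc_ring n k I)" for h :: "'a bipoly"
    using sec_coset_simps(3)[OF assms(1), of "- 1" I h] that by (simp add: l)
  show "sec_coset n k I (- f) = sec_coset n k I (- f')"
    using assms by (simp add: neg)
qed

lemma global_sections_closed:
  fixes s t :: "'a::field gsection"
  assumes kn: "k \<le> n"
  shows "s \<in> global_sections n k r \<Longrightarrow> t \<in> global_sections n k r \<Longrightarrow>
      gadd n k s t \<in> global_sections n k r"
    and "s \<in> global_sections n k q \<Longrightarrow> t \<in> global_sections n k r \<Longrightarrow>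
      gmult n k s t \<in> global_sections n k (q + r)"
    and "s \<in> global_sections n k r \<Longrightarrow> \<exists>t\<in>global_sections n k r. gadd n k t s = gpoly n k 0"
    and "gpoly n k 0 \<in> (global_sections n k r :: 'a gsection set)"
    and "gpoly n k 1 \<in> (global_sections n k 0 :: 'a gsection set)"
proof -
  note simps = sec_coset_simps[OF kn] and l = loc_ring_closed
  have loc: "f \<in> carrier (loc_ring n k {i, j}) \<and> f \<in> carrier (loc_ring n k {j, i})"
    if "f \<in> carrier (loc_ring n k {i})" for f :: "'a bipoly" and i j
    using that loc_ring_mono[of "{i}" "{i, j}" n k] by (auto simp: insert_commute)
  {
    assume "s \<in> global_sections n k r"
    from global_sectionsE[OF kn this] obtain f where f: "\<And>i. i \<in> {0..k} \<Longrightarrow> f i \<in> carrier (loc_ring n k {i}) \<inter> homog_z r"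
      "s = (\<lambda>i\<in>{0..k}. sec_coset n k {i} (f i))"
      "\<And>i j. i \<in> {0..k} \<Longrightarrow> j \<in> {0..k} \<Longrightarrow> sec_coset n k {i, j} (f i) = sec_coset n k {i, j} (f j)"
      by blast
    {
      assume "t \<in> global_sections n k r"
      from global_sectionsE[OF kn this] obtain g where g: "\<And>i. i \<in> {0..k} \<Longrightarrow> g i \<in> carrier (loc_ring n k {i}) \<inter> homog_z r"
        "t = (\<lambda>i\<in>{0..k}. sec_coset n k {i} (g i))"
        "\<And>i j. i \<in> {0..k} \<Longrightarrow> j \<in> {0..k} \<Longrightarrow> sec_coset n k {i, j} (g i) = sec_coset n k {i, j} (g j)"
        by blast
      have "(\<lambda>i\<in>{0..k}. sec_coset n k {i} (f i + g i)) \<in> global_sections n k r"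
      proof (rule global_sectionsI[OF kn])
        show "f i + g i \<in> carrier (loc_ring n k {i}) \<inter> homog_z r" if "i \<in> {0..k}" for i
          using f(1)[OF that] g(1)[OF that] by (simp add: l homog_z_add)
        show "sec_coset n k {i, j} (f i + g i) = sec_coset n k {i, j} (f j + g j)"
          if "i \<in> {0..k}" "j \<in> {0..k}" for i j
          by (rule sec_coset_cong[OF kn]) (use that f g loc in blast)+
      qed
      moreover have "gadd n k s t = (\<lambda>i\<in>{0..k}. sec_coset n k {i} (f i + g i))"
        unfolding gadd_def using f(1) g(1) by (intro restrict_ext) (simp add: f(2) g(2) simps)
      ultimately show "gadd n k s t \<in> global_sections n k r" by simp
    }
    have "(\<lambda>i\<in>{0..k}. sec_coset n k {i} (- f i)) \<in> global_sections n k r"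
    proof (rule global_sectionsI[OF kn])
      show "- f i \<in> carrier (loc_ring n k {i}) \<inter> homog_z r" if "i \<in> {0..k}" for i
        using f(1)[OF that] by (simp add: l homog_z_uminus)
      show "sec_coset n k {i, j} (- f i) = sec_coset n k {i, j} (- f j)"
        if "i \<in> {0..k}" "j \<in> {0..k}" for i j
      proof -
        have "f i \<in> carrier (loc_ring n k {i, j})" "f j \<in> carrier (loc_ring n k {i, j})"
          using loc[of "f i" i j] loc[of "f j" j i] f(1) that by simp_all
        with f(3)[OF that] show ?thesis
          using sec_coset_cong(3)[OF kn, of "f i" "{i, j}" "f j" 0 0] by (simp add: l)
      qed
    qed
    moreover have "gadd n k (\<lambda>i\<in>{0..k}. sec_coset n k {i} (- f i)) s = gpoly n k 0"
      unfolding gadd_def gpoly_sec_coset using f(1)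
      by (intro restrict_ext) (simp add: f(2) simps l)
    ultimately show "\<exists>t\<in>global_sections n k r. gadd n k t s = gpoly n k 0" by blast
  }
  {
    assume s: "s \<in> global_sections n k q" and t: "t \<in> global_sections n k r"
    from global_sectionsE[OF kn s] obtain f where f: "\<And>i. i \<in> {0..k} \<Longrightarrow> f i \<in> carrier (loc_ring n k {i}) \<inter> homog_z q"
      "s = (\<lambda>i\<in>{0..k}. sec_coset n k {i} (f i))"
      "\<And>i j. i \<in> {0..k} \<Longrightarrow> j \<in> {0..k} \<Longrightarrow> sec_coset n k {i, j} (f i) = sec_coset n k {i, j} (f j)"
      by blast
    from global_sectionsE[OF kn t] obtain g where g: "\<And>i. i \<in> {0..k} \<Longrightarrow> g i \<in> carrier (loc_ring n k {i}) \<inter> homog_z r"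
      "t = (\<lambda>i\<in>{0..k}. sec_coset n k {i} (g i))"
      "\<And>i j. i \<in> {0..k} \<Longrightarrow> j \<in> {0..k} \<Longrightarrow> sec_coset n k {i, j} (g i) = sec_coset n k {i, j} (g j)"
      by blast
    have "(\<lambda>i\<in>{0..k}. sec_coset n k {i} (f i * g i)) \<in> global_sections n k (q + r)"
      proof (rule global_sectionsI[OF kn])
        show "f i * g i \<in> carrier (loc_ring n k {i}) \<inter> homog_z (q + r)" if "i \<in> {0..k}" for i
          using f(1)[OF that] g(1)[OF that] by (simp add: l homog_z_mult)
        show "sec_coset n k {i, j} (f i * g i) = sec_coset n k {i, j} (f j * g j)"
          if "i \<in> {0..k}" "j \<in> {0..k}" for i j
          by (rule sec_coset_cong[OF kn]) (use that f g loc in blast)+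
      qed
      moreover have "gmult n k s t = (\<lambda>i\<in>{0..k}. sec_coset n k {i} (f i * g i))"
        unfolding gmult_def using f(1) g(1) by (intro restrict_ext) (simp add: f(2) g(2) simps)
      ultimately show "gmult n k s t \<in> global_sections n k (q + r)" by simp
  }
  show "gpoly n k 0 \<in> (global_sections n k r :: 'a gsection set)"
    unfolding gpoly_sec_coset
    by (rule global_sectionsI[OF kn]) (simp_all add: l homog_z_0)
  show "gpoly n k 1 \<in> (global_sections n k 0 :: 'a gsection set)"
    unfolding gpoly_sec_coset
    by (rule global_sectionsI[OF kn]) (simp_all add: l homog_z_1)
qed

lemma global_sections_laws:
  fixes s t u :: "'a::field gsection"
  assumes kn: "k \<le> n"
    and "s \<in> global_sections n k p" "t \<in> global_sections n k q" "u \<in> global_sections n k r"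
  shows "gadd n k (gadd n k s t) u = gadd n k s (gadd n k t u)"
    and "gadd n k s t = gadd n k t s"
    and "gadd n k (gpoly n k 0) s = s"
    and "gmult n k (gmult n k s t) u = gmult n k s (gmult n k t u)"
    and "gmult n k s t = gmult n k t s"
    and "gmult n k (gpoly n k 1) s = s"
    and "gmult n k (gadd n k s t) u = gadd n k (gmult n k s u) (gmult n k t u)"
    and "gmult n k s (gadd n k t u) = gadd n k (gmult n k s t) (gmult n k s u)"
proof -
  interpret S: cring "sec_ring n k {i}" for i :: nat by (rule sec_ring_cring[OF kn])
  have ext: "s = (\<lambda>i\<in>{0..k}. s i)"
    using assms(2) by (auto simp: global_sections_def PiE_iff extensional_restrict)
  have c: "s i \<in> carrier (sec_ring n k {i})" "t i \<in> carrier (sec_ring n k {i})"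
      "u i \<in> carrier (sec_ring n k {i})" if "i \<in> {0..k}" for i
    using assms that by (auto simp: global_sections_def sections_def)
  note simps = gadd_def gmult_def gpoly_sec_coset sec_coset_simps(4,5)[OF kn, symmetric] c
  show "gadd n k (gadd n k s t) u = gadd n k s (gadd n k t u)"
    by (auto simp: simps S.a_assoc intro!: restrict_ext)
  show "gadd n k s t = gadd n k t s"
    by (auto simp: simps S.a_comm intro!: restrict_ext)
  show "gadd n k (gpoly n k 0) s = s"
    by (subst (2) ext) (auto simp: simps intro!: restrict_ext)
  show "gmult n k (gmult n k s t) u = gmult n k s (gmult n k t u)"
    by (auto simp: simps S.m_assoc intro!: restrict_ext)
  show "gmult n k s t = gmult n k t s"
    by (auto simp: simps S.m_comm intro!: restrict_ext)
  show "gmult n k (gpoly n k 1) s = s"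
    by (subst (2) ext) (auto simp: simps intro!: restrict_ext)
  show "gmult n k (gadd n k s t) u = gadd n k (gmult n k s u) (gmult n k t u)"
    by (auto simp: simps S.l_distr intro!: restrict_ext)
  show "gmult n k s (gadd n k t u) = gadd n k (gmult n k s t) (gmult n k s u)"
    by (auto simp: simps S.r_distr intro!: restrict_ext)
qed

lemma B_ring_cring:
  assumes "k \<le> n"
  shows "cring (B_ring n k :: 'a::field gsection ring)"
proof (rule cringI)
  note closed = global_sections_closed[OF assms] and laws = global_sections_laws[OF assms]
  show "abelian_group (B_ring n k :: 'a gsection ring)"
    by (rule abelian_groupI) (auto simp: B_ring_def closed intro: laws)
  show "comm_monoid (B_ring n k :: 'a gsection ring)"
    using closed(2)[where q = 0 and r = 0]
    by (intro comm_monoidI) (auto simp: B_ring_def closed intro: laws)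
qed (auto simp: B_ring_def intro: global_sections_laws[OF assms])

theorem M_module_module:
  assumes "k \<le> n"
  shows "module (B_ring n k) (M_module n k r :: ('a::field gsection, 'a gsection) module)"
proof (rule moduleI)
  note closed = global_sections_closed[OF assms] and laws = global_sections_laws[OF assms]
  show "abelian_group (M_module n k r :: ('a gsection, 'a gsection) module)"
    by (rule abelian_groupI) (auto simp: M_module_def closed intro: laws)
  show "b \<odot>\<^bsub>M_module n k r\<^esub> s \<in> carrier (M_module n k r)"
    if "b \<in> carrier (B_ring n k)" "s \<in> carrier (M_module n k r)" for b s :: "'a gsection"
    using closed(2)[of b 0 s r] that by (simp add: B_ring_def M_module_def)
qed (use B_ring_cring[OF assms] in \<open>auto simp: B_ring_def M_module_def intro: global_sections_laws[OF assms]\<close>)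


section \<open>Modules, generators\<close>

definition module_iso ::
    "('a, 'b) module \<Rightarrow> ('a, 'c) module \<Rightarrow> 'a set \<Rightarrow> ('b \<Rightarrow> 'c) set" where
  "module_iso M N R =
    {f. bij_betw f (carrier M) (carrier N)
      \<and> (\<forall>x\<in>carrier M. \<forall>y\<in>carrier M. f (x \<oplus>\<^bsub>M\<^esub> y) = f x \<oplus>\<^bsub>N\<^esub> f y)
      \<and> (\<forall>c\<in>R. \<forall>x\<in>carrier M. f (c \<odot>\<^bsub>M\<^esub> x) = c \<odot>\<^bsub>N\<^esub> f x)}"

definition module_span :: "'a ring \<Rightarrow> ('a, 'b) module \<Rightarrow> 'b set \<Rightarrow> 'b set" where
  "module_span R M X = \<Inter>{N. submodule N R M \<and> X \<subseteq> N}"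

text \<open>\<open>B\<^sub>+ M\<^sub>r\<close>, where \<open>B\<^sub>+\<close> is the ideal generated by the elements of positive degree.\<close>

definition irrelevant_part :: "nat \<Rightarrow> nat \<Rightarrow> int \<Rightarrow> 'a::field gsection set" where
  "irrelevant_part n k r =
    module_span (B_ring n k) (M_module n k r)
      {gmult n k b s | b s d. d > 0 \<and> b \<in> carrier (M_piece n k 0 d) \<and> s \<in> global_sections n k r}"

text \<open>
  \<open>M\<^sub>r\<close> is generated in degree \<open>e\<close>, and the graded piece of degree \<open>e\<close> is its space of minimal
  generators, i.e. maps isomorphically onto \<open>M\<^sub>r / B\<^sub>+ M\<^sub>r\<close>.
\<close>

definition generated_in_degree :: "'a::field itself \<Rightarrow> nat \<Rightarrow> nat \<Rightarrow> int \<Rightarrow> int \<Rightarrow> bool" where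
  "generated_in_degree _ n k r e \<longleftrightarrow>
    (let M = M_module n k r :: ('a gsection, 'a gsection) module;
         V = carrier (M_piece n k r e)
     in module_span (B_ring n k) M V = carrier M
      \<and> bij_betw (\<lambda>s. irrelevant_part n k r +>\<^bsub>M\<^esub> s) V (a_rcosets\<^bsub>M\<^esub> irrelevant_part n k r))"


section \<open>The generators of \<open>M\<^bsub>-1\<^esub>\<close>\<close>

text \<open>
  Sections over \<open>D\<^sub>I\<close> of the \<open>q\<close>-th term
  \<open>\<And>\<^sup>q(Sym\<^bsup>n-k\<^esup> U) \<otimes> Sym\<^bsup>k-q\<^esup>(Sym\<^sup>n U) \<otimes> O(-q-1)\<close> of the resolution of \<open>Sym\<^sup>k E \<otimes> O(-1)\<close>, in coordinates
  with respect to the basis \<open>e\<^sub>T\<close> of the exterior power.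
\<close>

definition koszul_sections :: "nat \<Rightarrow> nat \<Rightarrow> nat \<Rightarrow> nat set \<Rightarrow> (nat set \<Rightarrow> 'a::field bipoly) set" where
  "koszul_sections n k q I =
    {c. \<forall>T. c T \<in> carrier (loc_ring n k I) \<inter> homog_z (- int q - 1) \<inter> homog_y (int k - int q)
          \<and> (c T \<noteq> 0 \<longrightarrow> T \<subseteq> {0..n - k} \<and> card T = q)}"

text \<open>
  The differential sends \<open>e\<^sub>T\<close> to \<open>\<Sum>t\<in>T. \<plusminus> lin_form k t \<cdot> e\<^bsub>T - {t}\<^esub>\<close>, the sign being that of the
  position of \<open>t\<close> in \<open>T\<close>.
\<close>

definition koszul_diff ::
    "nat \<Rightarrow> nat \<Rightarrow> (nat set \<Rightarrow> 'a::field bipoly) \<Rightarrow> nat set \<Rightarrow> 'a bipoly" where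
  "koszul_diff n k c S =
    (\<Sum>t\<in>{0..n - k} - S. (- 1) ^ card {s \<in> S. s < t} * lin_form k t * c (insert t S))"

text \<open>
  Alternating Cech cochains for the cover of \<open>P\<^sup>k\<close> by the sets \<open>D\<^bsub>{i}\<^esub>\<close>; a \<open>p\<close>-cochain assigns a
  section over \<open>D\<^sub>I\<close> to each \<open>I \<subseteq> {0..k}\<close> with \<open>p + 1\<close> elements.
\<close>

definition cech_diff ::
    "(nat set \<Rightarrow> nat set \<Rightarrow> 'a::field bipoly) \<Rightarrow> nat set \<Rightarrow> nat set \<Rightarrow> 'a bipoly" where
  "cech_diff c I T = (\<Sum>i\<in>I. (- 1) ^ card {j \<in> I. j < i} * c (I - {i}) T)"

text \<open>
  The isomorphism \<open>H\<^sup>0(P\<^sup>k, Sym\<^sup>k E (-1)) \<cong> H\<^sup>k(P\<^sup>k, \<And>\<^sup>k(Sym\<^bsup>n-k\<^esup> U) \<otimes> O(-k-1)) = \<And>\<^sup>k(Sym\<^bsup>n-k\<^esup> U)\<close> as a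
  relation between \<open>s\<close> and \<open>w\<close>: the first step is the iterated connecting homomorphism, i.e. a
  zigzag in the Cech-Koszul double complex, which lifts \<open>s\<close> to a \<open>0\<close>-cochain \<open>c 0\<close> in the term
  \<open>q = 0\<close> and ends in a \<open>k\<close>-cochain \<open>c k\<close> in the term \<open>q = k\<close>. The second is the identification of
  \<open>H\<^sup>k(P\<^sup>k, O(-k-1))\<close> with the ground field by the coefficient of \<open>1 / (z\<^sub>0 \<cdots> z\<^sub>k)\<close>.
\<close>

definition generator_rel ::
    "nat \<Rightarrow> nat \<Rightarrow> 'a::field gsection \<Rightarrow> (nat set \<Rightarrow> 'a) \<Rightarrow> bool" where
  "generator_rel n k s w \<longleftrightarrow>
    (\<exists>c :: nat \<Rightarrow> nat set \<Rightarrow> nat set \<Rightarrow> 'a bipoly.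
       (\<forall>p\<le>k. \<forall>I\<subseteq>{0..k}. card I = p + 1 \<longrightarrow> c p I \<in> koszul_sections n k p I)
     \<and> (\<forall>i\<le>k. c 0 {i} {} \<in> s i)
     \<and> (\<forall>p<k. \<forall>I\<subseteq>{0..k}. card I = p + 2 \<longrightarrow>
          cech_diff (c p) I = koszul_diff n k (c (p + 1) I))
     \<and> w = (\<lambda>T. Poly_Mapping.lookup (c k {0..k} T) (\<Sum>i\<le>k. Poly_Mapping.single i (- 1), 0)))"

definition generator_ident :: "nat \<Rightarrow> nat \<Rightarrow> 'a::field gsection \<Rightarrow> nat set \<Rightarrow> 'a" where
  "generator_ident n k s = (THE w. generator_rel n k s w)"


section \<open>Hermite reciprocity\<close>

text \<open>
  The action of \<open>Sym(D\<^sup>k U)\<close>. The operators by which the \<open>z\<^sub>i\<close> act commute, so the order in which they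
  are composed is immaterial.
\<close>

definition sym_act :: "nat \<Rightarrow> 'a::field bipoly \<Rightarrow> (nat set \<Rightarrow> 'a) \<Rightarrow> nat set \<Rightarrow> 'a" where
  "sym_act k f w S =
    (\<Sum>(a, b)\<in>Poly_Mapping.keys f.
       Poly_Mapping.lookup f (a, b)
         * foldr (\<lambda>i. tensor_act k (coord_tensor k i) ^^ nat (Poly_Mapping.lookup a i))
             [0..<k + 1] w S)"

text \<open>\<open>f \<mapsto> f * (x\<^bsup>k-1\<^esup> \<and> ... \<and> x \<and> 1)\<close>\<close>

definition hermite_map :: "nat \<Rightarrow> 'a::field bipoly \<Rightarrow> nat set \<Rightarrow> 'a" where
  "hermite_map k f = sym_act k f (wedge k (\<lambda>j. monom 1 (k - 1 - j)))"

definition hermite :: "nat \<Rightarrow> nat \<Rightarrow> (nat set \<Rightarrow> 'a::field) \<Rightarrow> 'a bipoly" where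
  "hermite n k = inv_into (carrier (sym_divided_module k (n + 1 - 2 * k))) (hermite_map k)"

end

theory Submission
  imports Defs "HOL-Library.Product_Lexorder"
begin

text \<open>
  On every chart the forms \<open>L\<^sub>j = \<Sum>i\<le>k. z\<^sub>i y\<^bsub>i+j\<^esub>\<close> are a regular sequence, so the Koszul complex resolves
  \<open>Sym E\<close>, and global sections of \<open>O(r)\<close> can be computed by zigzags in the Cech-Koszul double complex.
  For \<open>r \<ge> 0\<close> every section is a polynomial. For \<open>r = -1\<close> the zigzag can be written down: a section is
  determined by an element \<open>w\<close> of \<open>\<And>\<^sup>k(Sym\<^bsup>n-k\<^esup> U) \<otimes> k[y]\<close>, and on \<open>D\<^bsub>{i}\<^esub>\<close> it is \<open>\<plusminus> m\<^sub>i(w) / z\<^sub>i\<close>, where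
  \<open>m\<^sub>i(w)\<close> is the maximal minor of the Hankel matrix \<open>(y\<^bsub>t+i\<^esub>)\<close> without column \<open>i\<close>, applied to \<open>w\<close>.

  The action of \<open>D\<^sup>k U\<close> satisfies \<open>m\<^sub>k(z\<^sub>i * w) = \<plusminus> m\<^sub>i(w)\<close>, hence \<open>z\<^sub>i m\<^sub>k(w) = z\<^sub>k m\<^sub>k(z\<^sub>i * w)\<close> modulo the
  \<open>L\<^sub>j\<close>. With \<open>w\<^sub>0 = x\<^bsup>k-1\<^esup> \<and> ... \<and> 1\<close> it follows that \<open>f m\<^sub>k(w\<^sub>0) = z\<^sub>k\<^bsup>n-2k+1\<^esup> m\<^sub>k(f * w\<^sub>0)\<close> for every form \<open>f\<close> of
  degree \<open>n - 2k + 1\<close>. So division by \<open>m\<^sub>k(w\<^sub>0)\<close>, up to a power of \<open>z\<^sub>k\<close>, takes the section belonging to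
  \<open>f * w\<^sub>0\<close> to the section \<open>f\<close>. It is compatible with multiplication by \<open>B\<close> and is a bijection on
  generators, and both modules are spanned by their generators over the polynomials in the \<open>y\<^sub>i\<close>.
\<close>

text \<open>A Cech cochain can be contracted monomial by monomial as long as some \<open>z_i\<close>
  has a nonnegative exponent, and a monomial with only negative exponents has z-degree at most
  \<open>-k-1\<close>. Along a zigzag the term \<open>q \<le> k\<close> has z-degree
  \<open>r - q\<close>. So nothing is obstructed for \<open>r \<ge> 0\<close>, while for
  \<open>r = -1\<close> only the last term is, and only by \<open>1 / (z_0 ... z_k)\<close>; its
  coefficient is \<open>w\<close>. Regularity is delicate because a chart inverts one
  \<open>z_i\<close> only, whereas the leading coefficient of \<open>L_j\<close> is
  \<open>z_k\<close>. Modulo \<open>z_k\<close> the forms become shorter forms of the same shape,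
  which allows an induction on the length. The two modules are compared on the chart
  \<open>z_k \<noteq> 0\<close> alone: its ring is a domain, and a section vanishing there vanishes
  everywhere, since \<open>z_k\<close> is a nonzerodivisor on the other charts. Hermite reciprocity
  is proved bijective on the way. It is injective because \<open>f\<close> is recovered by
  cancelling \<open>m_k(w_0)\<close>, and surjective because the images of the operators
  \<open>z_i\<close> span, by a triangularity argument. Since minors lie in a commutative ring, no
  commutation of these operators enters.\<close>

text \<open>With the lexicographic order the exponents of \<open>bipoly\<close> form a linearly
  ordered cancellative monoid. This makes the Laurent polynomials over a field a domain, as is
  needed for primality of the relation ideal on the chart \<open>{k}\<close>.\<close>

instance prod :: (ordered_cancel_comm_monoid_add, ordered_cancel_comm_monoid_add) ordered_cancel_comm_monoid_add
  by standard (auto simp: less_eq_prod_def less_prod_def add_left_mono intro: add_strict_left_mono)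

abbreviation "keys \<equiv> Poly_Mapping.keys"
abbreviation "lookup \<equiv> Poly_Mapping.lookup"
abbreviation "single \<equiv> Poly_Mapping.single"

section \<open>Linear maps given on monomials\<close>

text \<open>Projections onto monomials, division by a variable, residues and the substitution on the
  chart \<open>{k}\<close> are all instances, so that additivity and multiplicativity are proved
  once.\<close>

definition lin_ext :: "('k \<Rightarrow> 'l::comm_monoid_add \<Rightarrow>\<^sub>0 'a::comm_ring_1) \<Rightarrow> ('k \<Rightarrow>\<^sub>0 'a) \<Rightarrow> ('l \<Rightarrow>\<^sub>0 'a)" where
  "lin_ext \<mu> f = (\<Sum>u\<in>keys f. single 0 (lookup f u) * \<mu> u)"

lemma lin_ext_superset:
  assumes "finite U" "keys f \<subseteq> U"
  shows "lin_ext \<mu> f = (\<Sum>u\<in>U. single 0 (lookup f u) * \<mu> u)"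
  unfolding lin_ext_def using assms
  by (intro sum.mono_neutral_left) (auto simp: in_keys_iff)

lemma lin_ext_0 [simp]: "lin_ext \<mu> 0 = 0"
  by (simp add: lin_ext_def)

lemma lin_ext_add: "lin_ext \<mu> (f + g) = lin_ext \<mu> f + lin_ext \<mu> g"
proof -
  let ?U = "keys f \<union> keys g"
  show ?thesis
    using Poly_Mapping.keys_add[of f g]
    by (simp add: lin_ext_superset[of ?U f] lin_ext_superset[of ?U g] lin_ext_superset[of ?U "f + g"]
        lookup_add single_add distrib_right sum.distrib)
qed

lemma lin_ext_uminus: "lin_ext \<mu> (- f) = - lin_ext \<mu> f"
  using lin_ext_add[of \<mu> f "- f"] by (simp add: eq_neg_iff_add_eq_0 add.commute)

lemma lin_ext_diff: "lin_ext \<mu> (f - g) = lin_ext \<mu> f - lin_ext \<mu> g"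
  using lin_ext_add[of \<mu> f "- g"] by (simp add: lin_ext_uminus)

lemma lin_ext_sum: "lin_ext \<mu> (\<Sum>x\<in>X. f x) = (\<Sum>x\<in>X. lin_ext \<mu> (f x))"
  by (induction X rule: infinite_finite_induct) (simp_all add: lin_ext_add)

lemma lin_ext_single: "lin_ext \<mu> (single u c) = single 0 c * \<mu> u"
  by (simp add: lin_ext_def)

lemma sum_single_keys:
  "(\<Sum>u\<in>keys f. single u (lookup f u)) = f"
  by (rule poly_mapping_eqI)
    (auto simp: lookup_sum lookup_single when_def in_keys_iff sum.delta)

lemma lin_ext_cong: "(\<And>u. u \<in> keys f \<Longrightarrow> \<mu> u = \<nu> u) \<Longrightarrow> lin_ext \<mu> f = lin_ext \<nu> f"
  by (simp add: lin_ext_def)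

lemma lin_ext_monomials [simp]: "lin_ext (\<lambda>u. single u 1) f = f"
  by (simp add: lin_ext_def mult_single sum_single_keys)

lemma mult_sum_single:
  fixes f g :: "'k::comm_monoid_add \<Rightarrow>\<^sub>0 'a::comm_ring_1"
  shows "f * g = (\<Sum>u\<in>keys f. \<Sum>v\<in>keys g.
     single (u + v) (lookup f u * lookup g v))"
  by (subst (1) sum_single_keys[of f, symmetric], subst (1) sum_single_keys[of g, symmetric])
    (simp add: sum_product mult_single)

lemma lin_ext_mult:
  fixes f g :: "'k::comm_monoid_add \<Rightarrow>\<^sub>0 'a::comm_ring_1" and \<mu> :: "'k \<Rightarrow> 'l::comm_monoid_add \<Rightarrow>\<^sub>0 'a"
  assumes "\<And>u v. u \<in> keys f \<Longrightarrow> v \<in> keys g \<Longrightarrow> \<mu> (u + v) = \<alpha> u * \<nu> v"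
  shows "lin_ext \<mu> (f * g) = lin_ext \<alpha> f * lin_ext \<nu> g"
proof -
  have "lin_ext \<mu> (f * g) = (\<Sum>u\<in>keys f. \<Sum>v\<in>keys g.
      single 0 (lookup f u * lookup g v) * \<mu> (u + v))"
    by (simp add: mult_sum_single lin_ext_sum lin_ext_single)
  also have "\<dots> = (\<Sum>u\<in>keys f. \<Sum>v\<in>keys g.
      (single 0 (lookup f u) * \<alpha> u) *
      (single 0 (lookup g v) * \<nu> v))"
  proof (intro sum.cong refl)
    fix u v assume "u \<in> keys f" "v \<in> keys g"
    moreover have "single 0 (lookup f u * lookup g v)
      = single 0 (lookup f u) * (single 0 (lookup g v) :: 'l \<Rightarrow>\<^sub>0 'a)"
      by (simp add: mult_single)
    ultimately show "single 0 (lookup f u * lookup g v) * \<mu> (u + v)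
      = (single 0 (lookup f u) * \<alpha> u) *
        (single 0 (lookup g v) * \<nu> v)"
      by (simp add: assms mult_ac)
  qed
  also have "\<dots> = lin_ext \<alpha> f * lin_ext \<nu> g"
    by (simp add: lin_ext_def sum_product)
  finally show ?thesis .
qed

lemma keys_lin_ext:
  assumes "\<And>u v. u \<in> keys f \<Longrightarrow> v \<in> keys (\<mu> u) \<Longrightarrow> v \<in> V"
  shows "keys (lin_ext \<mu> f) \<subseteq> V"
proof
  fix v assume "v \<in> keys (lin_ext \<mu> f)"
  then obtain u where u: "u \<in> keys f"
    "v \<in> keys (single 0 (lookup f u) * \<mu> u)"
    unfolding lin_ext_def
    using Poly_Mapping.keys_sum[of "\<lambda>u. single 0 (lookup f u) * \<mu> u" "keys f"] by auto
  then have "v \<in> keys (\<mu> u)"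
    using Poly_Mapping.keys_mult[of "single 0 (lookup f u)" "\<mu> u"]
    by (auto split: if_splits)
  with u assms show "v \<in> V" by blast
qed

section \<open>Projections onto sets of monomials\<close>

definition mono_part :: "'k set \<Rightarrow> ('k::comm_monoid_add \<Rightarrow>\<^sub>0 'a::comm_ring_1) \<Rightarrow> ('k \<Rightarrow>\<^sub>0 'a)" where
  "mono_part U = lin_ext (\<lambda>u. if u \<in> U then single u 1 else 0)"

lemma lookup_mono_part:
  "lookup (mono_part U f) u = (if u \<in> U then lookup f u else 0)"
proof -
  have "lookup (mono_part U f) u =
     (\<Sum>v\<in>keys f. if v = u then (if u \<in> U then lookup f u else 0) else 0)"
    unfolding mono_part_def lin_ext_def lookup_sum
    by (intro sum.cong) (auto simp: mult_single lookup_single when_def)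
  then show ?thesis by (simp add: in_keys_iff)
qed

lemma keys_mono_part: "keys (mono_part U f) = keys f \<inter> U"
  by (auto simp: in_keys_iff lookup_mono_part split: if_splits)

lemmas mono_part_add = lin_ext_add[of "\<lambda>u. if u \<in> U then single u 1 else 0" for U, folded mono_part_def]
lemmas mono_part_diff = lin_ext_diff[of "\<lambda>u. if u \<in> U then single u 1 else 0" for U, folded mono_part_def]
lemmas mono_part_uminus = lin_ext_uminus[of "\<lambda>u. if u \<in> U then single u 1 else 0" for U, folded mono_part_def]
lemmas mono_part_sum = lin_ext_sum[of "\<lambda>u. if u \<in> U then single u 1 else 0" for U, folded mono_part_def]

lemma mono_part_0 [simp]: "mono_part U 0 = 0"
  by (simp add: mono_part_def)

lemma mono_part_id: "keys f \<subseteq> U \<Longrightarrow> mono_part U f = f"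
  by (rule poly_mapping_eqI) (auto simp: lookup_mono_part in_keys_iff)

lemma mono_part_eq_0: "keys f \<inter> U = {} \<Longrightarrow> mono_part U f = 0"
  using keys_mono_part[of U f] keys_eq_empty[of "mono_part U f"] by simp

text \<open>Meant for gradings: \<open>f\<close> is homogeneous, and \<open>U\<close> and
  \<open>V\<close> are pieces whose degrees differ by that of \<open>f\<close>.\<close>

lemma mono_part_mult:
  assumes "\<And>u v. u \<in> keys f \<Longrightarrow> v \<in> keys g \<Longrightarrow> u + v \<in> U \<longleftrightarrow> v \<in> V"
  shows "mono_part U (f * g) = f * mono_part V g"
  using lin_ext_mult[of f g "\<lambda>u. if u \<in> U then single u 1 else 0" "\<lambda>u. single u 1"
      "\<lambda>u. if u \<in> V then single u 1 else 0"]
  by (simp add: mono_part_def mult_single assms)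

lemma mono_part_partition:
  assumes "finite J" "\<And>u. u \<in> keys f \<Longrightarrow> \<exists>!j. j \<in> J \<and> u \<in> U j"
  shows "(\<Sum>j\<in>J. mono_part (U j) f) = f"
proof (rule poly_mapping_eqI)
  fix u
  show "lookup (\<Sum>j\<in>J. mono_part (U j) f) u = lookup f u"
  proof (cases "u \<in> keys f")
    case True
    from assms(2)[OF this] obtain j where j: "j \<in> J" "u \<in> U j" "\<And>i. i \<in> J \<Longrightarrow> u \<in> U i \<Longrightarrow> i = j"
      by (elim ex1E conjE) blast
    have "(\<Sum>i\<in>J. if u \<in> U i then lookup f u else 0) = (\<Sum>i\<in>J. if i = j then lookup f u else 0)"
      using j(1,2) by (intro sum.cong) (auto dest: j(3))
    with j(1) assms(1) show ?thesis by (simp add: lookup_sum lookup_mono_part)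
  qed (simp add: lookup_sum lookup_mono_part in_keys_iff sum.neutral)
qed

section \<open>The forms \<open>L\<^sub>0, ..., L\<^bsub>n-k\<^esub>\<close> are a regular sequence\<close>

text \<open>The rings of all charts are subsets of one type of Laurent polynomials. Treating
  subrings as sets keeps the type class operations, and elements pass between charts without
  coercion.\<close>

definition ring_subset :: "'r::comm_ring_1 set \<Rightarrow> bool" where
  "ring_subset A \<longleftrightarrow> 1 \<in> A \<and> (\<forall>x\<in>A. \<forall>y\<in>A. x - y \<in> A \<and> x * y \<in> A)"

lemma ring_subsetD:
  assumes "ring_subset A"
  shows "1 \<in> A" "0 \<in> A" "x \<in> A \<Longrightarrow> - x \<in> A" "x \<in> A \<Longrightarrow> y \<in> A \<Longrightarrow> x - y \<in> A"
    "x \<in> A \<Longrightarrow> y \<in> A \<Longrightarrow> x + y \<in> A" "x \<in> A \<Longrightarrow> y \<in> A \<Longrightarrow> x * y \<in> A"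
proof -
  have d: "x - y \<in> A" if "x \<in> A" "y \<in> A" for x y using assms that by (auto simp: ring_subset_def)
  show 1: "1 \<in> A" and "x \<in> A \<Longrightarrow> y \<in> A \<Longrightarrow> x * y \<in> A" using assms by (auto simp: ring_subset_def)
  show 0: "0 \<in> A" using d[OF 1 1] by simp
  show m: "x \<in> A \<Longrightarrow> - x \<in> A" for x using d[OF 0, of x] by simp
  show "x \<in> A \<Longrightarrow> y \<in> A \<Longrightarrow> x - y \<in> A" by (rule d)
  show "x \<in> A \<Longrightarrow> y \<in> A \<Longrightarrow> x + y \<in> A" using d[OF _ m, of x y] by simp
qed

lemma ring_subset_sum: "ring_subset A \<Longrightarrow> (\<And>x. x \<in> X \<Longrightarrow> f x \<in> A) \<Longrightarrow> sum f X \<in> A"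
  by (induction X rule: infinite_finite_induct) (auto intro: ring_subsetD)

lemma ring_subset_neg_one_power: "ring_subset A \<Longrightarrow> (- 1) ^ i \<in> A"
  by (induction i) (auto intro: ring_subsetD)

text \<open>The generators form a sequence, since regularity speaks of the ideals of all its initial
  segments.\<close>

definition ideal_span :: "'r::comm_ring_1 set \<Rightarrow> (nat \<Rightarrow> 'r) \<Rightarrow> nat \<Rightarrow> 'r set" where
  "ideal_span A x m = {(\<Sum>j<m. a j * x j) | a. \<forall>j<m. a j \<in> A}"

lemma ideal_spanI: "(\<And>j. j < m \<Longrightarrow> a j \<in> A) \<Longrightarrow> (\<Sum>j<m. a j * x j) \<in> ideal_span A x m"
  unfolding ideal_span_def by blast

lemma ideal_spanE:
  assumes "f \<in> ideal_span A x m"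
  obtains c where "f = (\<Sum>j<m. c j * x j)" "\<forall>j<m. c j \<in> A"
  using assms unfolding ideal_span_def by auto

lemma ideal_span_mult:
  assumes "ring_subset A" "a \<in> A" "f \<in> ideal_span A x m"
  shows "a * f \<in> ideal_span A x m"
proof -
  from assms(3) obtain c where c: "f = (\<Sum>j<m. c j * x j)" "\<forall>j<m. c j \<in> A" by (rule ideal_spanE)
  have "a * f = (\<Sum>j<m. (a * c j) * x j)" by (simp add: c(1) sum_distrib_left mult.assoc)
  also have "\<dots> \<in> ideal_span A x m"
    using assms(1,2) c(2) by (intro ideal_spanI) (auto intro: ring_subsetD)
  finally show ?thesis .
qed

lemma ideal_span_diff:
  assumes "ring_subset A" "f \<in> ideal_span A x m" "g \<in> ideal_span A x m"
  shows "f - g \<in> ideal_span A x m"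
proof -
  from assms(2) obtain c where c: "f = (\<Sum>j<m. c j * x j)" "\<forall>j<m. c j \<in> A" by (rule ideal_spanE)
  from assms(3) obtain d where d: "g = (\<Sum>j<m. d j * x j)" "\<forall>j<m. d j \<in> A" by (rule ideal_spanE)
  have "f - g = (\<Sum>j<m. (c j - d j) * x j)" by (simp add: c(1) d(1) sum_subtractf left_diff_distrib)
  also have "\<dots> \<in> ideal_span A x m"
    using assms(1) c(2) d(2) by (intro ideal_spanI) (auto intro: ring_subsetD)
  finally show ?thesis .
qed

lemma ideal_span_0: "ring_subset A \<Longrightarrow> 0 \<in> ideal_span A x m"
  using ideal_spanI[of m "\<lambda>_. 0" A x] by (simp add: ring_subsetD)

lemma ideal_span_uminus:
  "ring_subset A \<Longrightarrow> f \<in> ideal_span A x m \<Longrightarrow> - f \<in> ideal_span A x m"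
  using ideal_span_diff[of A 0 x m f] by (simp add: ideal_span_0)

lemma ideal_span_add:
  "ring_subset A \<Longrightarrow> f \<in> ideal_span A x m \<Longrightarrow> g \<in> ideal_span A x m \<Longrightarrow> f + g \<in> ideal_span A x m"
  using ideal_span_diff[of A f x m "- g"] by (simp add: ideal_span_uminus)

lemma ideal_span_Suc:
  "f \<in> ideal_span A x (Suc m) \<longleftrightarrow> (\<exists>g\<in>ideal_span A x m. \<exists>a\<in>A. f = g + a * x m)"
proof
  assume "f \<in> ideal_span A x (Suc m)"
  then obtain c where "f = (\<Sum>j<Suc m. c j * x j)" "\<forall>j<Suc m. c j \<in> A" by (rule ideal_spanE)
  then show "\<exists>g\<in>ideal_span A x m. \<exists>a\<in>A. f = g + a * x m"
    by (intro bexI[of _ "\<Sum>j<m. c j * x j"] bexI[of _ "c m"] ideal_spanI) auto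
next
  assume "\<exists>g\<in>ideal_span A x m. \<exists>a\<in>A. f = g + a * x m"
  then obtain g a where ga: "g \<in> ideal_span A x m" "a \<in> A" "f = g + a * x m" by blast
  from ga(1) obtain c where c: "g = (\<Sum>j<m. c j * x j)" "\<forall>j<m. c j \<in> A" by (rule ideal_spanE)
  have "f = (\<Sum>j<Suc m. (if j = m then a else c j) * x j)"
    by (simp add: ga(3) c(1))
  also have "\<dots> \<in> ideal_span A x (Suc m)"
    using ga(2) c(2) by (intro ideal_spanI) auto
  finally show "f \<in> ideal_span A x (Suc m)" .
qed

lemma ideal_span_subset:
  assumes "ring_subset A" "\<And>j. j < m \<Longrightarrow> x j \<in> A"
  shows "ideal_span A x m \<subseteq> A"
  using assms by (auto simp: ideal_span_def intro!: ring_subset_sum ring_subsetD)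

lemma ideal_span_mem:
  assumes "ring_subset A" "j < m"
  shows "x j \<in> ideal_span A x m"
proof -
  have "x j = (\<Sum>i<m. (if i = j then 1 else 0) * x i)" using assms(2) by (simp add: if_distrib[of "\<lambda>c. c * _"] cong: if_cong)
  also have "\<dots> \<in> ideal_span A x m" using assms(1) by (intro ideal_spanI) (auto intro: ring_subsetD)
  finally show ?thesis .
qed

definition nzd_mod :: "'r::comm_ring_1 set \<Rightarrow> 'r set \<Rightarrow> 'r \<Rightarrow> bool" where
  "nzd_mod A Q x \<longleftrightarrow> (\<forall>f\<in>A. x * f \<in> Q \<longrightarrow> f \<in> Q)"

text \<open>Exchange in a regular sequence: \<open>quot\<close> says that \<open>x j\<close> is a
  nonzerodivisor modulo the first \<open>j\<close> elements together with \<open>z\<close>. From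
  \<open>z * f = g + a * x j\<close> it follows that \<open>a\<close> is a multiple of
  \<open>z\<close> modulo the ideal; this multiple is moved to the left and \<open>z\<close> is
  cancelled.\<close>

lemma nzd_mod_swap:
  assumes A: "ring_subset A" and x: "x j \<in> A" and z: "z \<in> A"
    and reg: "nzd_mod A (ideal_span A x j) z"
    and quot: "\<And>a. a \<in> A \<Longrightarrow> \<exists>q\<in>ideal_span A x j. \<exists>c\<in>A. x j * a = q + z * c \<Longrightarrow>
        \<exists>q\<in>ideal_span A x j. \<exists>c\<in>A. a = q + z * c"
  shows "nzd_mod A (ideal_span A x (Suc j)) z"
  unfolding nzd_mod_def
proof (intro ballI impI)
  fix f assume f: "f \<in> A" "z * f \<in> ideal_span A x (Suc j)"
  then obtain g a where ga: "g \<in> ideal_span A x j" "a \<in> A" "z * f = g + a * x j"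
    unfolding ideal_span_Suc by blast
  have "x j * a = - g + z * f" using ga(3) by (simp add: algebra_simps)
  then obtain q c where qc: "q \<in> ideal_span A x j" "c \<in> A" "a = q + z * c"
    using quot[OF ga(2)] f(1) ideal_span_uminus[OF A ga(1)] by blast
  have "z * (f - c * x j) = g + x j * q"
    using ga(3) qc(3) by (simp add: algebra_simps)
  moreover have "g + x j * q \<in> ideal_span A x j"
    using A ga(1) qc(1) x by (intro ideal_span_add ideal_span_mult)
  moreover have "f - c * x j \<in> A" using A f(1) qc(2) x by (intro ring_subsetD(4,6))
  ultimately have "f - c * x j \<in> ideal_span A x j" using reg by (simp add: nzd_mod_def)
  then show "f \<in> ideal_span A x (Suc j)"
    unfolding ideal_span_Suc using qc(2) by (intro bexI[of _ "f - c * x j"] bexI[of _ c]) simp_all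
qed

subsection \<open>The localized polynomial rings\<close>

definition loc_keys :: "nat \<Rightarrow> nat \<Rightarrow> nat set \<Rightarrow> ((nat \<Rightarrow>\<^sub>0 int) \<times> (nat \<Rightarrow>\<^sub>0 nat)) set" where
  "loc_keys n k I = {u. keys (fst u) \<subseteq> {0..k} \<and> keys (snd u) \<subseteq> {0..n} \<and> (\<forall>i. lookup (fst u) i < 0 \<longrightarrow> i \<in> I)}"

abbreviation loc :: "nat \<Rightarrow> nat \<Rightarrow> nat set \<Rightarrow> 'a::field bipoly set" where
  "loc n k I \<equiv> carrier (loc_ring n k I)"

lemma loc_iff: "p \<in> loc n k I \<longleftrightarrow> keys p \<subseteq> loc_keys n k I"
  unfolding loc_ring_def loc_keys_def by fastforce

lemma ring_subset_loc: "ring_subset (loc n k I)"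
  unfolding ring_subset_def
  by (metis diff_conv_add_uminus loc_ring_closed(1) loc_ring_closed(2) loc_ring_closed(3) loc_ring_closed(5))

lemma mono_part_loc: "f \<in> loc n k I \<Longrightarrow> mono_part U f \<in> loc n k I"
  by (auto simp: loc_iff keys_mono_part)

lemma single_loc: "u \<in> loc_keys n k I \<Longrightarrow> single u c \<in> loc n k I"
  by (simp add: loc_iff)

lemma yvar_loc: "t \<le> n \<Longrightarrow> yvar t \<in> loc n k I"
  unfolding yvar_def by (intro single_loc) (auto simp: loc_keys_def)

lemma zvar_loc: "i \<le> k \<Longrightarrow> zvar i \<in> loc n k I"
  unfolding zvar_def by (intro single_loc) (auto simp: loc_keys_def lookup_single when_def)

definition zinv :: "nat \<Rightarrow> 'a::field bipoly" where
  "zinv i = single (single i (- 1), 0) 1"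

lemma zinv_loc: "i \<le> k \<Longrightarrow> i \<in> I \<Longrightarrow> zinv i \<in> loc n k I"
  unfolding zinv_def by (intro single_loc) (auto simp: loc_keys_def lookup_single when_def)

lemma zvar_zinv [simp]: "zvar i * zinv i = 1"
proof -
  have "single i 1 + single i (- 1) = (0 :: nat \<Rightarrow>\<^sub>0 int)" by (simp flip: single_add)
  then show ?thesis by (simp add: zvar_def zinv_def mult_single flip: zero_prod_def)
qed

lemma zinv_zvar [simp]: "zinv i * zvar i = 1"
  using zvar_zinv[of i] by (simp add: mult.commute)

lemma zvar_nonzero [simp]: "zvar i \<noteq> 0"
  using zvar_zinv[of i] by (metis mult_zero_left zero_neq_one)

lemma lin_form_loc': "\<kappa> \<le> k \<Longrightarrow> \<kappa> + j \<le> n \<Longrightarrow> lin_form \<kappa> j \<in> loc n k I"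
  unfolding lin_form_def
  by (intro ring_subset_sum[OF ring_subset_loc] ring_subsetD(6)[OF ring_subset_loc] zvar_loc yvar_loc) auto

subsection \<open>Forms that are linear in one of the variables\<close>

definition y_free :: "nat \<Rightarrow> 'a::field bipoly \<Rightarrow> bool" where
  "y_free t x \<longleftrightarrow> (\<forall>u\<in>keys x. lookup (snd u) t = 0)"

text \<open>A left inverse of multiplication by \<open>yvar t\<close>. Monomials without
  \<open>yvar t\<close> are sent to 0, which makes the map linear over all elements free of that
  variable.\<close>

definition y_div :: "nat \<Rightarrow> 'a::field bipoly \<Rightarrow> 'a bipoly" where
  "y_div t = lin_ext (\<lambda>(a, b). if lookup b t \<ge> 1 then single (a, b - single t 1) 1 else 0)"

lemma y_div_0: "y_div t 0 = 0" and y_div_add: "y_div t (f + g) = y_div t f + y_div t g"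
  by (simp_all add: y_div_def lin_ext_add)

lemma y_div_mult: 
  assumes "y_free t x"
  shows "y_div t (x * f) = x * y_div t f"
proof -
  have "y_div t (x * f) = lin_ext (\<lambda>u. single u 1) x * y_div t f"
    unfolding y_div_def
  proof (rule lin_ext_mult)
    fix u v :: "(nat \<Rightarrow>\<^sub>0 int) \<times> (nat \<Rightarrow>\<^sub>0 nat)" assume u: "u \<in> keys x"
    obtain a b c d where eq: "u = (a, b)" "v = (c, d)" by fastforce
    have b: "lookup b t = 0" using u assms by (auto simp: y_free_def eq)
    have "b + d - single t 1 = b + (d - single t 1)" if "lookup d t \<ge> 1"
      using that b by (intro poly_mapping_eqI) (auto simp: lookup_add lookup_minus lookup_single when_def)
    then show "(case u + v of (a, b) \<Rightarrow> if lookup b t \<ge> 1 then single (a, b - single t 1) (1 :: 'a) else 0)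
      = single u 1 * (case v of (a, b) \<Rightarrow> if lookup b t \<ge> 1 then single (a, b - single t 1) 1 else 0)"
      by (simp add: eq lookup_add b mult_single)
  qed
  then show ?thesis by simp
qed

lemma y_div_yvar: "y_div t (yvar t * f) = f"
proof -
  have "y_div t (yvar t * f) = lin_ext (\<lambda>_. 1) (yvar t) * lin_ext (\<lambda>u. single u 1) f"
    unfolding y_div_def by (rule lin_ext_mult) (auto simp: yvar_def lookup_add)
  then show ?thesis by (simp add: yvar_def lin_ext_single flip: zero_prod_def)
qed

lemma y_div_loc:
  assumes "f \<in> loc n k I"
  shows "y_div t f \<in> loc n k I"
proof -
  have "keys (y_div t f) \<subseteq> loc_keys n k I"
    unfolding y_div_def
  proof (rule keys_lin_ext)
    fix u v assume u: "u \<in> keys f" and v: "v \<in> keys (case u of (a, b) \<Rightarrow> if lookup b t \<ge> 1 then single (a, b - single t 1) (1 :: 'a) else 0)"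
    obtain a b where eq: "u = (a, b)" by fastforce
    have "keys (b - single t 1) \<subseteq> keys b" by (auto simp: in_keys_iff lookup_minus)
    moreover have "u \<in> loc_keys n k I" using u assms by (auto simp: loc_iff)
    ultimately show "v \<in> loc_keys n k I" using v by (auto simp: eq loc_keys_def split: if_splits)
  qed
  then show ?thesis by (simp add: loc_iff)
qed

lemma ideal_span_image:
  assumes "\<And>i a. i < j \<Longrightarrow> a \<in> A \<Longrightarrow> h (x i * a) = x i * h a" "\<And>a. a \<in> A \<Longrightarrow> h a \<in> A"
    and "h 0 = 0" "\<And>f g. h (f + g) = h f + h g" and f: "f \<in> ideal_span A x j"
  shows "h f \<in> ideal_span A x j"
proof -
  from f obtain a where a: "f = (\<Sum>i<j. a i * x i)" "\<forall>i<j. a i \<in> A" by (rule ideal_spanE)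
  have "h (sum g J) = (\<Sum>i\<in>J. h (g i))" for g and J :: "nat set"
    by (induction J rule: infinite_finite_induct) (simp_all add: assms)
  then have "h f = (\<Sum>i<j. h (a i) * x i)"
    unfolding a(1) using assms(1)[of _ "a _"] a(2) by (simp add: mult.commute)
  then show ?thesis using a(2) assms(2) by (auto intro: ideal_spanI)
qed

text \<open>The ideal is generated by elements free of \<open>yvar t\<close>, hence graded by the
  degree in this variable. So the part of \<open>f\<close> of top degree can be split off: its
  product with the leading coefficient \<open>z\<close> lies in the ideal, and \<open>z\<close> is
  regular.\<close>

lemma nzd_mod_linear:
  fixes x :: "nat \<Rightarrow> 'a::field bipoly"
  assumes t: "t \<le> n" and x: "\<And>i. i < j \<Longrightarrow> y_free t (x i)"
    and b: "y_free t b" "b \<in> loc n k I" and z: "y_free t z" "z \<in> loc n k I"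
    and reg: "nzd_mod (loc n k I) (ideal_span (loc n k I) x j) z"
  shows "nzd_mod (loc n k I) (ideal_span (loc n k I) x j) (z * yvar t + b)"
proof -
  let ?A = "loc n k I :: 'a bipoly set"
  let ?Q = "ideal_span ?A x j"
  define U where "U N = {u :: (nat \<Rightarrow>\<^sub>0 int) \<times> (nat \<Rightarrow>\<^sub>0 nat). lookup (snd u) t = N}" for N
  note A = ring_subset_loc[of n k I, where 'a = 'a]
  have part: "mono_part (U N) (c * f) = c * mono_part (U N) f" if "y_free t c" for c f :: "'a bipoly" and N
    using that by (intro mono_part_mult) (auto simp: U_def y_free_def lookup_add)
  have part_y: "mono_part (U (Suc N)) (yvar t * f) = yvar t * mono_part (U N) f" for f :: "'a bipoly" and N
    by (intro mono_part_mult) (auto simp: U_def yvar_def lookup_add)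
  have Q_part: "mono_part (U N) f \<in> ?Q" if "f \<in> ?Q" for f N
    using that x by (intro ideal_span_image[where h = "mono_part (U N)"]) (auto simp: part mono_part_loc mono_part_add)
  have Q_div: "y_div t f \<in> ?Q" if "f \<in> ?Q" for f
    using that x by (intro ideal_span_image[where h = "y_div t"])
      (auto simp: y_div_mult y_div_loc y_div_0 y_div_add)
  have main: "f \<in> ?Q" if "f \<in> ?A" "\<And>u. u \<in> keys f \<Longrightarrow> lookup (snd u) t < N" "(z * yvar t + b) * f \<in> ?Q" for f N
    using that
  proof (induction N arbitrary: f)
    case 0
    then have "f = 0" by (metis keys_eq_empty all_not_in_conv not_less_zero)
    then show ?case by (simp add: ideal_span_0[OF A])
  next
    case (Suc N)
    let ?f = "mono_part (U N) f"
    have "mono_part (U (Suc N)) f = 0"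
      by (intro mono_part_eq_0 equals0I) (use Suc.prems(2) in \<open>force simp: U_def\<close>)
    \<comment> \<open>In degree \<open>N + 1\<close> only \<open>z * yvar t\<close> times the part
      of degree \<open>N\<close> survives, as \<open>f\<close> has no part of degree
      \<open>N + 1\<close> for \<open>b\<close> to meet.\<close>
    then have "mono_part (U (Suc N)) ((z * yvar t + b) * f) = yvar t * (z * ?f)"
      by (simp add: distrib_right mono_part_add part b(1) z(1) part_y mult.assoc mult.left_commute[of z])
    with Q_part[OF Suc.prems(3), of "Suc N"] have "yvar t * (z * ?f) \<in> ?Q" by simp
    from Q_div[OF this] have "z * ?f \<in> ?Q" by (simp add: y_div_yvar)
    with reg Suc.prems(1) have fN: "?f \<in> ?Q" by (simp add: nzd_mod_def mono_part_loc)
    have "f - ?f \<in> ?Q"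
    proof (rule Suc.IH)
      show "f - ?f \<in> ?A" using Suc.prems(1) by (intro ring_subsetD(4)[OF A] mono_part_loc)
      show "lookup (snd u) t < N" if "u \<in> keys (f - ?f)" for u
      proof -
        have "lookup f u \<noteq> 0" "u \<notin> U N" using that by (auto simp: in_keys_iff lookup_minus lookup_mono_part split: if_splits)
        then show ?thesis using Suc.prems(2)[of u] by (auto simp: in_keys_iff U_def)
      qed
      have "(z * yvar t + b) * ?f \<in> ?Q"
        using b z t fN by (intro ideal_span_mult[OF A] ring_subsetD(5,6)[OF A] yvar_loc)
      then show "(z * yvar t + b) * (f - ?f) \<in> ?Q"
        using Suc.prems(3) by (simp add: right_diff_distrib ideal_span_diff[OF A])
    qed
    with fN show ?case using ideal_span_add[OF A, of "f - ?f" x j ?f] by simp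
  qed
  show ?thesis
    unfolding nzd_mod_def
  proof (intro ballI impI)
    fix f assume f: "f \<in> ?A" "(z * yvar t + b) * f \<in> ?Q"
    have "lookup (snd u) t < Suc (\<Sum>u\<in>keys f. lookup (snd u) t)" if "u \<in> keys f" for u
      using member_le_sum[OF that, of "\<lambda>u. lookup (snd u) t"] by simp
    then show "f \<in> ?Q" by (rule main[OF f(1) _ f(2)])
  qed
qed

subsection \<open>Regularity\<close>

lemma lin_form_Suc: "lin_form (Suc \<kappa>) j = lin_form \<kappa> j + zvar (Suc \<kappa>) * yvar (Suc \<kappa> + j)"
  by (simp add: lin_form_def)

lemma keys_lin_form: "keys (lin_form \<kappa> j :: 'a::field bipoly) \<subseteq> (\<lambda>i. (single i 1, single (i + j) 1)) ` {..\<kappa>}"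
  unfolding lin_form_def
  by (rule order_trans[OF Poly_Mapping.keys_sum])
    (auto simp: zvar_def yvar_def mult_single split: if_splits)

lemma y_free_lin_form: "\<kappa> + j < t \<Longrightarrow> y_free t (lin_form \<kappa> j)"
  using keys_lin_form[of \<kappa> j] by (fastforce simp: y_free_def lookup_single)

lemma nzd_mod_unit:
  assumes "ring_subset A" "z' \<in> A" "z' * z = 1"
  shows "nzd_mod A (ideal_span A x j) z"
  unfolding nzd_mod_def
proof (intro ballI impI)
  fix f assume "z * f \<in> ideal_span A x j"
  from ideal_span_mult[OF assms(1,2) this] show "f \<in> ideal_span A x j"
    by (simp add: assms(3) flip: mult.assoc)
qed

text \<open>The variable \<open>yvar (\<kappa> + j)\<close> occurs in
  \<open>lin_form \<kappa> j\<close> linearly with coefficient \<open>zvar \<kappa>\<close>, and in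
  no earlier form. So regularity of the form reduces to that of its leading coefficient.\<close>

lemma nzd_mod_lin_form_step:
  fixes n k \<kappa> :: nat and I :: "nat set"
  assumes \<kappa>: "\<kappa> \<le> k" "\<kappa> + j \<le> n"
    and reg: "nzd_mod (loc n k I) (ideal_span (loc n k I) (lin_form \<kappa>) j) (zvar \<kappa> :: 'a::field bipoly)"
  shows "nzd_mod (loc n k I) (ideal_span (loc n k I) (lin_form \<kappa>) j) (lin_form \<kappa> j :: 'a bipoly)"
proof -
  define b :: "'a bipoly" where "b = (\<Sum>i<\<kappa>. zvar i * yvar (i + j))"
  have eq: "lin_form \<kappa> j = zvar \<kappa> * yvar (\<kappa> + j) + b"
    by (simp add: lin_form_def b_def lessThan_Suc_atMost[symmetric])
  have "keys b \<subseteq> (\<Union>i<\<kappa>. {(single i 1, single (i + j) 1)})"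
    unfolding b_def
    by (rule order_trans[OF Poly_Mapping.keys_sum]) (auto simp: zvar_def yvar_def mult_single split: if_splits)
  then have "y_free (\<kappa> + j) b" by (fastforce simp: y_free_def lookup_single)
  moreover have "b \<in> loc n k I"
    unfolding b_def using \<kappa>
    by (intro ring_subset_sum[OF ring_subset_loc] ring_subsetD(6)[OF ring_subset_loc] zvar_loc yvar_loc) auto
  moreover have "y_free (\<kappa> + j) (zvar \<kappa> :: 'a bipoly)" by (simp add: y_free_def zvar_def)
  ultimately show ?thesis
    unfolding eq using \<kappa> reg
    by (intro nzd_mod_linear y_free_lin_form zvar_loc) auto
qed

text \<open>Modulo \<open>zvar (Suc \<kappa>)\<close> the forms of length
  \<open>Suc \<kappa>\<close> become those of length \<open>\<kappa>\<close>, which are regular by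
  \<open>reg\<close>; the exchange lemma then moves \<open>zvar (Suc \<kappa>)\<close> behind the
  forms.\<close>

lemma nzd_mod_zvar:
  fixes n k \<kappa> :: nat and I :: "nat set"
  assumes \<kappa>: "Suc \<kappa> \<le> k" "Suc \<kappa> \<notin> I" "Suc \<kappa> + j \<le> Suc n"
    and reg: "\<And>i. \<kappa> + i \<le> n \<Longrightarrow> nzd_mod (loc n k I) (ideal_span (loc n k I) (lin_form \<kappa>) i) (lin_form \<kappa> i :: 'a::field bipoly)"
  shows "nzd_mod (loc n k I) (ideal_span (loc n k I) (lin_form (Suc \<kappa>)) j) (zvar (Suc \<kappa>) :: 'a bipoly)"
  using \<kappa>(3)
proof (induction j)
  case 0
  show ?case by (auto simp: nzd_mod_def ideal_span_def)
next
  case (Suc j)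
  let ?A = "loc n k I :: 'a bipoly set"
  note A = ring_subset_loc[of n k I, where 'a = 'a]
  let ?L = "lin_form (Suc \<kappa>) :: nat \<Rightarrow> 'a bipoly" and ?L' = "lin_form \<kappa> :: nat \<Rightarrow> 'a bipoly" and ?z = "zvar (Suc \<kappa>) :: 'a bipoly"
  \<comment> \<open>Projection onto \<open>U\<close> is the evaluation at
    \<open>zvar (Suc \<kappa>) = 0\<close>. It makes sense because this variable is not
    inverted.\<close>
  define U where "U = {u :: (nat \<Rightarrow>\<^sub>0 int) \<times> (nat \<Rightarrow>\<^sub>0 nat). lookup (fst u) (Suc \<kappa>) = 0}"
  have part: "mono_part U (?L' i * f) = ?L' i * mono_part U f" for i f
  proof (rule mono_part_mult)
    fix u v assume "u \<in> keys (?L' i)"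
    then have "lookup (fst u) (Suc \<kappa>) = 0"
      using keys_lin_form[of \<kappa> i] by (fastforce simp: lookup_single)
    then show "u + v \<in> U \<longleftrightarrow> v \<in> U" by (simp add: U_def lookup_add)
  qed
  have nonneg: "lookup (fst u) (Suc \<kappa>) \<ge> 0" if "f \<in> ?A" "u \<in> keys f" for f u
    using that \<kappa>(2) by (force simp: loc_iff loc_keys_def)
  have part_z: "mono_part U (?z * f) = 0" if "f \<in> ?A" for f
  proof -
    have "mono_part U (?z * f) = ?z * mono_part {} f"
      using nonneg[OF that] by (intro mono_part_mult) (fastforce simp: U_def zvar_def lookup_add)
    also have "mono_part {} f = 0" by (rule mono_part_eq_0) simp
    finally show ?thesis by simp
  qed
  have z_dvd: "\<exists>c\<in>?A. f - mono_part U f = ?z * c" if f: "f \<in> ?A" for f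
  proof (rule bexI[of _ "zinv (Suc \<kappa>) * (f - mono_part U f)"])
    show "f - mono_part U f = ?z * (zinv (Suc \<kappa>) * (f - mono_part U f))"
      by (simp flip: mult.assoc)
    show "zinv (Suc \<kappa>) * (f - mono_part U f) \<in> ?A"
      unfolding loc_iff
    proof
      fix w assume "w \<in> keys (zinv (Suc \<kappa>) * (f - mono_part U f))"
      then obtain v where w: "w = (single (Suc \<kappa>) (- 1), 0) + v" and "v \<in> keys (f - mono_part U f)"
        using Poly_Mapping.keys_mult[of "zinv (Suc \<kappa>)" "f - mono_part U f"] by (auto simp: zinv_def)
      then have "lookup f v \<noteq> 0" "v \<notin> U"
        by (auto simp: in_keys_iff lookup_minus lookup_mono_part split: if_splits)
      with nonneg[OF f, of v] f have v: "lookup (fst v) (Suc \<kappa>) \<ge> 1" "v \<in> loc_keys n k I"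
        by (auto simp: in_keys_iff U_def loc_iff)
      have "keys (single (Suc \<kappa>) (- 1) + fst v) \<subseteq> {0..k}"
        using v(2) \<kappa>(1) Poly_Mapping.keys_add[of "single (Suc \<kappa>) (- 1)" "fst v"] by (auto simp: loc_keys_def split: if_splits)
      moreover have "i \<in> I" if "lookup (single (Suc \<kappa>) (- 1) + fst v) i < 0" for i
        using that v by (auto simp: loc_keys_def lookup_add lookup_single when_def split: if_splits)
      ultimately show "w \<in> loc_keys n k I" using v(2) by (auto simp: w loc_keys_def)
    qed
  qed
  show ?case
  proof (rule nzd_mod_swap[OF A])
    show "?L j \<in> ?A" using Suc.prems \<kappa>(1) by (intro lin_form_loc') auto
    show "?z \<in> ?A" using \<kappa>(1) by (rule zvar_loc)
    show "nzd_mod ?A (ideal_span ?A ?L j) ?z" using Suc by simp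
    fix a assume a: "a \<in> ?A" and "\<exists>q\<in>ideal_span ?A ?L j. \<exists>c\<in>?A. ?L j * a = q + ?z * c"
    then obtain q c where q: "q \<in> ideal_span ?A ?L j" and c: "c \<in> ?A" and eq: "?L j * a = q + ?z * c" by blast
    from q obtain d where d: "q = (\<Sum>i<j. d i * ?L i)" "\<forall>i<j. d i \<in> ?A" by (rule ideal_spanE)
    \<comment> \<open>When every long form is split into the short one and its last summand,
      \<open>e\<close> is the total cofactor of \<open>zvar (Suc \<kappa>)\<close>.\<close>
    define e where "e = (\<Sum>i<j. d i * yvar (Suc \<kappa> + i)) + c - yvar (Suc \<kappa> + j) * a"
    have e: "e \<in> ?A"
      unfolding e_def using a c d(2) Suc.prems
      by (intro ring_subsetD(4,5,6)[OF A] ring_subset_sum[OF A] yvar_loc) auto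
    have "?L' j * a = (\<Sum>i<j. ?L' i * d i) + ?z * e"
      using eq by (simp add: d(1) e_def lin_form_Suc algebra_simps sum.distrib sum_distrib_left)
    then have "mono_part U (?L' j * a) = (\<Sum>i<j. mono_part U (?L' i * d i)) + mono_part U (?z * e)"
      by (simp only: mono_part_add mono_part_sum)
    then have "?L' j * mono_part U a = (\<Sum>i<j. ?L' i * mono_part U (d i))"
      by (simp add: part part_z[OF e])
    also have "\<dots> = (\<Sum>i<j. mono_part U (d i) * ?L' i)" by (simp add: mult.commute)
    also have "\<dots> \<in> ideal_span ?A ?L' j" using d(2) by (auto intro!: ideal_spanI mono_part_loc)
    finally have "mono_part U a \<in> ideal_span ?A ?L' j"
      using reg[of j] Suc.prems mono_part_loc[OF a] by (simp add: nzd_mod_def)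
    then obtain g where g: "mono_part U a = (\<Sum>i<j. g i * ?L' i)" "\<forall>i<j. g i \<in> ?A" by (rule ideal_spanE)
    obtain h where h: "h \<in> ?A" "a - mono_part U a = ?z * h" using z_dvd[OF a] by blast
    have "a = (\<Sum>i<j. g i * ?L i) + ?z * (h - (\<Sum>i<j. g i * yvar (Suc \<kappa> + i)))"
      using h(2) g(1) by (simp add: lin_form_Suc algebra_simps sum.distrib sum_distrib_left)
    moreover have "h - (\<Sum>i<j. g i * yvar (Suc \<kappa> + i)) \<in> ?A"
      using h(1) g(2) Suc.prems by (intro ring_subsetD(4,6)[OF A] ring_subset_sum[OF A] yvar_loc) auto
    ultimately show "\<exists>q\<in>ideal_span ?A ?L j. \<exists>c\<in>?A. a = q + ?z * c"
      using ideal_spanI[of j g ?A ?L] g(2) by blast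
  qed
qed

text \<open>The leading coefficient \<open>zvar \<kappa>\<close> is a unit if
  \<open>\<kappa> \<in> I\<close>. Otherwise \<open>I\<close> still meets the range of the shorter
  forms, and their regularity makes \<open>zvar \<kappa>\<close> regular. The condition on
  \<open>I\<close> guarantees that a unit is met at last.\<close>

theorem nzd_mod_lin_form:
  fixes n k \<kappa> :: nat and I :: "nat set"
  assumes "\<kappa> \<le> k" "\<kappa> + j \<le> n" "I \<inter> {0..\<kappa>} \<noteq> {}"
  shows "nzd_mod (loc n k I) (ideal_span (loc n k I) (lin_form \<kappa>) j) (lin_form \<kappa> j :: 'a::field bipoly)"
  using assms
proof (induction \<kappa> arbitrary: j)
  case 0
  then show ?case
    by (intro nzd_mod_lin_form_step nzd_mod_unit[OF ring_subset_loc, of "zinv 0"] zinv_loc) auto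
next
  case (Suc \<kappa>)
  show ?case
  proof (cases "Suc \<kappa> \<in> I")
    case True
    with Suc.prems show ?thesis
      by (intro nzd_mod_lin_form_step nzd_mod_unit[OF ring_subset_loc, of "zinv (Suc \<kappa>)"] zinv_loc) auto
  next
    case False
    with Suc.prems(3) have "I \<inter> {0..\<kappa>} \<noteq> {}" by (auto simp: atLeastAtMostSuc_conv)
    with False Suc.prems Suc.IH show ?thesis
      by (intro nzd_mod_lin_form_step nzd_mod_zvar Suc.IH) simp_all
  qed
qed

text \<open>Used to carry the vanishing of a section from the chart \<open>{k}\<close> to the other
  charts.\<close>

corollary nzd_mod_last_zvar:
  fixes n k :: nat and I :: "nat set"
  assumes "k + j \<le> Suc n" "I \<inter> {0..<k} \<noteq> {}" "k \<notin> I"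
  shows "nzd_mod (loc n k I) (ideal_span (loc n k I) (lin_form k) j) (zvar k :: 'a::field bipoly)"
proof (cases k)
  case 0
  with assms(2) show ?thesis by simp
next
  case (Suc \<kappa>)
  with assms show ?thesis
    by (auto intro!: nzd_mod_zvar nzd_mod_lin_form simp: atLeastLessThanSuc_atLeastAtMost)
qed

section \<open>Koszul complexes of regular sequences\<close>

text \<open>The element \<open>t\<close> need not belong to \<open>S\<close>, so one sign serves for
  insertion and removal, in the Koszul and in the Cech complex. The ring is arbitrary since signs
  occur among scalars and among polynomials.\<close>

definition pos_sign :: "nat set \<Rightarrow> nat \<Rightarrow> 'r::comm_ring_1" where
  "pos_sign S t = (- 1) ^ card {s \<in> S. s < t}"

lemma pos_sign_insert:
  assumes "t \<notin> S"
  shows "pos_sign (insert t S) u = (if t < u then - pos_sign S u else (pos_sign S u :: 'r::comm_ring_1))"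
proof -
  have "{s \<in> insert t S. s < u} = (if t < u then insert t {s \<in> S. s < u} else {s \<in> S. s < u})" by auto
  moreover have "finite {s \<in> S. s < u}" by (rule finite_subset[of _ "{..<u}"]) auto
  ultimately show ?thesis using assms by (simp add: pos_sign_def)
qed

lemma pos_sign_remove:
  assumes "t \<in> S"
  shows "pos_sign (S - {t}) u = (if t < u then - pos_sign S u else (pos_sign S u :: 'r::comm_ring_1))"
  using pos_sign_insert[of t "S - {t}" u, where 'r = 'r] assms
  by (cases "t < u") (simp_all add: insert_absorb)

lemma pos_sign_square [simp]: "pos_sign S t * pos_sign S t = (1 :: 'r::comm_ring_1)"
  by (simp add: pos_sign_def flip: power_add mult_2)

text \<open>Contraction of an exterior power with the functional \<open>e_t \<mapsto> x t\<close>.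
  Besides the forms \<open>L_t\<close>, which give the Koszul differential, \<open>x\<close> will be
  a column of the Hankel matrix.\<close>

definition kdiff :: "nat \<Rightarrow> (nat \<Rightarrow> 'r::comm_ring_1) \<Rightarrow> (nat set \<Rightarrow> 'r) \<Rightarrow> nat set \<Rightarrow> 'r" where
  "kdiff m x c S = (\<Sum>t\<in>{0..<m} - S. pos_sign S t * x t * c (insert t S))"

lemma kdiff_add: "kdiff m x (\<lambda>T. c T + c' T) S = kdiff m x c S + kdiff m x c' S"
  by (simp add: kdiff_def algebra_simps sum.distrib)

lemma kdiff_diff: "kdiff m x (\<lambda>T. c T - c' T) S = kdiff m x c S - kdiff m x c' S"
  by (simp add: kdiff_def algebra_simps sum_subtractf)

lemma kdiff_scale: "kdiff m x (\<lambda>T. a * c T) S = a * kdiff m x c S"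
  by (simp add: kdiff_def sum_distrib_left mult_ac)

lemma kdiff_0 [simp]: "kdiff m x (\<lambda>T. 0) S = 0"
  by (simp add: kdiff_def)

lemma kdiff_sum: "kdiff m x (\<lambda>T. \<Sum>i\<in>I. c i T) S = (\<Sum>i\<in>I. kdiff m x (c i) S)"
  by (induction I rule: infinite_finite_induct) (simp_all add: kdiff_add)

lemma kdiff_form_add: "kdiff m (\<lambda>t. x t + x' t) c S = kdiff m x c S + kdiff m x' c S"
  by (simp add: kdiff_def algebra_simps sum.distrib)

lemma kdiff_form_sum: "kdiff m (\<lambda>t. \<Sum>i\<in>I. a i * x i t) c S = (\<Sum>i\<in>I. a i * kdiff m (x i) c S)"
proof -
  have "kdiff m (\<lambda>t. a * x t) c S = a * kdiff m x c S" for a x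
    by (simp add: kdiff_def sum_distrib_left mult_ac)
  then show ?thesis
    by (induction I rule: infinite_finite_induct) (simp_all add: kdiff_form_add, simp_all add: kdiff_def)
qed

text \<open>Removing \<open>t\<close> and \<open>u\<close> in the two possible orders gives opposite
  signs, so the ordered pairs cancel in twos.\<close>

lemma kdiff_kdiff [simp]: "kdiff m x (kdiff m x c) S = 0"
proof -
  define D where "D = {0..<m} - S"
  define P where "P = Sigma D (\<lambda>t. D - {t})"
  define F where "F = (\<lambda>(t, u). pos_sign S t * x t * (pos_sign (insert t S) u * x u * c (insert u (insert t S))))"
  have fin: "finite D" "finite P" by (auto simp: D_def P_def)
  have "kdiff m x (kdiff m x c) S = (\<Sum>t\<in>D. \<Sum>u\<in>D - {t}. F (t, u))"
    by (auto simp: kdiff_def sum_distrib_left D_def F_def intro!: sum.cong)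
  also have "\<dots> = sum F P"
    unfolding P_def using fin by (subst sum.Sigma) auto
  also have "\<dots> = sum F {p \<in> P. fst p < snd p} + sum F {p \<in> P. snd p < fst p}"
    using fin by (subst sum.union_disjoint[symmetric]) (auto intro!: sum.cong simp: P_def)
  also have "sum F {p \<in> P. snd p < fst p} = (\<Sum>p\<in>{p \<in> P. fst p < snd p}. F (prod.swap p))"
    by (rule sum.reindex_bij_witness[of _ prod.swap prod.swap]) (auto simp: P_def)
  also have "\<dots> = (\<Sum>p\<in>{p \<in> P. fst p < snd p}. - F p)"
  proof (rule sum.cong[OF refl])
    fix p assume "p \<in> {p \<in> P. fst p < snd p}"
    then obtain t u where p: "p = (t, u)" "t \<notin> S" "u \<notin> S" "t < u" by (auto simp: P_def D_def)
    then show "F (prod.swap p) = - F p"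
      by (simp add: F_def pos_sign_insert mult_ac insert_commute)
  qed
  finally show ?thesis by (simp add: sum_negf)
qed

text \<open>Polarization: the square of the contraction with \<open>x + y\<close> vanishes.\<close>

lemma kdiff_anticommute: "kdiff m x (kdiff m y c) S = - kdiff m y (kdiff m x c) S"
proof -
  have eq: "kdiff m (\<lambda>t. x t + y t) c = (\<lambda>T. kdiff m x c T + kdiff m y c T)" for c
    by (rule ext) (rule kdiff_form_add)
  have "kdiff m (\<lambda>t. x t + y t) (kdiff m (\<lambda>t. x t + y t) c) S = 0" by (rule kdiff_kdiff)
  then show ?thesis
    unfolding eq by (simp add: kdiff_add eq_neg_iff_add_eq_0)
qed

definition supp_on :: "nat \<Rightarrow> nat \<Rightarrow> (nat set \<Rightarrow> 'r::zero) \<Rightarrow> bool" where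
  "supp_on m q c \<longleftrightarrow> (\<forall>T. c T \<noteq> 0 \<longrightarrow> T \<subseteq> {0..<m} \<and> card T = q)"

lemma supp_onD: "supp_on m q c \<Longrightarrow> \<not> (T \<subseteq> {0..<m} \<and> card T = q) \<Longrightarrow> c T = 0"
  by (auto simp: supp_on_def)

lemma supp_on_kdiff:
  assumes "supp_on m (Suc q) c"
  shows "supp_on m q (kdiff m x c)"
  unfolding supp_on_def
proof (intro allI impI)
  fix S assume "kdiff m x c S \<noteq> 0"
  then have "\<exists>t\<in>{0..<m} - S. c (insert t S) \<noteq> 0"
    by (rule contrapos_np) (simp add: kdiff_def)
  then obtain t where t: "t \<in> {0..<m} - S" "c (insert t S) \<noteq> 0" by blast
  with assms have *: "insert t S \<subseteq> {0..<m}" "card (insert t S) = Suc q" by (auto simp: supp_on_def)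
  then have "finite S" using finite_subset by auto
  with * t show "S \<subseteq> {0..<m} \<and> card S = q" by auto
qed

lemma supp_on_0: "supp_on m q (\<lambda>T. 0)"
  by (simp add: supp_on_def)

lemma supp_on_add: "supp_on m q c \<Longrightarrow> supp_on m q c' \<Longrightarrow> supp_on m q (\<lambda>T. c T + c' T :: 'r::comm_ring_1)"
  unfolding supp_on_def by (metis add.right_neutral)

lemma supp_on_scale: "supp_on m q c \<Longrightarrow> supp_on m q (\<lambda>T. a * c T :: 'r::comm_ring_1)"
  unfolding supp_on_def by (metis mult_zero_right)

lemma supp_on_diff: "supp_on m q c \<Longrightarrow> supp_on m q c' \<Longrightarrow> supp_on m q (\<lambda>T. c T - c' T :: 'r::comm_ring_1)"
  using supp_on_add[of m q c "\<lambda>T. - 1 * c' T"] supp_on_scale[of m q c' "- 1"] by simp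

text \<open>With the next lemma this presents the complex on \<open>m + 1\<close> elements as the
  cone of multiplication by \<open>x m\<close> on the complex on \<open>m\<close> elements. The new
  index is the largest and leaves the other signs unchanged.\<close>

lemma kdiff_insert_last:
  assumes "S \<subseteq> {0..<m}"
  shows "kdiff (Suc m) x c (insert m S) = kdiff m x (\<lambda>T. c (insert m T)) S"
proof -
  have "{0..<Suc m} - insert m S = {0..<m} - S" by auto
  moreover have "{s \<in> insert m S. s < t} = {s \<in> S. s < t}" if "t < m" for t using that by auto
  ultimately show ?thesis by (auto simp: kdiff_def pos_sign_def insert_commute intro!: sum.cong)
qed

lemma kdiff_last:
  assumes "S \<subseteq> {0..<m}"
  shows "kdiff (Suc m) x c S = kdiff m x c S + (- 1) ^ card S * x m * c (insert m S)"
proof -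
  have "{0..<Suc m} - S = insert m ({0..<m} - S)" using assms by auto
  moreover have "{s \<in> S. s < m} = S" using assms by auto
  ultimately show ?thesis by (simp add: kdiff_def pos_sign_def add.commute)
qed

lemma kdiff_cong: "(\<And>t. t < m \<Longrightarrow> t \<notin> S \<Longrightarrow> c (insert t S) = c' (insert t S)) \<Longrightarrow> kdiff m x c S = kdiff m x c' S"
  by (auto simp: kdiff_def intro!: sum.cong)

lemma ideal_span_kdiff:
  assumes "ring_subset A" "f \<in> ideal_span A x m"
  obtains b where "\<forall>T. b T \<in> A" "supp_on m 1 b" "kdiff m x b = (\<lambda>S. if S = {} then f else 0)"
proof -
  from assms(2) obtain a where a: "f = (\<Sum>j<m. a j * x j)" "\<forall>j<m. a j \<in> A" by (rule ideal_spanE)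
  define b where "b T = (if \<exists>j<m. T = {j} then a (the_elem T) else 0)" for T
  have s: "supp_on m 1 b" by (auto simp: supp_on_def b_def)
  moreover have "\<forall>T. b T \<in> A" using a(2) assms(1) by (auto simp: b_def ring_subsetD)
  moreover have "kdiff m x b S = (if S = {} then f else 0)" for S
  proof (cases "S = {}")
    case True
    then show ?thesis by (auto simp: kdiff_def pos_sign_def b_def a(1) atLeast0LessThan mult.commute intro!: sum.cong)
  next
    case False
    have "supp_on m 0 (kdiff m x b)" using s by (intro supp_on_kdiff) simp
    moreover have "\<not> (S \<subseteq> {0..<m} \<and> card S = 0)" using False finite_subset[of S "{0..<m}"] by auto
    ultimately have "kdiff m x b S = 0" by (rule supp_onD)
    with False show ?thesis by simp
  qed
  ultimately show ?thesis by (intro that[of b]) auto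
qed

lemma kdiff_in_ideal_span:
  assumes A: "ring_subset A" and b: "\<forall>T. b T \<in> A"
  shows "kdiff m x b {} \<in> ideal_span A x m"
proof -
  have "kdiff m x b {} = (\<Sum>t<m. b {t} * x t)"
    by (auto simp: kdiff_def pos_sign_def atLeast0LessThan mult.commute intro!: sum.cong)
  also have "\<dots> \<in> ideal_span A x m" using b by (intro ideal_spanI) auto
  finally show ?thesis .
qed

text \<open>Induction through the cone: \<open>c\<close> splits into \<open>c0\<close> without the
  last index and \<open>c1\<close>, its cofactor. The part \<open>c1\<close> is a cycle, hence a
  boundary, and a preimage of it serves to correct \<open>c0\<close> to a cycle.\<close>

theorem koszul_exact:
  assumes A: "ring_subset A" and "\<And>j. j < m \<Longrightarrow> x j \<in> A"
    and "\<And>j. j < m \<Longrightarrow> nzd_mod A (ideal_span A x j) (x j)"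
    and "\<forall>T. c T \<in> A" "supp_on m (Suc q) c" "kdiff m x c = (\<lambda>S. 0)"
  shows "\<exists>b. (\<forall>T. b T \<in> A) \<and> supp_on m (Suc (Suc q)) b \<and> kdiff m x b = c"
  using assms(2-)
proof (induction m arbitrary: q c)
  case 0
  have "c T = 0" for T by (rule supp_onD[OF 0(4)]) auto
  then have "c = (\<lambda>T. 0)" by blast
  then show ?case using A by (intro exI[of _ "\<lambda>T. 0"]) (auto simp: supp_on_0 ring_subsetD)
next
  case (Suc m)
  define c0 where "c0 T = (if m \<in> T then 0 else c T)" for T
  define c1 where "c1 T = (if T \<subseteq> {0..<m} then c (insert m T) else 0)" for T
  have c0A: "c0 T \<in> A" and c1A: "c1 T \<in> A" for T
    using Suc.prems(3) A by (auto simp: c0_def c1_def ring_subsetD)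
  have less_Suc: "T \<subseteq> {0..<m}" if "T \<subseteq> {0..<Suc m}" "m \<notin> T" for T :: "nat set"
    using that by (auto simp: less_Suc_eq)
  have supp0: "supp_on m (Suc q) c0"
    using Suc.prems(4) less_Suc by (auto simp: supp_on_def c0_def)
  have supp1: "supp_on m q c1"
    unfolding supp_on_def
  proof (intro allI impI)
    fix T assume "c1 T \<noteq> 0"
    then have T: "T \<subseteq> {0..<m}" "card (insert m T) = Suc q"
      using Suc.prems(4) by (auto simp: c1_def supp_on_def split: if_splits)
    moreover have "finite T" "m \<notin> T" using T(1) finite_subset by auto
    ultimately show "T \<subseteq> {0..<m} \<and> card T = q" by simp
  qed
  have outside: "kdiff m x c' S = 0" if "supp_on m q' c'" "\<not> S \<subseteq> {0..<m}" for c' q' and S :: "nat set"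
  proof -
    have "c' (insert t S) = 0" for t using that(2) by (intro supp_onD[OF that(1)]) auto
    then show ?thesis by (simp add: kdiff_def)
  qed
  have d1: "kdiff m x c1 S = 0" for S
  proof (cases "S \<subseteq> {0..<m}")
    case True
    have "kdiff m x c1 S = kdiff m x (\<lambda>T. c (insert m T)) S"
      using True by (intro kdiff_cong) (auto simp: c1_def)
    also have "\<dots> = kdiff (Suc m) x c (insert m S)" by (simp add: kdiff_insert_last[OF True])
    finally show ?thesis using Suc.prems(5) by simp
  qed (rule outside[OF supp1])
  have d0: "kdiff m x c0 S = - ((- 1) ^ q * x m * c1 S)" for S
  proof (cases "S \<subseteq> {0..<m}")
    case True
    have "kdiff m x c0 S = kdiff m x c S"
      using True by (intro kdiff_cong) (auto simp: c0_def)
    also have "\<dots> = - ((- 1) ^ card S * x m * c1 S)"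
      using kdiff_last[OF True, of x c] True Suc.prems(5) by (simp add: c1_def eq_neg_iff_add_eq_0)
    also have "\<dots> = - ((- 1) ^ q * x m * c1 S)"
      using supp_onD[OF supp1, of S] by (cases "card S = q") auto
    finally show ?thesis .
  qed (simp add: outside[OF supp0] c1_def)
  have "\<exists>b1. (\<forall>T. b1 T \<in> A) \<and> supp_on m (Suc q) b1 \<and> kdiff m x b1 = c1"
  \<comment> \<open>For \<open>q = 0\<close> the cofactor \<open>c1\<close> is a scalar, and the
    smaller complex is not exact there. Instead \<open>x m * c1 {}\<close> lies in the ideal of the
    earlier elements; this is where regularity of \<open>x m\<close> enters.\<close>
  proof (cases q)
    case 0
    have "x m * c1 {} = kdiff m x (\<lambda>T. - c0 T) {}"
      using d0[of "{}"] kdiff_scale[of m x "- 1" c0 "{}"] 0 by simp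
    also have "\<dots> \<in> ideal_span A x m"
      using A c0A by (intro kdiff_in_ideal_span) (auto intro: ring_subsetD)
    finally have "c1 {} \<in> ideal_span A x m"
      using Suc.prems(2)[of m] c1A by (simp add: nzd_mod_def)
    then obtain b where b: "\<forall>T. b T \<in> A" "supp_on m 1 b" "kdiff m x b = (\<lambda>S. if S = {} then c1 {} else 0)"
      by (rule ideal_span_kdiff[OF A])
    have "c1 S = 0" if "S \<noteq> {}" for S
    proof (rule supp_onD[OF supp1])
      show "\<not> (S \<subseteq> {0..<m} \<and> card S = q)" using that 0 finite_subset[of S "{0..<m}"] by auto
    qed
    with b(3) have "kdiff m x b = c1" by (intro ext) simp
    with b(1,2) 0 show ?thesis by (intro exI[of _ b]) simp
  next
    case (Suc q')
    with Suc.IH[of c1 q'] Suc.prems(1,2) c1A supp1 d1 show ?thesis by auto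
  qed
  then obtain b1 where b1: "\<forall>T. b1 T \<in> A" "supp_on m (Suc q) b1" "kdiff m x b1 = c1" by blast
  \<comment> \<open>The boundary of \<open>c0\<close> is \<open>x m * c1\<close> up to sign, and the
    added multiple of \<open>b1\<close> cancels it.\<close>
  define c2 where "c2 T = c0 T + ((- 1) ^ q * x m) * b1 T" for T
  have "c2 T \<in> A" for T
    unfolding c2_def using A c0A b1(1) Suc.prems(1)[of m]
    by (intro ring_subsetD(5,6)[OF A] ring_subset_neg_one_power) auto
  moreover have "supp_on m (Suc q) c2"
    unfolding c2_def by (intro supp_on_add supp_on_scale supp0 b1(2))
  moreover have "kdiff m x c2 = (\<lambda>S. 0)"
    unfolding c2_def kdiff_add kdiff_scale b1(3) d0 by simp
  ultimately obtain b0 where b0: "\<forall>T. b0 T \<in> A" "supp_on m (Suc (Suc q)) b0" "kdiff m x b0 = c2"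
    using Suc.IH[of c2 q] Suc.prems(1,2) by auto
  define b where "b T = (if m \<in> T then b1 (T - {m}) else b0 T)" for T
  have suppb: "supp_on (Suc m) (Suc (Suc q)) b"
    unfolding supp_on_def
  proof (intro allI impI)
    fix T assume "b T \<noteq> 0"
    then consider "m \<notin> T" "T \<subseteq> {0..<m}" "card T = Suc (Suc q)" | "m \<in> T" "T - {m} \<subseteq> {0..<m}" "card (T - {m}) = Suc q"
      using b0(2) b1(2) by (auto simp: b_def supp_on_def split: if_splits)
    then show "T \<subseteq> {0..<Suc m} \<and> card T = Suc (Suc q)"
    proof cases
      case 2
      then have "finite T" using finite_subset[OF 2(2)] by simp
      then have "card T = Suc (Suc q)" using 2 card_Suc_Diff1[of T m] by simp
      with 2 show ?thesis by (auto simp: less_Suc_eq)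
    qed auto
  qed
  have "kdiff (Suc m) x b S = c S" for S
  proof -
    consider "S \<subseteq> {0..<m}" | "S \<subseteq> {0..<Suc m}" "m \<in> S" | "\<not> S \<subseteq> {0..<Suc m}" using less_Suc[of S] by blast
    then show ?thesis
    proof cases
      case 1
      then have m: "m \<notin> S" by auto
      have "kdiff (Suc m) x b S = kdiff m x b S + (- 1) ^ card S * x m * b1 S"
        using m by (simp add: kdiff_last[OF 1] b_def)
      also have "kdiff m x b S = kdiff m x b0 S" using m by (intro kdiff_cong) (auto simp: b_def)
      also have "\<dots> = c S + (- 1) ^ q * x m * b1 S" by (simp add: b0(3) c2_def c0_def m)
      finally show ?thesis using supp_onD[OF b1(2), of S] by (cases "card S = Suc q") auto
    next
      case 2
      define S' where "S' = S - {m}"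
      have S: "S = insert m S'" "S' \<subseteq> {0..<m}" using 2 by (auto simp: S'_def less_Suc_eq)
      have "kdiff (Suc m) x b S = kdiff m x (\<lambda>T. b (insert m T)) S'"
        unfolding S(1) by (rule kdiff_insert_last[OF S(2)])
      also have "\<dots> = kdiff m x b1 S'"
        using S(2) by (intro kdiff_cong) (auto simp: b_def intro!: arg_cong[of _ _ b1])
      finally show ?thesis using S by (simp add: b1(3) c1_def)
    next
      case 3
      then have "b (insert t S) = 0" for t by (intro supp_onD[OF suppb]) auto
      with 3 show ?thesis using supp_onD[OF Suc.prems(4), of S] by (simp add: kdiff_def)
    qed
  qed
  moreover have "b T \<in> A" for T using b0(1) b1(1) by (simp add: b_def)
  ultimately show ?case using suppb by (intro exI[of _ b]) auto
qed

section \<open>Cech complexes\<close>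

lemma mono_part_sign: "mono_part U ((- 1) ^ e * f) = (- 1) ^ e * mono_part U f"
  by (cases "even e") (simp_all add: mono_part_uminus)

lemma mono_part_pos_sign: "mono_part U (pos_sign S t * f) = pos_sign S t * mono_part U f"
  by (simp add: pos_sign_def mono_part_sign)

lemma cech_diff_pos_sign: "cech_diff c I T = (\<Sum>i\<in>I. pos_sign I i * c (I - {i}) T)"
  by (simp add: cech_diff_def pos_sign_def)

lemma cech_diff_cech_diff:
  assumes "finite I"
  shows "cech_diff (cech_diff c) I T = 0"
proof -
  define P where "P = Sigma I (\<lambda>i. I - {i})"
  define F :: "nat \<times> nat \<Rightarrow> _" where "F = (\<lambda>(i, j). pos_sign I i * (pos_sign (I - {i}) j * c (I - {i} - {j}) T))"
  have fin: "finite P" using assms by (auto simp: P_def)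
  have "cech_diff (cech_diff c) I T = (\<Sum>i\<in>I. \<Sum>j\<in>I - {i}. F (i, j))"
    by (auto simp: cech_diff_pos_sign sum_distrib_left F_def intro!: sum.cong)
  also have "\<dots> = sum F P"
    unfolding P_def using assms by (subst sum.Sigma) auto
  also have "\<dots> = sum F {p \<in> P. fst p < snd p} + sum F {p \<in> P. snd p < fst p}"
    using fin by (subst sum.union_disjoint[symmetric]) (auto intro!: sum.cong simp: P_def)
  also have "sum F {p \<in> P. snd p < fst p} = (\<Sum>p\<in>{p \<in> P. fst p < snd p}. F (prod.swap p))"
    by (rule sum.reindex_bij_witness[of _ prod.swap prod.swap]) (auto simp: P_def)
  also have "\<dots> = (\<Sum>p\<in>{p \<in> P. fst p < snd p}. - F p)"
  proof (rule sum.cong[OF refl])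
    fix p assume "p \<in> {p \<in> P. fst p < snd p}"
    then obtain i j where p: "p = (i, j)" "i \<in> I" "j \<in> I" "i < j" by (auto simp: P_def)
    then show "F (prod.swap p) = - F p"
      by (simp add: F_def pos_sign_remove mult_ac Diff_insert2[symmetric] Diff_insert[symmetric] insert_commute)
  qed
  finally show ?thesis by (simp add: sum_negf)
qed

text \<open>If a monomial has a nonnegative exponent at \<open>i\<close>, then it is defined without
  inverting \<open>zvar i\<close>. Choosing the first such \<open>i\<close> makes the choice
  canonical and splits the monomials into disjoint classes.\<close>

definition first_nonneg :: "nat \<Rightarrow> ((nat \<Rightarrow>\<^sub>0 int) \<times> (nat \<Rightarrow>\<^sub>0 nat)) set" where
  "first_nonneg i = {u. lookup (fst u) i \<ge> 0 \<and> (\<forall>j<i. lookup (fst u) j < 0)}"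

definition cech_htpy ::
    "nat \<Rightarrow> (nat set \<Rightarrow> nat set \<Rightarrow> 'a::field bipoly) \<Rightarrow> nat set \<Rightarrow> nat set \<Rightarrow> 'a bipoly" where
  "cech_htpy k c J T = (\<Sum>i\<in>{0..k} - J. pos_sign J i * mono_part (first_nonneg i) (c (insert i J) T))"

lemma sum_first_nonneg:
  assumes "\<And>u. u \<in> keys f \<Longrightarrow> \<exists>i\<le>k. lookup (fst u) i \<ge> 0"
  shows "(\<Sum>i\<in>{0..k}. mono_part (first_nonneg i) f) = f"
proof (rule mono_part_partition)
  fix u assume "u \<in> keys f"
  with assms obtain i where "i \<le> k" "lookup (fst u) i \<ge> 0" by blast
  define l where "l = (LEAST i. lookup (fst u) i \<ge> 0)"
  have l: "lookup (fst u) l \<ge> 0" "l \<le> i"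
    unfolding l_def using \<open>lookup (fst u) i \<ge> 0\<close> by (rule LeastI, rule Least_le)
  moreover have "lookup (fst u) j < 0" if "j < l" for j
    using not_less_Least[OF that[unfolded l_def]] by simp
  ultimately show "\<exists>!i. i \<in> {0..k} \<and> u \<in> first_nonneg i"
    using \<open>i \<le> k\<close> by (intro ex1I[of _ l]) (auto simp: first_nonneg_def, meson linorder_neqE_nat not_le)
qed simp

text \<open>For a fixed monomial the first index with nonnegative exponent is a cone point of the
  simplex of charts, and the homotopy is the usual one for that cone. Only monomials with all
  exponents negative have no cone point. For the full index set there is no cocycle
  condition.\<close>

theorem cech_htpy:
  assumes I: "I \<subseteq> {0..k}"
    and nonneg: "\<And>u. u \<in> keys (c I T) \<Longrightarrow> \<exists>i\<le>k. lookup (fst u) i \<ge> 0"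
    and cocycle: "\<And>l. l \<in> {0..k} - I \<Longrightarrow> cech_diff c (insert l I) T = 0"
  shows "cech_diff (cech_htpy k c) I T = c I T"
proof -
  have finI: "finite I" using I finite_subset by auto
  define \<pi> :: "nat \<Rightarrow> 'a bipoly \<Rightarrow> 'a bipoly" where "\<pi> = (\<lambda>i. mono_part (first_nonneg i))"
  define F where "F i l = pos_sign I i * (pos_sign (I - {i}) l * \<pi> l (c (insert l (I - {i})) T))" for i l
  have "cech_diff (cech_htpy k c) I T = (\<Sum>i\<in>I. \<Sum>l\<in>{0..k} - (I - {i}). F i l)"
    by (simp add: cech_diff_pos_sign cech_htpy_def sum_distrib_left F_def \<pi>_def)
  also have "\<dots> = (\<Sum>i\<in>I. F i i + (\<Sum>l\<in>{0..k} - I. F i l))"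
  proof (rule sum.cong[OF refl])
    fix i assume i: "i \<in> I"
    then have "{0..k} - (I - {i}) = insert i ({0..k} - I)" using I by auto
    with i show "(\<Sum>l\<in>{0..k} - (I - {i}). F i l) = F i i + (\<Sum>l\<in>{0..k} - I. F i l)" by simp
  qed
  also have "\<dots> = (\<Sum>i\<in>I. F i i) + (\<Sum>l\<in>{0..k} - I. \<Sum>i\<in>I. F i l)"
    by (simp add: sum.distrib sum.swap[of _ "{0..k} - I"])
  also have "(\<Sum>i\<in>I. F i i) = (\<Sum>i\<in>I. \<pi> i (c I T))"
    by (intro sum.cong) (auto simp: F_def pos_sign_remove insert_absorb simp flip: mult.assoc)
  \<comment> \<open>The diagonal terms gave the monomials whose cone point lies in \<open>I\<close>;
    for a cone point \<open>l\<close> outside \<open>I\<close> the cocycle condition on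
    \<open>insert l I\<close> expresses the sum over \<open>I\<close> by \<open>c I\<close>.\<close>
  also have "(\<Sum>l\<in>{0..k} - I. \<Sum>i\<in>I. F i l) = (\<Sum>l\<in>{0..k} - I. \<pi> l (c I T))"
  proof (rule sum.cong[OF refl])
    fix l assume l: "l \<in> {0..k} - I"
    have F: "F i l = - (pos_sign I l * \<pi> l (pos_sign (insert l I) i * c (insert l I - {i}) T))" if "i \<in> I" for i
    proof -
      have "i \<noteq> l" using that l by auto
      then have "insert l (I - {i}) = insert l I - {i}" by auto
      then show ?thesis
        using that l \<open>i \<noteq> l\<close> by (simp add: F_def \<pi>_def mono_part_pos_sign mono_part_uminus pos_sign_remove pos_sign_insert mult_ac)
    qed
    have "insert l I - {l} = I" using l by auto
    then have "0 = pos_sign I l * c I T + (\<Sum>i\<in>I. pos_sign (insert l I) i * c (insert l I - {i}) T)"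
      using cocycle[OF l] l finI by (simp add: cech_diff_pos_sign pos_sign_insert)
    then have "(\<Sum>i\<in>I. pos_sign (insert l I) i * c (insert l I - {i}) T) = - (pos_sign I l * c I T)"
      by (simp add: eq_neg_iff_add_eq_0 add.commute)
    then have "\<pi> l (\<Sum>i\<in>I. pos_sign (insert l I) i * c (insert l I - {i}) T) = - (pos_sign I l * \<pi> l (c I T))"
      by (simp add: \<pi>_def mono_part_uminus mono_part_pos_sign)
    moreover have "(\<Sum>i\<in>I. F i l) = - (pos_sign I l * \<pi> l (\<Sum>i\<in>I. pos_sign (insert l I) i * c (insert l I - {i}) T))"
      by (simp add: F sum_negf sum_distrib_left \<pi>_def mono_part_sum)
    ultimately show "(\<Sum>i\<in>I. F i l) = \<pi> l (c I T)" by (simp flip: mult.assoc)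
  qed
  also have "(\<Sum>i\<in>I. \<pi> i (c I T)) + (\<Sum>l\<in>{0..k} - I. \<pi> l (c I T)) = (\<Sum>i\<in>{0..k}. \<pi> i (c I T))"
    using I finI by (subst sum.subset_diff[of I "{0..k}"]) (auto simp: add.commute)
  also have "\<dots> = c I T" unfolding \<pi>_def by (rule sum_first_nonneg[OF nonneg])
  finally show ?thesis .
qed

section \<open>The zigzag in the Cech-Koszul double complex\<close>

text \<open>The bridge from the ideal of the ring record to linear combinations, to which regularity
  and Koszul exactness apply. There are \<open>n - k + 1\<close> forms.\<close>

lemma rel_ideal_eq:
  assumes "k \<le> n"
  shows "(rel_ideal n k I :: 'a::field bipoly set) = ideal_span (loc n k I) (lin_form k) (Suc (n - k))"
proof
  let ?R = "loc_ring n k I :: 'a bipoly ring" and ?J = "ideal_span (loc n k I) (lin_form k) (Suc (n - k)) :: 'a bipoly set"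
  note A = ring_subset_loc[of n k I, where 'a = 'a]
  interpret L: cring ?R by (rule loc_ring_cring)
  have ops: "x \<otimes>\<^bsub>?R\<^esub> y = x * y" "x \<oplus>\<^bsub>?R\<^esub> y = x + y" "\<zero>\<^bsub>?R\<^esub> = 0" for x y
    by (simp_all add: loc_ring_def)
  have lin: "(lin_form k j :: 'a bipoly) \<in> loc n k I" if "j < Suc (n - k)" for j
    using that assms by (intro lin_form_loc') auto
  have "subgroup ?J (add_monoid ?R)"
  proof (rule L.add.subgroupI)
    show "?J \<subseteq> carrier ?R" by (rule ideal_span_subset[OF A lin])
    show "?J \<noteq> {}" using ideal_span_0[OF A] by blast
    show "a \<oplus>\<^bsub>?R\<^esub> b \<in> ?J" if "a \<in> ?J" "b \<in> ?J" for a b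
      using that by (simp add: ops ideal_span_add[OF A])
    show "\<ominus>\<^bsub>?R\<^esub> a \<in> ?J" if "a \<in> ?J" for a
    proof -
      have "\<ominus>\<^bsub>?R\<^esub> a = - a"
        using subsetD[OF ideal_span_subset[OF A lin] that] ring_subsetD(3)[OF A, of a]
        by (intro L.minus_equality) (simp_all add: ops)
      then show ?thesis using that by (simp add: ideal_span_uminus[OF A])
    qed
  qed
  moreover have "a * x \<in> ?J" if "a \<in> ?J" "x \<in> loc n k I" for a x
    using ideal_span_mult[OF A that(2,1)] by (simp add: mult.commute)
  ultimately have ideal: "ideal ?J ?R"
    by (intro idealI) (simp_all add: L.ring_axioms ops ideal_span_mult[OF A])
  have "lin_form k ` {0..n - k} \<subseteq> ?J"
    using ideal_span_mem[OF A, of _ "Suc (n - k)" "lin_form k"] by auto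
  then show "rel_ideal n k I \<subseteq> ?J"
    unfolding rel_ideal_def by (rule L.genideal_minimal[OF ideal])
  interpret J: ideal "rel_ideal n k I :: 'a bipoly set" ?R using assms by (rule rel_ideal_ideal)
  have "lin_form k ` {0..n - k} \<subseteq> carrier ?R" using lin by (auto simp: less_Suc_eq_le)
  then have "lin_form k ` {0..n - k} \<subseteq> (rel_ideal n k I :: 'a bipoly set)"
    unfolding rel_ideal_def by (rule L.genideal_self)
  then have gen: "lin_form k j \<in> (rel_ideal n k I :: 'a bipoly set)" if "j < Suc (n - k)" for j
    using that by auto
  show "?J \<subseteq> rel_ideal n k I"
  proof
    fix f assume "f \<in> ?J"
    then obtain c where c: "f = (\<Sum>j<Suc (n - k). c j * lin_form k j)" "\<forall>j<Suc (n - k). c j \<in> loc n k I"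
      by (rule ideal_spanE)
    have "(\<Sum>j\<in>X. c j * lin_form k j) \<in> rel_ideal n k I" if "X \<subseteq> {..<Suc (n - k)}" for X
      using finite_subset[OF that finite_lessThan] that
    proof (induction X rule: finite_induct)
      case empty
      show ?case using J.zero_closed by (simp add: ops)
    next
      case (insert j X)
      then have "c j * lin_form k j \<in> rel_ideal n k I"
        using J.I_l_closed[OF gen, of j "c j"] c(2) by (simp add: ops)
      with insert J.a_closed show ?case by (simp add: ops)
    qed
    from this[OF subset_refl] show "f \<in> rel_ideal n k I" unfolding c(1) .
  qed
qed

text \<open>
  The sets \<open>D q\<close> of monomials prescribe the degree of the \<open>q\<close>-th term of the complex; the choice
  matters because the same argument is used with and without a condition on the degree in the \<open>y\<^sub>i\<close>.
\<close>

lemma supp_on_mono_part: "supp_on m q c \<Longrightarrow> supp_on m q (\<lambda>T. mono_part U (c T))"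
  unfolding supp_on_def by (metis mono_part_0)

text \<open>The empty index set acts as augmentation: a section over it is a polynomial, restricted
  to every chart.\<close>

lemma cech_diff_singleton: "cech_diff c {i} T = c {} T"
proof -
  have e: "{j. j = i \<and> j < i} = {}" by auto
  show ?thesis by (simp add: cech_diff_def e)
qed

lemma keys_lin_formE:
  assumes "u \<in> keys (lin_form k j :: 'a::field bipoly)"
  obtains i where "i \<le> k" "u = (single i 1, single (i + j) 1)"
  using subsetD[OF keys_lin_form assms] by auto

locale koszul_cech =
  fixes n k :: nat and D :: "nat \<Rightarrow> ((nat \<Rightarrow>\<^sub>0 int) \<times> (nat \<Rightarrow>\<^sub>0 nat)) set"
  assumes kn: "k \<le> n"
    and D_shift: "\<And>i j v q. i \<le> k \<Longrightarrow> (single i 1, single (i + j) 1) + v \<in> D q \<longleftrightarrow> v \<in> D (Suc q)"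
begin

definition terms :: "nat \<Rightarrow> nat set \<Rightarrow> (nat set \<Rightarrow> 'a::field bipoly) set" where
  "terms q I = {c. (\<forall>T. c T \<in> loc n k I \<and> keys (c T) \<subseteq> D q) \<and> supp_on (Suc (n - k)) q c}"

abbreviation diff :: "(nat set \<Rightarrow> 'a::field bipoly) \<Rightarrow> nat set \<Rightarrow> 'a bipoly" where
  "diff \<equiv> kdiff (Suc (n - k)) (lin_form k)"

lemma termsD:
  assumes "c \<in> terms q I"
  shows "c T \<in> loc n k I" "keys (c T) \<subseteq> D q" "supp_on (Suc (n - k)) q c"
  using assms by (auto simp: terms_def)

lemma terms_0: "(\<lambda>T. 0) \<in> terms q I"
  by (simp add: terms_def supp_on_0 loc_ring_closed)

lemma terms_diff: "c \<in> terms q I \<Longrightarrow> c' \<in> terms q I \<Longrightarrow> (\<lambda>T. c T - c' T) \<in> terms q I"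
  using keys_diff[of "c _" "c' _"]
  by (fastforce simp: terms_def supp_on_diff ring_subsetD[OF ring_subset_loc])

lemma lin_form_terms: "j < Suc (n - k) \<Longrightarrow> lin_form k j \<in> loc n k I"
  using kn by (intro lin_form_loc') auto

lemma keys_lin_form_mult:
  assumes "keys f \<subseteq> D (Suc q)"
  shows "keys (lin_form k j * f) \<subseteq> D q"
proof
  fix w assume "w \<in> keys (lin_form k j * f)"
  then obtain u v where "w = u + v" "u \<in> keys (lin_form k j :: 'a bipoly)" "v \<in> keys f"
    using Poly_Mapping.keys_mult[of "lin_form k j" f] by blast
  from this(2) obtain i where "i \<le> k" "u = (single i 1, single (i + j) 1)" by (rule keys_lin_formE)
  with \<open>w = u + v\<close> \<open>v \<in> keys f\<close> assms D_shift[of i j v q] show "w \<in> D q" by auto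
qed

text \<open>Since \<open>D_shift\<close> is an equivalence, projections to the prescribed degrees
  commute with the differential. Exactness without degree conditions therefore passes to each
  piece.\<close>

lemma mono_part_lin_form: "mono_part (D q) (lin_form k j * f :: 'b::field bipoly) = lin_form k j * mono_part (D (Suc q)) f"
proof (rule mono_part_mult)
  fix u v assume "u \<in> keys (lin_form k j :: 'b bipoly)"
  then obtain i where "i \<le> k" "u = (single i 1, single (i + j) 1)" by (rule keys_lin_formE)
  then show "u + v \<in> D q \<longleftrightarrow> v \<in> D (Suc q)" using D_shift by simp
qed

lemma keys_pos_sign: "keys (pos_sign S t * f) = keys f"
  by (cases "even (card {s \<in> S. s < t})") (simp_all add: pos_sign_def)

lemma pos_sign_loc: "f \<in> loc n k I \<Longrightarrow> pos_sign S t * f \<in> loc n k I"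
  by (simp add: loc_iff keys_pos_sign)

lemma keys_sum_subset: "(\<And>x. x \<in> X \<Longrightarrow> keys (f x) \<subseteq> U) \<Longrightarrow> keys (sum f X) \<subseteq> U"
  using Poly_Mapping.keys_sum[of f X] by blast

lemma diff_terms:
  assumes "c \<in> terms (Suc q) I"
  shows "diff c \<in> terms q I"
proof -
  have "diff c S \<in> loc n k I" for S
    unfolding kdiff_def mult.assoc using termsD[OF assms]
    by (intro ring_subset_sum[OF ring_subset_loc] pos_sign_loc ring_subsetD(6)[OF ring_subset_loc] lin_form_terms) auto
  moreover have "keys (diff c S) \<subseteq> D q" for S
    unfolding kdiff_def mult.assoc
    by (rule keys_sum_subset) (simp add: keys_pos_sign keys_lin_form_mult termsD(2)[OF assms])
  ultimately show ?thesis
    using termsD(3)[OF assms] by (simp add: terms_def supp_on_kdiff)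
qed

lemma diff_mono_part: "diff (\<lambda>T. mono_part (D (Suc q)) (c T)) S = mono_part (D q) (diff c S)"
  by (simp add: kdiff_def mono_part_sum mono_part_pos_sign mono_part_lin_form mult.assoc)

lemma diff_exact:
  assumes I: "I \<inter> {0..k} \<noteq> {}" and c: "c \<in> terms (Suc q) I" and "\<And>S. diff c S = 0"
  shows "\<exists>b\<in>terms (Suc (Suc q)) I. diff b = c"
proof -
  have "\<exists>b. (\<forall>T. b T \<in> loc n k I) \<and> supp_on (Suc (n - k)) (Suc (Suc q)) b \<and> diff b = c"
  proof (rule koszul_exact[OF ring_subset_loc])
    show "nzd_mod (loc n k I) (ideal_span (loc n k I) (lin_form k) j) (lin_form k j)" if "j < Suc (n - k)" for j
      using that kn I by (intro nzd_mod_lin_form) auto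
  qed (use lin_form_terms termsD[OF c] assms(3) in auto)
  then obtain b where b: "\<And>T. b T \<in> loc n k I" "supp_on (Suc (n - k)) (Suc (Suc q)) b" "diff b = c" by blast
  define b' where "b' = (\<lambda>T. mono_part (D (Suc (Suc q))) (b T))"
  have "diff b' S = c S" for S
    unfolding b'_def diff_mono_part b(3) using termsD(2)[OF c] by (rule mono_part_id)
  moreover have "b' \<in> terms (Suc (Suc q)) I"
    using b(1,2) by (simp add: terms_def b'_def mono_part_loc keys_mono_part supp_on_mono_part)
  ultimately show ?thesis by (intro bexI[of _ b']) auto
qed

lemma diff_exact_0:
  assumes "f \<in> rel_ideal n k I" "keys f \<subseteq> D 0"
  shows "\<exists>b\<in>terms 1 I. diff b = (\<lambda>S. if S = {} then f else 0)"
proof -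
  from assms(1) obtain b where b: "\<forall>T. b T \<in> loc n k I" "supp_on (Suc (n - k)) 1 b" "diff b = (\<lambda>S. if S = {} then f else 0)"
    unfolding rel_ideal_eq[OF kn] by (rule ideal_span_kdiff[OF ring_subset_loc])
  define b' where "b' = (\<lambda>T. mono_part (D (Suc 0)) (b T))"
  have "diff b' S = (if S = {} then f else 0)" for S
    unfolding b'_def diff_mono_part b(3) using assms(2) by (simp add: mono_part_id)
  moreover have "b' \<in> terms 1 I"
    using b(1,2) by (simp add: terms_def b'_def mono_part_loc keys_mono_part supp_on_mono_part)
  ultimately show ?thesis by (intro bexI[of _ b']) auto
qed

lemma diff_in_rel_ideal: "b \<in> terms q I \<Longrightarrow> diff b {} \<in> rel_ideal n k I"
  unfolding rel_ideal_eq[OF kn] by (intro kdiff_in_ideal_span ring_subset_loc) (simp add: terms_def)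

lemma cech_diff_terms:
  assumes "\<And>i. i \<in> I \<Longrightarrow> c (I - {i}) \<in> terms q (I - {i})"
  shows "cech_diff c I \<in> terms q I"
proof -
  have "cech_diff c I T \<in> loc n k I" for T
    unfolding cech_diff_pos_sign
  proof (intro ring_subset_sum[OF ring_subset_loc] pos_sign_loc)
    fix i assume "i \<in> I"
    then have "c (I - {i}) T \<in> loc n k (I - {i})" by (intro termsD(1)[OF assms])
    then show "c (I - {i}) T \<in> loc n k I" using loc_ring_mono[of "I - {i}" I n k] by blast
  qed
  moreover have "keys (cech_diff c I T) \<subseteq> D q" for T
    unfolding cech_diff_pos_sign
    by (rule keys_sum_subset) (simp add: keys_pos_sign termsD(2)[OF assms])
  moreover have "supp_on (Suc (n - k)) q (cech_diff c I)"
    unfolding supp_on_def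
  proof (intro allI impI)
    fix T assume "cech_diff c I T \<noteq> 0"
    then have "\<exists>i\<in>I. c (I - {i}) T \<noteq> 0"
      by (rule contrapos_np) (simp add: cech_diff_pos_sign)
    then obtain i where i: "i \<in> I" "c (I - {i}) T \<noteq> 0" by blast
    show "T \<subseteq> {0..<Suc (n - k)} \<and> card T = q"
      using termsD(3)[OF assms[OF i(1)]] i(2) unfolding supp_on_def by blast
  qed
  ultimately show ?thesis by (simp add: terms_def)
qed

lemma diff_cech_diff: "diff (cech_diff c I) S = cech_diff (\<lambda>J. diff (c J)) I S"
  unfolding cech_diff_pos_sign by (simp add: kdiff_sum kdiff_scale)

lemma cech_diff_diff: "cech_diff (\<lambda>J T. c J T - c' J T) I T = cech_diff c I T - cech_diff c' I T"
  by (simp add: cech_diff_def algebra_simps sum_subtractf)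

lemma cech_diff_cong: "(\<And>i. i \<in> I \<Longrightarrow> c (I - {i}) = c' (I - {i})) \<Longrightarrow> cech_diff c I T = cech_diff c' I T"
  by (simp add: cech_diff_def)

lemma cech_htpy_terms:
  assumes "J \<subseteq> {0..k}" "\<And>i. i \<in> {0..k} - J \<Longrightarrow> c (insert i J) \<in> terms q (insert i J)"
  shows "cech_htpy k c J \<in> terms q J"
proof -
  have "mono_part (first_nonneg i) (c (insert i J) T) \<in> loc n k J" if "i \<in> {0..k} - J" for i T
  proof -
    have "keys (c (insert i J) T) \<subseteq> loc_keys n k (insert i J)"
      using termsD(1)[OF assms(2)[OF that]] by (simp add: loc_iff)
    then show ?thesis
      unfolding loc_iff keys_mono_part loc_keys_def first_nonneg_def
      by (force simp: subset_iff)
  qed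
  then have "cech_htpy k c J T \<in> loc n k J" for T
    unfolding cech_htpy_def by (intro ring_subset_sum[OF ring_subset_loc] pos_sign_loc) auto
  moreover have "keys (cech_htpy k c J T) \<subseteq> D q" for T
    unfolding cech_htpy_def
    by (rule keys_sum_subset) (simp add: keys_pos_sign keys_mono_part le_infI1 termsD(2)[OF assms(2)])
  moreover have "supp_on (Suc (n - k)) q (cech_htpy k c J)"
    unfolding supp_on_def
  proof (intro allI impI)
    fix T assume "cech_htpy k c J T \<noteq> 0"
    then have "\<exists>i\<in>{0..k} - J. c (insert i J) T \<noteq> 0"
      by (rule contrapos_np) (simp add: cech_htpy_def)
    then obtain i where i: "i \<in> {0..k} - J" "c (insert i J) T \<noteq> 0" by blast
    show "T \<subseteq> {0..<Suc (n - k)} \<and> card T = q"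
      using termsD(3)[OF assms(2)[OF i(1)]] i(2) unfolding supp_on_def by blast
  qed
  ultimately show ?thesis by (simp add: terms_def)
qed

text \<open>The staircase of the double complex on which the Cech degree equals the Koszul degree.
  It starts with sections on the single charts and ends with one cochain on their common
  intersection.\<close>

definition zigzag :: "(nat \<Rightarrow> nat set \<Rightarrow> nat set \<Rightarrow> 'a::field bipoly) \<Rightarrow> bool" where
  "zigzag c \<longleftrightarrow> (\<forall>p\<le>k. \<forall>I\<subseteq>{0..k}. card I = p + 1 \<longrightarrow> c p I \<in> terms p I)
     \<and> (\<forall>p<k. \<forall>I\<subseteq>{0..k}. card I = p + 2 \<longrightarrow> cech_diff (c p) I = diff (c (p + 1) I))"

lemma zigzag_terms: "zigzag c \<Longrightarrow> p \<le> k \<Longrightarrow> I \<subseteq> {0..k} \<Longrightarrow> card I = Suc p \<Longrightarrow> c p I \<in> terms p I"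
  and zigzag_diff: "zigzag c \<Longrightarrow> p < k \<Longrightarrow> I \<subseteq> {0..k} \<Longrightarrow> card I = Suc (Suc p) \<Longrightarrow> cech_diff (c p) I = diff (c (Suc p) I)"
  by (simp_all add: zigzag_def)

lemma card_remove: "I \<subseteq> {0..k} \<Longrightarrow> card I = Suc p \<Longrightarrow> i \<in> I \<Longrightarrow> I - {i} \<subseteq> {0..k} \<and> card (I - {i}) = p"
  by (metis Diff_subset card_Diff_singleton diff_Suc_1 subset_trans)

lemma card_add: "I \<subseteq> {0..k} \<Longrightarrow> i \<in> {0..k} - I \<Longrightarrow> insert i I \<subseteq> {0..k} \<and> card (insert i I) = Suc (card I)"
  using finite_subset[of I "{0..k}"] by auto

lemma card_nonempty: "I \<subseteq> {0..k} \<Longrightarrow> card I = Suc p \<Longrightarrow> I \<inter> {0..k} \<noteq> {}"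
  by (auto simp: Int_absorb2)

text \<open>The Cech differential of each stage is a Koszul cycle, because the Cech differential of
  the previous stage was a Koszul boundary. Exactness lifts it; at the start, membership of the
  differences in the ideal takes the place of exactness.\<close>

lemma zigzag_exists:
  assumes f: "\<And>i. i \<le> k \<Longrightarrow> f i \<in> loc n k {i} \<and> keys (f i) \<subseteq> D 0"
    and agree: "\<And>i j. i \<le> k \<Longrightarrow> j \<le> k \<Longrightarrow> f i - f j \<in> rel_ideal n k {i, j}"
  shows "\<exists>c. zigzag c \<and> (\<forall>i\<le>k. c 0 {i} {} = f i)"
proof -
  define c0 where "c0 I T = (if T = {} then f (the_elem I) else 0)" for I T :: "nat set"
  define c where "c = rec_nat c0 (\<lambda>p cp I. SOME b. b \<in> terms (Suc p) I \<and> diff b = cech_diff cp I)"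
  have c_0: "c 0 = c0" and c_Suc: "c (Suc p) I = (SOME b. b \<in> terms (Suc p) I \<and> diff b = cech_diff (c p) I)" for p I
    by (simp_all add: c_def)
  have main: "(\<forall>I\<subseteq>{0..k}. card I = Suc p \<longrightarrow> c p I \<in> terms p I)
      \<and> (\<forall>I\<subseteq>{0..k}. card I = Suc (Suc p) \<longrightarrow> c (Suc p) I \<in> terms (Suc p) I \<and> diff (c (Suc p) I) = cech_diff (c p) I)" for p
  proof (induction p)
    case 0
    have t0: "c 0 I \<in> terms 0 I" if I: "I \<subseteq> {0..k}" "card I = Suc 0" for I
    proof -
      from I obtain i where "I = {i}" "i \<le> k" by (metis atLeastAtMost_iff card_1_singletonE insert_subset One_nat_def)
      with f[of i] show ?thesis by (auto simp: c_0 c0_def terms_def supp_on_def loc_ring_closed)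
    qed
    have "c 1 I \<in> terms 1 I \<and> diff (c 1 I) = cech_diff (c 0) I" if I: "I \<subseteq> {0..k}" "card I = Suc (Suc 0)" for I
    proof -
      obtain i j where ij: "I = {i, j}" "i \<noteq> j" using I(2) by (metis card_2_iff numeral_2_eq_2)
      define i' j' where "i' = min i j" and "j' = max i j"
      have ij': "I = {i', j'}" "i' < j'" "i' \<le> k" "j' \<le> k"
        using ij I(1) by (auto simp: i'_def j'_def min_def max_def)
      have e: "{s. (s = i' \<or> s = j') \<and> s < i'} = {}" "{s. (s = i' \<or> s = j') \<and> s < j'} = {i'}"
        using ij'(2) by auto
      have "cech_diff (c 0) I T = c 0 {j'} T - c 0 {i'} T" for T
        using ij'(2) by (simp add: cech_diff_def ij'(1) insert_Diff_if e)
      then have *: "cech_diff (c 0) I = (\<lambda>T. if T = {} then f j' - f i' else 0)"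
        by (intro ext) (simp add: c_0 c0_def)
      have "f j' - f i' \<in> rel_ideal n k I"
        using agree[OF ij'(4,3)] by (simp add: ij'(1) insert_commute)
      moreover have "keys (f j' - f i') \<subseteq> D 0"
        using f[OF ij'(3)] f[OF ij'(4)] keys_diff[of "f j'" "f i'"] by blast
      ultimately have "\<exists>b. b \<in> terms 1 I \<and> diff b = cech_diff (c 0) I"
        unfolding * using diff_exact_0 by blast
      then show ?thesis unfolding c_Suc[of 0, folded One_nat_def] by (rule someI_ex)
    qed
    with t0 show ?case by simp
  next
    case (Suc p)
    have "c (Suc (Suc p)) I \<in> terms (Suc (Suc p)) I \<and> diff (c (Suc (Suc p)) I) = cech_diff (c (Suc p)) I"
      if I: "I \<subseteq> {0..k}" "card I = Suc (Suc (Suc p))" for I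
    proof -
      have "cech_diff (c (Suc p)) I \<in> terms (Suc p) I"
        using Suc card_remove[OF I] by (intro cech_diff_terms) blast
      moreover have "diff (cech_diff (c (Suc p)) I) S = 0" for S
      proof -
        have "diff (cech_diff (c (Suc p)) I) S = cech_diff (cech_diff (c p)) I S"
          unfolding diff_cech_diff using Suc card_remove[OF I] by (intro cech_diff_cong) blast
        also have "\<dots> = 0" using I(1) finite_subset by (intro cech_diff_cech_diff) blast
        finally show ?thesis .
      qed
      ultimately have "\<exists>b. b \<in> terms (Suc (Suc p)) I \<and> diff b = cech_diff (c (Suc p)) I"
        using diff_exact[OF card_nonempty[OF I]] by blast
      then show ?thesis unfolding c_Suc by (rule someI_ex)
    qed
    with Suc show ?case by blast
  qed
  then have "zigzag c" by (simp add: zigzag_def)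
  moreover have "c 0 {i} {} = f i" for i by (simp add: c_0 c0_def)
  ultimately show ?thesis by blast
qed

text \<open>Downward induction trivializes each stage as a Cech coboundary plus a Koszul boundary.
  The last stage has to be free of totally negative monomials by \<open>top\<close>; in the others
  they are excluded by degree. At stage 0 the cochain on the empty index set is the global
  polynomial.\<close>

lemma zigzag_global:
  assumes c: "zigzag c"
    and top: "\<And>T u. u \<in> keys (c k {0..k} T) \<Longrightarrow> \<exists>i\<le>k. lookup (fst u) i \<ge> 0"
    and D: "\<And>q u. q < k \<Longrightarrow> u \<in> D q \<Longrightarrow> keys (fst u) \<subseteq> {0..k} \<Longrightarrow> \<exists>i\<le>k. lookup (fst u) i \<ge> 0"
  shows "\<exists>g. g \<in> loc n k {} \<and> keys g \<subseteq> D 0 \<and> (\<forall>i\<le>k. c 0 {i} {} - g \<in> rel_ideal n k {i})"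
proof -
  have "\<exists>b b'. (\<forall>J\<subseteq>{0..k}. card J = p \<longrightarrow> b J \<in> terms p J)
      \<and> (\<forall>I\<subseteq>{0..k}. card I = Suc p \<longrightarrow> b' I \<in> terms (Suc p) I \<and> (\<forall>T. cech_diff b I T = c p I T - diff (b' I) T))"
    if "p \<le> k" for p
    using that
  proof (induction p rule: inc_induct)
    case base
    have h1: "cech_htpy k (c k) J \<in> terms k J" if J: "J \<subseteq> {0..k}" "card J = k" for J
      using J card_add[OF J(1)] by (intro cech_htpy_terms zigzag_terms[OF c]) auto
    have h2: "cech_diff (cech_htpy k (c k)) {0..k} T = c k {0..k} T" for T
      by (rule cech_htpy) (use top in auto)
    have h3: "cech_diff (cech_htpy k (c k)) I T = c k I T" if "I \<subseteq> {0..k}" "card I = Suc k" for I T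
      using that card_subset_eq[of "{0..k}" I] h2 by simp
    have "(\<forall>J\<subseteq>{0..k}. card J = k \<longrightarrow> cech_htpy k (c k) J \<in> terms k J)
      \<and> (\<forall>I\<subseteq>{0..k}. card I = Suc k \<longrightarrow> (\<lambda>T. 0) \<in> terms (Suc k) I
            \<and> (\<forall>T. cech_diff (cech_htpy k (c k)) I T = c k I T - diff (\<lambda>T. 0) T))"
      using h1 h3 by (simp add: terms_0)
    then show ?case
      by - (rule exI[where x = "cech_htpy k (c k)"], rule exI[where x = "\<lambda>_ _. 0"], assumption)
  next
    case (step p)
    from step.IH obtain b b' where
      "(\<forall>J\<subseteq>{0..k}. card J = Suc p \<longrightarrow> b J \<in> terms (Suc p) J)
      \<and> (\<forall>I\<subseteq>{0..k}. card I = Suc (Suc p) \<longrightarrow> b' I \<in> terms (Suc (Suc p)) I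
            \<and> (\<forall>T. cech_diff b I T = c (Suc p) I T - diff (b' I) T))"
      by (elim exE)
    then have b: "\<And>J. J \<subseteq> {0..k} \<Longrightarrow> card J = Suc p \<Longrightarrow> b J \<in> terms (Suc p) J"
      and b': "\<And>I. I \<subseteq> {0..k} \<Longrightarrow> card I = Suc (Suc p) \<Longrightarrow> b' I \<in> terms (Suc (Suc p)) I"
      "\<And>I T. I \<subseteq> {0..k} \<Longrightarrow> card I = Suc (Suc p) \<Longrightarrow> cech_diff b I T = c (Suc p) I T - diff (b' I) T"
      by blast+
    \<comment> \<open>Subtracting the Koszul boundary of the cochain found one stage higher turns
      \<open>c p\<close> into a Cech cocycle.\<close>
    define e where "e I T = c p I T - diff (b I) T" for I T
    have e: "e I \<in> terms p I" if "I \<subseteq> {0..k}" "card I = Suc p" for I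
      unfolding e_def using that step by (intro terms_diff zigzag_terms[OF c] diff_terms b) auto
    have e_cocycle: "cech_diff e I T = 0" if I: "I \<subseteq> {0..k}" "card I = Suc (Suc p)" for I T
    proof -
      have "cech_diff e I T = diff (c (Suc p) I) T - diff (cech_diff b I) T"
        unfolding e_def cech_diff_diff diff_cech_diff using zigzag_diff[OF c _ I] step by simp
      also have "\<dots> = diff (\<lambda>T. c (Suc p) I T - cech_diff b I T) T" by (simp add: kdiff_diff)
      also have "\<dots> = diff (diff (b' I)) T" using b'(2)[OF I] by simp
      finally show ?thesis by simp
    qed
    have h1: "cech_htpy k e J \<in> terms p J" if "J \<subseteq> {0..k}" "card J = p" for J
      using that card_add[OF that(1)] by (intro cech_htpy_terms e) auto
    have h2: "cech_diff (cech_htpy k e) I T = c p I T - diff (b I) T"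
      if I: "I \<subseteq> {0..k}" "card I = Suc p" for I T
    proof -
      have "cech_diff (cech_htpy k e) I T = e I T"
      proof (rule cech_htpy[OF I(1)])
        show "cech_diff e (insert l I) T = 0" if "l \<in> {0..k} - I" for l
          using card_add[OF I(1) that] I(2) by (intro e_cocycle) auto
        fix u assume u: "u \<in> keys (e I T)"
        have "u \<in> D p" "keys (fst u) \<subseteq> {0..k}"
          using termsD(1,2)[OF e[OF I], of T] u by (auto simp: loc_iff loc_keys_def)
        then show "\<exists>i\<le>k. lookup (fst u) i \<ge> 0" using D[of p u] step by simp
      qed
      then show ?thesis by (simp add: e_def)
    qed
    show ?case
      by (rule exI[where x = "cech_htpy k e"], rule exI[where x = b]) (use h1 h2 b in blast)
  qed
  from this[OF le0] obtain b b' where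
    "(\<forall>J\<subseteq>{0..k}. card J = 0 \<longrightarrow> b J \<in> terms 0 J)
      \<and> (\<forall>I\<subseteq>{0..k}. card I = Suc 0 \<longrightarrow> b' I \<in> terms (Suc 0) I
            \<and> (\<forall>T. cech_diff b I T = c 0 I T - diff (b' I) T))"
    by (elim exE)
  then have b: "\<And>J. J \<subseteq> {0..k} \<Longrightarrow> card J = 0 \<Longrightarrow> b J \<in> terms 0 J"
    and b': "\<And>I. I \<subseteq> {0..k} \<Longrightarrow> card I = Suc 0 \<Longrightarrow> b' I \<in> terms (Suc 0) I"
      "\<And>I T. I \<subseteq> {0..k} \<Longrightarrow> card I = Suc 0 \<Longrightarrow> cech_diff b I T = c 0 I T - diff (b' I) T"
    by blast+
  have "c 0 {i} {} - b {} {} \<in> rel_ideal n k {i}" if "i \<le> k" for i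
  proof -
    have "b {} {} = c 0 {i} {} - diff (b' {i}) {}"
      using b'(2)[of "{i}" "{}"] that by (simp add: cech_diff_singleton)
    then show ?thesis using diff_in_rel_ideal[OF b'(1)[of "{i}"]] that by simp
  qed
  then show ?thesis
    using termsD(1,2)[OF b[of "{}"], of "{}"] by (intro exI[of _ "b {} {}"]) auto
qed

text \<open>If the initial sections vanish, then each stage is a Koszul boundary plus a Cech
  coboundary, by induction upwards. At the end neither summand contains the monomial
  \<open>u\<close>, so the coefficient depends on the section only and not on the liftings
  chosen.\<close>

lemma zigzag_residue:
  assumes c: "zigzag c" and k: "1 \<le> k" and rel: "\<And>i. i \<le> k \<Longrightarrow> c 0 {i} {} \<in> rel_ideal n k {i}"
    and u: "\<And>i. i \<le> k \<Longrightarrow> lookup (fst u) i < 0" "snd u = 0"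
  shows "lookup (c k {0..k} T) u = 0"
proof -
  have "\<exists>b b'. (\<forall>I\<subseteq>{0..k}. card I = Suc p \<longrightarrow> b I \<in> terms (Suc p) I)
      \<and> (\<forall>J\<subseteq>{0..k}. card J = p \<longrightarrow> b' J \<in> terms p J)
      \<and> (\<forall>I\<subseteq>{0..k}. card I = Suc p \<longrightarrow> (\<forall>T. c p I T = diff (b I) T + cech_diff b' I T))"
    if "p \<le> k" for p
    using that
  proof (induction p)
    case 0
    have "\<exists>b\<in>terms 1 I. diff b = c 0 I" if I: "I \<subseteq> {0..k}" "card I = Suc 0" for I
    proof -
      from I obtain i where i: "I = {i}" "i \<le> k" by (metis atLeastAtMost_iff card_1_singletonE insert_subset One_nat_def)
      have t: "c 0 I \<in> terms 0 I" using I by (intro zigzag_terms[OF c]) auto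
      have "c 0 I S = 0" if "S \<noteq> {}" for S
        using that finite_subset[of S "{0..<Suc (n - k)}"] by (intro supp_onD[OF termsD(3)[OF t]]) auto
      then have "c 0 I = (\<lambda>S. if S = {} then c 0 {i} {} else 0)" by (auto simp: i(1))
      with diff_exact_0[OF rel[OF i(2)]] termsD(2)[OF t] i(1) show ?thesis by metis
    qed
    then have "\<forall>I. \<exists>b. I \<subseteq> {0..k} \<longrightarrow> card I = Suc 0 \<longrightarrow> b \<in> terms 1 I \<and> diff b = c 0 I" by blast
    then obtain b where "\<forall>I. I \<subseteq> {0..k} \<longrightarrow> card I = Suc 0 \<longrightarrow> b I \<in> terms 1 I \<and> diff (b I) = c 0 I"
      by (rule choice[THEN exE])
    then show ?case
      by - (rule exI[where x = b], rule exI[where x = "\<lambda>_ _. 0"], simp add: terms_0 cech_diff_def)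
  next
    case (Suc p)
    from Suc.IH[OF Suc_leD[OF Suc.prems]] obtain b b' where
      "(\<forall>I\<subseteq>{0..k}. card I = Suc p \<longrightarrow> b I \<in> terms (Suc p) I)
      \<and> (\<forall>J\<subseteq>{0..k}. card J = p \<longrightarrow> b' J \<in> terms p J)
      \<and> (\<forall>I\<subseteq>{0..k}. card I = Suc p \<longrightarrow> (\<forall>T. c p I T = diff (b I) T + cech_diff b' I T))"
      by (elim exE)
    then have b: "\<And>I. I \<subseteq> {0..k} \<Longrightarrow> card I = Suc p \<Longrightarrow> b I \<in> terms (Suc p) I"
      and b': "\<And>I T. I \<subseteq> {0..k} \<Longrightarrow> card I = Suc p \<Longrightarrow> c p I T = diff (b I) T + cech_diff b' I T"
      by blast+
    have "\<exists>a\<in>terms (Suc (Suc p)) I. diff a = (\<lambda>T. c (Suc p) I T - cech_diff b I T)"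
      if I: "I \<subseteq> {0..k}" "card I = Suc (Suc p)" for I
    proof (rule diff_exact[OF card_nonempty[OF I]])
      show "(\<lambda>T. c (Suc p) I T - cech_diff b I T) \<in> terms (Suc p) I"
        using I Suc.prems card_remove[OF I] by (intro terms_diff zigzag_terms[OF c] cech_diff_terms b) auto
      fix S
      have "cech_diff (c p) I S = cech_diff (\<lambda>J T. diff (b J) T + cech_diff b' J T) I S"
        using card_remove[OF I] b' by (intro cech_diff_cong) blast
      also have "\<dots> = cech_diff (\<lambda>J T. diff (b J) T) I S + cech_diff (cech_diff b') I S"
        by (simp add: cech_diff_def algebra_simps sum.distrib)
      also have "\<dots> = diff (cech_diff b I) S"
        using finite_subset[OF I(1)] by (simp add: diff_cech_diff cech_diff_cech_diff)
      finally show "diff (\<lambda>T. c (Suc p) I T - cech_diff b I T) S = 0"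
        using zigzag_diff[OF c _ I] Suc.prems by (simp add: kdiff_diff)
    qed
    then have "\<forall>I. \<exists>a. I \<subseteq> {0..k} \<longrightarrow> card I = Suc (Suc p) \<longrightarrow>
        a \<in> terms (Suc (Suc p)) I \<and> diff a = (\<lambda>T. c (Suc p) I T - cech_diff b I T)" by blast
    then obtain a where a: "\<forall>I. I \<subseteq> {0..k} \<longrightarrow> card I = Suc (Suc p) \<longrightarrow>
        a I \<in> terms (Suc (Suc p)) I \<and> diff (a I) = (\<lambda>T. c (Suc p) I T - cech_diff b I T)"
      by (rule choice[THEN exE])
    then have h: "c (Suc p) I T = diff (a I) T + cech_diff b I T" if "I \<subseteq> {0..k}" "card I = Suc (Suc p)" for I T
      using that by simp
    show ?case
      by (rule exI[where x = a], rule exI[where x = b]) (use h a b in blast)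
  qed
  from this[OF order_refl] obtain bb b' where
    "(\<forall>I\<subseteq>{0..k}. card I = Suc k \<longrightarrow> bb I \<in> terms (Suc k) I)
      \<and> (\<forall>J\<subseteq>{0..k}. card J = k \<longrightarrow> b' J \<in> terms k J)
      \<and> (\<forall>I\<subseteq>{0..k}. card I = Suc k \<longrightarrow> (\<forall>T. c k I T = diff (bb I) T + cech_diff b' I T))"
    by (elim exE)
  then have b': "\<And>J. J \<subseteq> {0..k} \<Longrightarrow> card J = k \<Longrightarrow> b' J \<in> terms k J"
    and eq': "\<forall>I\<subseteq>{0..k}. card I = Suc k \<longrightarrow> (\<forall>T. c k I T = diff (bb I) T + cech_diff b' I T)"
    by blast+
  define b where "b = bb {0..k}"
  have eq: "c k {0..k} T = diff b T + cech_diff b' {0..k} T" for T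
    using eq' by (simp add: b_def)
  \<comment> \<open>Each monomial of a multiple of \<open>lin_form k t\<close> involves some
    \<open>yvar\<close>. The coboundary is excluded next: each of its summands lives where one
    \<open>zvar i\<close> is not inverted.\<close>
  have "u \<notin> keys (diff b T)"
  proof
    assume "u \<in> keys (diff b T)"
    then have "u \<in> (\<Union>t\<in>{0..<Suc (n - k)} - T. keys (pos_sign T t * (lin_form k t * b (insert t T))))"
      unfolding kdiff_def mult.assoc by (rule subsetD[OF Poly_Mapping.keys_sum])
    then obtain t where "u \<in> keys (lin_form k t * b (insert t T))" by (auto simp: keys_pos_sign)
    then obtain v w where vw: "u = v + w" "v \<in> keys (lin_form k t :: 'a bipoly)"
      using Poly_Mapping.keys_mult[of "lin_form k t" "b (insert t T)"] by blast
    from vw(2) obtain i where "v = (single i 1, single (i + t) 1)" by (rule keys_lin_formE)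
    with vw(1) have "lookup (snd u) (i + t) \<ge> 1" by (simp add: lookup_add)
    with u(2) show False by simp
  qed
  moreover have "u \<notin> keys (cech_diff b' {0..k} T)"
  proof
    assume "u \<in> keys (cech_diff b' {0..k} T)"
    then obtain i where i: "i \<le> k" "u \<in> keys (b' ({0..k} - {i}) T)"
      unfolding cech_diff_pos_sign using Poly_Mapping.keys_sum[of "\<lambda>i. pos_sign {0..k} i * b' ({0..k} - {i}) T" "{0..k}"]
      by (auto simp: keys_pos_sign)
    have "b' ({0..k} - {i}) \<in> terms k ({0..k} - {i})" using i(1) by (intro b') auto
    from termsD(1)[OF this, of T] i(2) u(1)[OF i(1)] show False by (auto simp: loc_iff loc_keys_def)
  qed
  ultimately show ?thesis by (simp add: eq lookup_add in_keys_iff)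
qed

end

section \<open>An explicit zigzag\<close>

text \<open>
  Contraction with the functional \<open>x\<^sup>t \<mapsto> y\<^bsub>t+i\<^esub>\<close>. A product of such contractions over a set of
  columns \<open>i\<close> produces minors of the Hankel matrix \<open>(y\<^bsub>t+i\<^esub>)\<close>.
\<close>

abbreviation contract :: "nat \<Rightarrow> nat \<Rightarrow> (nat set \<Rightarrow> 'a::field bipoly) \<Rightarrow> nat set \<Rightarrow> 'a bipoly" where
  "contract m i \<equiv> kdiff m (\<lambda>t. yvar (i + t))"

definition contract_list :: "nat \<Rightarrow> nat list \<Rightarrow> (nat set \<Rightarrow> 'a::field bipoly) \<Rightarrow> nat set \<Rightarrow> 'a bipoly" where
  "contract_list m is w = foldr (contract m) is w"

lemma contract_list_Nil [simp]: "contract_list m [] w = w"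
  and contract_list_Cons: "contract_list m (i # is) w = contract m i (contract_list m is w)"
  by (simp_all add: contract_list_def)

text \<open>The Koszul differential becomes a combination of contractions by Hankel columns with
  coefficients \<open>zvar i\<close>; denominators cancel against these coefficients in the explicit
  zigzag.\<close>

lemma kdiff_lin_form: "kdiff m (lin_form k) c S = (\<Sum>i\<le>k. zvar i * contract m i c S)"
  using kdiff_form_sum[where m = m and I = "{..k}" and a = zvar and x = "\<lambda>i t. yvar (i + t)" and c = c and S = S] by (simp add: lin_form_def[abs_def])

lemma contract_contract_list_in: "l \<in> set is \<Longrightarrow> contract m l (contract_list m is w) S = 0"
proof (induction "is" arbitrary: S)
  case (Cons i "is")
  show ?case
  proof (cases "l = i")
    case False
    with Cons have "contract m l (contract_list m is w) = (\<lambda>S. 0)" by auto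
    then show ?thesis
      by (simp add: contract_list_Cons kdiff_anticommute[of m "\<lambda>t. yvar (l + t)" "\<lambda>t. yvar (i + t)"])
  qed (simp add: contract_list_Cons)
qed simp

lemma contract_contract_list_insort:
  "sorted is \<Longrightarrow> l \<notin> set is \<Longrightarrow> distinct is \<Longrightarrow>
    contract m l (contract_list m is w) S = pos_sign (set is) l * contract_list m (insort l is) w S"
proof (induction "is" arbitrary: S)
  case Nil
  then show ?case by (simp add: contract_list_Cons pos_sign_def)
next
  case (Cons i "is")
  show ?case
  proof (cases "l \<le> i")
    case True
    with Cons.prems have e: "{s. (s = i \<or> s \<in> set is) \<and> s < l} = {}" by auto
    with True show ?thesis by (simp add: contract_list_Cons pos_sign_def e)
  next
    case False
    have eq: "contract m l (contract_list m is w) = (\<lambda>S. pos_sign (set is) l * contract_list m (insort l is) w S)"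
      using Cons by auto
    have "contract m l (contract_list m (i # is) w) S = - (pos_sign (set is) l * contract_list m (insort l (i # is)) w S)"
      using False by (simp add: contract_list_Cons kdiff_anticommute[of m "\<lambda>t. yvar (l + t)" "\<lambda>t. yvar (i + t)"] eq kdiff_scale)
    with False Cons.prems show ?thesis by (simp add: pos_sign_insert)
  qed
qed

definition contract_set :: "nat \<Rightarrow> nat set \<Rightarrow> (nat set \<Rightarrow> 'a::field bipoly) \<Rightarrow> nat set \<Rightarrow> 'a bipoly" where
  "contract_set m C = contract_list m (sorted_list_of_set C)"

lemma contract_contract_set:
  assumes "finite C"
  shows "contract m l (contract_set m C w) S = (if l \<in> C then 0 else pos_sign C l * contract_set m (insert l C) w S)"
  using assms contract_contract_list_insort[of "sorted_list_of_set C" l m w S]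
  by (simp add: contract_set_def contract_contract_list_in)

definition zprod_inv :: "nat set \<Rightarrow> 'a::field bipoly" where
  "zprod_inv I = (\<Prod>i\<in>I. zinv i)"

lemma zvar_zprod_inv: "finite I \<Longrightarrow> l \<in> I \<Longrightarrow> zvar l * zprod_inv I = zprod_inv (I - {l})"
  by (simp add: zprod_inv_def prod.remove[of I l] flip: mult.assoc)

text \<open>The denominators are the variables in \<open>I\<close>, the columns those outside
  \<open>I\<close>. The sign turns the position of an index among the columns into its position in
  \<open>I\<close>.\<close>

definition expl :: "nat \<Rightarrow> nat \<Rightarrow> (nat set \<Rightarrow> 'a::field bipoly) \<Rightarrow> nat set \<Rightarrow> nat set \<Rightarrow> 'a bipoly" where
  "expl m k w I S = (- 1) ^ (\<Sum>I) * zprod_inv I * contract_set m ({0..k} - I) w S"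

text \<open>Of the contractions in the differential, those with a column outside \<open>I\<close>
  repeat a column and vanish. For \<open>l \<in> I\<close> the factor \<open>zvar l\<close> cancels
  its inverse and \<open>l\<close> becomes a column, which is the term of
  \<open>I - {l}\<close>.\<close>

theorem expl_zigzag:
  assumes I: "I \<subseteq> {0..k}"
  shows "cech_diff (expl m k w) I S = kdiff m (lin_form k) (expl m k w I) S"
proof -
  have finI: "finite I" using I finite_subset by blast
  let ?F = "\<lambda>C. contract_set m C w"
  define co :: "'a bipoly" where "co = (- 1) ^ (\<Sum>I) * zprod_inv I"
  have "kdiff m (lin_form k) (expl m k w I) S = (\<Sum>l\<in>{0..k}. zvar l * (co * contract m l (?F ({0..k} - I)) S))"
    unfolding expl_def co_def[symmetric] by (simp add: kdiff_lin_form kdiff_scale atLeast0AtMost sum_distrib_left mult.left_commute)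
  also have "\<dots> = (\<Sum>l\<in>I. zvar l * (co * contract m l (?F ({0..k} - I)) S))"
    using I by (intro sum.mono_neutral_right) (auto simp: contract_contract_set)
  also have "\<dots> = (\<Sum>l\<in>I. pos_sign I l * expl m k w (I - {l}) S)"
  proof (rule sum.cong[OF refl])
    fix l assume l: "l \<in> I"
    have C: "insert l ({0..k} - I) = {0..k} - (I - {l})" using l I by auto
    \<comment> \<open>Below \<open>l\<close> the sets \<open>I\<close> and \<open>{0..k} - I\<close>
      together have \<open>l\<close> elements, so the two position signs multiply to
      \<open>(-1) ^ l\<close>.\<close>
    have "card {s \<in> I. s < l} + card {s \<in> {0..k} - I. s < l} = card ({s \<in> I. s < l} \<union> {s \<in> {0..k} - I. s < l})"
      using finI by (subst card_Un_disjoint) auto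
    also have "{s \<in> I. s < l} \<union> {s \<in> {0..k} - I. s < l} = {..<l}" using l I by auto
    finally have "pos_sign I l * pos_sign ({0..k} - I) l = ((- 1) ^ l :: 'a bipoly)"
      by (simp add: pos_sign_def flip: power_add)
    then have "pos_sign I l * (pos_sign I l * pos_sign ({0..k} - I) l) = pos_sign I l * ((- 1) ^ l :: 'a bipoly)"
      by simp
    then have "pos_sign ({0..k} - I) l = (pos_sign I l * (- 1) ^ l :: 'a bipoly)"
      by (simp flip: mult.assoc)
    moreover have "\<Sum>I = l + \<Sum>(I - {l})" using finI l by (simp add: sum.remove)
    moreover have "(- 1) ^ l * (- 1) ^ l = (1 :: 'a bipoly)" by (simp flip: power_add mult_2)
    ultimately have sgn: "(- 1) ^ (\<Sum>I) * pos_sign ({0..k} - I) l = (pos_sign I l * (- 1) ^ (\<Sum>(I - {l})) :: 'a bipoly)"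
      by (simp add: power_add mult_ac)
    have "zvar l * (co * contract m l (?F ({0..k} - I)) S)
      = ((- 1) ^ (\<Sum>I) * pos_sign ({0..k} - I) l) * (zvar l * zprod_inv I) * ?F ({0..k} - (I - {l})) S"
      using l by (simp add: contract_contract_set C co_def mult_ac)
    also have "\<dots> = pos_sign I l * expl m k w (I - {l}) S"
      by (simp only: sgn zvar_zprod_inv[OF finI l]) (simp add: expl_def mult_ac)
    finally show "zvar l * (co * contract m l (?F ({0..k} - I)) S) = pos_sign I l * expl m k w (I - {l}) S" .
  qed
  finally show ?thesis by (simp add: cech_diff_pos_sign)
qed

section \<open>Degrees\<close>

lemma deg_z_single [simp]: "deg_z (single i c) = c"
  by (simp add: deg_z_def)

lemma deg_y_single [simp]: "deg_y (single i c) = int c"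
  by (simp add: deg_y_def)

lemma deg_0 [simp]: "deg_z 0 = 0" "deg_y 0 = 0"
  by (simp_all add: deg_z_def deg_y_def)

lemma deg_y_add: "deg_y (a + b) = deg_y a + deg_y b"
proof -
  have *: "deg_y c = (\<Sum>i\<in>A. int (lookup c i))" if "finite A" "keys c \<subseteq> A" for A c
    unfolding deg_y_def using that by (intro sum.mono_neutral_left) (auto simp: in_keys_iff)
  let ?A = "keys a \<union> keys b"
  show ?thesis
    using Poly_Mapping.keys_add[of a b]
    by (simp add: *[of ?A a] *[of ?A b] *[of ?A "a + b"] lookup_add sum.distrib)
qed

lemma deg_y_nonneg: "deg_y b \<ge> 0"
  by (simp add: deg_y_def sum_nonneg)

lemma deg_y_eq_0_iff: "deg_y b = 0 \<longleftrightarrow> b = 0"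
proof
  assume "deg_y b = 0"
  then have "\<forall>i\<in>keys b. int (lookup b i) = 0" unfolding deg_y_def by (subst (asm) sum_nonneg_eq_0_iff) auto
  then show "b = 0" by (intro poly_mapping_eqI) (auto simp: in_keys_iff)
qed simp

lemma homog_z_iff: "p \<in> homog_z r \<longleftrightarrow> keys p \<subseteq> {u. deg_z (fst u) = r}"
  unfolding homog_z_def by fastforce

lemma homog_y_iff: "p \<in> homog_y d \<longleftrightarrow> keys p \<subseteq> {u. deg_y (snd u) = d}"
  unfolding homog_y_def by fastforce

lemma deg_z_ge:
  assumes "keys a \<subseteq> {0..k}"
  shows "deg_z a = (\<Sum>i\<in>{0..k}. lookup a i)"
  unfolding deg_z_def using assms by (intro sum.mono_neutral_left) (auto simp: in_keys_iff)

text \<open>The numerical form of \<open>H^k(P^k, O(d)) = 0\<close> for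
  \<open>d > -k-1\<close>.\<close>

lemma all_neg_deg_z:
  assumes "keys a \<subseteq> {0..k}" "\<And>i. i \<le> k \<Longrightarrow> lookup a i < 0"
  shows "deg_z a \<le> - int k - 1"
proof -
  have "(\<Sum>i\<in>{0..k}. lookup a i) \<le> (\<Sum>i\<in>{0..k}. - 1)" using assms(2) by (intro sum_mono) force
  then show ?thesis by (simp add: deg_z_ge[OF assms(1)])
qed

text \<open>In the borderline degree \<open>1 / (z_0 ... z_k)\<close> is the only candidate, so that
  \<open>H^k(P^k, O(-k-1))\<close> is one-dimensional.\<close>

lemma all_neg_deg_z_eq:
  assumes "keys a \<subseteq> {0..k}" "\<And>i. i \<le> k \<Longrightarrow> lookup a i < 0" "deg_z a = - int k - 1" "i \<le> k"
  shows "lookup a i = - 1"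
proof -
  have "(\<Sum>i\<in>{0..k}. - 1 - lookup a i) = 0"
    using deg_z_ge[OF assms(1)] assms(3) by (simp add: sum_subtractf)
  moreover have "- 1 - lookup a i \<ge> 0" if "i \<in> {0..k}" for i using assms(2)[of i] that by auto
  ultimately have "\<forall>i\<in>{0..k}. - 1 - lookup a i = 0" by (subst (asm) sum_nonneg_eq_0_iff) auto
  then show ?thesis using assms(4) by auto
qed

text \<open>Bidegree of the \<open>q\<close>-th term of the resolution of \<open>Sym\<^sup>d E \<otimes> O(r)\<close>, for all \<open>d\<close> satisfying \<open>Y\<close>.\<close>

definition term_keys :: "int \<Rightarrow> (int \<Rightarrow> bool) \<Rightarrow> nat \<Rightarrow> ((nat \<Rightarrow>\<^sub>0 int) \<times> (nat \<Rightarrow>\<^sub>0 nat)) set" where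
  "term_keys r Y q = {u. deg_z (fst u) = r - int q \<and> Y (deg_y (snd u) + int q)}"

locale secant =
  fixes n k :: nat
  assumes k1: "1 \<le> k" and k2: "2 * k \<le> n + 1"
begin

lemma kn: "k \<le> n" using k1 k2 by linarith

sublocale kc: koszul_cech n k "term_keys r Y" for r Y
  by unfold_locales (use kn in \<open>auto simp: term_keys_def deg_z_add deg_y_add algebra_simps\<close>)

abbreviation m :: nat where "m \<equiv> Suc (n - k)"

text \<open>The elements of \<open>\<And>\<^sup>q(Sym\<^bsup>n-k\<^esup> U)\<close> with coefficients in \<open>k[y]\<close>.\<close>

definition ext_y :: "(int \<Rightarrow> bool) \<Rightarrow> nat \<Rightarrow> (nat set \<Rightarrow> 'a::field bipoly) set" where
  "ext_y Y q = {w. (\<forall>T. w T \<in> loc n k {} \<and> keys (w T) \<subseteq> {u. fst u = 0 \<and> Y (deg_y (snd u) + int q)}) \<and> supp_on m q w}"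

lemma contract_ext_y:
  assumes w: "w \<in> ext_y Y (Suc q)" and i: "i \<le> k"
  shows "contract m i w \<in> ext_y Y q"
proof -
  have loc: "contract m i w S \<in> loc n k {}" for S
    unfolding kdiff_def mult.assoc
  proof (intro ring_subset_sum[OF ring_subset_loc] kc.pos_sign_loc ring_subsetD(6)[OF ring_subset_loc] yvar_loc)
    show "i + t \<le> n" if "t \<in> {0..<m} - S" for t using that i kn by auto
    show "w T \<in> loc n k {}" for T using w by (simp add: ext_y_def)
  qed
  moreover have "keys (contract m i w S) \<subseteq> {u. fst u = 0 \<and> Y (deg_y (snd u) + int q)}" for S
    unfolding kdiff_def mult.assoc
  proof (rule kc.keys_sum_subset, unfold kc.keys_pos_sign, rule subsetI)
    fix t v assume "v \<in> keys (yvar (i + t) * w (insert t S))"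
    then obtain u where "v = (0, single (i + t) 1) + u" "u \<in> keys (w (insert t S))"
      using Poly_Mapping.keys_mult[of "yvar (i + t)" "w (insert t S)"] by (auto simp: yvar_def)
    moreover have "keys (w (insert t S)) \<subseteq> {u. fst u = 0 \<and> Y (deg_y (snd u) + int (Suc q))}"
      using w by (simp add: ext_y_def)
    ultimately show "v \<in> {u. fst u = 0 \<and> Y (deg_y (snd u) + int q)}" by (auto simp: deg_y_add algebra_simps)
  qed
  ultimately show ?thesis using w by (simp add: ext_y_def supp_on_kdiff)
qed

lemma contract_list_ext_y:
  "w \<in> ext_y Y (length is + q) \<Longrightarrow> set is \<subseteq> {0..k} \<Longrightarrow> contract_list m is w \<in> ext_y Y q"
  by (induction "is" arbitrary: q) (auto simp: contract_list_Cons intro!: contract_ext_y)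

lemma contract_set_ext_y:
  "w \<in> ext_y Y (card C + q) \<Longrightarrow> C \<subseteq> {0..k} \<Longrightarrow> contract_set m C w \<in> ext_y Y q"
  unfolding contract_set_def using finite_subset[of C "{0..k}"]
  by (intro contract_list_ext_y) auto

lemma zprod_inv_single: "finite I \<Longrightarrow> zprod_inv I = single (\<Sum>i\<in>I. single i (- 1), 0) 1"
  unfolding zprod_inv_def
  by (induction I rule: finite_induct) (simp_all add: zinv_def mult_single flip: zero_prod_def)

lemma deg_z_sum: "deg_z (\<Sum>i\<in>I. f i) = (\<Sum>i\<in>I. deg_z (f i))"
  by (induction I rule: infinite_finite_induct) (simp_all add: deg_z_add)

lemma zprod_inv_loc: "I \<subseteq> {0..k} \<Longrightarrow> zprod_inv I \<in> loc n k I"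
proof -
  have "J \<subseteq> I \<Longrightarrow> I \<subseteq> {0..k} \<Longrightarrow> zprod_inv J \<in> loc n k I" for J
    using infinite_finite_induct
    by (induction J rule: infinite_finite_induct)
      (auto simp: zprod_inv_def loc_ring_closed intro!: ring_subsetD(6)[OF ring_subset_loc] zinv_loc)
  then show "I \<subseteq> {0..k} \<Longrightarrow> zprod_inv I \<in> loc n k I" by blast
qed

lemma expl_terms:
  assumes w: "w \<in> ext_y Y k" and I: "I \<subseteq> {0..k}" "card I = Suc p"
  shows "expl m k w I \<in> kc.terms (- 1) Y p I"
proof -
  have fin: "finite I" using I(1) finite_subset by blast
  have card: "card ({0..k} - I) + p = k"
    using card_Diff_subset[OF fin I(1)] card_mono[OF _ I(1)] I(2) by simp
  have F: "contract_set m ({0..k} - I) w \<in> ext_y Y p"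
    using w by (intro contract_set_ext_y) (auto simp: card)
  have sgn: "(- 1) ^ e * f = (if even e then f else - f)" for e and f :: "'a bipoly" by simp
  have loc: "expl m k w I S \<in> loc n k I" for S
  proof -
    have "contract_set m ({0..k} - I) w S \<in> loc n k I"
      using F loc_ring_mono[of "{}" I n k] by (auto simp: ext_y_def)
    then have "zprod_inv I * contract_set m ({0..k} - I) w S \<in> loc n k I"
      using I by (intro ring_subsetD(6)[OF ring_subset_loc] zprod_inv_loc)
    then show ?thesis by (auto simp: expl_def mult.assoc sgn ring_subsetD(3)[OF ring_subset_loc])
  qed
  moreover have "keys (expl m k w I S) \<subseteq> term_keys (- 1) Y p" for S
  proof
    fix v assume "v \<in> keys (expl m k w I S)"
    then have "v \<in> keys (zprod_inv I * contract_set m ({0..k} - I) w S)"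
      by (auto simp: expl_def mult.assoc sgn split: if_splits)
    then obtain u where v: "v = (\<Sum>i\<in>I. single i (- 1), 0) + u" "u \<in> keys (contract_set m ({0..k} - I) w S)"
      using Poly_Mapping.keys_mult[of "zprod_inv I" "contract_set m ({0..k} - I) w S"]
      by (auto simp: zprod_inv_single[OF fin])
    then have "fst u = 0" "Y (deg_y (snd u) + int p)" using F by (auto simp: ext_y_def)
    then show "v \<in> term_keys (- 1) Y p"
      using I(2) by (simp add: v(1) term_keys_def deg_z_add deg_y_add deg_z_sum)
  qed
  moreover have "supp_on m p (expl m k w I)"
    using F unfolding expl_def[abs_def] by (intro supp_on_scale) (simp add: ext_y_def)
  ultimately show ?thesis by (simp add: kc.terms_def)
qed

theorem zigzag_expl:
  assumes "w \<in> ext_y Y k"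
  shows "kc.zigzag (- 1) Y (\<lambda>p. expl m k w)"
  unfolding kc.zigzag_def
  using expl_terms[OF assms] expl_zigzag by (auto intro!: ext)

end

section \<open>Global sections\<close>

context koszul_cech begin

lemma zigzag_minus:
  assumes "zigzag c" "zigzag c'"
  shows "zigzag (\<lambda>p I T. c p I T - c' p I T)"
  unfolding zigzag_def
proof (intro conjI allI impI)
  show "(\<lambda>T. c p I T - c' p I T) \<in> terms p I" if "p \<le> k" "I \<subseteq> {0..k}" "card I = p + 1" for p I
    using assms that by (intro terms_diff) (auto simp: zigzag_def)
  show "cech_diff (\<lambda>I T. c p I T - c' p I T) I = diff (\<lambda>T. c (p + 1) I T - c' (p + 1) I T)"
    if "p < k" "I \<subseteq> {0..k}" "card I = p + 2" for p I
  proof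
    fix T
    have "cech_diff (c p) I = diff (c (p + 1) I)" "cech_diff (c' p) I = diff (c' (p + 1) I)"
      using assms that by (auto simp: zigzag_def)
    then show "cech_diff (\<lambda>I T. c p I T - c' p I T) I T = diff (\<lambda>T. c (p + 1) I T - c' (p + 1) I T) T"
      by (simp add: cech_diff_diff kdiff_diff)
  qed
qed

end

lemma lin_ext_scale: "h * lin_ext \<mu> f = lin_ext (\<lambda>u. h * \<mu> u) f"
  by (simp add: lin_ext_def sum_distrib_left mult.left_commute)

text \<open>The coefficient of \<open>1 / (z\<^sub>0 \<cdots> z\<^sub>k)\<close>, a polynomial in the \<open>y\<^sub>i\<close>.\<close>

definition residue :: "nat \<Rightarrow> 'a::field bipoly \<Rightarrow> 'a bipoly" where
  "residue k = lin_ext (\<lambda>u. if \<forall>i\<le>k. lookup (fst u) i = - 1 then single (0, snd u) 1 else 0)"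

lemma supp_on_map: "supp_on m q c \<Longrightarrow> h 0 = 0 \<Longrightarrow> supp_on m q (\<lambda>T. h (c T))"
  unfolding supp_on_def by metis

lemma lookup_sum_single:
  "finite I \<Longrightarrow> lookup (\<Sum>i\<in>I. single i c) j = (if j \<in> I then c else 0)"
  by (simp add: lookup_sum lookup_single when_def)

lemma mk_neg_one:
  fixes k :: nat
  assumes "keys a \<subseteq> {0..k}" "\<forall>i\<le>k. lookup a i = (- 1 :: int)"
  shows "a = (\<Sum>i\<in>{0..k}. single i (- 1))"
proof (rule poly_mapping_eqI)
  fix i show "lookup a i = lookup (\<Sum>i\<in>{0..k}. single i (- 1)) i"
    unfolding lookup_sum_single[OF finite_atLeastAtMost]
    using assms by (cases "i \<le> k") (auto simp: in_keys_iff subset_iff)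
qed

context secant begin

lemma sec_coset_eq_iff:
  assumes "f \<in> loc n k I" "g \<in> loc n k I"
  shows "sec_coset n k I f = sec_coset n k I g \<longleftrightarrow> f - g \<in> rel_ideal n k I"
proof -
  note A = ring_subset_loc[of n k I, where 'a = 'a]
  have coset: "sec_coset n k I h = {p + h | p. p \<in> rel_ideal n k I}" for h :: "'a bipoly"
    by (auto simp: sec_coset_def a_r_coset_def' loc_ring_def)
  show ?thesis
  proof
    assume "sec_coset n k I f = sec_coset n k I g"
    with sec_coset_self[OF kn assms(1)] have "f \<in> sec_coset n k I g" by simp
    then show "f - g \<in> rel_ideal n k I" by (auto simp: coset)
  next
    assume fg: "f - g \<in> rel_ideal n k I"
    have "sec_coset n k I f' \<subseteq> sec_coset n k I g'" if "f' - g' \<in> rel_ideal n k I" for f' g' :: "'a bipoly"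
    proof
      fix h assume "h \<in> sec_coset n k I f'"
      then obtain p where "p \<in> rel_ideal n k I" "h = p + f'" by (auto simp: coset)
      with that have "p + (f' - g') \<in> rel_ideal n k I" "h = (p + (f' - g')) + g'"
        by (auto simp: rel_ideal_eq[OF kn] intro: ideal_span_add[OF A])
      then show "h \<in> sec_coset n k I g'" unfolding coset by blast
    qed
    moreover have "g - f \<in> rel_ideal n k I"
      using fg ideal_span_uminus[OF A, of "f - g"] by (simp add: rel_ideal_eq[OF kn])
    ultimately show "sec_coset n k I f = sec_coset n k I g" using fg by blast
  qed
qed

section \<open>Global sections as compatible families of representatives\<close>

definition mk_section :: "(nat \<Rightarrow> 'a::field bipoly) \<Rightarrow> 'a gsection" where
  "mk_section f = (\<lambda>i\<in>{0..k}. sec_coset n k {i} (f i))"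

definition compatible :: "(nat \<Rightarrow> 'a::field bipoly) \<Rightarrow> bool" where
  "compatible f \<longleftrightarrow> (\<forall>i\<le>k. f i \<in> loc n k {i}) \<and> (\<forall>i\<le>k. \<forall>j\<le>k. f i - f j \<in> rel_ideal n k {i, j})"

text \<open>The predicate \<open>Y\<close> on y-degrees covers at once the whole module, its graded
  pieces and its parts above a given degree.\<close>

definition gsec :: "int \<Rightarrow> (int \<Rightarrow> bool) \<Rightarrow> 'a::field gsection set" where
  "gsec r Y = {mk_section f | f. compatible f \<and> (\<forall>i\<le>k. keys (f i) \<subseteq> term_keys r Y 0)}"

lemma loc_pair: "f \<in> loc n k {i} \<Longrightarrow> f \<in> loc n k {i, j}" "f \<in> loc n k {j} \<Longrightarrow> f \<in> loc n k {i, j}"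
  using loc_ring_mono[of "{i}" "{i, j}" n k] loc_ring_mono[of "{j}" "{i, j}" n k] by auto

lemma gsecI: "compatible f \<Longrightarrow> (\<And>i. i \<le> k \<Longrightarrow> keys (f i) \<subseteq> term_keys r Y 0) \<Longrightarrow> mk_section f \<in> gsec r Y"
  unfolding gsec_def by blast

lemma gsecE:
  assumes "s \<in> gsec r Y"
  obtains f where "s = mk_section f" "compatible f" "\<forall>i\<le>k. keys (f i) \<subseteq> term_keys r Y 0"
  using assms unfolding gsec_def by blast

lemma mk_section_mem: "compatible f \<Longrightarrow> i \<le> k \<Longrightarrow> f i \<in> mk_section f i"
  by (simp add: mk_section_def compatible_def sec_coset_self[OF kn])

lemma mk_section_eq_iff:
  assumes "compatible f" "compatible g"
  shows "mk_section f = mk_section g \<longleftrightarrow> (\<forall>i\<le>k. f i - g i \<in> rel_ideal n k {i})"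
proof -
  have "mk_section f = mk_section g \<longleftrightarrow> (\<forall>i\<le>k. sec_coset n k {i} (f i) = sec_coset n k {i} (g i))"
    unfolding mk_section_def by (auto simp: fun_eq_iff restrict_def)
  with assms show ?thesis by (simp add: compatible_def sec_coset_eq_iff)
qed

lemma term_keys_0: "keys p \<subseteq> term_keys r Y 0 \<longleftrightarrow> p \<in> homog_z r \<and> keys p \<subseteq> {u. Y (deg_y (snd u))}"
  by (auto simp: homog_z_iff term_keys_def)

lemma global_sections_mem:
  assumes "s \<in> global_sections n k r" "i \<le> k" "p \<in> s i"
  shows "p \<in> loc n k {i}" "s i = sec_coset n k {i} p"
  using assms sec_coset_eqI[OF kn, of "s i" "{i}" p]
  by (auto simp: global_sections_def sections_def PiE_iff)

lemma gsec_iff: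
  "s \<in> gsec r Y \<longleftrightarrow> s \<in> global_sections n k r \<and> (\<forall>i\<in>{0..k}. \<exists>p\<in>s i. keys p \<subseteq> term_keys r Y 0)"
proof
  assume "s \<in> gsec r Y"
  then obtain f where f: "s = mk_section f" "compatible f" "\<forall>i\<le>k. keys (f i) \<subseteq> term_keys r Y 0" by (rule gsecE)
  have "s \<in> global_sections n k r"
    unfolding f(1) mk_section_def
  proof (rule global_sectionsI[OF kn])
    show "f i \<in> loc n k {i} \<inter> homog_z r" if "i \<in> {0..k}" for i
      using f(2,3) that by (auto simp: compatible_def term_keys_0)
    show "sec_coset n k {i, j} (f i) = sec_coset n k {i, j} (f j)" if "i \<in> {0..k}" "j \<in> {0..k}" for i j
      using f(2) that by (subst sec_coset_eq_iff) (auto simp: compatible_def loc_pair)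
  qed
  moreover have "\<forall>i\<in>{0..k}. \<exists>p\<in>s i. keys p \<subseteq> term_keys r Y 0"
    using f(3) mk_section_mem[OF f(2)] unfolding f(1) by (metis atLeastAtMost_iff)
  ultimately show "s \<in> global_sections n k r \<and> (\<forall>i\<in>{0..k}. \<exists>p\<in>s i. keys p \<subseteq> term_keys r Y 0)" by blast
next
  assume s: "s \<in> global_sections n k r \<and> (\<forall>i\<in>{0..k}. \<exists>p\<in>s i. keys p \<subseteq> term_keys r Y 0)"
  then obtain f where f: "\<And>i. i \<in> {0..k} \<Longrightarrow> f i \<in> s i" "\<And>i. i \<in> {0..k} \<Longrightarrow> keys (f i) \<subseteq> term_keys r Y 0" by metis
  have loc: "f i \<in> loc n k {i}" and eq: "s i = sec_coset n k {i} (f i)" if "i \<in> {0..k}" for i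
    using global_sections_mem[of s r i "f i"] s f(1)[OF that] that by auto
  have "s \<in> extensional {0..k}" using s by (auto simp: global_sections_def PiE_iff)
  then have "s = mk_section f"
    unfolding mk_section_def by (intro extensionalityI[of s "{0..k}"]) (auto simp: eq)
  moreover have "compatible f"
    unfolding compatible_def
  proof (intro conjI allI impI)
    fix i j assume "i \<le> k" "j \<le> k"
    then have ij: "i \<in> {0..k}" "j \<in> {0..k}" by auto
    have "restr n k {i, j} (s i) = restr n k {i, j} (s j)"
      using s ij unfolding global_sections_def by blast
    then have "sec_coset n k {i, j} (f i) = sec_coset n k {i, j} (f j)"
      by (simp add: eq[OF ij(1)] eq[OF ij(2)] restr_sec_coset[OF kn])
    then show "f i - f j \<in> rel_ideal n k {i, j}"
      using loc[OF ij(1)] loc[OF ij(2)] by (subst (asm) sec_coset_eq_iff) (auto simp: loc_pair)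
  qed (use loc in auto)
  ultimately show "s \<in> gsec r Y" using f(2) by (auto intro: gsecI)
qed

lemma global_sections_eq: "global_sections n k r = gsec r (\<lambda>_. True)"
proof -
  have "\<exists>p\<in>s i. p \<in> homog_z r" if "s \<in> global_sections n k r" "i \<in> {0..k}" for s :: "'a gsection" and i
    using that by (auto simp: global_sections_def sections_def PiE_iff)
  then show ?thesis by (auto simp: gsec_iff term_keys_0)
qed

lemma carrier_M_piece: "carrier (M_piece n k r d) = gsec r (\<lambda>e. e = d)"
proof -
  have "(X \<inter> homog_z r \<inter> homog_y d \<noteq> {}) \<longleftrightarrow> (\<exists>p\<in>X. keys p \<subseteq> term_keys r (\<lambda>e. e = d) 0)" for X :: "'a bipoly set"
    unfolding term_keys_0 homog_y_iff[symmetric] by blast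
  then show ?thesis unfolding gsec_iff set_eq_iff M_piece_def by (simp only: module.simps partial_object.simps mem_Collect_eq) blast
qed

lemma carrier_M_module: "carrier (M_module n k r) = gsec r (\<lambda>_. True)"
  by (simp add: M_module_def global_sections_eq)

lemma gadd_mk_section:
  assumes "compatible f" "compatible g"
  shows "gadd n k (mk_section f) (mk_section g) = mk_section (\<lambda>i. f i + g i)"
  unfolding gadd_def using assms
  by (auto simp: mk_section_def compatible_def sec_coset_simps[OF kn] intro!: restrict_ext)

lemma gmult_mk_section:
  assumes "compatible f" "compatible g"
  shows "gmult n k (mk_section f) (mk_section g) = mk_section (\<lambda>i. f i * g i)"
  unfolding gmult_def using assms
  by (auto simp: mk_section_def compatible_def sec_coset_simps[OF kn] intro!: restrict_ext)

lemma compatible_add: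
  assumes "compatible f" "compatible g"
  shows "compatible (\<lambda>i. f i + g i)"
proof -
  have "(f i + g i) - (f j + g j) \<in> rel_ideal n k {i, j}" if "i \<le> k" "j \<le> k" for i j
  proof -
    have "(f i - f j) + (g i - g j) \<in> rel_ideal n k {i, j}"
      using assms that by (auto simp: compatible_def rel_ideal_eq[OF kn] intro!: ideal_span_add[OF ring_subset_loc])
    then show ?thesis by (simp add: algebra_simps)
  qed
  then show ?thesis using assms by (auto simp: compatible_def loc_ring_closed)
qed

lemma compatible_mult:
  assumes "compatible f" "compatible g"
  shows "compatible (\<lambda>i. f i * g i)"
proof -
  have "f i * g i - f j * g j \<in> rel_ideal n k {i, j}" if ij: "i \<le> k" "j \<le> k" for i j
  proof -
    have "f i \<in> loc n k {i, j}" "g j \<in> loc n k {i, j}" using assms ij by (auto simp: compatible_def loc_pair)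
    then have "f i * (g i - g j) + g j * (f i - f j) \<in> rel_ideal n k {i, j}"
      using assms ij
      by (auto simp: compatible_def rel_ideal_eq[OF kn] intro!: ideal_span_add[OF ring_subset_loc] ideal_span_mult[OF ring_subset_loc])
    then show ?thesis by (simp add: algebra_simps)
  qed
  then show ?thesis using assms by (auto simp: compatible_def loc_ring_closed)
qed

lemma rel_ideal_0: "0 \<in> rel_ideal n k I"
  by (simp add: rel_ideal_eq[OF kn] ideal_span_0[OF ring_subset_loc])

lemma compatible_const: "g \<in> loc n k {} \<Longrightarrow> compatible (\<lambda>_. g)"
  using loc_ring_mono[of "{}" "{_}" n k] by (auto simp: compatible_def rel_ideal_0)

lemma gpoly_mk_section: "gpoly n k g = mk_section (\<lambda>_. g)"
  by (simp add: gpoly_sec_coset mk_section_def)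

lemma gpoly_gsec: "g \<in> loc n k {} \<Longrightarrow> keys g \<subseteq> term_keys r Y 0 \<Longrightarrow> gpoly n k g \<in> gsec r Y"
  unfolding gpoly_mk_section by (intro gsecI compatible_const) auto

subsection \<open>Sections of nonnegative twists\<close>

text \<open>All terms of the zigzag have z-degree \<open>r - q \<ge> -k\<close>, which no totally
  negative monomial attains; so nothing obstructs a global polynomial.\<close>

theorem gsec_nonneg:
  assumes "r \<ge> 0" and s: "s \<in> gsec r Y"
  shows "\<exists>g. g \<in> loc n k {} \<and> keys g \<subseteq> term_keys r Y 0 \<and> s = gpoly n k g"
proof -
  obtain f where f: "s = mk_section f" "compatible f" "\<forall>i\<le>k. keys (f i) \<subseteq> term_keys r Y 0"
    using s by (rule gsecE)
  have "\<exists>c. kc.zigzag r Y c \<and> (\<forall>i\<le>k. c 0 {i} {} = f i)"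
    using f(2,3) by (intro kc.zigzag_exists) (auto simp: compatible_def)
  then obtain c where c: "kc.zigzag r Y c" "\<forall>i\<le>k. c 0 {i} {} = f i" by blast
  have nonneg: "\<exists>i\<le>k. lookup (fst u) i \<ge> 0"
    if "q \<le> k" "u \<in> term_keys r Y q" "keys (fst u) \<subseteq> {0..k}" for q u
  proof (rule ccontr)
    assume "\<not> (\<exists>i\<le>k. lookup (fst u) i \<ge> 0)"
    then have "deg_z (fst u) \<le> - int k - 1" by (intro all_neg_deg_z[OF that(3)]) (metis not_le)
    with that(1,2) assms(1) show False by (simp add: term_keys_def)
  qed
  have "\<exists>g. g \<in> loc n k {} \<and> keys g \<subseteq> term_keys r Y 0 \<and> (\<forall>i\<le>k. c 0 {i} {} - g \<in> rel_ideal n k {i})"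
  proof (rule kc.zigzag_global[OF c(1)])
    fix T u assume u: "u \<in> keys (c k {0..k} T)"
    have "c k {0..k} \<in> kc.terms r Y k {0..k}" by (rule kc.zigzag_terms[OF c(1)]) auto
    from kc.termsD(1,2)[OF this, of T] u have "u \<in> term_keys r Y k" "keys (fst u) \<subseteq> {0..k}"
      by (auto simp: loc_iff loc_keys_def)
    with nonneg[of k u] show "\<exists>i\<le>k. lookup (fst u) i \<ge> 0" by simp
  qed (rule nonneg[OF less_imp_le])
  then obtain g where g: "g \<in> loc n k {}" "keys g \<subseteq> term_keys r Y 0" "\<forall>i\<le>k. f i - g \<in> rel_ideal n k {i}"
    using c(2) by auto
  then have "s = gpoly n k g"
    unfolding f(1) gpoly_mk_section by (subst mk_section_eq_iff) (auto simp: f(2) compatible_const)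
  with g show ?thesis by blast
qed

subsection \<open>Sections of \<open>O(-1)\<close>\<close>

definition sec_of :: "(nat set \<Rightarrow> 'a::field bipoly) \<Rightarrow> 'a gsection" where
  "sec_of w = mk_section (\<lambda>i. expl m k w {i} {})"

lemma zigzag_compatible:
  assumes c: "kc.zigzag r Y c"
  shows "compatible (\<lambda>i. c 0 {i} {})" "i \<le> k \<Longrightarrow> keys (c 0 {i} {}) \<subseteq> term_keys r Y 0"
proof -
  have t: "c 0 {i} \<in> kc.terms r Y 0 {i}" if "i \<le> k" for i
    using that by (intro kc.zigzag_terms[OF c]) auto
  then show "i \<le> k \<Longrightarrow> keys (c 0 {i} {}) \<subseteq> term_keys r Y 0" for i using kc.termsD(2) by blast
  have lt: "c 0 {j} {} - c 0 {i} {} \<in> rel_ideal n k {i, j}" if "i < j" "j \<le> k" for i j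
  proof -
    have e: "{s. (s = i \<or> s = j) \<and> s < i} = {}" "{s. (s = i \<or> s = j) \<and> s < j} = {i}"
      using that by auto
    have "c 0 {j} {} - c 0 {i} {} = cech_diff (c 0) {i, j} {}"
      using that by (simp add: cech_diff_def insert_Diff_if e)
    also have "\<dots> = kc.diff (c 1 {i, j}) {}"
      using kc.zigzag_diff[OF c, of 0 "{i, j}"] that k1 by simp
    also have "\<dots> \<in> rel_ideal n k {i, j}"
      using that k1 by (intro kc.diff_in_rel_ideal[of _ r Y 1] kc.zigzag_terms[OF c]) auto
    finally show ?thesis .
  qed
  have "c 0 {i} {} - c 0 {j} {} \<in> rel_ideal n k {i, j}" if "i \<le> k" "j \<le> k" for i j
  proof (cases i j rule: linorder_cases)
    case greater
    then show ?thesis using lt[of j i] that by (simp add: insert_commute)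
  next
    case less
    with lt[of i j] that have "- (c 0 {j} {} - c 0 {i} {}) \<in> rel_ideal n k {i, j}"
      unfolding rel_ideal_eq[OF kn] by (intro ideal_span_uminus[OF ring_subset_loc])
    then show ?thesis by simp
  qed (simp add: rel_ideal_0)
  then show "compatible (\<lambda>i. c 0 {i} {})"
    using kc.termsD(1)[OF t] by (simp add: compatible_def)
qed

lemma sec_of_gsec: "w \<in> ext_y Y k \<Longrightarrow> sec_of w \<in> gsec (- 1) Y"
  unfolding sec_of_def by (intro gsecI zigzag_compatible[OF zigzag_expl])

lemma compatible_expl: "w \<in> ext_y Y k \<Longrightarrow> compatible (\<lambda>i. expl m k w {i} {})"
  using zigzag_compatible(1)[OF zigzag_expl] .

lemma residue_zprod_inv:
  assumes "f \<in> loc n k I"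
  shows "zprod_inv {0..k} * residue k f = mono_part {u. \<forall>i\<le>k. lookup (fst u) i = - 1} f"
  unfolding residue_def lin_ext_scale mono_part_def
proof (rule lin_ext_cong)
  fix u assume "u \<in> keys f"
  with assms have "keys (fst u) \<subseteq> {0..k}" by (auto simp: loc_iff loc_keys_def)
  then show "zprod_inv {0..k} * (if \<forall>i\<le>k. lookup (fst u) i = - 1 then single (0, snd u) 1 else 0)
    = (if u \<in> {u. \<forall>i\<le>k. lookup (fst u) i = - 1} then single u (1 :: 'a) else 0)"
    using mk_neg_one[of "fst u" k] by (cases u) (auto simp: zprod_inv_single mult_single)
qed

lemma residue_ext_y:
  assumes "c \<in> kc.terms (- 1) Y k I"
  shows "(\<lambda>T. residue k (c T)) \<in> ext_y Y k"
proof -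
  have *: "keys (residue k (c T)) \<subseteq> loc_keys n k {} \<inter> {u. fst u = 0 \<and> Y (deg_y (snd u) + int k)}" for T
    unfolding residue_def
  proof (rule keys_lin_ext)
    fix u v :: "(nat \<Rightarrow>\<^sub>0 int) \<times> (nat \<Rightarrow>\<^sub>0 nat)"
    assume "u \<in> keys (c T)"
      and v: "v \<in> keys (if \<forall>i\<le>k. lookup (fst u) i = - 1 then single (0, snd u) (1 :: 'a) else 0)"
    then have "u \<in> loc_keys n k I" "u \<in> term_keys (- 1) Y k"
      using kc.termsD(1,2)[OF assms, of T] by (auto simp: loc_iff)
    with v show "v \<in> loc_keys n k {} \<inter> {u. fst u = 0 \<and> Y (deg_y (snd u) + int k)}"
      by (auto simp: loc_keys_def term_keys_def split: if_splits)
  qed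
  moreover have "supp_on m k (\<lambda>T. residue k (c T))"
    by (rule supp_on_map[OF kc.termsD(3)[OF assms]]) (simp add: residue_def)
  ultimately show ?thesis by (auto simp: ext_y_def loc_iff)
qed

lemma ext_y_scale_sign: "w \<in> ext_y Y q \<Longrightarrow> (\<lambda>T. (- 1) ^ e * w T) \<in> ext_y Y q"
  by (cases "even e") (auto simp: ext_y_def supp_on_def ring_subsetD(3)[OF ring_subset_loc])

lemma expl_top: "expl m k w {0..k} S = (- 1) ^ (\<Sum>{0..k}) * zprod_inv {0..k} * w S"
  by (simp add: expl_def contract_set_def)

text \<open>The explicit zigzag with the same residue is subtracted. What remains has no totally
  negative monomial at the end, hence comes from a global polynomial, which has z-degree -1 and
  vanishes.\<close>

theorem gsec_minus_one:
  assumes s: "s \<in> gsec (- 1) Y"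
  shows "\<exists>w\<in>ext_y Y k. s = sec_of w"
proof -
  obtain f where f: "s = mk_section f" "compatible f" "\<forall>i\<le>k. keys (f i) \<subseteq> term_keys (- 1) Y 0"
    using s by (rule gsecE)
  have "\<exists>c. kc.zigzag (- 1) Y c \<and> (\<forall>i\<le>k. c 0 {i} {} = f i)"
    using f(2,3) by (intro kc.zigzag_exists) (auto simp: compatible_def)
  then obtain c where c: "kc.zigzag (- 1) Y c" "\<forall>i\<le>k. c 0 {i} {} = f i" by blast
  have top: "c k {0..k} \<in> kc.terms (- 1) Y k {0..k}" by (rule kc.zigzag_terms[OF c(1)]) auto
  \<comment> \<open>The sign cancels the one in \<open>expl\<close> on the full index set.\<close>
  define w where "w T = (- 1) ^ (\<Sum>{0..k}) * residue k (c k {0..k} T)" for T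
  have w: "w \<in> ext_y Y k"
    unfolding w_def[abs_def] by (intro ext_y_scale_sign residue_ext_y[OF top])
  let ?c = "\<lambda>p I T. c p I T - expl m k w I T"
  have c': "kc.zigzag (- 1) Y ?c" by (rule kc.zigzag_minus[OF c(1) zigzag_expl[OF w]])
  have all_neg: "\<not> (\<forall>i\<le>k. lookup (fst u) i < 0)" if "u \<in> keys (?c k {0..k} T)" for u T
  proof
    assume neg: "\<forall>i\<le>k. lookup (fst u) i < 0"
    have "(- 1) ^ e * ((- 1) ^ e * g) = g" for e and g :: "'a bipoly"
      by (simp flip: mult.assoc power_add mult_2)
    then have "expl m k w {0..k} T = mono_part {u. \<forall>i\<le>k. lookup (fst u) i = - 1} (c k {0..k} T)"
      unfolding expl_top w_def
      using residue_zprod_inv[OF kc.termsD(1)[OF top]] by (simp add: mult_ac)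
    then have u: "u \<in> keys (c k {0..k} T)" "\<not> (\<forall>i\<le>k. lookup (fst u) i = - 1)"
      using that by (auto simp: in_keys_iff lookup_minus lookup_mono_part split: if_splits)
    then have "keys (fst u) \<subseteq> {0..k}" "deg_z (fst u) = - int k - 1"
      using kc.termsD(1,2)[OF top, of T] by (auto simp: loc_iff loc_keys_def term_keys_def)
    with neg u(2) show False using all_neg_deg_z_eq[of "fst u" k] by auto
  qed
  have "\<exists>g. g \<in> loc n k {} \<and> keys g \<subseteq> term_keys (- 1) Y 0 \<and> (\<forall>i\<le>k. ?c 0 {i} {} - g \<in> rel_ideal n k {i})"
  proof (rule kc.zigzag_global[OF c'])
    show "\<exists>i\<le>k. lookup (fst u) i \<ge> 0" if "u \<in> keys (?c k {0..k} T)" for T u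
      using all_neg[OF that] by (auto simp: not_less)
    show "\<exists>i\<le>k. lookup (fst u) i \<ge> 0"
      if "q < k" "u \<in> term_keys (- 1) Y q" "keys (fst u) \<subseteq> {0..k}" for q u
    proof (rule ccontr)
      assume "\<not> (\<exists>i\<le>k. lookup (fst u) i \<ge> 0)"
      then have "deg_z (fst u) \<le> - int k - 1" by (intro all_neg_deg_z[OF that(3)]) (metis not_le)
      with that(1,2) show False by (simp add: term_keys_def)
    qed
  qed
  then obtain g where g: "g \<in> loc n k {}" "keys g \<subseteq> term_keys (- 1) Y 0"
    "\<forall>i\<le>k. f i - expl m k w {i} {} - g \<in> rel_ideal n k {i}"
    using c(2) by auto
  \<comment> \<open>Exponents in \<open>loc n k {}\<close> are nonnegative and cannot sum to
    -1.\<close>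
  have "u \<notin> keys g" for u
  proof
    assume "u \<in> keys g"
    with g(1,2) have "u \<in> loc_keys n k {}" "deg_z (fst u) = - 1" by (auto simp: loc_iff term_keys_def)
    then have "lookup (fst u) i \<ge> 0" for i by (auto simp: loc_keys_def not_less[symmetric])
    then have "deg_z (fst u) \<ge> 0" unfolding deg_z_def by (intro sum_nonneg)
    with \<open>deg_z (fst u) = - 1\<close> show False by simp
  qed
  then have "keys g = {}" by blast
  then have "g = 0" by simp
  with g(3) have "s = sec_of w"
    unfolding f(1) sec_of_def by (subst mk_section_eq_iff) (auto simp: f(2) compatible_expl[OF w])
  with w show ?thesis by blast
qed

end

section \<open>The spaces of generators\<close>

lemma contract_list_add: "contract_list m is (\<lambda>T. v T + w T) = (\<lambda>T. contract_list m is v T + contract_list m is w T)"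
  by (induction "is") (simp_all add: contract_list_Cons kdiff_add ext)

lemma contract_list_scale: "contract_list m is (\<lambda>T. a * w T) = (\<lambda>T. a * contract_list m is w T)"
  by (induction "is") (simp_all add: contract_list_Cons kdiff_scale ext)

lemma expl_add: "expl m k (\<lambda>T. v T + w T) I S = expl m k v I S + expl m k w I S"
  by (simp add: expl_def contract_set_def contract_list_add algebra_simps)

lemma expl_scale: "expl m k (\<lambda>T. a * w T) I S = a * expl m k w I S"
  by (simp add: expl_def contract_set_def contract_list_scale mult_ac)

definition const_fun :: "(nat set \<Rightarrow> 'a::field) \<Rightarrow> nat set \<Rightarrow> 'a bipoly" where
  "const_fun w T = single 0 (w T)"

lemma const_fun_add: "const_fun (\<lambda>T. v T + w T) = (\<lambda>T. const_fun v T + const_fun w T)"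
  by (simp add: const_fun_def fun_eq_iff single_add)

lemma const_fun_scale: "const_fun (\<lambda>T. c * w T) = (\<lambda>T. single 0 c * const_fun w T)"
  by (simp add: const_fun_def fun_eq_iff mult_single)

context secant begin

lemma ext_y_add: "v \<in> ext_y Y q \<Longrightarrow> w \<in> ext_y Y q \<Longrightarrow> (\<lambda>T. v T + w T) \<in> ext_y Y q"
  using Poly_Mapping.keys_add[of "v _" "w _"]
  by (fastforce simp: ext_y_def supp_on_add loc_ring_closed)

lemma sec_of_add:
  assumes "v \<in> ext_y Y k" "w \<in> ext_y Y' k"
  shows "gadd n k (sec_of v) (sec_of w) = sec_of (\<lambda>T. v T + w T)"
  unfolding sec_of_def by (simp add: gadd_mk_section[OF compatible_expl[OF assms(1)] compatible_expl[OF assms(2)]] expl_add)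

lemma sec_of_scale:
  assumes "g \<in> loc n k {}" "w \<in> ext_y Y k"
  shows "gmult n k (gpoly n k g) (sec_of w) = sec_of (\<lambda>T. g * w T)"
  unfolding sec_of_def gpoly_mk_section
  by (simp add: gmult_mk_section[OF compatible_const[OF assms(1)] compatible_expl[OF assms(2)]] expl_scale)

lemma ext_module_carrier: "w \<in> carrier (ext_module k (n - k)) \<longleftrightarrow> supp_on m k w"
  by (simp add: ext_module_def supp_on_def atLeastLessThanSuc_atLeastAtMost)

lemma const_loc: "single 0 c \<in> loc n k I"
  by (rule single_loc) (simp add: loc_keys_def)

lemma const_fun_ext_y:
  assumes "w \<in> carrier (ext_module k (n - k))"
  shows "const_fun w \<in> ext_y (\<lambda>d. d = int k) k"
  using assms supp_on_map[of m k w "single (0 :: (nat \<Rightarrow>\<^sub>0 int) \<times> (nat \<Rightarrow>\<^sub>0 nat))"]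
  by (auto simp: ext_y_def const_fun_def[abs_def] ext_module_carrier const_loc split: if_splits)

lemma ext_y_const_fun:
  assumes "W \<in> ext_y (\<lambda>d. d = int k) k"
  obtains w where "w \<in> carrier (ext_module k (n - k))" "W = const_fun w"
proof
  show "(\<lambda>T. lookup (W T) 0) \<in> carrier (ext_module k (n - k))"
    unfolding ext_module_carrier by (rule supp_on_map) (use assms in \<open>auto simp: ext_y_def\<close>)
  have "lookup (W T) u = 0" if "u \<noteq> 0" for T u
  proof (rule ccontr)
    assume "lookup (W T) u \<noteq> 0"
    then have "u \<in> keys (W T)" by (simp add: in_keys_iff)
    then have "fst u = 0" "deg_y (snd u) + int k = int k" using assms unfolding ext_y_def by blast+
    with that show False by (simp add: deg_y_eq_0_iff prod_eq_iff)
  qed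
  then show "W = const_fun (\<lambda>T. lookup (W T) 0)"
    by (intro ext poly_mapping_eqI) (auto simp: const_fun_def lookup_single when_def)
qed

text \<open>Each of the \<open>k\<close> contractions contributes one factor \<open>yvar\<close>, so
  constant \<open>w\<close> belong to sections of y-degree \<open>k\<close>.\<close>

abbreviation gen_deg :: "int \<Rightarrow> bool" where "gen_deg \<equiv> \<lambda>d. d = int k"

section \<open>The generators of \<open>M_{-1}\<close>\<close>

lemma koszul_sections_eq: "(koszul_sections n k q I :: (nat set \<Rightarrow> 'a::field bipoly) set) = kc.terms (- 1) gen_deg q I"
proof -
  have "keys p \<subseteq> term_keys (- 1) gen_deg q \<longleftrightarrow> p \<in> homog_z (- int q - 1) \<and> p \<in> homog_y (int k - int q)" for p :: "'a bipoly"
    unfolding homog_z_iff homog_y_iff term_keys_def by auto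
  then show ?thesis
    unfolding koszul_sections_def kc.terms_def supp_on_def atLeastLessThanSuc_atLeastAtMost by blast
qed

lemma koszul_diff_eq: "koszul_diff n k = kc.diff"
  by (intro ext) (simp add: koszul_diff_def kdiff_def pos_sign_def atLeastLessThanSuc_atLeastAtMost)

definition neg_key :: "(nat \<Rightarrow>\<^sub>0 int) \<times> (nat \<Rightarrow>\<^sub>0 nat)" where
  "neg_key = (\<Sum>i\<in>{0..k}. single i (- 1), 0)"

lemma generator_rel_iff:
  "generator_rel n k s w \<longleftrightarrow> (\<exists>c. kc.zigzag (- 1) gen_deg c \<and> (\<forall>i\<le>k. c 0 {i} {} \<in> s i)
     \<and> w = (\<lambda>T. lookup (c k {0..k} T) neg_key))"
  unfolding generator_rel_def kc.zigzag_def koszul_sections_eq koszul_diff_eq neg_key_def atLeast0AtMost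
  by (simp only: conj_assoc) (intro iff_exI, blast)

text \<open>The sign of \<open>expl\<close> on the full index set; by it \<open>w\<close> and the
  element identified with \<open>sec_of (const_fun w)\<close> differ.\<close>

definition gen_sign :: "'a::field" where
  "gen_sign = (- 1) ^ (\<Sum>{0..k})"

lemma gen_sign_square [simp]: "gen_sign * gen_sign = (1 :: 'a::field)" "gen_sign * (gen_sign * c) = (c :: 'a)"
  by (simp_all add: gen_sign_def flip: power_add mult_2 mult.assoc)

lemma sign_single: "(- 1) ^ e * single u c = single u ((- 1) ^ e * (c :: 'a::field))"
  for u :: "(nat \<Rightarrow>\<^sub>0 int) \<times> (nat \<Rightarrow>\<^sub>0 nat)"
  by (cases "even e") (simp_all add: single_uminus)

lemma generator_rel_sec_of:
  assumes w: "w \<in> carrier (ext_module k (n - k))"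
  shows "generator_rel n k (sec_of (const_fun w)) (\<lambda>T. gen_sign * w T)"
  unfolding generator_rel_iff
proof (intro exI conjI)
  show "kc.zigzag (- 1) gen_deg (\<lambda>p. expl m k (const_fun w))"
    by (rule zigzag_expl[OF const_fun_ext_y[OF w]])
  show "\<forall>i\<le>k. expl m k (const_fun w) {i} {} \<in> sec_of (const_fun w) i"
    unfolding sec_of_def using mk_section_mem[OF compatible_expl[OF const_fun_ext_y[OF w]]] by auto
  show "(\<lambda>T. gen_sign * w T) = (\<lambda>T. lookup (expl m k (const_fun w) {0..k} T) neg_key)"
    by (simp add: expl_top const_fun_def zprod_inv_single mult_single mult.assoc sign_single neg_key_def gen_sign_def
        flip: zero_prod_def)
qed

text \<open>The difference of two zigzags for the same section starts with sections in the relation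
  ideals, so its final coefficient vanishes.\<close>

lemma generator_rel_unique:
  assumes s: "s \<in> global_sections n k (- 1)" and "generator_rel n k s v" "generator_rel n k s w"
  shows "v = w"
proof -
  obtain c where c: "kc.zigzag (- 1) gen_deg c" "\<forall>i\<le>k. c 0 {i} {} \<in> s i"
    "v = (\<lambda>T. lookup (c k {0..k} T) neg_key)"
    using assms(2) unfolding generator_rel_iff by blast
  obtain d where d: "kc.zigzag (- 1) gen_deg d" "\<forall>i\<le>k. d 0 {i} {} \<in> s i"
    "w = (\<lambda>T. lookup (d k {0..k} T) neg_key)"
    using assms(3) unfolding generator_rel_iff by blast
  have "lookup (c k {0..k} T - d k {0..k} T) neg_key = 0" for T
  proof (rule kc.zigzag_residue[OF kc.zigzag_minus[OF c(1) d(1)] k1])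
    fix i assume i: "i \<le> k"
    have "sec_coset n k {i} (c 0 {i} {}) = sec_coset n k {i} (d 0 {i} {})"
      using global_sections_mem(2)[OF s i] c(2) d(2) i by metis
    then show "c 0 {i} {} - d 0 {i} {} \<in> rel_ideal n k {i}"
      using global_sections_mem(1)[OF s i] c(2) d(2) i by (subst (asm) sec_coset_eq_iff) auto
  qed (simp_all add: neg_key_def lookup_sum_single)
  then show ?thesis by (simp add: c(3) d(3) lookup_minus)
qed

lemma M_piece_minus_one_cases:
  assumes "s \<in> carrier (M_piece n k (- 1) (int k))"
  obtains w where "w \<in> carrier (ext_module k (n - k))" "s = sec_of (const_fun w)"
proof -
  have "s \<in> gsec (- 1) gen_deg" using assms by (simp add: carrier_M_piece)
  then obtain W where "W \<in> ext_y gen_deg k" "s = sec_of W" using gsec_minus_one by blast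
  then show ?thesis using that by (elim ext_y_const_fun) auto
qed

lemma sec_of_const_fun:
  "w \<in> carrier (ext_module k (n - k)) \<Longrightarrow> sec_of (const_fun w) \<in> carrier (M_piece n k (- 1) (int k))"
  unfolding carrier_M_piece by (intro sec_of_gsec const_fun_ext_y)

lemma sec_of_const_fun_global:
  "w \<in> carrier (ext_module k (n - k)) \<Longrightarrow> sec_of (const_fun w) \<in> global_sections n k (- 1)"
  using sec_of_const_fun[of w] by (simp add: M_piece_def)

lemma generator_ident_sec_of:
  assumes "w \<in> carrier (ext_module k (n - k))"
  shows "generator_ident n k (sec_of (const_fun w)) = (\<lambda>T. gen_sign * w T)"
  unfolding generator_ident_def
proof (rule the_equality)
  show gen: "generator_rel n k (sec_of (const_fun w)) (\<lambda>T. gen_sign * w T)"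
    by (rule generator_rel_sec_of[OF assms])
  show "v = (\<lambda>T. gen_sign * w T)" if "generator_rel n k (sec_of (const_fun w)) v" for v
    by (rule generator_rel_unique[OF sec_of_const_fun_global[OF assms] that gen])
qed

lemma ext_module_scale:
  "w \<in> carrier (ext_module k (n - k)) \<Longrightarrow> (\<lambda>T. c * w T) \<in> carrier (ext_module k (n - k))"
  unfolding ext_module_carrier by (rule supp_on_scale)

theorem generator_rel_ex1:
  assumes "s \<in> carrier (M_piece n k (- 1) (int k))"
  shows "\<exists>!w. generator_rel n k s w"
  using assms
proof (rule M_piece_minus_one_cases)
  fix w assume "w \<in> carrier (ext_module k (n - k))" "s = sec_of (const_fun w)"
  then show ?thesis
    using generator_rel_sec_of generator_rel_unique[OF sec_of_const_fun_global] by metis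
qed

theorem generator_ident_iso:
  "generator_ident n k \<in> module_iso (M_piece n k (- 1) (int k)) (ext_module k (n - k)) (UNIV :: 'a::field set)"
proof -
  let ?M = "M_piece n k (- 1) (int k) :: ('a, 'a gsection) module" and ?E = "ext_module k (n - k) :: ('a, nat set \<Rightarrow> 'a) module"
  have "bij_betw (generator_ident n k) (carrier ?M) (carrier ?E)"
  proof (rule bij_betw_byWitness[where f' = "\<lambda>w. sec_of (const_fun (\<lambda>T. gen_sign * w T))"])
    show "\<forall>s\<in>carrier ?M. sec_of (const_fun (\<lambda>T. gen_sign * generator_ident n k s T)) = s"
      by (auto elim!: M_piece_minus_one_cases simp: generator_ident_sec_of)
    show "\<forall>w\<in>carrier ?E. generator_ident n k (sec_of (const_fun (\<lambda>T. gen_sign * w T))) = w"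
      by (simp add: generator_ident_sec_of ext_module_scale)
    show "generator_ident n k ` carrier ?M \<subseteq> carrier ?E"
      by (auto elim!: M_piece_minus_one_cases simp: generator_ident_sec_of ext_module_scale)
    show "(\<lambda>w. sec_of (const_fun (\<lambda>T. gen_sign * w T))) ` carrier ?E \<subseteq> carrier ?M"
      by (auto intro: sec_of_const_fun ext_module_scale)
  qed
  moreover have "generator_ident n k (s \<oplus>\<^bsub>?M\<^esub> t) = generator_ident n k s \<oplus>\<^bsub>?E\<^esub> generator_ident n k t"
    if s: "s \<in> carrier ?M" and t: "t \<in> carrier ?M" for s t
  proof -
    obtain v where v: "v \<in> carrier ?E" "s = sec_of (const_fun v)" using s by (rule M_piece_minus_one_cases)
    obtain w where w: "w \<in> carrier ?E" "t = sec_of (const_fun w)" using t by (rule M_piece_minus_one_cases)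
    have vw: "(\<lambda>T. v T + w T) \<in> carrier ?E"
      using v(1) w(1) by (simp add: ext_module_carrier supp_on_add)
    have "s \<oplus>\<^bsub>?M\<^esub> t = sec_of (const_fun (\<lambda>T. v T + w T))"
      using sec_of_add[OF const_fun_ext_y[OF v(1)] const_fun_ext_y[OF w(1)]]
      by (simp add: v(2) w(2) M_piece_def const_fun_add)
    then show ?thesis
      by (simp add: v(2) w(2) generator_ident_sec_of[OF vw] generator_ident_sec_of[OF v(1)] generator_ident_sec_of[OF w(1)])
        (simp add: ext_module_def distrib_left)
  qed
  moreover have "generator_ident n k (c \<odot>\<^bsub>?M\<^esub> s) = c \<odot>\<^bsub>?E\<^esub> generator_ident n k s"
    if s: "s \<in> carrier ?M" for c s
  proof -
    obtain w where w: "w \<in> carrier ?E" "s = sec_of (const_fun w)" using s by (rule M_piece_minus_one_cases)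
    have "c \<odot>\<^bsub>?M\<^esub> s = sec_of (const_fun (\<lambda>T. c * w T))"
      using sec_of_scale[OF const_loc const_fun_ext_y[OF w(1)]] by (simp add: w(2) M_piece_def const_fun_scale)
    then show ?thesis
      by (simp add: w generator_ident_sec_of[OF ext_module_scale[OF w(1)]] generator_ident_sec_of[OF w(1)])
        (simp add: ext_module_def mult_ac)
  qed
  ultimately show ?thesis by (simp add: module_iso_def)
qed

section \<open>The generators of \<open>M_{n-2k+1}\<close>\<close>

lemma sym_divided_carrier:
  "f \<in> carrier (sym_divided_module k q) \<longleftrightarrow> f \<in> loc n k {} \<and> keys f \<subseteq> term_keys (int q) (\<lambda>d. d = 0) 0"
proof -
  have "f \<in> carrier (sym_divided_module k q) \<longleftrightarrow> (\<forall>u\<in>keys f. keys (fst u) \<subseteq> {0..k} \<and> (\<forall>i. lookup (fst u) i \<ge> 0)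
      \<and> snd u = 0 \<and> deg_z (fst u) = int q)"
    unfolding sym_divided_module_def homog_z_def by fastforce
  also have "\<dots> \<longleftrightarrow> (\<forall>u\<in>keys f. u \<in> loc_keys n k {} \<and> u \<in> term_keys (int q) (\<lambda>d. d = 0) 0)"
    by (intro ball_cong refl) (auto simp: loc_keys_def term_keys_def deg_y_eq_0_iff not_less)
  finally show ?thesis by (auto simp: loc_iff)
qed

text \<open>Every form \<open>L_j\<close> contains one factor \<open>yvar\<close>. Hence two forms
  in the \<open>zvar\<close> alone that define the same section are equal.\<close>

lemma rel_ideal_deg_y:
  assumes "p \<in> rel_ideal n k I" "u \<in> keys p"
  shows "deg_y (snd u) \<ge> 1"
proof -
  from assms(1) obtain a where p: "p = (\<Sum>j<m. a j * lin_form k j)"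
    unfolding rel_ideal_eq[OF kn] by (rule ideal_spanE)
  have "u \<in> (\<Union>j\<in>{..<m}. keys (a j * lin_form k j))"
    by (rule subsetD[OF Poly_Mapping.keys_sum assms(2)[unfolded p]])
  then obtain j where "u \<in> keys (a j * lin_form k j)" by blast
  then obtain v w where vw: "u = v + w" "w \<in> keys (lin_form k j :: 'a bipoly)"
    using Poly_Mapping.keys_mult[of "a j" "lin_form k j"] by blast
  from vw(2) obtain i where "w = (single i 1, single (i + j) 1)" by (rule keys_lin_formE)
  then show ?thesis using deg_y_nonneg[of "snd v"] by (simp add: vw(1) deg_y_add)
qed

lemma gpoly_add:
  assumes "f \<in> loc n k {}" "g \<in> loc n k {}"
  shows "gpoly n k (f + g) = gadd n k (gpoly n k f) (gpoly n k g)"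
  using gadd_mk_section[OF compatible_const[OF assms(1)] compatible_const[OF assms(2)]] by (simp add: gpoly_mk_section)

lemma gpoly_mult:
  assumes "f \<in> loc n k {}" "g \<in> loc n k {}"
  shows "gpoly n k (f * g) = gmult n k (gpoly n k f) (gpoly n k g)"
  using gmult_mk_section[OF compatible_const[OF assms(1)] compatible_const[OF assms(2)]] by (simp add: gpoly_mk_section)

theorem gpoly_iso:
  "gpoly n k \<in> module_iso (sym_divided_module k q) (M_piece n k (int q) 0) (UNIV :: 'a::field set)"
proof -
  let ?S = "sym_divided_module k q :: ('a, 'a bipoly) module" and ?M = "M_piece n k (int q) 0 :: ('a, 'a gsection) module"
  have "bij_betw (gpoly n k) (carrier ?S) (carrier ?M)"
    unfolding bij_betw_def
  proof
    show "inj_on (gpoly n k) (carrier ?S)"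
    proof (rule inj_onI)
      fix f g assume f: "f \<in> carrier ?S" and g: "g \<in> carrier ?S" and "gpoly n k f = gpoly n k g"
      then have rel: "f - g \<in> rel_ideal n k {0}"
        unfolding gpoly_mk_section sym_divided_carrier by (subst (asm) mk_section_eq_iff) (auto simp: compatible_const)
      have "keys (f - g) \<subseteq> term_keys (int q) (\<lambda>d. d = 0) 0"
        using f g keys_diff[of f g] unfolding sym_divided_carrier by blast
      then have "u \<notin> keys (f - g)" for u
        using rel_ideal_deg_y[OF rel, of u] by (auto simp: term_keys_def)
      then have "keys (f - g) = {}" by blast
      then show "f = g" by simp
    qed
    have "gpoly n k f \<in> carrier ?M" if "f \<in> carrier ?S" for f
      unfolding carrier_M_piece by (rule gpoly_gsec) (use that in \<open>simp_all add: sym_divided_carrier\<close>)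
    moreover have "s \<in> gpoly n k ` carrier ?S" if "s \<in> carrier ?M" for s
      using gsec_nonneg[of "int q" s "\<lambda>d. d = 0"] that by (auto simp: carrier_M_piece sym_divided_carrier)
    ultimately show "gpoly n k ` carrier ?S = carrier ?M" by blast
  qed
  moreover have "gpoly n k (f \<oplus>\<^bsub>?S\<^esub> g) = gpoly n k f \<oplus>\<^bsub>?M\<^esub> gpoly n k g" if "f \<in> carrier ?S" "g \<in> carrier ?S" for f g
    using that gpoly_add[of f g] unfolding sym_divided_carrier by (simp add: sym_divided_module_def M_piece_def)
  moreover have "gpoly n k (c \<odot>\<^bsub>?S\<^esub> f) = c \<odot>\<^bsub>?M\<^esub> gpoly n k f" if "f \<in> carrier ?S" for c f
    using that gpoly_mult[OF const_loc, of f c] unfolding sym_divided_carrier by (simp add: sym_divided_module_def M_piece_def)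
  ultimately show ?thesis by (simp add: module_iso_def)
qed

end

section \<open>The Hermite action and minors\<close>

text \<open>
  Elements of an exterior power are viewed as alternating functions on lists of indices, which makes
  signs and collisions of indices automatic.
\<close>

primrec list_sign :: "nat list \<Rightarrow> 'r::comm_ring_1" where
  "list_sign [] = 1"
| "list_sign (t # ts) = pos_sign (set ts) t * list_sign ts"

definition alt_fun :: "(nat set \<Rightarrow> 'r::comm_ring_1) \<Rightarrow> nat list \<Rightarrow> 'r" where
  "alt_fun w ts = (if distinct ts then list_sign ts * w (set ts) else 0)"

definition alternating :: "(nat list \<Rightarrow> 'r::comm_ring_1) \<Rightarrow> bool" where
  "alternating a \<longleftrightarrow> (\<forall>xs s t ys. a (xs @ s # t # ys) = - a (xs @ t # s # ys)) \<and> (\<forall>xs t ys. a (xs @ t # t # ys) = 0)"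

lemma alternatingD:
  "alternating a \<Longrightarrow> a (xs @ s # t # ys) = - a (xs @ t # s # ys)"
  "alternating a \<Longrightarrow> a (xs @ t # t # ys) = 0"
  unfolding alternating_def by blast+

lemma list_sign_swap:
  assumes "s \<noteq> t" "s \<notin> set ys" "t \<notin> set ys"
  shows "list_sign (xs @ s # t # ys) = - (list_sign (xs @ t # s # ys) :: 'r::comm_ring_1)"
proof (induction xs)
  case Nil
  show ?case using assms by (simp add: pos_sign_insert mult_ac)
next
  case (Cons x xs)
  have "set (xs @ s # t # ys) = set (xs @ t # s # ys)" by auto
  with Cons show ?case by (simp only: append_Cons list_sign.simps mult_minus_right)
qed

lemma alternating_alt_fun: "alternating (alt_fun w)"
proof -
  have "alt_fun w (xs @ s # t # ys) = - alt_fun w (xs @ t # s # ys)" for xs s t ys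
  proof (cases "distinct (xs @ s # t # ys)")
    case True
    then have "list_sign (xs @ s # t # ys) = - (list_sign (xs @ t # s # ys) :: 'a)"
      by (intro list_sign_swap) auto
    moreover have "set (xs @ s # t # ys) = set (xs @ t # s # ys)" by auto
    moreover have "distinct (xs @ t # s # ys)" using True by auto
    ultimately show ?thesis using True by (simp only: alt_fun_def if_True mult_minus_left)
  qed (auto simp: alt_fun_def)
  moreover have "alt_fun w (xs @ t # t # ys) = 0" for xs t ys by (simp add: alt_fun_def)
  ultimately show ?thesis unfolding alternating_def by blast
qed

lemma alternating_diff:
  assumes "alternating a" "alternating b"
  shows "alternating (\<lambda>ts. a ts - b ts)"
  unfolding alternating_def
proof (intro conjI allI)
  fix xs ys :: "nat list" and s t
  show "a (xs @ s # t # ys) - b (xs @ s # t # ys) = - (a (xs @ t # s # ys) - b (xs @ t # s # ys))"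
    unfolding alternatingD(1)[OF assms(1), of xs s] alternatingD(1)[OF assms(2), of xs s] by simp
  show "a (xs @ t # t # ys) - b (xs @ t # t # ys) = 0"
    by (simp add: alternatingD(2)[OF assms(1)] alternatingD(2)[OF assms(2)])
qed

lemma alternating_scale:
  assumes "alternating a"
  shows "alternating (\<lambda>ts. c * a ts)"
  unfolding alternating_def
proof (intro conjI allI)
  fix xs ys :: "nat list" and s t
  show "c * a (xs @ s # t # ys) = - (c * a (xs @ t # s # ys))"
    unfolding alternatingD(1)[OF assms, of xs s] by simp
  show "c * a (xs @ t # t # ys) = 0" by (simp add: alternatingD(2)[OF assms])
qed

text \<open>Only vanishing is compared, so that the sign of the sorting permutation need not be
  tracked. Applied to a difference of alternating functions this suffices for equality.\<close>

lemma alternating_insort: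
  assumes "alternating a"
  shows "a (xs @ insort t ts) = 0 \<longleftrightarrow> a (xs @ t # ts) = 0"
proof (induction ts arbitrary: xs)
  case (Cons u ts)
  show ?case
  proof (cases "t \<le> u")
    case False
    then have "a (xs @ insort t (u # ts)) = a ((xs @ [u]) @ insort t ts)" by simp
    also have "\<dots> = 0 \<longleftrightarrow> a (xs @ u # t # ts) = 0" using Cons[of "xs @ [u]"] by simp
    also have "\<dots> \<longleftrightarrow> a (xs @ t # u # ts) = 0" using alternatingD(1)[OF assms, of xs u t ts] by simp
    finally show ?thesis .
  qed simp
qed simp

lemma alternating_sort:
  assumes "alternating a"
  shows "a (xs @ sort ts) = 0 \<longleftrightarrow> a (xs @ ts) = 0"
proof (induction ts arbitrary: xs)
  case (Cons t ts)
  have "a (xs @ sort (t # ts)) = 0 \<longleftrightarrow> a ((xs @ [t]) @ sort ts) = 0"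
    using alternating_insort[OF assms, of xs t "sort ts"] by simp
  then show ?case using Cons[of "xs @ [t]"] by simp
qed simp

lemma sorted_not_distinct:
  "sorted ts \<Longrightarrow> \<not> distinct ts \<Longrightarrow> \<exists>xs t ys. ts = xs @ t # t # (ys :: nat list)"
proof (induction ts)
  case (Cons t ts)
  show ?case
  proof (cases "distinct ts")
    case True
    then obtain u us where ts: "ts = u # us" using Cons.prems by (cases ts) auto
    have "t \<in> set ts" using True Cons.prems by simp
    moreover have "\<forall>v\<in>set ts. u \<le> v" "t \<le> u" using Cons.prems(1) by (auto simp: ts)
    ultimately have "t = u" by fastforce
    then have "t # ts = [] @ t # t # us" by (simp add: ts)
    then show ?thesis by blast
  next
    case False
    with Cons obtain xs u ys where "ts = xs @ u # u # ys" by auto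
    then have "t # ts = (t # xs) @ u # u # ys" by simp
    then show ?thesis by blast
  qed
qed simp

lemma alternating_eqI:
  assumes "alternating a" "alternating b" "\<And>ts. sorted ts \<Longrightarrow> distinct ts \<Longrightarrow> a ts = b ts"
  shows "a ts = b ts"
proof -
  have alt: "alternating (\<lambda>ts. a ts - b ts)" by (rule alternating_diff[OF assms(1,2)])
  have "a (sort ts) - b (sort ts) = 0"
  proof (cases "distinct (sort ts)")
    case False
    then obtain xs t ys where "sort ts = xs @ t # t # ys" using sorted_not_distinct[OF sorted_sort] by blast
    then show ?thesis using alternatingD(2)[OF alt] by simp
  qed (use assms(3) sorted_sort in auto)
  then have "a ts - b ts = 0" using alternating_sort[OF alt, of "[]" ts] by simp
  then show ?thesis by simp
qed

lemma list_sign_sorted: "sorted ts \<Longrightarrow> distinct ts \<Longrightarrow> list_sign ts = 1"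
proof (induction ts)
  case (Cons t ts)
  then have e: "{s. s \<in> set ts \<and> s < t} = {}" by auto
  from Cons show ?case by (simp add: pos_sign_def e)
qed simp

text \<open>The coefficient of \<open>\<lambda> ^ e\<close> in the transpose of multiplying every
  factor by \<open>1 + \<lambda> x\<close>: exactly \<open>e\<close> entries are lowered by one, and
  an entry 0 cannot be lowered. No sorting is involved, so collisions are left to
  alternation.\<close>

primrec down_shift :: "nat list \<Rightarrow> nat \<Rightarrow> (nat list \<Rightarrow> 'r::comm_ring_1) \<Rightarrow> 'r" where
  "down_shift [] e a = (if e = 0 then a [] else 0)"
| "down_shift (t # ts) e a = down_shift ts e (\<lambda>us. a (t # us))
     + (if e > 0 \<and> t > 0 then down_shift ts (e - 1) (\<lambda>us. a ((t - 1) # us)) else 0)"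

lemma down_shift_add: "down_shift ts e (\<lambda>us. a us + b us) = down_shift ts e a + down_shift ts e b"
  by (induction ts arbitrary: e a b) (simp_all add: algebra_simps)

lemma down_shift_scale: "down_shift ts e (\<lambda>us. c * a us) = c * down_shift ts e a"
  by (induction ts arbitrary: e a) (simp_all add: algebra_simps)

lemma down_shift_0 [simp]: "down_shift ts e (\<lambda>us. 0) = 0"
  by (induction ts arbitrary: e) simp_all

lemma down_shift_uminus: "down_shift ts e (\<lambda>us. - a us) = - down_shift ts e a"
  using down_shift_scale[of ts e "- 1" a] by simp

lemma down_shift_sum: "down_shift ts e (\<lambda>us. \<Sum>i\<in>I. a i us) = (\<Sum>i\<in>I. down_shift ts e (a i))"
  by (induction I rule: infinite_finite_induct) (simp_all add: down_shift_add)

lemma alternating_Cons: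
  assumes "alternating a"
  shows "alternating (\<lambda>us. a (x # us))"
  unfolding alternating_def
proof (intro conjI allI)
  fix xs ys :: "nat list" and s t
  show "a (x # xs @ s # t # ys) = - a (x # xs @ t # s # ys)"
    using alternatingD(1)[OF assms, of "x # xs" s t ys] by (simp only: append_Cons)
  show "a (x # xs @ t # t # ys) = 0"
    using alternatingD(2)[OF assms, of "x # xs" t ys] by (simp only: append_Cons)
qed

text \<open>For adjacent entries the four ways of lowering none, one or both of them correspond
  under the swap, and alternation of \<open>a\<close> supplies the sign.\<close>

lemma alternating_down_shift:
  fixes a :: "nat list \<Rightarrow> 'r::comm_ring_1"
  assumes "alternating a"
  shows "alternating (\<lambda>ts. down_shift ts e a)"
proof -
  have swap: "a (s # t # us) = - a (t # s # us)" and eq: "a (t # t # us) = 0"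
    if "alternating a" for a :: "nat list \<Rightarrow> 'r" and s t us
    using alternatingD(1)[OF that, of "[]" s t us] alternatingD(2)[OF that, of "[]" t us] by (simp_all only: append_Nil)
  have "down_shift (xs @ s # t # ys) e a = - down_shift (xs @ t # s # ys) e a" if "alternating a"
    for xs s t ys e and a :: "nat list \<Rightarrow> 'r"
    using that
  proof (induction xs arbitrary: e a)
    case Nil
    note sw = swap[OF Nil, of s t] swap[OF Nil, of "s - Suc 0" t] swap[OF Nil, of s "t - Suc 0"]
      swap[OF Nil, of "s - Suc 0" "t - Suc 0"] swap[OF Nil, of "s - Suc 0" 0] swap[OF Nil, of 0 "t - Suc 0"]
    show ?case
      by (simp add: sw down_shift_uminus)
  next
    case (Cons x xs)
    show ?case using Cons.IH[OF alternating_Cons[OF Cons.prems]] by simp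
  qed
  moreover have "down_shift (xs @ t # t # ys) e a = 0" if "alternating a"
    for xs t ys e and a :: "nat list \<Rightarrow> 'r"
    using that
  proof (induction xs arbitrary: e a)
    case Nil
    show ?case by (simp add: eq[OF Nil] swap[OF Nil, of "t - Suc 0" t] down_shift_uminus)
  next
    case (Cons x xs)
    show ?case using Cons.IH[OF alternating_Cons[OF Cons.prems]] by simp
  qed
  ultimately show ?thesis using assms unfolding alternating_def by blast
qed

definition list_contract :: "nat \<Rightarrow> nat \<Rightarrow> (nat list \<Rightarrow> 'a::field bipoly) \<Rightarrow> nat list \<Rightarrow> 'a bipoly" where
  "list_contract m i a ts = (\<Sum>t<m. yvar (i + t) * a (t # ts))"

lemma alt_fun_contract: "alt_fun (contract m i w) = list_contract m i (alt_fun w)"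
proof
  fix ts
  show "alt_fun (contract m i w) ts = list_contract m i (alt_fun w) ts"
  proof (cases "distinct ts")
    case True
    have "alt_fun (contract m i w) ts
      = (\<Sum>t\<in>{0..<m} - set ts. yvar (i + t) * alt_fun w (t # ts))"
      using True by (simp add: alt_fun_def kdiff_def sum_distrib_left mult_ac)
    also have "\<dots> = (\<Sum>t<m. yvar (i + t) * alt_fun w (t # ts))"
      by (rule sum.mono_neutral_left) (auto simp: alt_fun_def)
    finally show ?thesis by (simp add: list_contract_def)
  qed (simp add: alt_fun_def list_contract_def)
qed

definition list_contracts :: "nat \<Rightarrow> nat list \<Rightarrow> (nat list \<Rightarrow> 'a::field bipoly) \<Rightarrow> nat list \<Rightarrow> 'a bipoly" where
  "list_contracts m is a = foldr (list_contract m) is a"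

lemma list_contracts_Nil [simp]: "list_contracts m [] a = a"
  and list_contracts_Cons: "list_contracts m (i # is) a = list_contract m i (list_contracts m is a)"
  by (simp_all add: list_contracts_def)

lemma alt_fun_contract_list: "alt_fun (contract_list m is w) = list_contracts m is (alt_fun w)"
  by (induction "is") (simp_all add: contract_list_Cons list_contracts_Cons alt_fun_contract)

lemma list_contracts_repeat:
  assumes "i \<in> set is"
  shows "list_contract m i (list_contracts m is (alt_fun w)) = (\<lambda>ts. 0)"
proof -
  have "list_contract m i (list_contracts m is (alt_fun w)) = alt_fun (contract m i (contract_list m is w))"
    by (simp only: alt_fun_contract alt_fun_contract_list)
  also have "\<dots> = (\<lambda>ts. 0)" by (simp add: alt_fun_def contract_contract_list_in[OF assms] fun_eq_iff)
  finally show ?thesis .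
qed

text \<open>Indices stay at most \<open>m - 2\<close>, one less than the range of the contractions,
  which leaves room for raising an index once.\<close>

definition bounded_below :: "nat \<Rightarrow> (nat list \<Rightarrow> 'r::zero) \<Rightarrow> bool" where
  "bounded_below m a \<longleftrightarrow> (\<forall>ts. \<forall>t\<in>set ts. Suc t \<ge> m \<longrightarrow> a ts = 0)"

lemma bounded_below_contracts: "bounded_below m a \<Longrightarrow> bounded_below m (list_contracts m is a)"
  by (induction "is") (auto simp: list_contracts_Cons list_contract_def bounded_below_def)

text \<open>This is the Hankel property: substituting \<open>t + 1\<close> for a lowered index turns
  \<open>yvar (i + t)\<close> into the entry of column \<open>i + 1\<close>. The summand at the
  upper end that the new range adds vanishes by \<open>bounded_below\<close>.\<close>

lemma list_contract_down_shift:
  assumes "bounded_below m a"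
  shows "list_contract m i (\<lambda>ts. down_shift ts e a) ts
    = down_shift ts e (list_contract m i a) + (if e > 0 then down_shift ts (e - 1) (list_contract m (Suc i) a) else 0)"
proof -
  have a0: "a (t # us) = 0" if "Suc t \<ge> m" for t us
    using assms that by (auto simp: bounded_below_def)
  have 1: "(\<Sum>t<m. yvar (i + t) * down_shift ts e' (\<lambda>us. a (t # us))) = down_shift ts e' (list_contract m i a)" for e' i
    by (simp add: list_contract_def[abs_def] down_shift_sum down_shift_scale)
  have 2: "(\<Sum>t<m. yvar (i + t) * (if t > 0 then down_shift ts (e - 1) (\<lambda>us. a ((t - 1) # us)) else 0))
    = (\<Sum>t<m. yvar (Suc i + t) * down_shift ts (e - 1) (\<lambda>us. a (t # us)))"
  proof (cases m)
    case (Suc m')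
    have "(\<Sum>t<Suc m'. yvar (i + t) * (if t > 0 then down_shift ts (e - 1) (\<lambda>us. a ((t - 1) # us)) else 0))
      = (\<Sum>t<m'. yvar (Suc i + t) * down_shift ts (e - 1) (\<lambda>us. a (t # us)))"
      by (simp add: sum.lessThan_Suc_shift del: sum.lessThan_Suc)
    also have "\<dots> = (\<Sum>t<Suc m'. yvar (Suc i + t) * down_shift ts (e - 1) (\<lambda>us. a (t # us)))"
      by (simp add: a0 Suc)
    finally show ?thesis by (simp only: Suc)
  qed simp
  have "list_contract m i (\<lambda>ts. down_shift ts e a) ts
    = (\<Sum>t<m. yvar (i + t) * down_shift ts e (\<lambda>us. a (t # us)))
      + (if e > 0 then \<Sum>t<m. yvar (i + t) * (if t > 0 then down_shift ts (e - 1) (\<lambda>us. a ((t - 1) # us)) else 0) else 0)"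
    by (auto simp: list_contract_def distrib_left sum.distrib intro!: sum.cong)
  then show ?thesis by (simp only: 1 2)
qed

definition cols_without :: "nat \<Rightarrow> nat \<Rightarrow> nat \<Rightarrow> nat list" where
  "cols_without k j i = [j..<i] @ [Suc i..<Suc k]"

text \<open>
  Modulo products with a repeated factor, \<open>(i\<^sub>j + \<lambda> i\<^bsub>j+1\<^esub>) \<cdots> (i\<^bsub>k-1\<^esub> + \<lambda> i\<^sub>k)\<close> is the sum of
  \<open>\<lambda>\<^sup>e\<close> times the product of all of \<open>i\<^sub>j, ..., i\<^sub>k\<close> except \<open>i\<^bsub>k-e\<^esub>\<close>.
\<close>

lemma list_contracts_down_shift:
  assumes b: "bounded_below m (alt_fun w)" and "j \<le> k"
  shows "list_contracts m [j..<k] (\<lambda>ts. down_shift ts e (alt_fun w)) ts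
    = (\<Sum>i\<in>{j..k}. if k - i \<le> e then down_shift ts (e - (k - i)) (list_contracts m (cols_without k j i) (alt_fun w)) else 0)"
  using assms(2)
proof (induction j arbitrary: ts rule: inc_induct)
  case base
  show ?case by (simp add: cols_without_def)
next
  case (step j)
  let ?X = "\<lambda>j i. list_contracts m (cols_without k j i) (alt_fun w)"
  let ?f = "\<lambda>j i e ts. if k - i \<le> e then down_shift ts (e - (k - i)) (?X j i) else 0"
  have bX: "bounded_below m (?X j i)" for j i by (rule bounded_below_contracts[OF b])
  have lin: "list_contract m i (\<lambda>ts. \<Sum>x\<in>A. g x ts) ts = (\<Sum>x\<in>A. list_contract m i (g x) ts)" for i A ts and g :: "nat \<Rightarrow> nat list \<Rightarrow> 'a bipoly"
    by (simp add: list_contract_def sum_distrib_left sum.swap[of _ A])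
  have X_low: "list_contract m j (?X (Suc j) i) = ?X j i" if "i \<in> {Suc j..k}" for i
    using that by (simp add: cols_without_def upt_rec[of j] list_contracts_Cons)
  have X_top: "list_contract m (Suc j) (?X (Suc j) (Suc j)) = ?X j j"
  proof -
    have "cols_without k j j = Suc j # cols_without k (Suc j) (Suc j)"
      using step by (simp add: cols_without_def upt_rec[of "Suc j"])
    then show ?thesis by (simp add: list_contracts_Cons)
  qed
  \<comment> \<open>Column \<open>j + 1\<close> is already present unless it is the omitted one, so
    the shifted factor contributes for one value of \<open>i\<close> only.\<close>
  have X_mid: "list_contract m (Suc j) (?X (Suc j) i) = (\<lambda>ts. 0)" if "i \<in> {Suc j..k}" "i \<noteq> Suc j" for i
    using that by (intro list_contracts_repeat) (auto simp: cols_without_def)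
  have summand: "list_contract m j (?f (Suc j) i e) ts
      = ?f j i e ts + (if i = Suc j \<and> k - j \<le> e then down_shift ts (e - (k - j)) (?X j j) else 0)"
    if i: "i \<in> {Suc j..k}" for i
  proof (cases "k - i \<le> e")
    case True
    have "list_contract m j (?f (Suc j) i e) ts
      = down_shift ts (e - (k - i)) (?X j i) + (if e - (k - i) > 0 then down_shift ts (e - (k - i) - 1) (list_contract m (Suc j) (?X (Suc j) i)) else 0)"
      using True by (simp add: list_contract_down_shift[OF bX] X_low[OF i])
    also have "(if e - (k - i) > 0 then down_shift ts (e - (k - i) - 1) (list_contract m (Suc j) (?X (Suc j) i)) else 0)
      = (if i = Suc j \<and> k - j \<le> e then down_shift ts (e - (k - j)) (?X j j) else 0)"
    proof (cases "i = Suc j")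
      case True
      then have "e - (k - i) > 0 \<longleftrightarrow> k - j \<le> e" "e - (k - i) - 1 = e - (k - j)" using i by auto
      with True show ?thesis by (simp add: X_top)
    qed (simp add: X_mid[OF i])
    finally show ?thesis using True by simp
  next
    case False
    then show ?thesis using i by (auto simp: list_contract_def)
  qed
  have "list_contracts m [j..<k] (\<lambda>ts. down_shift ts e (alt_fun w)) ts
    = list_contract m j (list_contracts m [Suc j..<k] (\<lambda>ts. down_shift ts e (alt_fun w))) ts"
    using step by (simp add: upt_rec[of j] list_contracts_Cons)
  also have "\<dots> = (\<Sum>i\<in>{Suc j..k}. list_contract m j (?f (Suc j) i e) ts)"
    unfolding step.IH lin ..
  also have "\<dots> = (\<Sum>i\<in>{Suc j..k}. ?f j i e ts + (if i = Suc j then (if k - j \<le> e then down_shift ts (e - (k - j)) (?X j j) else 0) else 0))"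
    by (rule sum.cong[OF refl]) (subst summand, simp_all)
  also have "\<dots> = (\<Sum>i\<in>{Suc j..k}. ?f j i e ts) + (\<Sum>i\<in>{Suc j..k}. if i = Suc j then (if k - j \<le> e then down_shift ts (e - (k - j)) (?X j j) else 0) else 0)"
    by (rule sum.distrib)
  also have "\<dots> = (\<Sum>i\<in>{Suc j..k}. ?f j i e ts) + ?f j j e ts"
    using step by simp
  also have "\<dots> = (\<Sum>i\<in>{j..k}. ?f j i e ts)"
    using step by (simp add: sum.atLeast_Suc_atMost[of j k] add.commute)
  finally show ?case .
qed

text \<open>On the empty list nothing can be lowered, so the only summand that survives is the one
  in which no shift is left over.\<close>

corollary list_contracts_down_shift_Nil:
  assumes "bounded_below m (alt_fun w)" and "i \<le> k"
  shows "list_contracts m [0..<k] (\<lambda>ts. down_shift ts (k - i) (alt_fun w)) []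
    = list_contracts m (cols_without k 0 i) (alt_fun w) []"
proof -
  have "(\<Sum>l\<in>{0..k}. if k - l \<le> k - i then down_shift [] (k - i - (k - l)) (list_contracts m (cols_without k 0 l) (alt_fun w)) else 0)
    = (\<Sum>l\<in>{0..k}. if l = i then list_contracts m (cols_without k 0 i) (alt_fun w) [] else 0)"
    using assms(2) by (intro sum.cong) auto
  with assms show ?thesis by (simp add: list_contracts_down_shift)
qed

lemma sorted_list_cols_without: "i \<le> k \<Longrightarrow> sorted_list_of_set ({0..k} - {i}) = cols_without k 0 i"
proof -
  assume i: "i \<le> k"
  have "sorted (cols_without k 0 i)" "distinct (cols_without k 0 i)"
    by (auto simp: cols_without_def sorted_append)
  moreover have "set (cols_without k 0 i) = {0..k} - {i}" using i by (auto simp: cols_without_def)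
  ultimately show ?thesis
    by (metis sorted_distinct_set_unique sorted_list_of_set.distinct_sorted_key_list_of_set
        sorted_list_of_set.set_sorted_key_list_of_set sorted_list_of_set.sorted_sorted_key_list_of_set finite_set)
qed

section \<open>The operators \<open>z_i\<close> in coordinates\<close>

lemma permutes_mono_id:
  assumes p: "p permutes {0..<k}" and mono: "\<And>i j. i < j \<Longrightarrow> j < k \<Longrightarrow> p i < p j" and "j < k"
  shows "p j = (j :: nat)"
proof -
  have "sorted_wrt (<) (map p [0..<k])"
    by (auto simp: sorted_wrt_iff_nth_less intro: mono)
  moreover have "set (map p [0..<k]) = set [0..<k]"
    using permutes_image[OF p] by simp
  ultimately have "map p [0..<k] = [0..<k]"
    by (intro sorted_distinct_set_unique) (auto simp: strict_sorted_iff)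
  with \<open>j < k\<close> show ?thesis by (metis add.left_neutral diff_zero length_upt nth_map nth_upt)
qed

text \<open>A permutation with nonzero product is increasing, since the elements of \<open>S\<close>
  are strictly sorted, and is thus the identity. Weak monotonicity is the right hypothesis: raising
  some entries of a strictly increasing list may create equalities.\<close>

lemma wedge_monom:
  assumes mono: "\<And>i j. i < j \<Longrightarrow> j < k \<Longrightarrow> u i \<le> u j" and S: "finite S" "card S = k"
  shows "wedge k (\<lambda>j. monom 1 (u j)) S = (if \<forall>j<k. u j = sorted_list_of_set S ! j then 1 else 0 :: 'a::field)"
proof -
  define ts where "ts = sorted_list_of_set S"
  have ts: "sorted_wrt (<) ts" "length ts = k" using S by (simp_all add: ts_def)
  define F :: "(nat \<Rightarrow> nat) \<Rightarrow> 'a" where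
    "F p = of_int (sign p) * (\<Prod>j<k. poly.coeff (monom 1 (u j)) (ts ! p j))" for p
  have F: "F p = (if p = id \<and> (\<forall>j<k. u j = ts ! j) then 1 else 0)" if p: "p permutes {0..<k}" for p
  proof (cases "\<forall>j<k. u j = ts ! p j")
    case True
    have mono': "p i < p j" if "i < j" "j < k" for i j
    proof (rule ccontr)
      assume "\<not> p i < p j"
      moreover have "p i \<noteq> p j" using permutes_inj[OF p] that(1) by (auto simp: inj_def)
      ultimately have "p j < p i" by simp
      moreover have "p i < k" using permutes_in_image[OF p, of i] that by simp
      ultimately have "ts ! p j < ts ! p i" using ts by (simp add: sorted_wrt_iff_nth_less)
      with True mono[OF that] that show False by auto
    qed
    have "p j = j" for j
    proof (cases "j < k")
      case True
      with p mono' show ?thesis by (rule permutes_mono_id)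
    qed (simp add: permutes_not_in[OF p])
    then have "p = id" by auto
    with True show ?thesis by (simp add: F_def)
  next
    case False
    then obtain j where "j < k" "u j \<noteq> ts ! p j" by blast
    then have "F p = 0" by (auto simp: F_def intro!: prod_zero)
    with False show ?thesis by auto
  qed
  have "wedge k (\<lambda>j. monom 1 (u j)) S = (\<Sum>p | p permutes {0..<k}. F p)"
    using S by (simp add: wedge_def F_def ts_def)
  also have "\<dots> = (\<Sum>p | p permutes {0..<k}. if p = id then (if \<forall>j<k. u j = ts ! j then 1 else 0) else 0)"
    using F by (intro sum.cong) auto
  also have "\<dots> = (if \<forall>j<k. u j = ts ! j then 1 else 0)"
    using finite_permutations[of "{0..<k}"] by (simp add: sum.delta permutes_id[unfolded id_def] id_def[symmetric])
  finally show ?thesis by (simp add: ts_def)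
qed

definition decrease :: "nat list \<Rightarrow> nat set \<Rightarrow> nat list" where
  "decrease ts J = map (\<lambda>j. if j \<in> J then ts ! j - 1 else ts ! j) [0..<length ts]"

lemma length_decrease [simp]: "length (decrease ts J) = length ts"
  by (simp add: decrease_def)

lemma nth_decrease: "j < length ts \<Longrightarrow> decrease ts J ! j = (if j \<in> J then ts ! j - 1 else ts ! j)"
  by (simp add: decrease_def)

lemma decrease_Cons:
  "decrease (t # ts) (Suc ` J) = t # decrease ts J"
  "decrease (t # ts) (insert 0 (Suc ` J)) = (t - 1) # decrease ts J"
  by (auto simp: decrease_def upt_conv_Cons simp flip: map_Suc_upt simp del: upt_Suc)

lemma down_shift_eq_sum:
  "down_shift ts e a = (\<Sum>J | J \<subseteq> {0..<length ts} \<and> card J = e \<and> (\<forall>j\<in>J. ts ! j > 0). a (decrease ts J))"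
proof (induction ts arbitrary: e a)
  case Nil
  have "{J. J = {} \<and> card J = e} = (if e = 0 then {{}} else {})" by auto
  then show ?case by (simp add: decrease_def cong: conj_cong)
next
  case (Cons t ts)
  define P where "P ts e = {J. J \<subseteq> {0..<length ts} \<and> card J = e \<and> (\<forall>j\<in>J. ts ! j > 0)}" for ts :: "nat list" and e
  have fin: "finite (P ts e)" for ts e by (rule finite_subset[of _ "Pow {0..<length ts}"]) (auto simp: P_def)
  have pre: "finite J" if "J \<in> P ts e" for J ts e using that finite_subset by (auto simp: P_def)
  have dec: "{j. Suc j \<in> insert 0 (Suc ` J)} = J" "{j. Suc j \<in> Suc ` J} = J" for J by auto
  have rem0: "Suc ` {j. Suc j \<in> J} = J" if "0 \<notin> J" for J :: "nat set"
    using that by (auto simp: image_iff) (metis not0_implies_Suc)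
  have rem1: "insert 0 (Suc ` {j. Suc j \<in> J}) = J" if "0 \<in> J" for J :: "nat set"
    using that by (auto simp: image_iff) (metis not0_implies_Suc)
  have mem0: "Suc ` J \<in> P (t # ts) e \<longleftrightarrow> J \<in> P ts e" for J e
    by (auto simp: P_def card_image)
  have mem1: "insert 0 (Suc ` J) \<in> P (t # ts) e \<longleftrightarrow> t > 0 \<and> e > 0 \<and> J \<in> P ts (e - 1)" for J e
  proof (cases "finite J")
    case True
    then have "card (insert 0 (Suc ` J)) = Suc (card J)" by (simp add: card_image)
    then show ?thesis by (cases e) (auto simp: P_def)
  next
    case False
    then have "infinite (insert 0 (Suc ` J))" by (simp add: finite_image_iff)
    with False show ?thesis using pre[of "insert 0 (Suc ` J)" "t # ts" e] pre[of J ts "e - 1"] by auto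
  qed
  have "(\<Sum>J\<in>P (t # ts) e. a (decrease (t # ts) J))
    = (\<Sum>J\<in>{J \<in> P (t # ts) e. 0 \<notin> J}. a (decrease (t # ts) J)) + (\<Sum>J\<in>{J \<in> P (t # ts) e. 0 \<in> J}. a (decrease (t # ts) J))"
    using fin[of "t # ts" e] by (subst sum.union_disjoint[symmetric]) (auto intro!: sum.cong)
  also have "(\<Sum>J\<in>{J \<in> P (t # ts) e. 0 \<notin> J}. a (decrease (t # ts) J)) = (\<Sum>J\<in>P ts e. a (t # decrease ts J))"
  proof (rule sum.reindex_bij_witness[of _ "\<lambda>J. Suc ` J" "\<lambda>J. {j. Suc j \<in> J}"])
    fix J assume J: "J \<in> {J \<in> P (t # ts) e. 0 \<notin> J}"
    then have e: "Suc ` {j. Suc j \<in> J} = J" by (intro rem0) simp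
    then show "Suc ` {j. Suc j \<in> J} = J" .
    show "{j. Suc j \<in> J} \<in> P ts e" using J mem0[of "{j. Suc j \<in> J}" e] e by simp
    show "a (t # decrease ts {j. Suc j \<in> J}) = a (decrease (t # ts) J)"
      using decrease_Cons(1)[of t ts "{j. Suc j \<in> J}"] by (simp only: e)
  next
    fix J assume J: "J \<in> P ts e"
    show "{j. Suc j \<in> Suc ` J} = J" by (rule dec)
    show "Suc ` J \<in> {J \<in> P (t # ts) e. 0 \<notin> J}" using J by (simp add: mem0)
  qed
  also have "(\<Sum>J\<in>{J \<in> P (t # ts) e. 0 \<in> J}. a (decrease (t # ts) J))
    = (if e > 0 \<and> t > 0 then \<Sum>J\<in>P ts (e - 1). a ((t - 1) # decrease ts J) else 0)"
  proof (cases "e > 0 \<and> t > 0")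
    case True
    have "(\<Sum>J\<in>{J \<in> P (t # ts) e. 0 \<in> J}. a (decrease (t # ts) J)) = (\<Sum>J\<in>P ts (e - 1). a ((t - 1) # decrease ts J))"
    proof (rule sum.reindex_bij_witness[of _ "\<lambda>J. insert 0 (Suc ` J)" "\<lambda>J. {j. Suc j \<in> J}"])
      fix J assume J: "J \<in> {J \<in> P (t # ts) e. 0 \<in> J}"
      then have e: "insert 0 (Suc ` {j. Suc j \<in> J}) = J" by (intro rem1) simp
      then show "insert 0 (Suc ` {j. Suc j \<in> J}) = J" .
      show "{j. Suc j \<in> J} \<in> P ts (e - 1)" using J mem1[of "{j. Suc j \<in> J}" e] e by simp
      show "a ((t - 1) # decrease ts {j. Suc j \<in> J}) = a (decrease (t # ts) J)"
        using decrease_Cons(2)[of t ts "{j. Suc j \<in> J}"] by (simp only: e)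
    next
      fix J assume J: "J \<in> P ts (e - 1)"
      show "{j. Suc j \<in> insert 0 (Suc ` J)} = J" by (rule dec)
      show "insert 0 (Suc ` J) \<in> {J \<in> P (t # ts) e. 0 \<in> J}" using J True by (simp add: mem1)
    qed
    with True show ?thesis by simp
  next
    case False
    have "J \<notin> P (t # ts) e" if "0 \<in> J" for J
      using mem1[of "{j. Suc j \<in> J}" e] rem1[OF that] False by auto
    then have empty: "{J \<in> P (t # ts) e. 0 \<in> J} = {}" by blast
    show ?thesis unfolding empty using False by auto
  qed
  finally show ?case by (simp add: Cons P_def)
qed

lemma sorted_decrease:
  assumes "sorted ts" "distinct ts"
  shows "sorted (decrease ts J)"
proof -
  have "decrease ts J ! i \<le> decrease ts J ! j" if "i < j" "j < length ts" for i j
  proof -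
    have "ts ! i < ts ! j" using assms that by (metis sorted_wrt_nth_less strict_sorted_iff)
    then show ?thesis using that by (cases "i \<in> J"; cases "j \<in> J") (auto simp: nth_decrease)
  qed
  then show ?thesis by (simp add: sorted_iff_nth_mono_less)
qed

lemma tensor_factor_monom: "tensor_factor J j * monom 1 a = (monom 1 (if j \<in> J then Suc a else a) :: 'a::field poly)"
  by (simp add: tensor_factor_def mult_monom)

lemma wedge_eq_0: "\<not> (finite S \<and> card S = k) \<Longrightarrow> wedge k v S = 0"
  by (auto simp: wedge_def)

lemma supp_on_finite: "supp_on d k w \<Longrightarrow> finite {T. w T \<noteq> 0}"
  by (rule finite_subset[of _ "Pow {0..<d}"]) (auto simp: supp_on_def)

text \<open>The coefficient of \<open>e_S\<close> counts the ways to obtain \<open>S\<close> from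
  some \<open>T\<close> by raising \<open>k - i\<close> positions; read backwards, these positions
  are lowered in the list of \<open>S\<close>. The sign is that of
  \<open>coord_tensor\<close>.\<close>

lemma tensor_act_sorted:
  fixes w :: "nat set \<Rightarrow> 'a::field"
  assumes w: "supp_on d k w" and i: "i \<le> k" and ts: "sorted ts" "distinct ts" "length ts = k"
  shows "tensor_act k (coord_tensor k i) w (set ts) = (- 1) ^ (k - i) * down_shift ts (k - i) (alt_fun w)"
proof -
  define PJ where "PJ = {J. J \<subseteq> {0..<k} \<and> card J = k - i}"
  have finPJ: "finite PJ" by (rule finite_subset[of _ "Pow {0..<k}"]) (auto simp: PJ_def)
  \<comment> \<open>Raising the positions \<open>J\<close> in the sorted list of \<open>T\<close>
    produces \<open>ts\<close>.\<close>
  define E where "E T J \<longleftrightarrow> (\<forall>j<k. (if j \<in> J then Suc (sorted_list_of_set T ! j) else sorted_list_of_set T ! j) = ts ! j)" for T J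
  have sl: "sorted_list_of_set (set ts) = ts" using ts by (simp add: sorted_list_of_set.idem_if_sorted_distinct)
  have card: "card (set ts) = k" using ts by (simp add: distinct_card)
  have T: "finite T" "card T = k" "length (sorted_list_of_set T) = k" "sorted_wrt (<) (sorted_list_of_set T)"
    if "w T \<noteq> 0" for T
    using that w finite_subset[of T "{0..<d}"] by (auto simp: supp_on_def)
  have wedge: "wedge k (\<lambda>j. tensor_factor J j * monom 1 (sorted_list_of_set T ! j)) (set ts) = (if E T J then 1 else 0 :: 'a)"
    if "w T \<noteq> 0" for T J
  proof -
    define u where "u j = (if j \<in> J then Suc (sorted_list_of_set T ! j) else sorted_list_of_set T ! j)" for j
    have "u i \<le> u j" if "i < j" "j < k" for i j
      using sorted_wrt_nth_less[OF T(4)[OF \<open>w T \<noteq> 0\<close>], of i j] T(3)[OF \<open>w T \<noteq> 0\<close>] that by (auto simp: u_def)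
    then show ?thesis
      using wedge_monom[of k u "set ts", where 'a = 'a] by (simp add: tensor_factor_monom E_def u_def sl card)
  qed
  have inner: "(\<Sum>T | w T \<noteq> 0. if E T J then w T else 0) = (if \<forall>j\<in>J. ts ! j > 0 then alt_fun w (decrease ts J) else 0)"
    if J: "J \<in> PJ" for J
  proof -
    have E: "E T J \<longleftrightarrow> (\<forall>j\<in>J. ts ! j > 0) \<and> sorted_list_of_set T = decrease ts J" if "w T \<noteq> 0" for T
    proof
      assume e: "E T J"
      have "ts ! j > 0" if "j \<in> J" for j
      proof -
        have "j < k" using J that by (auto simp: PJ_def)
        with e that have "Suc (sorted_list_of_set T ! j) = ts ! j" by (auto simp: E_def)
        then show ?thesis by linarith
      qed
      moreover have "sorted_list_of_set T ! j = decrease ts J ! j" if "j < k" for j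
        using e that ts(3) by (auto simp: E_def nth_decrease)
      then have "sorted_list_of_set T = decrease ts J"
        using T(3)[OF \<open>w T \<noteq> 0\<close>] ts(3) by (intro nth_equalityI) auto
      ultimately show "(\<forall>j\<in>J. ts ! j > 0) \<and> sorted_list_of_set T = decrease ts J" by blast
    next
      assume "(\<forall>j\<in>J. ts ! j > 0) \<and> sorted_list_of_set T = decrease ts J"
      then show "E T J" using ts(3) by (auto simp: E_def nth_decrease)
    qed
    show ?thesis
    proof (cases "(\<forall>j\<in>J. ts ! j > 0) \<and> distinct (decrease ts J)")
      case True
      let ?us = "decrease ts J"
      have us: "sorted ?us" "distinct ?us" using sorted_decrease[OF ts(1,2)] True by auto
      then have sl': "sorted_list_of_set (set ?us) = ?us" by (simp add: sorted_list_of_set.idem_if_sorted_distinct)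
      have "E T J \<longleftrightarrow> T = set ?us" if "w T \<noteq> 0" for T
        unfolding E[OF that] using True sl' T(1)[OF that] by (metis sorted_list_of_set.set_sorted_key_list_of_set)
      then have "(\<Sum>T | w T \<noteq> 0. if E T J then w T else 0) = (\<Sum>T | w T \<noteq> 0. if T = set ?us then w T else 0)"
        by (intro sum.cong) auto
      also have "\<dots> = w (set ?us)" using supp_on_finite[OF w] by simp
      also have "\<dots> = alt_fun w ?us" using us by (simp add: alt_fun_def list_sign_sorted)
      finally show ?thesis using True by simp
    next
      case False
      \<comment> \<open>A lowering that is impossible or creates a repeated entry comes from no
        \<open>T\<close>, and a repeated entry makes \<open>alt_fun\<close> vanish as well.\<close>
      have "\<not> E T J" if "w T \<noteq> 0" for T
        unfolding E[OF that] using False sorted_list_of_set.distinct_sorted_key_list_of_set[of T] by metis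
      then have "(\<Sum>T | w T \<noteq> 0. if E T J then w T else 0) = 0" by (intro sum.neutral) auto
      with False show ?thesis by (auto simp: alt_fun_def)
    qed
  qed
  have "tensor_act k (coord_tensor k i) w (set ts)
    = (\<Sum>T | w T \<noteq> 0. \<Sum>J\<in>PJ. (- 1) ^ (k - i) * (if E T J then w T else 0))"
    unfolding tensor_act_def
  proof (rule sum.cong[OF refl])
    fix T assume "T \<in> {T. w T \<noteq> 0}"
    then have wT: "w T \<noteq> 0" by simp
    have "(\<Sum>J\<in>Pow {0..<k}. w T * coord_tensor k i J * wedge k (\<lambda>j. tensor_factor J j * monom 1 (sorted_list_of_set T ! j)) (set ts))
      = (\<Sum>J\<in>PJ. w T * coord_tensor k i J * wedge k (\<lambda>j. tensor_factor J j * monom 1 (sorted_list_of_set T ! j)) (set ts))"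
      by (rule sum.mono_neutral_right) (auto simp: PJ_def coord_tensor_def)
    also have "\<dots> = (\<Sum>J\<in>PJ. (- 1) ^ (k - i) * (if E T J then w T else 0))"
      by (intro sum.cong refl) (simp add: wedge[OF wT] PJ_def coord_tensor_def)
    finally show "(\<Sum>J\<in>Pow {0..<k}. w T * coord_tensor k i J * wedge k (\<lambda>j. tensor_factor J j * monom 1 (sorted_list_of_set T ! j)) (set ts))
      = (\<Sum>J\<in>PJ. (- 1) ^ (k - i) * (if E T J then w T else 0))" .
  qed
  also have "\<dots> = (- 1) ^ (k - i) * (\<Sum>J\<in>PJ. \<Sum>T | w T \<noteq> 0. if E T J then w T else 0)"
    by (subst sum.swap) (simp add: sum_distrib_left)
  also have "(\<Sum>J\<in>PJ. \<Sum>T | w T \<noteq> 0. if E T J then w T else 0)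
    = (\<Sum>J\<in>PJ. if \<forall>j\<in>J. ts ! j > 0 then alt_fun w (decrease ts J) else 0)"
    by (intro sum.cong refl inner)
  also have "\<dots> = (\<Sum>J | J \<in> PJ \<and> (\<forall>j\<in>J. ts ! j > 0). alt_fun w (decrease ts J))"
    using finPJ by (simp add: sum.inter_filter)
  also have "\<dots> = down_shift ts (k - i) (alt_fun w)"
    unfolding down_shift_eq_sum by (simp add: PJ_def ts(3) conj_assoc)
  finally show ?thesis .
qed

lemma tensor_act_eq_0: "\<not> (finite S \<and> card S = k) \<Longrightarrow> tensor_act k t w S = 0"
  by (simp add: tensor_act_def wedge_eq_0)

lemma alt_fun_length:
  assumes "supp_on d k w" "alt_fun w ts \<noteq> 0"
  shows "length ts = k" "set ts \<subseteq> {0..<d}"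
proof -
  have ts: "distinct ts" "w (set ts) \<noteq> 0" using assms(2) by (auto simp: alt_fun_def split: if_splits)
  then have "set ts \<subseteq> {0..<d} \<and> card (set ts) = k" using assms(1) unfolding supp_on_def by blast
  with ts(1) show "length ts = k" "set ts \<subseteq> {0..<d}" by (simp_all add: distinct_card)
qed

theorem alt_fun_tensor_act:
  assumes w: "supp_on d k w" and i: "i \<le> k"
  shows "alt_fun (tensor_act k (coord_tensor k i) w) ts = (- 1) ^ (k - i) * down_shift ts (k - i) (alt_fun w)"
proof (rule alternating_eqI)
  show "alternating (alt_fun (tensor_act k (coord_tensor k i) w))" by (rule alternating_alt_fun)
  show "alternating (\<lambda>ts. (- 1) ^ (k - i) * down_shift ts (k - i) (alt_fun w))"
    by (intro alternating_scale alternating_down_shift alternating_alt_fun)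
  fix ts :: "nat list" assume ts: "sorted ts" "distinct ts"
  show "alt_fun (tensor_act k (coord_tensor k i) w) ts = (- 1) ^ (k - i) * down_shift ts (k - i) (alt_fun w)"
  proof (cases "length ts = k")
    case True
    with ts show ?thesis using tensor_act_sorted[OF w i ts True] by (simp add: alt_fun_def list_sign_sorted)
  next
    case False
    then have "tensor_act k (coord_tensor k i) w (set ts) = 0"
      using ts(2) by (intro tensor_act_eq_0) (simp add: distinct_card)
    moreover have "alt_fun w (decrease ts J) = 0" for J
      using alt_fun_length(1)[OF w, of "decrease ts J"] False by auto
    ultimately show ?thesis by (simp add: down_shift_eq_sum alt_fun_def[of "tensor_act k (coord_tensor k i) w"])
  qed
qed

lemma supp_on_tensor_act:
  assumes w: "supp_on d k w" and i: "i \<le> k"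
  shows "supp_on (Suc d) k (tensor_act k (coord_tensor k i) w)"
  unfolding supp_on_def
proof (intro allI impI)
  fix S assume nz: "tensor_act k (coord_tensor k i) w S \<noteq> 0"
  then have S: "finite S" "card S = k" using tensor_act_eq_0 by blast+
  define ts where "ts = sorted_list_of_set S"
  have ts: "sorted ts" "distinct ts" "length ts = k" "set ts = S" using S by (simp_all add: ts_def)
  have "down_shift ts (k - i) (alt_fun w) \<noteq> 0"
    using nz tensor_act_sorted[OF w i ts(1-3)] ts(4) by auto
  then have "\<exists>J. alt_fun w (decrease ts J) \<noteq> 0"
    by (rule contrapos_np) (simp add: down_shift_eq_sum)
  then obtain J where "alt_fun w (decrease ts J) \<noteq> 0" by blast
  then have dec: "set (decrease ts J) \<subseteq> {0..<d}" by (rule alt_fun_length(2)[OF w])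
  have "t < Suc d" if "t \<in> S" for t
  proof -
    have "t \<in> set ts" using that ts(4) by simp
    then obtain j where j: "j < k" "t = ts ! j" using ts(3) by (auto simp: in_set_conv_nth)
    have "decrease ts J ! j \<in> set (decrease ts J)" using j ts(3) by (intro nth_mem) simp
    with dec have "decrease ts J ! j < d" by auto
    then show ?thesis using j(1) ts(3) unfolding j(2) by (cases "j \<in> J") (simp_all add: nth_decrease)
  qed
  with S show "S \<subseteq> {0..<Suc d} \<and> card S = k" by auto
qed

lemma pos_sign_const: "pos_sign S t = (single 0 (pos_sign S t) :: 'a::field bipoly)"
  by (cases "even (card {s \<in> S. s < t})") (simp_all add: pos_sign_def single_uminus)

lemma list_sign_const: "list_sign ts = (single 0 (list_sign ts) :: 'a::field bipoly)"
proof (induction ts)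
  case (Cons t ts)
  then show ?case using pos_sign_const[of "set ts" t, where 'a = 'a] by (simp add: mult_single)
qed simp

lemma alt_fun_const_fun: "alt_fun (const_fun w) ts = single 0 (alt_fun w ts)"
  unfolding alt_fun_def using list_sign_const[of ts, where 'a = 'a] by (simp add: const_fun_def mult_single)

lemma down_shift_const: "down_shift ts e (\<lambda>us. single 0 (a us) :: 'a::field bipoly) = single 0 (down_shift ts e a)"
  by (induction ts arbitrary: e a) (simp_all add: single_add)

lemma list_contracts_scale: "list_contracts m is (\<lambda>ts. c * a ts) = (\<lambda>ts. c * list_contracts m is a ts)"
  by (induction "is") (simp_all add: list_contracts_Cons list_contract_def[abs_def] sum_distrib_left mult_ac)

text \<open>The minor of the Hankel matrix with the columns \<open>{0..k} - {i}\<close> and the rows prescribed by \<open>w\<close>.\<close>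

definition minor :: "nat \<Rightarrow> nat \<Rightarrow> (nat set \<Rightarrow> 'a::field) \<Rightarrow> nat \<Rightarrow> 'a bipoly" where
  "minor m k w i = contract_set m ({0..k} - {i}) (const_fun w) {}"

lemma minor_list_contracts:
  "i \<le> k \<Longrightarrow> minor m k w i = list_contracts m (cols_without k 0 i) (alt_fun (const_fun w)) []"
  unfolding minor_def contract_set_def sorted_list_cols_without
  by (simp flip: alt_fun_contract_list add: alt_fun_def)

text \<open>Shifting \<open>k - i\<close> of the indices against the columns
  \<open>0, ..., k-1\<close> moves columns up by one; without repetition this is possible only for
  the last \<open>k - i\<close> of them, and column \<open>i\<close> is left out. The sign is the
  normalization of \<open>coord_tensor\<close>.\<close>

theorem minor_tensor_act:
  assumes w: "supp_on d k w" and d: "d < m" and i: "i \<le> k"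
  shows "minor m k (tensor_act k (coord_tensor k i) w) k = (- 1) ^ (k - i) * minor m k w i"
proof -
  have sign: "single 0 ((- 1) ^ e * c) = (- 1) ^ e * (single 0 c :: 'a bipoly)" for e and c :: 'a
    by (cases "even e") (simp_all add: single_uminus)
  have "alt_fun (const_fun (tensor_act k (coord_tensor k i) w)) ts
    = (- 1) ^ (k - i) * down_shift ts (k - i) (alt_fun (const_fun w))" for ts
    by (simp add: alt_fun_const_fun alt_fun_tensor_act[OF w i] sign)
      (simp add: alt_fun_const_fun[abs_def] down_shift_const)
  then have *: "alt_fun (const_fun (tensor_act k (coord_tensor k i) w))
    = (\<lambda>ts. (- 1) ^ (k - i) * down_shift ts (k - i) (alt_fun (const_fun w)))" by blast
  have "alt_fun (const_fun w) ts = 0" if "t \<in> set ts" "Suc t \<ge> m" for t ts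
    using alt_fun_length(2)[OF w, of ts] that d by (cases "alt_fun w ts = 0") (auto simp: alt_fun_const_fun)
  then have b: "bounded_below m (alt_fun (const_fun w))" by (auto simp: bounded_below_def)
  show ?thesis
    unfolding minor_list_contracts[OF order_refl] minor_list_contracts[OF i] * list_contracts_scale
    using list_contracts_down_shift_Nil[OF b i] by (simp add: cols_without_def)
qed

section \<open>The chart \<open>z\<^sub>k \<noteq> 0\<close>\<close>

lemma zvar_power: "zvar i ^ e = (single (single i (int e), 0) 1 :: 'a::field bipoly)"
  by (induction e) (simp_all add: zvar_def mult_single flip: single_add zero_prod_def)

text \<open>Where \<open>z\<^sub>k\<close> is invertible, \<open>L\<^sub>j = 0\<close> can be solved for \<open>y\<^bsub>k+j\<^esub>\<close>.\<close>

function ysub :: "nat \<Rightarrow> nat \<Rightarrow> 'a::field bipoly" where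
  "ysub k t = (if t < k then yvar t else - (\<Sum>l<k. zvar l * zinv k * ysub k (t - k + l)))"
  by pat_completeness auto
termination by (relation "measure snd") auto

declare ysub.simps [simp del]

definition ysub_prod :: "nat \<Rightarrow> (nat \<Rightarrow>\<^sub>0 nat) \<Rightarrow> 'a::field bipoly" where
  "ysub_prod k b = (\<Prod>i\<in>keys b. ysub k i ^ lookup b i)"

text \<open>A ring endomorphism that fixes the \<open>zvar\<close> and replaces each
  \<open>yvar t\<close> by its solution. Its kernel on the chart \<open>{k}\<close> will be the
  relation ideal.\<close>

definition chart_subst :: "nat \<Rightarrow> 'a::field bipoly \<Rightarrow> 'a bipoly" where
  "chart_subst k = lin_ext (\<lambda>(a, b). single (a, 0) 1 * ysub_prod k b)"

lemma ysub_prod_superset: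
  "finite A \<Longrightarrow> keys b \<subseteq> A \<Longrightarrow> ysub_prod k b = (\<Prod>i\<in>A. ysub k i ^ lookup b i)"
  unfolding ysub_prod_def by (intro prod.mono_neutral_left) (auto simp: in_keys_iff)

lemma ysub_prod_add: "ysub_prod k (b + d) = ysub_prod k b * ysub_prod k d"
proof -
  let ?A = "keys b \<union> keys d"
  have "keys (b + d) \<subseteq> ?A" by (rule Poly_Mapping.keys_add)
  then show ?thesis
    by (simp add: ysub_prod_superset[of ?A b] ysub_prod_superset[of ?A d] ysub_prod_superset[of ?A "b + d"]
        lookup_add power_add prod.distrib)
qed

lemma chart_subst_mult: "chart_subst k (f * g) = chart_subst k f * chart_subst k g"
  unfolding chart_subst_def
proof (rule lin_ext_mult)
  fix u v :: "(nat \<Rightarrow>\<^sub>0 int) \<times> (nat \<Rightarrow>\<^sub>0 nat)"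
  obtain a b c d where [simp]: "u = (a, b)" "v = (c, d)" by fastforce
  have "single (a + c, 0) (1 :: 'a) = single (a, 0 :: nat \<Rightarrow>\<^sub>0 nat) 1 * single (c, 0) 1"
    by (simp add: mult_single)
  then show "(case u + v of (a, b) \<Rightarrow> single (a, 0) (1 :: 'a) * ysub_prod k b)
    = (case u of (a, b) \<Rightarrow> single (a, 0) 1 * ysub_prod k b) * (case v of (a, b) \<Rightarrow> single (a, 0) 1 * ysub_prod k b)"
    by (simp add: ysub_prod_add mult_ac)
qed

lemma chart_subst_add: "chart_subst k (f + g) = chart_subst k f + chart_subst k g"
  and chart_subst_sum: "chart_subst k (\<Sum>x\<in>X. h x) = (\<Sum>x\<in>X. chart_subst k (h x))"
  by (simp_all add: chart_subst_def lin_ext_add lin_ext_sum)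

lemma chart_subst_zvar: "chart_subst k (zvar i) = zvar i"
  by (simp add: chart_subst_def zvar_def lin_ext_single ysub_prod_def flip: zero_prod_def)

lemma chart_subst_yvar: "chart_subst k (yvar t) = ysub k t"
  by (simp add: chart_subst_def yvar_def lin_ext_single ysub_prod_def flip: zero_prod_def)

lemma chart_subst_lin_form: "chart_subst k (lin_form k j) = 0"
proof -
  have "chart_subst k (lin_form k j) = (\<Sum>i<k. zvar i * ysub k (i + j)) + zvar k * ysub k (k + j)"
    by (simp add: lin_form_def chart_subst_add chart_subst_sum chart_subst_mult chart_subst_zvar chart_subst_yvar
        flip: lessThan_Suc_atMost)
  also have "zvar k * ysub k (k + j) = - (\<Sum>i<k. (zvar k * zinv k) * (zvar i * ysub k (i + j)))"
    by (subst ysub.simps[of k "k + j"]) (simp add: sum_distrib_left mult_ac add.commute del: zvar_zinv zinv_zvar)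
  finally show ?thesis by simp
qed

context secant begin

lemma rel_ideal_closed:
  shows "f \<in> rel_ideal n k I \<Longrightarrow> g \<in> rel_ideal n k I \<Longrightarrow> f + g \<in> rel_ideal n k I"
    and "f \<in> rel_ideal n k I \<Longrightarrow> g \<in> rel_ideal n k I \<Longrightarrow> f - g \<in> rel_ideal n k I"
    and "a \<in> loc n k I \<Longrightarrow> f \<in> rel_ideal n k I \<Longrightarrow> a * f \<in> rel_ideal n k I"
    and "a \<in> loc n k I \<Longrightarrow> f \<in> rel_ideal n k I \<Longrightarrow> f * a \<in> rel_ideal n k I"
  using ideal_span_add[OF ring_subset_loc] ideal_span_diff[OF ring_subset_loc] ideal_span_mult[OF ring_subset_loc]
  by (auto simp: rel_ideal_eq[OF kn] mult.commute)

lemma rel_ideal_sum: "(\<And>x. x \<in> X \<Longrightarrow> f x \<in> rel_ideal n k I) \<Longrightarrow> sum f X \<in> rel_ideal n k I"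
  by (induction X rule: infinite_finite_induct) (auto intro: rel_ideal_closed rel_ideal_0)

lemma loc_prod: "(\<And>x. x \<in> X \<Longrightarrow> f x \<in> loc n k I) \<Longrightarrow> prod f X \<in> loc n k I"
  by (induction X rule: infinite_finite_induct) (auto intro: loc_ring_closed)

lemma loc_power: "f \<in> loc n k I \<Longrightarrow> f ^ e \<in> loc n k I"
  by (induction e) (auto intro: loc_ring_closed)

lemma rel_ideal_mult_cong:
  assumes "f - f' \<in> rel_ideal n k I" "g - g' \<in> rel_ideal n k I" "g \<in> loc n k I" "f' \<in> loc n k I"
  shows "f * g - f' * g' \<in> rel_ideal n k I"
proof -
  have "(f - f') * g + f' * (g - g') \<in> rel_ideal n k I"
    by (intro rel_ideal_closed(1) rel_ideal_closed(4)[OF assms(3,1)] rel_ideal_closed(3)[OF assms(4,2)])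
  then show ?thesis by (simp add: algebra_simps)
qed

lemma chart_subst_rel_ideal:
  assumes "f \<in> rel_ideal n k I"
  shows "chart_subst k f = 0"
proof -
  from assms obtain a where "f = (\<Sum>j<m. a j * lin_form k j)"
    unfolding rel_ideal_eq[OF kn] by (rule ideal_spanE)
  then show ?thesis by (simp add: chart_subst_sum chart_subst_mult chart_subst_lin_form del: sum.lessThan_Suc)
qed

lemma ysub_cong:
  assumes "t \<le> n"
  shows "(yvar t - ysub k t :: 'a::field bipoly) \<in> rel_ideal n k {k} \<and> (ysub k t :: 'a bipoly) \<in> loc n k {k}"
  using assms
proof (induction t rule: less_induct)
  case (less t)
  show ?case
  proof (cases "t < k")
    case True
    then show ?thesis using less.prems by (simp add: ysub.simps[of k t] rel_ideal_0 yvar_loc)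
  next
    case False
    have IH: "(yvar (t - k + l) - ysub k (t - k + l) :: 'a bipoly) \<in> rel_ideal n k {k}" "(ysub k (t - k + l) :: 'a bipoly) \<in> loc n k {k}" if "l < k" for l
    proof -
      have "t - k + l < t" "t - k + l \<le> n" using less.prems False that by auto
      from less.IH[OF this] show "(yvar (t - k + l) - ysub k (t - k + l) :: 'a bipoly) \<in> rel_ideal n k {k}"
        "(ysub k (t - k + l) :: 'a bipoly) \<in> loc n k {k}" by blast+
    qed
    have zz: "(zvar l * zinv k :: 'a bipoly) \<in> loc n k {k}" if "l < k" for l
      using that by (intro loc_ring_closed zvar_loc zinv_loc) auto
    have loc: "(ysub k t :: 'a bipoly) \<in> loc n k {k}"
      using False IH(2) zz
      by (subst ysub.simps) (auto intro!: loc_ring_closed(3) ring_subset_sum[OF ring_subset_loc] loc_ring_closed(2)[of "_ * _"])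
    have "(lin_form k (t - k) :: 'a bipoly) = (\<Sum>l<k. zvar l * yvar (t - k + l)) + zvar k * yvar t"
      using False by (simp add: lin_form_def add.commute flip: lessThan_Suc_atMost)
    then have h1: "zinv k * lin_form k (t - k) = ((\<Sum>l<k. zvar l * zinv k * yvar (t - k + l)) + yvar t :: 'a bipoly)"
      by (simp add: distrib_left sum_distrib_left mult_ac)
    have h2: "(zinv k * lin_form k (t - k) :: 'a bipoly) \<in> rel_ideal n k {k}"
      unfolding rel_ideal_eq[OF kn] using less.prems False
      by (intro ideal_span_mult[OF ring_subset_loc] ideal_span_mem[OF ring_subset_loc] zinv_loc) auto
    have h3: "(\<Sum>l<k. zvar l * zinv k * (yvar (t - k + l) - ysub k (t - k + l)) :: 'a bipoly) \<in> rel_ideal n k {k}"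
      using IH(1) zz by (intro rel_ideal_sum rel_ideal_closed(3)) auto
    have "((\<Sum>l<k. zvar l * zinv k * yvar (t - k + l)) + yvar t)
      - (\<Sum>l<k. zvar l * zinv k * (yvar (t - k + l) - ysub k (t - k + l)) :: 'a bipoly) \<in> rel_ideal n k {k}"
      by (rule rel_ideal_closed(2)[OF h2[unfolded h1] h3])
    then have "(yvar t - ysub k t :: 'a bipoly) \<in> rel_ideal n k {k}"
      using False by (subst ysub.simps) (simp add: right_diff_distrib sum_subtractf)
    with loc show ?thesis by blast
  qed
qed

lemma yprod_cong:
  assumes "finite A" "A \<subseteq> {0..n}"
  shows "(\<Prod>i\<in>A. yvar i ^ e i) - (\<Prod>i\<in>A. ysub k i ^ e i) \<in> rel_ideal n k {k}"
  using assms
proof (induction A rule: finite_induct)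
  case (insert i A)
  have y: "yvar i - ysub k i \<in> rel_ideal n k {k}" "ysub k i \<in> loc n k {k}"
    using ysub_cong[of i] insert.prems by auto
  have "yvar i ^ e - ysub k i ^ e \<in> rel_ideal n k {k}" for e
  proof (induction e)
    case (Suc e)
    then show ?case
      using y insert.prems by (simp, intro rel_ideal_mult_cong loc_power yvar_loc) auto
  qed (simp add: rel_ideal_0)
  moreover have "(\<Prod>i\<in>A. yvar i ^ e i) \<in> loc n k {k}"
    using insert.prems by (intro loc_prod loc_power yvar_loc) auto
  ultimately show ?case
    using insert y(2) by (simp, intro rel_ideal_mult_cong loc_power) auto
qed (simp add: rel_ideal_0)

lemma single_yprod: "single (a, b) c = single (a, 0) c * (\<Prod>i\<in>keys b. yvar i ^ lookup b i)"
proof -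
  have pow: "yvar i ^ e = (single (0, single i e) 1 :: 'a::field bipoly)" for i e
    by (induction e) (simp_all add: yvar_def mult_single flip: single_add zero_prod_def)
  have "(\<Prod>i\<in>A. yvar i ^ lookup b i) = (single (0, \<Sum>i\<in>A. single i (lookup b i)) 1 :: 'a bipoly)" if "finite A" for A
    using that by (induction A rule: finite_induct) (simp_all add: pow mult_single flip: zero_prod_def)
  then show ?thesis by (simp add: mult_single sum_single_keys)
qed

text \<open>With \<open>chart_subst_rel_ideal\<close> it follows that on the chart
  \<open>{k}\<close> the relation ideal is exactly the kernel of the substitution.\<close>

lemma chart_subst_cong:
  assumes "f \<in> loc n k {k}"
  shows "f - chart_subst k f \<in> rel_ideal n k {k}"
proof -
  have "f - chart_subst k f = (\<Sum>u\<in>keys f. single 0 (lookup f u) *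
      (single u 1 - (case u of (a, b) \<Rightarrow> single (a, 0) 1 * ysub_prod k b)))"
  proof -
    have "(\<Sum>u\<in>keys f. single 0 (lookup f u) * single u 1) = f" by (simp add: mult_single sum_single_keys)
    then show ?thesis by (simp add: chart_subst_def lin_ext_def right_diff_distrib sum_subtractf)
  qed
  also have "\<dots> \<in> rel_ideal n k {k}"
  proof (intro rel_ideal_sum rel_ideal_closed(3) const_loc)
    fix u assume u: "u \<in> keys f"
    obtain a b where ab: "u = (a, b)" by fastforce
    have key: "(a, b) \<in> loc_keys n k {k}" using u assms by (auto simp: ab loc_iff)
    have "single u (1 :: 'a) - (case u of (a, b) \<Rightarrow> single (a, 0) 1 * ysub_prod k b)
      = single (a, 0) 1 * ((\<Prod>i\<in>keys b. yvar i ^ lookup b i) - ysub_prod k b)"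
      by (simp add: ab single_yprod[of a b] right_diff_distrib)
    also have "\<dots> \<in> rel_ideal n k {k}"
      unfolding ysub_prod_def using key
      by (intro rel_ideal_closed(3) yprod_cong single_loc) (auto simp: loc_keys_def)
    finally show "single u (1 :: 'a) - (case u of (a, b) \<Rightarrow> single (a, 0) 1 * ysub_prod k b) \<in> rel_ideal n k {k}" .
  qed
  finally show ?thesis .
qed

text \<open>The ideal is the kernel of a ring homomorphism into Laurent polynomials, which form a
  domain.\<close>

theorem rel_ideal_prime:
  assumes "f \<in> loc n k {k}" "g \<in> loc n k {k}" "f * g \<in> rel_ideal n k {k}"
  shows "f \<in> rel_ideal n k {k} \<or> g \<in> rel_ideal n k {k}"
proof -
  have "chart_subst k f * chart_subst k g = 0"
    using chart_subst_rel_ideal[OF assms(3)] by (simp add: chart_subst_mult)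
  then consider "chart_subst k f = 0" | "chart_subst k g = 0" by auto
  then show ?thesis using chart_subst_cong[OF assms(1)] chart_subst_cong[OF assms(2)] by cases auto
qed

lemma rel_ideal_cancel_zvar:
  assumes "zvar k ^ e * f \<in> rel_ideal n k {k}"
  shows "f \<in> rel_ideal n k {k}"
proof -
  have "zinv k ^ e * (zvar k ^ e * f) \<in> rel_ideal n k {k}"
    by (intro rel_ideal_closed(3) assms loc_power zinv_loc) auto
  then show ?thesis by (simp flip: mult.assoc power_mult_distrib)
qed

lemma clear_denominator:
  assumes "a \<in> loc n k (insert k I)"
  shows "\<exists>e. \<forall>e'\<ge>e. zvar k ^ e' * a \<in> loc n k I"
proof (intro exI allI impI)
  fix e' assume e': "e' \<ge> (\<Sum>u\<in>keys a. nat (- lookup (fst u) k))"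
  show "zvar k ^ e' * a \<in> loc n k I"
    unfolding loc_iff
  proof
    fix v assume "v \<in> keys (zvar k ^ e' * a)"
    then obtain u where u: "v = (single k (int e'), 0) + u" "u \<in> keys a"
      using Poly_Mapping.keys_mult[of "zvar k ^ e'" a] by (auto simp: zvar_power)
    have "nat (- lookup (fst u) k) \<le> e'"
      using member_le_sum[OF u(2), of "\<lambda>u. nat (- lookup (fst u) k)"] e' by simp
    then have k: "int e' + lookup (fst u) k \<ge> 0" by linarith
    have key: "u \<in> loc_keys n k (insert k I)" using u(2) assms by (auto simp: loc_iff)
    have "keys (single k (int e') + fst u) \<subseteq> {0..k}"
      using key Poly_Mapping.keys_add[of "single k (int e')" "fst u"] by (auto simp: loc_keys_def split: if_splits)
    moreover have "i \<in> I" if "lookup (single k (int e') + fst u) i < 0" for i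
    proof (cases "i = k")
      case False
      then show ?thesis using that key by (auto simp: lookup_add lookup_single loc_keys_def)
    qed (use that k in \<open>simp add: lookup_add\<close>)
    ultimately show "v \<in> loc_keys n k I" using key by (auto simp: u(1) loc_keys_def)
  qed
qed

text \<open>Vanishing passes from the chart \<open>{k}\<close> to its overlap with the chart
  \<open>{i}\<close>. Clearing denominators puts \<open>zvar k ^ N * f i\<close> into the ideal of
  the chart \<open>{i}\<close>, where \<open>zvar k\<close> is a nonzerodivisor. Sections are thus
  determined on the chart \<open>{k}\<close>.\<close>

lemma compatible_vanish:
  assumes f: "compatible f" and van: "f k \<in> rel_ideal n k {k}" and i: "i \<le> k"
  shows "f i \<in> rel_ideal n k {i}"
proof (cases "i = k")
  case False
  have "f k \<in> rel_ideal n k {i, k}" using van rel_ideal_mono[OF kn, of "{k}" "{i, k}"] by auto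
  moreover have "f i - f k \<in> rel_ideal n k {i, k}" using f i by (simp add: compatible_def)
  ultimately have "f i \<in> rel_ideal n k {i, k}" using rel_ideal_closed(1) by fastforce
  then obtain a where a: "f i = (\<Sum>j<m. a j * lin_form k j)" "\<forall>j<m. a j \<in> loc n k {i, k}"
    unfolding rel_ideal_eq[OF kn] by (rule ideal_spanE)
  have "\<forall>j\<in>{..<m}. \<exists>e. \<forall>e'\<ge>e. zvar k ^ e' * a j \<in> loc n k {i}"
    by (intro ballI clear_denominator) (use a(2) in \<open>simp add: insert_commute\<close>)
  then obtain e where e: "\<And>j e'. j < m \<Longrightarrow> e' \<ge> e j \<Longrightarrow> zvar k ^ e' * a j \<in> loc n k {i}"
    by (metis lessThan_iff)
  define N where "N = (\<Sum>j<m. e j)"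
  have "e j \<le> N" if "j < m" for j
    unfolding N_def using that by (intro member_le_sum) auto
  then have "(\<Sum>j<m. (zvar k ^ N * a j) * lin_form k j) \<in> rel_ideal n k {i}"
    unfolding rel_ideal_eq[OF kn] by (intro ideal_spanI e)
  then have main: "zvar k ^ N * f i \<in> rel_ideal n k {i}" by (simp only: a(1) sum_distrib_left mult.assoc)
  have nzd: "nzd_mod (loc n k {i}) (rel_ideal n k {i}) (zvar k :: 'a bipoly)"
    unfolding rel_ideal_eq[OF kn] using False i kn by (intro nzd_mod_last_zvar) auto
  have "f i \<in> rel_ideal n k {i}" if "zvar k ^ N * f i \<in> rel_ideal n k {i}" for N
    using that
  proof (induction N)
    case (Suc N)
    have "zvar k ^ N * f i \<in> loc n k {i}"
      using f i by (intro loc_ring_closed loc_power zvar_loc) (auto simp: compatible_def)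
    then have "zvar k ^ N * f i \<in> rel_ideal n k {i}"
      using nzd Suc.prems by (auto simp: nzd_mod_def mult.assoc)
    then show ?case by (rule Suc.IH)
  qed simp
  with main show ?thesis by blast
qed (use van in simp)

section \<open>Hermite reciprocity and the minors\<close>

lemma minor_add: "minor m k (\<lambda>T. v T + w T) i = minor m k v i + minor m k w i"
  by (simp add: minor_def const_fun_add contract_set_def contract_list_add)

lemma minor_scale: "minor m k (\<lambda>T. c * w T) i = single 0 c * minor m k w i"
  by (simp add: minor_def const_fun_scale contract_set_def contract_list_scale)

lemma minor_0: "minor m k (\<lambda>T. 0) i = 0"
  using minor_scale[of 0 "\<lambda>T. 0" i] by simp

lemma minor_loc:
  assumes "supp_on m k w" "i \<le> k"
  shows "minor m k w i \<in> loc n k I" "keys (minor m k w i) \<subseteq> {u. fst u = 0 \<and> deg_y (snd u) = int k}"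
proof -
  have "card ({0..k} - {i}) = k" using assms(2) by simp
  then have "contract_set m ({0..k} - {i}) (const_fun w) \<in> ext_y gen_deg 0"
    using const_fun_ext_y[of w] assms(1) by (intro contract_set_ext_y) (simp_all add: ext_module_carrier)
  then show "minor m k w i \<in> loc n k I" "keys (minor m k w i) \<subseteq> {u. fst u = 0 \<and> deg_y (snd u) = int k}"
    using loc_ring_mono[of "{}" I n k] by (auto simp: minor_def ext_y_def)
qed

lemma expl_minor: "expl m k (const_fun w) {i} {} = (- 1) ^ i * zinv i * minor m k w i"
  by (simp add: expl_def minor_def zprod_inv_def)

text \<open>The agreement of the explicit section on the charts \<open>{i}\<close> and
  \<open>{k}\<close>, multiplied by \<open>zvar i * zvar k\<close>. No denominators are left, so the
  relation holds over every \<open>I\<close>.\<close>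

lemma minor_relation:
  fixes w :: "nat set \<Rightarrow> 'a::field"
  assumes w: "supp_on m k w" and i: "i \<le> k"
  shows "zvar i * minor m k w k - (- 1) ^ (k - i) * (zvar k * minor m k w i) \<in> rel_ideal n k I"
proof (cases "i = k")
  case False
  with i have ik: "i < k" by simp
  let ?W = "const_fun w"
  let ?F = "contract_set m ({0..k} - {i, k}) ?W"
  have e: "{s. (s = i \<or> s = k) \<and> s < i} = {}" "{s. (s = i \<or> s = k) \<and> s < k} = {i}"
    using ik by auto
  have "expl m k ?W {k} {} - expl m k ?W {i} {} = cech_diff (expl m k ?W) {i, k} {}"
    using ik by (simp add: cech_diff_def insert_Diff_if e)
  also have "\<dots> = kc.diff (expl m k ?W {i, k}) {}"
    using i by (intro expl_zigzag) auto
  also have "\<dots> = (- 1) ^ (i + k) * zprod_inv {i, k} * kc.diff ?F {}"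
    using ik unfolding expl_def[abs_def] by (simp add: kdiff_scale)
  also have "zprod_inv {i, k} = zinv i * (zinv k :: 'a bipoly)" using ik by (simp add: zprod_inv_def)
  finally have D: "expl m k ?W {k} {} - expl m k ?W {i} {} = (- 1) ^ (i + k) * (zinv i * zinv k) * kc.diff ?F {}" .
  have "(zvar i * zvar k) * (expl m k ?W {k} {} - expl m k ?W {i} {})
    = (zvar i * zinv i) * (zvar k * zinv k) * ((- 1) ^ (i + k) * kc.diff ?F {})"
    by (simp only: D mult_ac)
  then have "(zvar i * zvar k) * (expl m k ?W {k} {} - expl m k ?W {i} {}) = (- 1) ^ (i + k) * kc.diff ?F {}"
    by simp
  moreover have "(zvar i * zvar k) * (expl m k ?W {k} {} - expl m k ?W {i} {})
    = (- 1) ^ k * (zvar i * minor m k w k) * (zvar k * zinv k) - (- 1) ^ i * (zvar k * minor m k w i) * (zvar i * zinv i)"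
    by (simp add: expl_minor algebra_simps del: zvar_zinv zinv_zvar)
  ultimately have eq: "(- 1) ^ k * (zvar i * minor m k w k) - (- 1) ^ i * (zvar k * minor m k w i) = (- 1) ^ (i + k) * kc.diff ?F {}"
    by simp
  have sq: "(- 1) ^ k * ((- 1) ^ k * f) = (f :: 'a bipoly)" for f
    by (simp flip: mult.assoc power_add mult_2)
  have "k + i = 2 * i + (k - i)" using ik by simp
  then have "(- 1) ^ (k + i) = ((- 1) ^ (2 * i + (k - i)) :: 'a bipoly)" by (rule arg_cong)
  also have "\<dots> = (- 1) ^ (k - i)" by (simp only: power_add power_minus1_even mult_1)
  finally have sgn: "(- 1) ^ k * ((- 1) ^ i * f) = (- 1) ^ (k - i) * (f :: 'a bipoly)" for f
    by (simp only: power_add mult.assoc[symmetric])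
  have "(- 1) ^ k * ((- 1) ^ k * (zvar i * minor m k w k) - (- 1) ^ i * (zvar k * minor m k w i))
    = (- 1) ^ k * ((- 1) ^ (i + k) * kc.diff ?F {})"
    by (simp only: eq)
  then have "zvar i * minor m k w k - (- 1) ^ (k - i) * (zvar k * minor m k w i) = (- 1) ^ k * ((- 1) ^ (i + k) * kc.diff ?F {})"
    by (simp only: right_diff_distrib sq sgn)
  moreover have "kc.diff ?F {} \<in> rel_ideal n k I"
  proof -
    have "card ({0..k} - {i, k}) + 1 = k" using ik by (subst card_Diff_subset) auto
    then have "?F \<in> ext_y gen_deg 1"
      using const_fun_ext_y[of w] w by (intro contract_set_ext_y) (simp_all add: ext_module_carrier)
    then show ?thesis
      using loc_ring_mono[of "{}" I n k] unfolding rel_ideal_eq[OF kn]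
      by (intro kdiff_in_ideal_span ring_subset_loc) (auto simp: ext_y_def)
  qed
  ultimately show ?thesis
    by (auto intro!: rel_ideal_closed(3) ring_subset_neg_one_power[OF ring_subset_loc])
qed (simp add: rel_ideal_0)

lemma supp_on_mono: "supp_on d k w \<Longrightarrow> d \<le> d' \<Longrightarrow> supp_on d' k w"
  unfolding supp_on_def by fastforce

theorem minor_act:
  assumes w: "supp_on d k w" and d: "d < m" and i: "i \<le> k"
  shows "zvar i * minor m k w k - zvar k * minor m k (tensor_act k (coord_tensor k i) w) k \<in> rel_ideal n k I"
  using minor_relation[OF supp_on_mono[OF w less_imp_le[OF d]] i, of I]
  by (simp add: minor_tensor_act[OF w d i] mult.left_commute)

lemma minor_act_pow:
  assumes w: "supp_on d k w" and d: "d + e \<le> m" and i: "i \<le> k"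
  shows "supp_on (d + e) k ((tensor_act k (coord_tensor k i) ^^ e) w) \<and>
    zvar i ^ e * minor m k w k - zvar k ^ e * minor m k ((tensor_act k (coord_tensor k i) ^^ e) w) k \<in> rel_ideal n k I"
  using d
proof (induction e)
  case (Suc e)
  let ?w = "(tensor_act k (coord_tensor k i) ^^ e) w"
  from Suc have IH: "supp_on (d + e) k ?w" "zvar i ^ e * minor m k w k - zvar k ^ e * minor m k ?w k \<in> rel_ideal n k I"
    by auto
  have "zvar k ^ e * (zvar i * minor m k ?w k - zvar k * minor m k (tensor_act k (coord_tensor k i) ?w) k)
      + zvar i * (zvar i ^ e * minor m k w k - zvar k ^ e * minor m k ?w k) \<in> rel_ideal n k I"
    using Suc.prems i by (intro rel_ideal_closed(1,3) IH(2) minor_act[OF IH(1)] loc_power zvar_loc) auto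
  then have "zvar i ^ Suc e * minor m k w k - zvar k ^ Suc e * minor m k ((tensor_act k (coord_tensor k i) ^^ Suc e) w) k \<in> rel_ideal n k I"
    by (simp add: algebra_simps)
  with supp_on_tensor_act[OF IH(1) i] show ?case by simp
qed (use w in \<open>simp add: rel_ideal_0\<close>)

lemma minor_act_foldr:
  assumes w: "supp_on d k w" and "d + sum_list (map e is) \<le> m" "set is \<subseteq> {0..k}"
  shows "supp_on (d + sum_list (map e is)) k (foldr (\<lambda>i. tensor_act k (coord_tensor k i) ^^ e i) is w) \<and>
    (\<Prod>i\<leftarrow>is. zvar i ^ e i) * minor m k w k
      - zvar k ^ sum_list (map e is) * minor m k (foldr (\<lambda>i. tensor_act k (coord_tensor k i) ^^ e i) is w) k \<in> rel_ideal n k I"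
  using assms(2,3)
proof (induction "is")
  case (Cons i "is")
  let ?w = "foldr (\<lambda>i. tensor_act k (coord_tensor k i) ^^ e i) is w"
  let ?v = "(tensor_act k (coord_tensor k i) ^^ e i) ?w"
  let ?E = "sum_list (map e is)"
  from Cons have IH: "supp_on (d + ?E) k ?w" "(\<Prod>i\<leftarrow>is. zvar i ^ e i) * minor m k w k - zvar k ^ ?E * minor m k ?w k \<in> rel_ideal n k I"
    by auto
  have act: "supp_on (d + ?E + e i) k ?v" "zvar i ^ e i * minor m k ?w k - zvar k ^ e i * minor m k ?v k \<in> rel_ideal n k I"
    using minor_act_pow[OF IH(1), of "e i" i I] Cons.prems by auto
  have "zvar i ^ e i * ((\<Prod>i\<leftarrow>is. zvar i ^ e i) * minor m k w k - zvar k ^ ?E * minor m k ?w k)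
      + zvar k ^ ?E * (zvar i ^ e i * minor m k ?w k - zvar k ^ e i * minor m k ?v k) \<in> rel_ideal n k I"
    using Cons.prems by (intro rel_ideal_closed(1,3) IH(2) act(2) loc_power zvar_loc) auto
  then show ?case using act(1) by (simp add: algebra_simps power_add)
qed (use w in \<open>simp add: rel_ideal_0\<close>)

end

section \<open>The images of the operators \<open>z_i\<close> span\<close>

definition basis_fun :: "nat set \<Rightarrow> nat set \<Rightarrow> 'a::field" where
  "basis_fun S T = (if T = S then 1 else 0)"

lemma supp_on_basis_fun: "S \<subseteq> {0..<d} \<Longrightarrow> card S = k \<Longrightarrow> supp_on d k (basis_fun S)"
  by (auto simp: supp_on_def basis_fun_def)

lemma sorted_list_of_set_top:
  assumes "finite A" "\<And>t. t \<in> A \<Longrightarrow> t < a"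
  shows "sorted_list_of_set (A \<union> {a..<b}) = sorted_list_of_set A @ [a..<b]"
proof -
  have "sorted (sorted_list_of_set A @ [a..<b])" "distinct (sorted_list_of_set A @ [a..<b])"
    using assms(1) by (auto simp: sorted_append dest: assms(2))
  moreover have "set (sorted_list_of_set A @ [a..<b]) = A \<union> {a..<b}" using assms(1) by simp
  ultimately show ?thesis by (metis sorted_list_of_set.idem_if_sorted_distinct)
qed

text \<open>
  The run of \<open>e\<close> largest possible indices in \<open>S\<close> arises from \<open>T\<close> by shifting a run of \<open>e\<close> indices up by
  one; no other term of \<open>z\<^bsub>k-e\<^esub> * e\<^sub>T\<close> contains that run.
\<close>

lemma tensor_act_basis_fun:
  assumes A: "A \<subseteq> {0..<d - e}" "card A = k - e" and e: "e \<le> k" "e \<le> d"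
    and S: "S \<subseteq> {0..<Suc d}" "card S = k" "{Suc d - e..<Suc d} \<subseteq> S"
  shows "tensor_act k (coord_tensor k (k - e)) (basis_fun (A \<union> {d - e..<d})) S
    = (if S = A \<union> {Suc d - e..<Suc d} then (- 1) ^ e else 0 :: 'a::field)"
proof -
  define B where "B = S - {Suc d - e..<Suc d}"
  have finA: "finite A" and finS: "finite S" using A(1) S(1) finite_subset by blast+
  have B: "finite B" "B \<subseteq> {0..<Suc d - e}" "S = B \<union> {Suc d - e..<Suc d}"
    using S finS by (auto simp: B_def not_le)
  have "card S = card B + card {Suc d - e..<Suc d}"
    unfolding B(3) using B(1,2) by (subst card_Un_disjoint) auto
  then have cardB: "card B = k - e" using S(2) e by simp
  let ?T = "A \<union> {d - e..<d}"
  have "card ?T = card A + card {d - e..<d}"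
    using finA A(1) by (subst card_Un_disjoint) auto
  then have T: "?T \<subseteq> {0..<d}" "card ?T = k" using A e by auto
  note w = supp_on_basis_fun[OF T, where 'a = 'a]
  define as where "as = sorted_list_of_set A"
  define bs where "bs = sorted_list_of_set B"
  have len: "length as = k - e" "length bs = k - e" using A(2) cardB by (simp_all add: as_def bs_def)
  have slT: "sorted_list_of_set ?T = as @ [d - e..<d]"
    unfolding as_def using A(1) finA by (intro sorted_list_of_set_top) auto
  have slS: "sorted_list_of_set S = bs @ [Suc d - e..<Suc d]"
    unfolding bs_def by (subst B(3)) (use B(1,2) in \<open>intro sorted_list_of_set_top; auto\<close>)
  define ts where "ts = sorted_list_of_set S"
  have ts: "sorted ts" "distinct ts" "length ts = k" "set ts = S"
    using finS S(2) by (simp_all add: ts_def)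
  have nth_ts: "ts ! j = (if j < k - e then bs ! j else Suc d - e + (j - (k - e)))" if "j < k" for j
    using that len e by (auto simp: ts_def slS nth_append)
  define J0 where "J0 = {k - e..<k}"
  have alt: "alt_fun (basis_fun ?T) (decrease ts J) = (if J = J0 \<and> as = bs then 1 else 0 :: 'a)"
    if J: "J \<subseteq> {0..<length ts}" "card J = k - (k - e)" "\<forall>j\<in>J. ts ! j > 0" for J
  proof -
    let ?us = "decrease ts J"
    have us: "sorted ?us" by (rule sorted_decrease[OF ts(1,2)])
    have "alt_fun (basis_fun ?T) ?us = (if ?us = as @ [d - e..<d] then 1 else 0 :: 'a)"
    proof (cases "distinct ?us")
      case True
      then have "set ?us = ?T \<longleftrightarrow> ?us = as @ [d - e..<d]"
        using us slT finA by (metis finite_UnI finite_atLeastLessThan sorted_list_of_set.idem_if_sorted_distinct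
            sorted_list_of_set.set_sorted_key_list_of_set)
      with True us show ?thesis by (simp add: alt_fun_def basis_fun_def list_sign_sorted)
    next
      case False
      moreover have "distinct (as @ [d - e..<d])" unfolding slT[symmetric] by simp
      ultimately show ?thesis by (auto simp: alt_fun_def)
    qed
    moreover have "?us = as @ [d - e..<d] \<longleftrightarrow> J = J0 \<and> as = bs"
    proof
      assume eq: "?us = as @ [d - e..<d]"
      have nth: "?us ! j = (if j < k - e then as ! j else d - e + (j - (k - e)))" if "j < k" for j
        using that len e by (auto simp: eq nth_append)
      have "J0 \<subseteq> J"
      proof
        fix j assume j: "j \<in> J0"
        then have "j < k" "\<not> j < k - e" by (auto simp: J0_def)
        then have "?us ! j \<noteq> ts ! j" using nth[of j] nth_ts[of j] e by simp
        then show "j \<in> J" using \<open>j < k\<close> ts(3) by (cases "j \<in> J") (simp_all add: nth_decrease)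
      qed
      moreover have "card J0 = card J" using J(2) by (simp add: J0_def)
      moreover have "finite J" using J(1) finite_subset by blast
      ultimately have J0: "J = J0" using card_subset_eq[of J J0] by auto
      have "as ! j = bs ! j" if "j < k - e" for j
        using nth[of j] nth_ts[of j] that ts(3) by (simp add: nth_decrease J0 J0_def)
      then have "as = bs" using len by (intro nth_equalityI) auto
      with J0 show "J = J0 \<and> as = bs" by blast
    next
      assume "J = J0 \<and> as = bs"
      then show "?us = as @ [d - e..<d]"
        using len ts(3) e by (intro nth_equalityI) (auto simp: nth_decrease nth_ts nth_append J0_def)
    qed
    ultimately show ?thesis by simp
  qed
  have J0: "J0 \<subseteq> {0..<length ts}" "card J0 = k - (k - e)" "\<forall>j\<in>J0. ts ! j > 0"
    using ts(3) nth_ts e by (auto simp: J0_def)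
  have "tensor_act k (coord_tensor k (k - e)) (basis_fun ?T) (set ts)
    = (- 1) ^ (k - (k - e)) * down_shift ts (k - (k - e)) (alt_fun (basis_fun ?T) :: nat list \<Rightarrow> 'a)"
    by (rule tensor_act_sorted[OF w _ ts(1-3)]) simp
  also have "down_shift ts (k - (k - e)) (alt_fun (basis_fun ?T) :: nat list \<Rightarrow> 'a)
    = (\<Sum>J | J \<subseteq> {0..<length ts} \<and> card J = k - (k - e) \<and> (\<forall>j\<in>J. ts ! j > 0). if J = J0 then (if as = bs then 1 else 0) else 0)"
    unfolding down_shift_eq_sum using alt by (intro sum.cong refl) auto
  also have "\<dots> = (if as = bs then 1 else 0)"
  proof (subst sum.delta)
    show "finite {J. J \<subseteq> {0..<length ts} \<and> card J = k - (k - e) \<and> (\<forall>j\<in>J. ts ! j > 0)}"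
      by (rule finite_subset[of _ "Pow {0..<length ts}"]) auto
  qed (use J0 in auto)
  finally have main: "tensor_act k (coord_tensor k (k - e)) (basis_fun ?T) S = (if as = bs then (- 1) ^ e else 0 :: 'a)"
    using e by (simp add: ts(4))
  have "as = bs \<longleftrightarrow> A = B" unfolding as_def bs_def using finA B(1) by (metis sorted_list_of_set.set_sorted_key_list_of_set)
  also have "\<dots> \<longleftrightarrow> S = A \<union> {Suc d - e..<Suc d}"
  proof -
    have "A \<inter> {Suc d - e..<Suc d} = {}" using A(1) by force
    moreover have "B \<inter> {Suc d - e..<Suc d} = {}" unfolding B_def by blast
    ultimately show ?thesis using B(3) by blast
  qed
  finally show ?thesis using main by simp
qed

text \<open>Triangularity with respect to the length of the run of largest indices in
  \<open>S\<close>: if it equals \<open>e\<close>, then \<open>z_{k-e}\<close> applied to the set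
  with that run lowered gives \<open>e_S\<close> up to sign and terms with shorter runs. A run of
  \<open>k + 1\<close> indices does not fit into \<open>S\<close>. The subspace \<open>C\<close> is
  arbitrary so that an existence statement can be put in its place.\<close>

theorem tensor_act_generates:
  fixes C :: "(nat set \<Rightarrow> 'a::field) set"
  assumes add: "\<And>v w. v \<in> C \<Longrightarrow> w \<in> C \<Longrightarrow> (\<lambda>T. v T + w T) \<in> C"
    and scale: "\<And>c w. w \<in> C \<Longrightarrow> (\<lambda>T. c * w T) \<in> C" and zero: "(\<lambda>T. 0) \<in> C"
    and act: "\<And>i w. i \<le> k \<Longrightarrow> supp_on d k w \<Longrightarrow> tensor_act k (coord_tensor k i) w \<in> C"
    and k: "1 \<le> k" "k \<le> d" and w: "supp_on (Suc d) k w"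
  shows "w \<in> C"
proof -
  have sum: "(\<lambda>T. \<Sum>S\<in>X. c S * basis_fun S T) \<in> C" if "finite X" "\<And>S. S \<in> X \<Longrightarrow> c S \<noteq> 0 \<Longrightarrow> basis_fun S \<in> C"
    for X and c :: "nat set \<Rightarrow> 'a"
    using that
  proof (induction X rule: finite_induct)
    case (insert S X)
    have "(\<lambda>T. c S * basis_fun S T) \<in> C"
      using insert.prems[of S] zero scale[of "basis_fun S" "c S"] by (cases "c S = 0") auto
    then have "(\<lambda>T. c S * basis_fun S T + (\<Sum>S\<in>X. c S * basis_fun S T)) \<in> C"
      using insert by (intro add) auto
    with insert show ?case by simp
  qed (simp add: zero)
  have expand: "v = (\<lambda>T. \<Sum>S\<in>{S. S \<subseteq> {0..<Suc d} \<and> card S = k}. v S * basis_fun S T)"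
    if "supp_on (Suc d) k v" for v :: "nat set \<Rightarrow> 'a"
  proof
    fix T
    have fin: "finite {S. S \<subseteq> {0..<Suc d} \<and> card S = k}" by (rule finite_subset[of _ "Pow {0..<Suc d}"]) auto
    have "(\<Sum>S\<in>{S. S \<subseteq> {0..<Suc d} \<and> card S = k}. v S * basis_fun S T)
      = (\<Sum>S\<in>{S. S \<subseteq> {0..<Suc d} \<and> card S = k}. if S = T then v T else 0)"
      by (intro sum.cong) (auto simp: basis_fun_def)
    also have "\<dots> = v T" using fin supp_onD[OF that, of T] by auto
    finally show "v T = (\<Sum>S\<in>{S. S \<subseteq> {0..<Suc d} \<and> card S = k}. v S * basis_fun S T)" ..
  qed
  have fin: "finite {S. S \<subseteq> {0..<Suc d} \<and> card S = k}" by (rule finite_subset[of _ "Pow {0..<Suc d}"]) auto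
  have basis: "basis_fun S \<in> C"
    if "e \<le> Suc k" "S \<subseteq> {0..<Suc d}" "card S = k" "\<not> {Suc d - e..<Suc d} \<subseteq> S" for e S
    using that
  proof (induction e arbitrary: S)
    case (Suc e)
    show ?case
    proof (cases "{Suc d - e..<Suc d} \<subseteq> S")
      case False
      with Suc show ?thesis by simp
    next
      case True
      have e: "e \<le> k" "e \<le> d" using Suc.prems(1) k by auto
      have nin: "d - e \<notin> S"
      proof
        assume "d - e \<in> S"
        moreover have "{Suc d - Suc e..<Suc d} = insert (d - e) {Suc d - e..<Suc d}" using e by auto
        ultimately show False using True Suc.prems(4) by auto
      qed
      define A where "A = S - {Suc d - e..<Suc d}"
      have S: "S = A \<union> {Suc d - e..<Suc d}" using True by (auto simp: A_def)
      have A: "A \<subseteq> {0..<d - e}"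
      proof
        fix t assume "t \<in> A"
        then have "t \<in> S" "t < Suc d - e" using Suc.prems(2) by (auto simp: A_def not_le)
        moreover have "t \<noteq> d - e" using nin \<open>t \<in> S\<close> by auto
        ultimately show "t \<in> {0..<d - e}" using e by auto
      qed
      have finA: "finite A" using A finite_subset by blast
      have "card S = card A + card {Suc d - e..<Suc d}"
      proof (subst S, rule card_Un_disjoint)
        show "A \<inter> {Suc d - e..<Suc d} = {}" using A by force
      qed (use finA in auto)
      then have cardA: "card A = k - e" using Suc.prems(3) e by simp
      \<comment> \<open>The run is lowered by one; it does not collide with \<open>A\<close>,
        because \<open>d - e\<close> is missing from \<open>S\<close>.\<close>
      let ?T = "A \<union> {d - e..<d}"
      have "card ?T = card A + card {d - e..<d}"
        using finA A by (subst card_Un_disjoint) auto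
      then have "?T \<subseteq> {0..<d}" "card ?T = k" using A cardA e by auto
      then have T: "supp_on d k (basis_fun ?T :: nat set \<Rightarrow> 'a)" by (rule supp_on_basis_fun)
      define W :: "nat set \<Rightarrow> 'a" where "W = tensor_act k (coord_tensor k (k - e)) (basis_fun ?T)"
      have W: "W \<in> C" "supp_on (Suc d) k W"
        unfolding W_def using T by (auto intro: act supp_on_tensor_act)
      have W_S: "W S' = (if S' = S then (- 1) ^ e else 0)"
        if "S' \<subseteq> {0..<Suc d}" "card S' = k" "{Suc d - e..<Suc d} \<subseteq> S'" for S'
        unfolding W_def S by (rule tensor_act_basis_fun[OF A cardA e that])
      define X where "X = {S'. S' \<subseteq> {0..<Suc d} \<and> card S' = k} - {S}"
      have rest: "(\<lambda>T. \<Sum>S'\<in>X. W S' * basis_fun S' T) \<in> C"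
      proof (rule sum)
        fix S' assume S': "S' \<in> X" "W S' \<noteq> 0"
        then have "\<not> {Suc d - e..<Suc d} \<subseteq> S'" using W_S[of S'] by (auto simp: X_def)
        with S'(1) Suc.prems(1) show "basis_fun S' \<in> C" by (intro Suc.IH) (auto simp: X_def)
      qed (use fin in \<open>simp add: X_def\<close>)
      have "basis_fun S T = (- 1) ^ e * (W T + (- 1) * (\<Sum>S'\<in>X. W S' * basis_fun S' T))" for T
      proof -
        have "W T = (\<Sum>S\<in>{S. S \<subseteq> {0..<Suc d} \<and> card S = k}. W S * basis_fun S T)"
          by (rule fun_cong[OF expand[OF W(2)]])
        also have "\<dots> = W S * basis_fun S T + (\<Sum>S'\<in>X. W S' * basis_fun S' T)"
          unfolding X_def using Suc.prems fin by (intro sum.remove) auto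
        finally have "W T + (- 1) * (\<Sum>S'\<in>X. W S' * basis_fun S' T) = (- 1) ^ e * basis_fun S T"
          using W_S[OF Suc.prems(2,3) True] by simp
        then show ?thesis by (cases "even e") simp_all
      qed
      then have "basis_fun S = (\<lambda>T. (- 1) ^ e * (W T + (- 1) * (\<Sum>S'\<in>X. W S' * basis_fun S' T)))" ..
      then show ?thesis using scale[OF add[OF W(1) scale[OF rest, of "- 1"]], of "(- 1) ^ e"] by simp
    qed
  qed simp
  have "basis_fun S \<in> C" if "S \<subseteq> {0..<Suc d}" "card S = k" for S
  proof (rule basis[OF order_refl that])
    have "card {Suc d - Suc k..<Suc d} = Suc k" using k by simp
    moreover have "finite S" using that(1) finite_subset by blast
    ultimately show "\<not> {Suc d - Suc k..<Suc d} \<subseteq> S" using card_mono[of S] that(2) by (metis Suc_n_not_le_n)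
  qed
  then have "(\<lambda>T. \<Sum>S\<in>{S. S \<subseteq> {0..<Suc d} \<and> card S = k}. w S * basis_fun S T) \<in> C"
    using fin by (intro sum) auto
  then show ?thesis using expand[OF w] by simp
qed

section \<open>Hermite reciprocity\<close>

abbreviation wedge_top :: "nat \<Rightarrow> nat set \<Rightarrow> 'a::field" where
  "wedge_top k \<equiv> wedge k (\<lambda>j. monom 1 (k - 1 - j))"

definition mono_act :: "nat \<Rightarrow> (nat \<Rightarrow>\<^sub>0 int) \<Rightarrow> (nat set \<Rightarrow> 'a::field) \<Rightarrow> nat set \<Rightarrow> 'a" where
  "mono_act k a = foldr (\<lambda>i. tensor_act k (coord_tensor k i) ^^ nat (lookup a i)) [0..<k + 1]"

lemma sym_act_superset:
  assumes "finite U" "keys f \<subseteq> U"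
  shows "sym_act k f w S = (\<Sum>u\<in>U. lookup f u * mono_act k (fst u) w S)"
proof -
  have "sym_act k f w S = (\<Sum>u\<in>keys f. lookup f u * mono_act k (fst u) w S)"
    by (simp add: sym_act_def mono_act_def case_prod_unfold)
  also have "\<dots> = (\<Sum>u\<in>U. lookup f u * mono_act k (fst u) w S)"
    using assms by (intro sum.mono_neutral_left) (auto simp: in_keys_iff)
  finally show ?thesis .
qed

lemma sym_act_add: "sym_act k (f + g) w S = sym_act k f w S + sym_act k g w S"
proof -
  have "keys (f + g) \<subseteq> keys f \<union> keys g" by (rule Poly_Mapping.keys_add)
  then show ?thesis
    by (simp add: sym_act_superset[of "keys f \<union> keys g"] lookup_add distrib_right sum.distrib)
qed

lemma lookup_const_mult: "lookup (single 0 c * f) u = c * lookup f u"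
proof -
  have "single 0 c * f = (\<Sum>v\<in>keys f. single v (c * lookup f v))"
    by (subst (1) sum_single_keys[of f, symmetric]) (simp add: sum_distrib_left mult_single)
  then show ?thesis by (auto simp: lookup_sum lookup_single when_def in_keys_iff sum.delta)
qed

lemma sym_act_scale: "sym_act k (single 0 c * f) w S = c * sym_act k f w S"
proof -
  have "keys (single 0 c * f) \<subseteq> keys f" by (auto simp: in_keys_iff lookup_const_mult)
  then show ?thesis
    by (simp add: sym_act_superset[of "keys f"] lookup_const_mult sum_distrib_left mult.assoc)
qed

lemma wedge_top_supp: "supp_on k k (wedge_top k :: nat set \<Rightarrow> 'a::field)"
  unfolding supp_on_def
proof (intro allI impI)
  fix S assume nz: "wedge_top k S \<noteq> (0 :: 'a)"
  then have S: "finite S" "card S = k" by (auto simp: wedge_def split: if_splits)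
  define ts where "ts = sorted_list_of_set S"
  have ts: "length ts = k" "set ts = S" using S by (simp_all add: ts_def)
  have eq: "wedge_top k S = (\<Sum>p | p permutes {0..<k}. of_int (sign p) * (\<Prod>j<k. poly.coeff (monom (1 :: 'a) (k - 1 - j)) (ts ! p j)))"
    unfolding wedge_def ts_def using S by (simp only: if_True simp_thms)
  obtain p where p: "p permutes {0..<k}" and pnz: "(\<Prod>j<k. poly.coeff (monom (1 :: 'a) (k - 1 - j)) (ts ! p j)) \<noteq> 0"
    using sum.not_neutral_contains_not_neutral[OF nz[unfolded eq]] by auto
  have j: "k - 1 - j = ts ! p j" if "j < k" for j
  proof (rule contrapos_np[OF pnz])
    assume "k - 1 - j \<noteq> ts ! p j"
    with that show "(\<Prod>j<k. poly.coeff (monom (1 :: 'a) (k - 1 - j)) (ts ! p j)) = 0"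
      by (intro prod_zero bexI[of _ j]) auto
  qed
  have "t < k" if "t \<in> S" for t
  proof -
    obtain i where i: "i < k" "t = ts ! i" using \<open>t \<in> S\<close> ts in_set_conv_nth[of t ts] by blast
    then have "i \<in> p ` {0..<k}" using permutes_image[OF p] by simp
    then obtain j' where "j' < k" and i_eq: "i = p j'" by auto
    then show ?thesis using j[OF \<open>j' < k\<close>] \<open>j' < k\<close> by (simp only: i(2) i_eq)
  qed
  with S show "S \<subseteq> {0..<k} \<and> card S = k" by auto
qed

lemma wedge_top_nonzero: "wedge_top k {0..<k} \<noteq> (0 :: 'a::field)"
proof -
  \<comment> \<open>The reversal; it is the only permutation whose product does not vanish.\<close>
  define r where "r j = (if j < k then k - 1 - j else j)" for j
  have rr: "r (r j) = j" for j by (auto simp: r_def)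
  have r: "r permutes {0..<k}"
    unfolding permutes_def
  proof (intro conjI allI impI)
    show "\<exists>!x. r x = y" for y by (rule ex1I[of _ "r y"]) (use rr in auto)
  qed (simp add: r_def)
  have "wedge_top k {0..<k} = (\<Sum>p | p permutes {0..<k}. of_int (sign p) * (\<Prod>j<k. poly.coeff (monom (1 :: 'a) (k - 1 - j)) (p j)))"
  proof -
    have "[0..<k] ! p j = p j" if "p permutes {0..<k}" "j < k" for p j
      using permutes_in_image[OF that(1), of j] that(2) by simp
    then show ?thesis by (auto simp: wedge_def intro!: sum.cong prod.cong)
  qed
  also have "\<dots> = (\<Sum>p | p permutes {0..<k}. if p = r then of_int (sign r) else 0)"
  proof (intro sum.cong refl)
    fix p assume "p \<in> {p. p permutes {0..<k}}"
    then have p: "p permutes {0..<k}" by simp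
    show "of_int (sign p) * (\<Prod>j<k. poly.coeff (monom (1 :: 'a) (k - 1 - j)) (p j)) = (if p = r then of_int (sign r) else 0)"
    proof (cases "p = r")
      case True
      then show ?thesis by (simp add: r_def)
    next
      case False
      then obtain j where "p j \<noteq> r j" by blast
      moreover from this have "j < k" using permutes_not_in[OF p, of j] by (auto simp: r_def split: if_splits)
      ultimately have "(\<Prod>j<k. poly.coeff (monom (1 :: 'a) (k - 1 - j)) (p j)) = 0"
        by (intro prod_zero bexI[of _ j]) (auto simp: r_def)
      with False show ?thesis by simp
    qed
  qed
  also have "\<dots> = of_int (sign r)"
    using finite_permutations[of "{0..<k}"] r by simp
  also have "\<dots> \<noteq> (0 :: 'a)" by (simp add: sign_def)
  finally show ?thesis .
qed

lemma single_zprod: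
  assumes "keys a \<subseteq> {0..k}" "\<And>i. lookup a i \<ge> 0"
  shows "(\<Prod>i\<leftarrow>[0..<k + 1]. zvar i ^ nat (lookup a i)) = (single (a, 0) 1 :: 'a::field bipoly)"
proof -
  have "(\<Prod>i\<leftarrow>is. zvar i ^ nat (lookup a i)) = (single (\<Sum>i\<leftarrow>is. single i (lookup a i), 0) 1 :: 'a bipoly)" for "is"
    using assms(2) by (induction "is") (simp_all add: zvar_power mult_single flip: zero_prod_def)
  moreover have "(\<Sum>i\<leftarrow>[0..<k + 1]. single i (lookup a i)) = a"
  proof -
    have "(\<Sum>i\<leftarrow>[0..<k + 1]. single i (lookup a i)) = (\<Sum>i\<in>{0..k}. single i (lookup a i))"
      by (simp add: sum_list_distinct_conv_sum_set atLeastLessThanSuc_atLeastAtMost del: upt_Suc)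
    also have "\<dots> = (\<Sum>i\<in>keys a. single i (lookup a i))"
      using assms(1) by (intro sum.mono_neutral_right) (auto simp: in_keys_iff)
    finally show ?thesis by (simp add: sum_single_keys)
  qed
  ultimately show ?thesis by (simp del: upt_Suc)
qed

context secant begin

definition tw :: nat where "tw = n + 1 - 2 * k"

text \<open>The wedge \<open>wedge_top k\<close> uses the indices below \<open>k\<close>, and each
  operator \<open>z_i\<close> extends the range by one, so \<open>tw\<close> of them reach exactly
  the exterior power of \<open>Sym^{n-k} U\<close>.\<close>

lemma k_tw: "k + tw = m"
  using k2 by (simp add: tw_def)

text \<open>Up to sign the leading \<open>k\<close> by \<open>k\<close> determinant of the Hankel
  matrix \<open>(y_{s+t})\<close>.\<close>

definition gm :: "'a::field bipoly" where
  "gm = minor m k (wedge_top k) k"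

abbreviation Sym :: "'a::field bipoly set" where
  "Sym \<equiv> carrier (sym_divided_module k tw)"

lemma gm_loc: "(gm :: 'a::field bipoly) \<in> loc n k I" "keys (gm :: 'a bipoly) \<subseteq> {u. fst u = 0 \<and> deg_y (snd u) = int k}"
proof -
  have w: "supp_on m k (wedge_top k :: nat set \<Rightarrow> 'a)"
    by (rule supp_on_mono[OF wedge_top_supp]) (use k2 in auto)
  show "gm \<in> (loc n k I :: 'a bipoly set)" "keys (gm :: 'a bipoly) \<subseteq> {u. fst u = 0 \<and> deg_y (snd u) = int k}"
    unfolding gm_def by (rule minor_loc[OF w order_refl])+
qed

lemma mono_act_minor:
  assumes a: "keys a \<subseteq> {0..k}" "\<And>i. lookup a i \<ge> 0" "deg_z a = int tw"
  shows "supp_on m k (mono_act k a (wedge_top k) :: nat set \<Rightarrow> 'a::field)"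
    and "single (a, 0) 1 * gm - zvar k ^ tw * minor m k (mono_act k a (wedge_top k)) k \<in> (rel_ideal n k I :: 'a bipoly set)"
proof -
  have "int (\<Sum>i\<leftarrow>[0..<k + 1]. nat (lookup a i)) = deg_z a"
    using a(2) by (simp add: deg_z_ge[OF a(1)] sum_list_distinct_conv_sum_set atLeastLessThanSuc_atLeastAtMost of_nat_sum
        del: upt_Suc)
  then have deg: "(\<Sum>i\<leftarrow>[0..<k + 1]. nat (lookup a i)) = tw" using a(3) by (simp only: of_nat_eq_iff)
  have "k + (\<Sum>i\<leftarrow>[0..<k + 1]. nat (lookup a i)) \<le> m" "set [0..<k + 1] \<subseteq> {0..k}"
    by (simp only: deg k_tw) auto
  from minor_act_foldr[OF wedge_top_supp this, of I]
  show "supp_on m k (mono_act k a (wedge_top k) :: nat set \<Rightarrow> 'a)"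
    and "single (a, 0) 1 * gm - zvar k ^ tw * minor m k (mono_act k a (wedge_top k)) k \<in> (rel_ideal n k I :: 'a bipoly set)"
    unfolding deg k_tw single_zprod[OF a(1,2)] unfolding mono_act_def gm_def by blast+
qed

lemma Sym_keys:
  assumes "f \<in> Sym" "u \<in> keys f"
  shows "keys (fst u) \<subseteq> {0..k}" "lookup (fst u) i \<ge> 0" "deg_z (fst u) = int tw" "snd u = 0"
proof -
  have "u \<in> loc_keys n k {}" "u \<in> term_keys (int tw) (\<lambda>d. d = 0) 0"
    using assms unfolding sym_divided_carrier loc_iff by auto
  then show "keys (fst u) \<subseteq> {0..k}" "lookup (fst u) i \<ge> 0" "deg_z (fst u) = int tw" "snd u = 0"
    by (auto simp: loc_keys_def term_keys_def deg_y_eq_0_iff not_less)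
qed

lemma hermite_map_eq: "hermite_map k f = (\<lambda>S. \<Sum>u\<in>keys f. lookup f u * mono_act k (fst u) (wedge_top k) S)"
  by (simp add: fun_eq_iff hermite_map_def sym_act_superset[of "keys f" f])

lemma supp_on_sum: "(\<And>x. x \<in> X \<Longrightarrow> supp_on d q (w x)) \<Longrightarrow> supp_on d q (\<lambda>T. \<Sum>x\<in>X. w x T :: 'r::comm_ring_1)"
  by (induction X rule: infinite_finite_induct) (auto simp: supp_on_0 intro!: supp_on_add)

lemma hermite_map_supp: "f \<in> Sym \<Longrightarrow> supp_on m k (hermite_map k f)"
  unfolding hermite_map_eq using Sym_keys
  by (intro supp_on_sum supp_on_scale mono_act_minor(1)) blast+

lemma minor_sum: "minor m k (\<lambda>T. \<Sum>x\<in>X. w x T) i = (\<Sum>x\<in>X. minor m k (w x) i)"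
  by (induction X rule: infinite_finite_induct) (simp_all add: minor_0 minor_add)

theorem hermite_map_minor:
  assumes f: "f \<in> Sym"
  shows "f * gm - zvar k ^ tw * minor m k (hermite_map k f) k \<in> rel_ideal n k I"
proof -
  have f_eq: "(\<Sum>u\<in>keys f. single 0 (lookup f u) * single (fst u, 0) 1) = f"
  proof -
    have "(\<Sum>u\<in>keys f. single 0 (lookup f u) * single (fst u, 0) 1) = (\<Sum>u\<in>keys f. single u (lookup f u))"
      by (intro sum.cong refl) (metis Sym_keys(4)[OF f] add_0 mult.right_neutral mult_single prod.collapse)
    then show ?thesis by (simp add: sum_single_keys)
  qed
  have "(\<Sum>u\<in>keys f. single 0 (lookup f u) * (single (fst u, 0) 1 * gm
      - zvar k ^ tw * minor m k (mono_act k (fst u) (wedge_top k)) k)) \<in> rel_ideal n k I"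
    using Sym_keys[OF f] by (intro rel_ideal_sum rel_ideal_closed(3) const_loc mono_act_minor(2)) auto
  also have "(\<Sum>u\<in>keys f. single 0 (lookup f u) * (single (fst u, 0) 1 * gm
      - zvar k ^ tw * minor m k (mono_act k (fst u) (wedge_top k)) k))
    = (\<Sum>u\<in>keys f. single 0 (lookup f u) * single (fst u, 0) 1) * gm
      - zvar k ^ tw * (\<Sum>u\<in>keys f. single 0 (lookup f u) * minor m k (mono_act k (fst u) (wedge_top k)) k)"
    by (simp add: right_diff_distrib sum_subtractf sum_distrib_left sum_distrib_right mult_ac)
  also have "(\<Sum>u\<in>keys f. single 0 (lookup f u) * minor m k (mono_act k (fst u) (wedge_top k)) k)
    = minor m k (hermite_map k f) k"
    unfolding hermite_map_eq by (simp add: minor_sum minor_scale)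
  finally show ?thesis by (simp only: f_eq)
qed

text \<open>The section of \<open>O(-1)\<close> belonging to \<open>w\<close> vanishes on the chart
  \<open>{k}\<close>, hence everywhere, and \<open>w\<close> is recovered from the section as its
  residue.\<close>

theorem minor_injective:
  fixes w :: "nat set \<Rightarrow> 'a::field"
  assumes w: "supp_on m k w" and "minor m k w k \<in> rel_ideal n k {k}"
  shows "w = (\<lambda>T. 0)"
proof -
  have carr: "w \<in> carrier (ext_module k (n - k))" "(\<lambda>T. 0 :: 'a) \<in> carrier (ext_module k (n - k))"
    using w by (auto simp: ext_module_carrier supp_on_0)
  note comp = compatible_expl[OF const_fun_ext_y[OF carr(1)]]
  have "(- 1) ^ k * zinv k * minor m k w k \<in> rel_ideal n k {k}"
    using assms(2) by (intro rel_ideal_closed(3) loc_ring_closed ring_subset_neg_one_power[OF ring_subset_loc] zinv_loc) auto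
  then have "expl m k (const_fun w) {k} {} \<in> rel_ideal n k {k}" by (simp only: expl_minor)
  from compatible_vanish[OF comp this]
  have "expl m k (const_fun w) {i} {} \<in> rel_ideal n k {i}" if "i \<le> k" for i using that by blast
  moreover have "expl m k (const_fun (\<lambda>T. 0 :: 'a)) {i} {} = 0" for i by (simp add: expl_minor minor_0)
  ultimately have "sec_of (const_fun w) = sec_of (const_fun (\<lambda>T. 0))"
    unfolding sec_of_def using mk_section_eq_iff[OF comp compatible_expl[OF const_fun_ext_y[OF carr(2)]]] by simp
  then have "(\<lambda>T. gen_sign * w T) = (\<lambda>T. gen_sign * 0)"
    using generator_ident_sec_of[OF carr(1)] generator_ident_sec_of[OF carr(2)] by simp
  then have "gen_sign * w T = 0" for T by (auto simp: fun_eq_iff)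
  moreover have "(gen_sign :: 'a) \<noteq> 0" by (metis gen_sign_square(1) mult_zero_left zero_neq_one)
  ultimately show ?thesis by (simp add: fun_eq_iff)
qed

lemma gm_not_rel: "gm \<notin> rel_ideal n k {k}"
proof
  assume "gm \<in> (rel_ideal n k {k} :: 'a::field bipoly set)"
  then have "wedge_top k = (\<lambda>T. 0 :: 'a)"
    unfolding gm_def using kn k2 by (intro minor_injective supp_on_mono[OF wedge_top_supp]) auto
  then show False using wedge_top_nonzero[of k, where 'a = 'a] by simp
qed

lemma gm_cancel:
  assumes "f * gm \<in> rel_ideal n k {k}" "f \<in> loc n k {k}"
  shows "f \<in> rel_ideal n k {k}"
  using rel_ideal_prime[OF assms(2) gm_loc(1) assms(1)] gm_not_rel by blast

lemma y_constant_rel_ideal: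
  assumes "f \<in> rel_ideal n k I" "keys f \<subseteq> term_keys r (\<lambda>d. d = 0) 0"
  shows "f = 0"
proof -
  have "u \<notin> keys f" for u
    using rel_ideal_deg_y[OF assms(1), of u] assms(2) by (auto simp: term_keys_def)
  then have "keys f = {}" by blast
  then show ?thesis by simp
qed

lemma Sym_diff:
  assumes "f \<in> Sym" "g \<in> Sym"
  shows "f - g \<in> Sym"
  using assms keys_diff[of f g] ring_subsetD(4)[OF ring_subset_loc]
  unfolding sym_divided_carrier by blast

lemma Sym_add:
  assumes "f \<in> Sym" "g \<in> Sym"
  shows "f + g \<in> Sym"
  using assms Poly_Mapping.keys_add[of f g] loc_ring_closed(1)
  unfolding sym_divided_carrier by blast

lemma Sym_scale:
  assumes "f \<in> Sym"
  shows "single 0 c * f \<in> Sym"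
proof -
  have "keys (single 0 c * f) \<subseteq> keys f" by (auto simp: in_keys_iff lookup_const_mult)
  moreover have "single 0 c * f \<in> loc n k {}"
    using assms unfolding sym_divided_carrier by (intro loc_ring_closed const_loc) blast
  ultimately show ?thesis using assms unfolding sym_divided_carrier by blast
qed

lemma hermite_map_add: "hermite_map k (f + g) = (\<lambda>T. hermite_map k f T + hermite_map k g T)"
  by (simp add: hermite_map_def fun_eq_iff sym_act_add)

lemma hermite_map_scale: "hermite_map k (single 0 c * f) = (\<lambda>T. c * hermite_map k f T)"
  by (simp add: hermite_map_def fun_eq_iff sym_act_scale)

text \<open>If two forms have equal images, then their difference times \<open>gm\<close> is zero on
  the chart \<open>{k}\<close>, and \<open>gm\<close> can be cancelled in a domain.\<close>

lemma hermite_map_inj: "inj_on (hermite_map k) Sym"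
proof (rule inj_onI)
  fix f g assume f: "f \<in> Sym" and g: "g \<in> Sym" and eq: "hermite_map k f = hermite_map k g"
  have "(f * gm - zvar k ^ tw * minor m k (hermite_map k f) k)
    - (g * gm - zvar k ^ tw * minor m k (hermite_map k g) k) \<in> rel_ideal n k {k}"
    using f g by (intro rel_ideal_closed(2) hermite_map_minor)
  then have *: "(f - g) * gm \<in> rel_ideal n k {k}" by (simp add: eq left_diff_distrib)
  have fg: "f - g \<in> Sym" by (rule Sym_diff[OF f g])
  then have "f - g \<in> loc n k {k}"
    using loc_ring_mono[of "{}" "{k}" n k] unfolding sym_divided_carrier by blast
  then have "f - g \<in> rel_ideal n k {k}" by (rule gm_cancel[OF *])
  then have "f - g = 0" using fg unfolding sym_divided_carrier by (blast intro: y_constant_rel_ideal)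
  then show "f = g" by simp
qed

text \<open>The first half of surjectivity, by induction on the degree through
  \<open>tensor_act_generates\<close>. Asking for a form with the right minor, instead of a preimage
  of \<open>w\<close>, keeps the argument in a commutative ring, whatever the order of the
  operators.\<close>

lemma minor_realized:
  assumes "q \<le> tw" "supp_on (k + q) k w"
  shows "\<exists>f\<in>carrier (sym_divided_module k q). zvar k ^ q * minor m k w k - f * gm \<in> rel_ideal n k {k}"
  using assms
proof (induction q arbitrary: w)
  case 0
  let ?W = "wedge_top k :: nat set \<Rightarrow> 'a"
  \<comment> \<open>For \<open>q = 0\<close> the exterior power is one-dimensional and spanned by
    \<open>wedge_top k\<close>.\<close>
  define c where "c = w {0..<k} / ?W {0..<k}"
  have "w T = c * ?W T" for T
  proof (cases "T \<subseteq> {0..<k} \<and> card T = k")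
    case True
    then have "T = {0..<k}" using card_subset_eq[of "{0..<k}" T] by simp
    then show ?thesis using wedge_top_nonzero[of k, where 'a = 'a] by (simp add: c_def)
  next
    case False
    then show ?thesis using supp_onD[of k k w T] supp_onD[OF wedge_top_supp[where 'a = 'a] False] 0 by simp
  qed
  then have "w = (\<lambda>T. c * ?W T)" by blast
  then have "minor m k w k = single 0 c * gm" by (simp add: minor_scale gm_def)
  moreover have "single 0 c \<in> carrier (sym_divided_module k 0)"
    unfolding sym_divided_carrier by (auto simp: const_loc term_keys_def split: if_splits)
  ultimately show ?case by (intro bexI[of _ "single 0 c"]) (auto simp: rel_ideal_0)
next
  case (Suc q)
  define C where "C = {w :: nat set \<Rightarrow> 'a. \<exists>f\<in>carrier (sym_divided_module k (Suc q)).
      zvar k ^ Suc q * minor m k w k - f * gm \<in> rel_ideal n k {k}}"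
  have "w \<in> C"
  proof (rule tensor_act_generates)
    show "1 \<le> k" "k \<le> k + q" "supp_on (Suc (k + q)) k w" using k1 Suc.prems by simp_all
    show "(\<lambda>T. 0) \<in> C"
      unfolding C_def by (auto intro!: bexI[of _ 0] simp: minor_0 rel_ideal_0 sym_divided_carrier loc_ring_closed)
  next
    fix v w assume "v \<in> C" "w \<in> C"
    then obtain f g where f: "f \<in> carrier (sym_divided_module k (Suc q))" "zvar k ^ Suc q * minor m k v k - f * gm \<in> rel_ideal n k {k}"
      and g: "g \<in> carrier (sym_divided_module k (Suc q))" "zvar k ^ Suc q * minor m k w k - g * gm \<in> rel_ideal n k {k}"
      unfolding C_def by blast
    have "f + g \<in> carrier (sym_divided_module k (Suc q))"
      using f(1) g(1) Poly_Mapping.keys_add[of f g] loc_ring_closed(1) unfolding sym_divided_carrier by blast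
    moreover have "zvar k ^ Suc q * minor m k (\<lambda>T. v T + w T) k - (f + g) * gm \<in> rel_ideal n k {k}"
      using rel_ideal_closed(1)[OF f(2) g(2)] by (simp add: minor_add algebra_simps)
    ultimately show "(\<lambda>T. v T + w T) \<in> C" unfolding C_def by blast
  next
    fix c and w assume "w \<in> C"
    then obtain f where f: "f \<in> carrier (sym_divided_module k (Suc q))" "zvar k ^ Suc q * minor m k w k - f * gm \<in> rel_ideal n k {k}"
      unfolding C_def by blast
    have "keys (single 0 c * f) \<subseteq> keys f" by (auto simp: in_keys_iff lookup_const_mult)
    moreover have "single 0 c * f \<in> loc n k {}"
      using f(1) unfolding sym_divided_carrier by (intro loc_ring_closed const_loc) blast
    ultimately have "single 0 c * f \<in> carrier (sym_divided_module k (Suc q))"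
      using f(1) unfolding sym_divided_carrier by blast
    moreover have "zvar k ^ Suc q * minor m k (\<lambda>T. c * w T) k - single 0 c * f * gm \<in> rel_ideal n k {k}"
      using rel_ideal_closed(3)[OF const_loc f(2), of c] by (simp add: minor_scale algebra_simps)
    ultimately show "(\<lambda>T. c * w T) \<in> C" unfolding C_def by blast
  next
    fix i and w :: "nat set \<Rightarrow> 'a" assume i: "i \<le> k" and w: "supp_on (k + q) k w"
    obtain f where f: "f \<in> carrier (sym_divided_module k q)" "zvar k ^ q * minor m k w k - f * gm \<in> rel_ideal n k {k}"
      using Suc.IH[OF _ w] Suc.prems(1) by auto
    have d: "k + q < m" using Suc.prems(1) k_tw by simp
    have "zvar i * (zvar k ^ q * minor m k w k - f * gm)
      - zvar k ^ q * (zvar i * minor m k w k - zvar k * minor m k (tensor_act k (coord_tensor k i) w) k) \<in> rel_ideal n k {k}"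
      using i by (intro rel_ideal_closed(2,3) f(2) minor_act[OF w d i] loc_power zvar_loc) auto
    then have "zvar k ^ Suc q * minor m k (tensor_act k (coord_tensor k i) w) k - (zvar i * f) * gm \<in> rel_ideal n k {k}"
      by (simp add: algebra_simps)
    moreover have "zvar i * f \<in> carrier (sym_divided_module k (Suc q))"
    proof -
      have "keys (zvar i * f) \<subseteq> term_keys (int (Suc q)) (\<lambda>d. d = 0) 0"
      proof
        fix v assume "v \<in> keys (zvar i * f)"
        then obtain u where "v = (single i 1, 0) + u" "u \<in> keys f"
          using Poly_Mapping.keys_mult[of "zvar i" f] by (auto simp: zvar_def)
        with f(1) show "v \<in> term_keys (int (Suc q)) (\<lambda>d. d = 0) 0"
          unfolding sym_divided_carrier by (auto simp: term_keys_def deg_z_add)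
      qed
      with f(1) i show ?thesis unfolding sym_divided_carrier by (auto intro: loc_ring_closed zvar_loc)
    qed
    ultimately show "tensor_act k (coord_tensor k i) w \<in> C" unfolding C_def by blast
  qed
  then show ?case by (simp only: C_def mem_Collect_eq)
qed

theorem hermite_map_bij: "bij_betw (hermite_map k) Sym (carrier (ext_module k (n - k) :: ('a::field, nat set \<Rightarrow> 'a) module))"
  unfolding bij_betw_def
proof
  show "hermite_map k ` Sym = carrier (ext_module k (n - k) :: ('a, nat set \<Rightarrow> 'a) module)"
  proof
    show "hermite_map k ` Sym \<subseteq> carrier (ext_module k (n - k) :: ('a, nat set \<Rightarrow> 'a) module)"
      using hermite_map_supp by (auto simp: ext_module_carrier)
    show "carrier (ext_module k (n - k) :: ('a, nat set \<Rightarrow> 'a) module) \<subseteq> hermite_map k ` Sym"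
    proof
      fix w :: "nat set \<Rightarrow> 'a" assume "w \<in> carrier (ext_module k (n - k))"
      then have w: "supp_on m k w" by (simp add: ext_module_carrier)
      then obtain f where f: "f \<in> Sym" "zvar k ^ tw * minor m k w k - f * gm \<in> rel_ideal n k {k}"
        using minor_realized[of tw w] k_tw by auto
      \<comment> \<open>The second half of surjectivity: \<open>w\<close> and the image of
        \<open>f\<close> have the same minor, so their difference vanishes by
        \<open>minor_injective\<close>.\<close>
      define v where "v T = w T + (- 1) * hermite_map k f T" for T
      have v: "supp_on m k v"
        unfolding v_def by (intro supp_on_add w supp_on_scale hermite_map_supp f(1))
      have v_eq: "minor m k v k = minor m k w k - minor m k (hermite_map k f) k"
        unfolding v_def minor_add minor_scale by (simp add: single_uminus)
      have "zvar k ^ tw * minor m k v k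
        = (zvar k ^ tw * minor m k w k - f * gm) + (f * gm - zvar k ^ tw * minor m k (hermite_map k f) k)"
        by (simp only: v_eq) (simp add: right_diff_distrib)
      also have "\<dots> \<in> rel_ideal n k {k}" by (intro rel_ideal_closed(1) f(2) hermite_map_minor f(1))
      finally have "minor m k v k \<in> rel_ideal n k {k}" by (rule rel_ideal_cancel_zvar)
      then have "v = (\<lambda>T. 0)" by (rule minor_injective[OF v])
      then have "w = hermite_map k f" by (simp add: v_def fun_eq_iff)
      with f(1) show "w \<in> hermite_map k ` Sym" by blast
    qed
  qed
qed (rule hermite_map_inj)

lemma hermite_eqI: "f \<in> Sym \<Longrightarrow> hermite_map k f = w \<Longrightarrow> hermite n k w = f"
  using inv_into_f_f[OF hermite_map_inj, of f] by (auto simp: hermite_def tw_def)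

lemma hermite_Sym:
  fixes w :: "nat set \<Rightarrow> 'a::field"
  assumes "w \<in> carrier (ext_module k (n - k))"
  shows "hermite n k w \<in> Sym" "hermite_map k (hermite n k w) = w"
proof -
  have "w \<in> hermite_map k ` Sym" using assms by (simp only: bij_betw_imp_surj_on[OF hermite_map_bij])
  then obtain f where f: "f \<in> Sym" "hermite_map k f = w" by (elim imageE) simp
  then have "hermite n k w = f" by (rule hermite_eqI)
  with f show "hermite n k w \<in> Sym" "hermite_map k (hermite n k w) = w" by simp_all
qed

theorem hermite_iso:
  "hermite n k \<in> module_iso (ext_module k (n - k)) (sym_divided_module k (n + 1 - 2 * k)) (UNIV :: 'a::field set)"
proof -
  let ?E = "ext_module k (n - k) :: ('a, nat set \<Rightarrow> 'a) module" and ?S = "sym_divided_module k tw :: ('a, 'a bipoly) module"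
  have "bij_betw (hermite n k) (carrier ?E) (carrier ?S)"
    unfolding hermite_def tw_def[symmetric] by (rule bij_betw_inv_into[OF hermite_map_bij])
  moreover have "hermite n k (v \<oplus>\<^bsub>?E\<^esub> w) = hermite n k v \<oplus>\<^bsub>?S\<^esub> hermite n k w"
    if "v \<in> carrier ?E" "w \<in> carrier ?E" for v w
  proof (rule hermite_eqI)
    show "hermite n k v \<oplus>\<^bsub>?S\<^esub> hermite n k w \<in> Sym"
      using Sym_add[OF hermite_Sym(1)[OF that(1)] hermite_Sym(1)[OF that(2)]] by (simp add: sym_divided_module_def)
    show "hermite_map k (hermite n k v \<oplus>\<^bsub>?S\<^esub> hermite n k w) = v \<oplus>\<^bsub>?E\<^esub> w"
      using hermite_Sym(2)[OF that(1)] hermite_Sym(2)[OF that(2)]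
      by (simp add: sym_divided_module_def ext_module_def hermite_map_add)
  qed
  moreover have "hermite n k (c \<odot>\<^bsub>?E\<^esub> w) = c \<odot>\<^bsub>?S\<^esub> hermite n k w" if "w \<in> carrier ?E" for c w
  proof (rule hermite_eqI)
    show "c \<odot>\<^bsub>?S\<^esub> hermite n k w \<in> Sym"
      using Sym_scale[OF hermite_Sym(1)[OF that], of c] by (simp add: sym_divided_module_def)
    show "hermite_map k (c \<odot>\<^bsub>?S\<^esub> hermite n k w) = c \<odot>\<^bsub>?E\<^esub> w"
      using hermite_Sym(2)[OF that] by (simp add: sym_divided_module_def ext_module_def hermite_map_scale)
  qed
  ultimately show ?thesis by (simp add: module_iso_def tw_def)
qed

end

section \<open>The isomorphism between the two modules\<close>

context secant begin

lemma compatible_diff: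
  fixes f g :: "nat \<Rightarrow> 'a::field bipoly"
  assumes "compatible f" "compatible g"
  shows "compatible (\<lambda>i. f i - g i)"
proof -
  have "compatible (\<lambda>i. - 1 :: 'a bipoly)" by (intro compatible_const loc_ring_closed)
  from compatible_add[OF assms(1) compatible_mult[OF this assms(2)]] show ?thesis by simp
qed

lemma gsec_add:
  assumes "s \<in> gsec r Y" "t \<in> gsec r Y"
  shows "gadd n k s t \<in> gsec r Y"
proof -
  obtain f where f: "s = mk_section f" "compatible f" "\<forall>i\<le>k. keys (f i) \<subseteq> term_keys r Y 0"
    using assms(1) by (rule gsecE)
  obtain g where g: "t = mk_section g" "compatible g" "\<forall>i\<le>k. keys (g i) \<subseteq> term_keys r Y 0"
    using assms(2) by (rule gsecE)
  show ?thesis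
    unfolding f(1) g(1) gadd_mk_section[OF f(2) g(2)]
  proof (intro gsecI compatible_add f(2) g(2))
    show "keys (f i + g i) \<subseteq> term_keys r Y 0" if "i \<le> k" for i
      using that f(3) g(3) Poly_Mapping.keys_add[of "f i" "g i"] by blast
  qed
qed

lemma gsec_mult:
  assumes "s \<in> gsec q X" "t \<in> gsec r Y" and Z: "\<And>d e. X d \<Longrightarrow> Y e \<Longrightarrow> Z (d + e)"
  shows "gmult n k s t \<in> gsec (q + r) Z"
proof -
  obtain f where f: "s = mk_section f" "compatible f" "\<forall>i\<le>k. keys (f i) \<subseteq> term_keys q X 0"
    using assms(1) by (rule gsecE)
  obtain g where g: "t = mk_section g" "compatible g" "\<forall>i\<le>k. keys (g i) \<subseteq> term_keys r Y 0"
    using assms(2) by (rule gsecE)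
  show ?thesis
    unfolding f(1) g(1) gmult_mk_section[OF f(2) g(2)]
  proof (intro gsecI compatible_mult f(2) g(2))
    fix i assume i: "i \<le> k"
    show "keys (f i * g i) \<subseteq> term_keys (q + r) Z 0"
    proof
      fix u assume "u \<in> keys (f i * g i)"
      then obtain v w where "u = v + w" "v \<in> keys (f i)" "w \<in> keys (g i)"
        using Poly_Mapping.keys_mult[of "f i" "g i"] by blast
      moreover from this have "v \<in> term_keys q X 0" "w \<in> term_keys r Y 0" using f(3) g(3) i by blast+
      ultimately show "u \<in> term_keys (q + r) Z 0"
        using Z[of "deg_y (snd v)" "deg_y (snd w)"] by (simp add: term_keys_def deg_z_add deg_y_add)
    qed
  qed
qed

lemma gsec_0: "gpoly n k 0 \<in> gsec r Y"
  by (rule gpoly_gsec) (simp_all add: loc_ring_closed)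

lemma gsec_mono: "s \<in> gsec r Y \<Longrightarrow> (\<And>d. Y d \<Longrightarrow> Z d) \<Longrightarrow> s \<in> gsec r Z"
  unfolding gsec_def term_keys_def by blast

lemma single_y_loc: "keys b \<subseteq> {0..n} \<Longrightarrow> single (0, b) c \<in> loc n k I"
  by (rule single_loc) (simp add: loc_keys_def)

lemma gpoly_single_y:
  assumes "keys b \<subseteq> {0..n}"
  shows "gpoly n k (single (0, b) c) \<in> gsec 0 (\<lambda>d. d = deg_y b)"
  by (rule gpoly_gsec[OF single_y_loc[OF assms]]) (simp add: term_keys_def)

text \<open>Sums of generators multiplied by monomials in the \<open>yvar\<close>, with
  \<open>Q\<close> controlling their degrees; scalars are absorbed in the generators. Being
  inductive, the predicate can be carried through \<open>hrel\<close> summand by summand.\<close>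

inductive ygen :: "'a::field gsection set \<Rightarrow> (int \<Rightarrow> bool) \<Rightarrow> 'a gsection \<Rightarrow> bool" for V Q where
  ygen_0: "ygen V Q (gpoly n k 0)"
| ygen_step: "v \<in> V \<Longrightarrow> keys b \<subseteq> {0..n} \<Longrightarrow> Q (deg_y b) \<Longrightarrow> ygen V Q s
    \<Longrightarrow> ygen V Q (gadd n k (gmult n k (gpoly n k (single (0, b) 1)) v) s)"

lemma ygen_gsec:
  assumes "ygen V Q s" "V \<subseteq> gsec r (\<lambda>d. d = e)" "\<And>d. d \<ge> 0 \<Longrightarrow> Q d \<Longrightarrow> Y (d + e)"
  shows "s \<in> gsec r Y"
  using assms(1)
proof (induction rule: ygen.induct)
  case (ygen_step v b s)
  have "gmult n k (gpoly n k (single (0, b) 1)) v \<in> gsec (0 + r) Y"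
  proof (rule gsec_mult[OF gpoly_single_y])
    show "keys b \<subseteq> {0..n}" by fact
    show "v \<in> gsec r (\<lambda>d. d = e)" using ygen_step assms(2) by blast
    show "Y (d + e')" if "d = deg_y b" "e' = e" for d e'
      using assms(3)[OF deg_y_nonneg[of b]] ygen_step that by simp
  qed
  with ygen_step show ?case by (simp add: gsec_add)
qed (rule gsec_0)

theorem gsec_nonneg_ygen:
  fixes t :: "'a::field gsection"
  assumes "t \<in> gsec (int q) Y"
  shows "ygen (gsec (int q) (\<lambda>d. d = 0)) Y t"
proof -
  obtain g where g: "g \<in> loc n k {}" "keys g \<subseteq> term_keys (int q) Y 0" "t = gpoly n k g"
    using gsec_nonneg[OF _ assms] by auto
  have "ygen (gsec (int q) (\<lambda>d. d = 0)) Y (gpoly n k (\<Sum>u\<in>U. single u (lookup g u)))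
      \<and> (\<Sum>u\<in>U. single u (lookup g u)) \<in> loc n k {}" if "U \<subseteq> keys g" for U
    using finite_subset[OF that finite_keys] that
  proof (induction U rule: finite_induct)
    case (insert u U)
    let ?h = "\<Sum>u\<in>U. single u (lookup g u)"
    obtain a b where u: "u = (a, b)" by (cases u)
    have ug: "u \<in> loc_keys n k {}" "u \<in> term_keys (int q) Y 0" using insert.prems g by (auto simp: loc_iff)
    have b: "keys b \<subseteq> {0..n}" "Y (deg_y b)" and a: "deg_z a = int q" and al: "(a, 0) \<in> loc_keys n k {}"
      using ug by (auto simp: u loc_keys_def term_keys_def)
    have al': "single (a, 0) (lookup g u) \<in> loc n k {}" by (rule single_loc[OF al])
    have eq: "single u (lookup g u) = single (0, b) 1 * single (a, 0) (lookup g u)" by (simp add: mult_single u)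
    have v: "gpoly n k (single (a, 0) (lookup g u)) \<in> gsec (int q) (\<lambda>d. d = 0)"
      by (rule gpoly_gsec[OF al']) (simp add: term_keys_def a deg_y_eq_0_iff)
    have ul: "single u (lookup g u) \<in> loc n k {}" by (rule single_loc[OF ug(1)])
    have h: "?h \<in> loc n k {}" "ygen (gsec (int q) (\<lambda>d. d = 0)) Y (gpoly n k ?h)" using insert by auto
    have "gpoly n k (single u (lookup g u) + ?h)
      = gadd n k (gmult n k (gpoly n k (single (0, b) 1)) (gpoly n k (single (a, 0) (lookup g u)))) (gpoly n k ?h)"
      unfolding gpoly_add[OF ul h(1)] by (simp only: eq gpoly_mult[OF single_y_loc[OF b(1)] al'])
    then have "ygen (gsec (int q) (\<lambda>d. d = 0)) Y (gpoly n k (single u (lookup g u) + ?h))"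
      using ygen_step[OF v b h(2)] by simp
    with insert(1,2) ul h(1) show ?case by (simp add: loc_ring_closed)
  qed (simp add: ygen_0 loc_ring_closed)
  from this[OF order_refl] show ?thesis by (simp add: g(3) sum_single_keys)
qed

text \<open>The section is linear in \<open>w\<close>, and the coefficient of each monomial of
  \<open>w\<close> is a constant element of the exterior power, hence a generator.\<close>

theorem gsec_minus_one_ygen:
  fixes s :: "'a::field gsection"
  assumes "s \<in> gsec (- 1) Y"
  shows "ygen (gsec (- 1) gen_deg) (\<lambda>d. Y (d + int k)) s"
proof -
  obtain w :: "nat set \<Rightarrow> 'a bipoly" where w: "w \<in> ext_y Y k" "s = sec_of w" using gsec_minus_one[OF assms] by blast
  \<comment> \<open>The exponents of all monomials in the \<open>yvar\<close> that occur in some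
    coordinate of \<open>w\<close>.\<close>
  define B where "B = (\<Union>T\<in>Pow {..<m}. snd ` keys (w T))"
  define W where "W U = (\<lambda>T. \<Sum>b\<in>U. single (0, b) 1 * const_fun (\<lambda>T. lookup (w T) (0, b)) T)" for U
  have supp: "supp_on m k w" and wl: "w T \<in> loc n k {}"
    and wk: "u \<in> keys (w T) \<Longrightarrow> fst u = 0 \<and> Y (deg_y (snd u) + int k)" for T u
    using w(1) unfolding ext_y_def by blast+
  have coeff: "(\<lambda>T. lookup (w T) (0, b)) \<in> carrier (ext_module k (n - k))" for b
    unfolding ext_module_carrier by (rule supp_on_map[OF supp]) simp
  have "finite B" by (simp add: B_def)
  have "ygen (gsec (- 1) gen_deg) (\<lambda>d. Y (d + int k)) (sec_of (W U)) \<and> W U \<in> ext_y (\<lambda>_. True) k" if "U \<subseteq> B" for U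
    using finite_subset[OF that \<open>finite B\<close>] that
  proof (induction U rule: finite_induct)
    case empty
    have "W {} = (\<lambda>T. 0)" by (simp add: W_def)
    moreover have "(\<lambda>T. 0 :: 'a bipoly) \<in> ext_y (\<lambda>_. True) k" by (simp add: ext_y_def supp_on_0 loc_ring_closed)
    moreover have "sec_of (\<lambda>T. 0 :: 'a bipoly) = gpoly n k 0"
      unfolding sec_of_def gpoly_mk_section using expl_scale[of m k 0 "\<lambda>T. 0 :: 'a bipoly"] by simp
    ultimately show ?case by (simp add: ygen_0)
  next
    case (insert b U)
    let ?c = "const_fun (\<lambda>T. lookup (w T) (0, b))"
    obtain T u where u: "u \<in> keys (w T)" "b = snd u" using insert.prems by (auto simp: B_def)
    have "u \<in> loc_keys n k {}" using u(1) wl[of T] by (auto simp: loc_iff)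
    then have b: "keys b \<subseteq> {0..n}" "Y (deg_y b + int k)" using wk[OF u(1)] by (auto simp: u(2) loc_keys_def)
    have c: "?c \<in> ext_y gen_deg k" by (rule const_fun_ext_y[OF coeff])
    have yl: "(single (0, b) 1 :: 'a bipoly) \<in> loc n k {}" by (rule single_y_loc[OF b(1)])
    have yc: "(\<lambda>T. single (0, b) 1 * ?c T) \<in> ext_y (\<lambda>_. True) k"
    proof -
      have "keys (single (0, b) 1 * ?c T) \<subseteq> {u. fst u = 0}" for T
        by (auto simp: const_fun_def mult_single split: if_splits)
      moreover have "supp_on m k ?c" "?c T \<in> loc n k {}" for T using c unfolding ext_y_def by blast+
      ultimately show ?thesis using yl by (auto simp: ext_y_def intro!: supp_on_scale loc_ring_closed)
    qed
    have IH: "ygen (gsec (- 1) gen_deg) (\<lambda>d. Y (d + int k)) (sec_of (W U))" "W U \<in> ext_y (\<lambda>_. True) k"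
      using insert by auto
    have W: "W (insert b U) = (\<lambda>T. single (0, b) 1 * ?c T + W U T)" using insert(1,2) by (simp add: W_def)
    have "sec_of (W (insert b U)) = gadd n k (gmult n k (gpoly n k (single (0, b) 1)) (sec_of ?c)) (sec_of (W U))"
      unfolding W sec_of_scale[OF yl c] by (rule sec_of_add[OF yc IH(2), symmetric])
    moreover have "W (insert b U) \<in> ext_y (\<lambda>_. True) k" unfolding W by (rule ext_y_add[OF yc IH(2)])
    ultimately show ?case using ygen_step[OF sec_of_gsec[OF c] b(1) _ IH(1)] b(2) by simp
  qed
  from this[OF order_refl] have "ygen (gsec (- 1) gen_deg) (\<lambda>d. Y (d + int k)) (sec_of (W B))" by blast
  moreover have "W B = w"
  proof (rule ext, rule poly_mapping_eqI)
    fix T u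
    have "W B T = (\<Sum>b\<in>B. single (0, b) (lookup (w T) (0, b)))"
      by (simp add: W_def const_fun_def mult_single flip: zero_prod_def)
    then have "lookup (W B T) u = (\<Sum>b\<in>B. if u = (0, b) then lookup (w T) u else 0)"
      by (auto simp: lookup_sum lookup_single when_def intro!: sum.cong)
    also have "\<dots> = (if fst u = 0 then \<Sum>b\<in>B. if b = snd u then lookup (w T) u else 0 else 0)"
      by (auto simp: prod_eq_iff intro!: sum.cong)
    also have "\<dots> = lookup (w T) u"
    proof (cases "u \<in> keys (w T)")
      case True
      then have "w T \<noteq> 0" by auto
      then have "T \<subseteq> {..<m}" using supp_onD[OF supp, of T] by (auto simp: atLeast0LessThan)
      with True have "snd u \<in> B" unfolding B_def by blast
      with wk[OF True] \<open>finite B\<close> show ?thesis by simp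
    qed (auto simp: in_keys_iff intro!: sum.neutral)
    finally show "lookup (W B T) u = lookup (w T) u" .
  qed
  ultimately show ?thesis by (simp add: w(2))
qed

text \<open>
  A section \<open>s\<close> of \<open>O(-1)\<close> corresponds to the section \<open>t\<close> of \<open>O(n-2k+1)\<close> with
  \<open>z\<^sub>k\<^bsup>n-2k+2\<^esup> s = \<plusminus> gm t\<close> on the chart \<open>D\<^bsub>{k}\<^esub>\<close>.
\<close>

definition hsign :: "'a::field bipoly" where
  "hsign = (- 1) ^ k * single 0 gen_sign"

definition hrel :: "'a::field gsection \<Rightarrow> 'a gsection \<Rightarrow> bool" where
  "hrel s t \<longleftrightarrow> (\<exists>f g. compatible f \<and> compatible g \<and> s = mk_section f \<and> t = mk_section g
     \<and> zvar k ^ Suc tw * f k - hsign * gm * g k \<in> rel_ideal n k {k})"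

lemma hsign_square: "hsign * hsign = (1 :: 'a::field bipoly)"
proof -
  have "hsign * hsign = ((- 1) ^ k * (- 1) ^ k) * (single 0 gen_sign * single 0 gen_sign :: 'a bipoly)"
    by (simp only: hsign_def mult_ac)
  then show ?thesis by (simp add: mult_single flip: power_add mult_2)
qed

lemma hsign_loc: "hsign \<in> loc n k I"
  unfolding hsign_def by (intro loc_ring_closed const_loc ring_subset_neg_one_power[OF ring_subset_loc])

lemma zvar_k_loc: "zvar k \<in> loc n k I"
  by (rule zvar_loc) simp

lemma hrelE:
  assumes "hrel s t"
  obtains f g where "compatible f" "compatible g" "s = mk_section f" "t = mk_section g"
    "zvar k ^ Suc tw * f k - hsign * gm * g k \<in> rel_ideal n k {k}"
  using assms unfolding hrel_def by blast

lemma hrel_0: "hrel (gpoly n k 0) (gpoly n k 0)"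
  unfolding hrel_def gpoly_mk_section
  using compatible_const[OF loc_ring_closed(4)]
  by (intro exI[of _ "\<lambda>_. 0"]) (simp add: rel_ideal_0)

lemma hrel_add:
  assumes "hrel s t" "hrel s' t'"
  shows "hrel (gadd n k s s') (gadd n k t t')"
proof -
  obtain f g where fg: "compatible f" "compatible g" "s = mk_section f" "t = mk_section g"
    "zvar k ^ Suc tw * f k - hsign * gm * g k \<in> rel_ideal n k {k}" using assms(1) by (rule hrelE)
  obtain f' g' where fg': "compatible f'" "compatible g'" "s' = mk_section f'" "t' = mk_section g'"
    "zvar k ^ Suc tw * f' k - hsign * gm * g' k \<in> rel_ideal n k {k}" using assms(2) by (rule hrelE)
  have "zvar k ^ Suc tw * (f k + f' k) - hsign * gm * (g k + g' k) \<in> rel_ideal n k {k}"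
    using rel_ideal_closed(1)[OF fg(5) fg'(5)] by (simp add: algebra_simps)
  moreover have "gadd n k s s' = mk_section (\<lambda>i. f i + f' i)" "gadd n k t t' = mk_section (\<lambda>i. g i + g' i)"
    using fg fg' by (simp_all add: gadd_mk_section)
  ultimately show ?thesis
    unfolding hrel_def using compatible_add[OF fg(1) fg'(1)] compatible_add[OF fg(2) fg'(2)]
    by (intro exI[of _ "\<lambda>i. f i + f' i"] exI[of _ "\<lambda>i. g i + g' i"]) simp
qed

lemma hrel_mult:
  assumes "hrel s t" "b \<in> gsec r Y"
  shows "hrel (gmult n k b s) (gmult n k b t)"
proof -
  obtain f g where fg: "compatible f" "compatible g" "s = mk_section f" "t = mk_section g"
    "zvar k ^ Suc tw * f k - hsign * gm * g k \<in> rel_ideal n k {k}" using assms(1) by (rule hrelE)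
  obtain p where p: "b = mk_section p" "compatible p" using assms(2) by (rule gsecE)
  have "p k \<in> loc n k {k}" using p(2) by (simp add: compatible_def)
  then have "zvar k ^ Suc tw * (p k * f k) - hsign * gm * (p k * g k) \<in> rel_ideal n k {k}"
    using rel_ideal_closed(3)[OF _ fg(5), of "p k"] by (simp add: algebra_simps)
  moreover have "gmult n k b s = mk_section (\<lambda>i. p i * f i)" "gmult n k b t = mk_section (\<lambda>i. p i * g i)"
    using fg p by (simp_all add: gmult_mk_section)
  ultimately show ?thesis
    unfolding hrel_def using compatible_mult[OF p(2) fg(1)] compatible_mult[OF p(2) fg(2)]
    by (intro exI[of _ "\<lambda>i. p i * f i"] exI[of _ "\<lambda>i. p i * g i"]) simp
qed

text \<open>The constants in \<open>hrel\<close> are fixed by this case. The additional power of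
  \<open>zvar k\<close> clears the denominator of \<open>expl\<close> on \<open>{k}\<close>, the
  factor \<open>(-1) ^ k\<close> is its sign, and \<open>gen_sign\<close> is the sign in
  \<open>generator_ident\<close>.\<close>

lemma hrel_generator:
  assumes w: "w \<in> carrier (ext_module k (n - k))"
  shows "hrel (sec_of (const_fun w)) (gpoly n k (hermite n k (\<lambda>T. gen_sign * w T)))"
proof -
  let ?f = "hermite n k (\<lambda>T. gen_sign * w T)"
  note f = hermite_Sym[OF ext_module_scale[OF w, of gen_sign]]
  have fl: "?f \<in> loc n k {}" using f(1) unfolding sym_divided_carrier by blast
  let ?d = "?f * gm - zvar k ^ tw * (single 0 gen_sign * minor m k w k)"
  have d: "?d \<in> rel_ideal n k {k}"
    using hermite_map_minor[OF f(1), of "{k}"] by (simp add: f(2) minor_scale)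
  have g2: "single 0 gen_sign * (single 0 gen_sign * p) = p" for p :: "'a bipoly"
    by (simp add: mult_single flip: mult.assoc)
  have "zvar k ^ Suc tw * expl m k (const_fun w) {k} {} - hsign * gm * ?f
    = (- 1) ^ k * (zvar k ^ tw * minor m k w k) - hsign * gm * ?f"
  proof -
    have "zvar k ^ Suc tw * ((- 1) ^ k * zinv k * minor m k w k)
      = (- 1) ^ k * (zvar k * zinv k) * (zvar k ^ tw * minor m k w k)"
      by (simp only: power_Suc mult_ac)
    then show ?thesis by (simp add: expl_minor)
  qed
  also have "\<dots> = - hsign * ?d"
    by (simp add: hsign_def algebra_simps g2)
  also have "\<dots> \<in> rel_ideal n k {k}"
    by (intro rel_ideal_closed(3) d loc_ring_closed hsign_loc)
  finally show ?thesis
    unfolding hrel_def sec_of_def gpoly_mk_section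
    using compatible_expl[OF const_fun_ext_y[OF w]] compatible_const[OF fl]
    by (intro exI[of _ "\<lambda>i. expl m k (const_fun w) {i} {}"] exI[of _ "\<lambda>_. ?f"]) simp
qed

text \<open>On the chart \<open>{k}\<close> both \<open>zvar k\<close> and \<open>gm\<close> can be
  cancelled, and both sections are determined there. So \<open>hrel\<close> is the graph of an
  injective partial function.\<close>

lemma hrel_unique:
  assumes "hrel s t" "hrel s' t'"
  shows "s = s' \<longleftrightarrow> t = t'"
proof -
  obtain f g where fg: "compatible f" "compatible g" "s = mk_section f" "t = mk_section g"
    "zvar k ^ Suc tw * f k - hsign * gm * g k \<in> rel_ideal n k {k}" using assms(1) by (rule hrelE)
  obtain f' g' where fg': "compatible f'" "compatible g'" "s' = mk_section f'" "t' = mk_section g'"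
    "zvar k ^ Suc tw * f' k - hsign * gm * g' k \<in> rel_ideal n k {k}" using assms(2) by (rule hrelE)
  have eq_iff: "mk_section p = mk_section q \<longleftrightarrow> p k - q k \<in> rel_ideal n k {k}" if "compatible p" "compatible q"
    for p q :: "nat \<Rightarrow> 'a bipoly"
    using compatible_vanish[OF compatible_diff[OF that]] by (auto simp: mk_section_eq_iff[OF that])
  let ?d = "zvar k ^ Suc tw * (f k - f' k) - hsign * gm * (g k - g' k)"
  have d: "?d \<in> rel_ideal n k {k}"
    using rel_ideal_closed(2)[OF fg(5) fg'(5)] by (simp add: algebra_simps)
  have gl: "g k - g' k \<in> loc n k {k}"
    using fg(2) fg'(2) by (intro ring_subsetD(4)[OF ring_subset_loc]) (simp_all add: compatible_def)
  have "f k - f' k \<in> rel_ideal n k {k} \<longleftrightarrow> g k - g' k \<in> rel_ideal n k {k}"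
  proof
    assume f: "f k - f' k \<in> rel_ideal n k {k}"
    have "hsign * (zvar k ^ Suc tw * (f k - f' k) - ?d) \<in> rel_ideal n k {k}"
      by (rule rel_ideal_closed(3)[OF hsign_loc rel_ideal_closed(2)[OF rel_ideal_closed(3)[OF loc_power[OF zvar_k_loc] f] d]])
    also have "hsign * (zvar k ^ Suc tw * (f k - f' k) - ?d) = (hsign * hsign) * ((g k - g' k) * gm)"
      by (simp only: diff_diff_eq2 add_diff_cancel_left' mult_ac)
    finally have "(g k - g' k) * gm \<in> rel_ideal n k {k}" by (simp add: hsign_square)
    then show "g k - g' k \<in> rel_ideal n k {k}" by (rule gm_cancel[OF _ gl])
  next
    assume g: "g k - g' k \<in> rel_ideal n k {k}"
    have "?d + hsign * gm * (g k - g' k) \<in> rel_ideal n k {k}"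
      by (rule rel_ideal_closed(1)[OF d rel_ideal_closed(3)[OF loc_ring_closed(2)[OF hsign_loc gm_loc(1)] g]])
    then have "zvar k ^ Suc tw * (f k - f' k) \<in> rel_ideal n k {k}" by (simp only: diff_add_cancel)
    then show "f k - f' k \<in> rel_ideal n k {k}" by (rule rel_ideal_cancel_zvar)
  qed
  then show ?thesis by (simp add: fg(3,4) fg'(3,4) eq_iff fg(1,2) fg'(1,2))
qed

lemma gpoly_Sym: "gpoly n k ` Sym = gsec (int tw) (\<lambda>e. e = 0)"
  using gpoly_iso[of tw] by (auto simp: module_iso_def bij_betw_def carrier_M_piece)

lemma hrel_generators:
  shows "v \<in> gsec (- 1) gen_deg \<Longrightarrow> \<exists>t\<in>gsec (int tw) (\<lambda>e. e = 0). hrel v t"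
    and "t \<in> gsec (int tw) (\<lambda>e. e = 0) \<Longrightarrow> \<exists>v\<in>gsec (- 1) gen_deg. hrel v t"
proof -
  assume "v \<in> gsec (- 1) gen_deg"
  then have "v \<in> carrier (M_piece n k (- 1) (int k))" by (simp add: carrier_M_piece)
  then obtain w where w: "w \<in> carrier (ext_module k (n - k))" "v = sec_of (const_fun w)"
    by (rule M_piece_minus_one_cases)
  have "gpoly n k (hermite n k (\<lambda>T. gen_sign * w T)) \<in> gsec (int tw) (\<lambda>e. e = 0)"
    unfolding gpoly_Sym[symmetric] by (rule imageI[OF hermite_Sym(1)[OF ext_module_scale[OF w(1)]]])
  then show "\<exists>t\<in>gsec (int tw) (\<lambda>e. e = 0). hrel v t"
    unfolding w(2) using hrel_generator[OF w(1)] by blast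
next
  assume "t \<in> gsec (int tw) (\<lambda>e. e = 0)"
  then obtain f where f: "f \<in> Sym" "t = gpoly n k f" unfolding gpoly_Sym[symmetric] by (elim imageE) simp
  let ?w = "\<lambda>T. gen_sign * hermite_map k f T"
  have w: "?w \<in> carrier (ext_module k (n - k))"
    using hermite_map_supp[OF f(1)] by (intro ext_module_scale) (simp add: ext_module_carrier)
  have "hermite n k (\<lambda>T. gen_sign * ?w T) = f" by (rule hermite_eqI[OF f(1)]) (simp add: fun_eq_iff)
  then have "hrel (sec_of (const_fun ?w)) t" using hrel_generator[OF w] by (simp add: f(2))
  moreover have "sec_of (const_fun ?w) \<in> gsec (- 1) gen_deg"
    using sec_of_const_fun[OF w] by (simp add: carrier_M_piece)
  ultimately show "\<exists>v\<in>gsec (- 1) gen_deg. hrel v t" by blast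
qed

lemma ygen_transfer:
  assumes "ygen V Q s" and V: "\<And>v. v \<in> V \<Longrightarrow> \<exists>t\<in>V'. hrel v t"
  shows "\<exists>t. ygen V' Q t \<and> hrel s t"
  using assms(1)
proof (induction rule: ygen.induct)
  case ygen_0
  show ?case using ygen.ygen_0 hrel_0 by blast
next
  case (ygen_step v b s)
  obtain t where t: "ygen V' Q t" "hrel s t" using ygen_step.IH by blast
  obtain u where u: "u \<in> V'" "hrel v u" using V[OF ygen_step.hyps(1)] by blast
  show ?case
    using ygen.ygen_step[OF u(1) ygen_step.hyps(2,3) t(1)]
      hrel_add[OF hrel_mult[OF u(2) gpoly_single_y[OF ygen_step.hyps(2)]] t(2)] by blast
qed

lemma ygen_transfer':
  assumes "ygen V' Q t" and V: "\<And>u. u \<in> V' \<Longrightarrow> \<exists>v\<in>V. hrel v u"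
  shows "\<exists>s. ygen V Q s \<and> hrel s t"
  using assms(1)
proof (induction rule: ygen.induct)
  case ygen_0
  show ?case using ygen.ygen_0 hrel_0 by blast
next
  case (ygen_step u b t)
  obtain s where s: "ygen V Q s" "hrel s t" using ygen_step.IH by blast
  obtain v where v: "v \<in> V" "hrel v u" using V[OF ygen_step.hyps(1)] by blast
  show ?case
    using ygen.ygen_step[OF v(1) ygen_step.hyps(2,3) s(1)]
      hrel_add[OF hrel_mult[OF v(2) gpoly_single_y[OF ygen_step.hyps(2)]] s(2)] by blast
qed

lemma hrel_left:
  assumes "s \<in> gsec (- 1) Y" "\<And>d. Y (d + int k) \<Longrightarrow> Z d"
  shows "\<exists>t\<in>gsec (int tw) Z. hrel s t"
proof -
  obtain t where t: "ygen (gsec (int tw) (\<lambda>e. e = 0)) (\<lambda>d. Y (d + int k)) t" "hrel s t"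
    using ygen_transfer[OF gsec_minus_one_ygen[OF assms(1)] hrel_generators(1)] by blast
  have "t \<in> gsec (int tw) Z" by (rule ygen_gsec[OF t(1) order_refl]) (simp add: assms(2))
  with t(2) show ?thesis by blast
qed

lemma hrel_right:
  assumes "t \<in> gsec (int tw) Z" "\<And>d. Z d \<Longrightarrow> Y (d + int k)"
  shows "\<exists>s\<in>gsec (- 1) Y. hrel s t"
proof -
  obtain s where s: "ygen (gsec (- 1) gen_deg) Z s" "hrel s t"
    using ygen_transfer'[OF gsec_nonneg_ygen[OF assms(1)] hrel_generators(2)] by blast
  have "s \<in> gsec (- 1) Y" by (rule ygen_gsec[OF s(1) order_refl]) (simp add: assms(2))
  with s(2) show ?thesis by blast
qed

definition hiso :: "'a::field gsection \<Rightarrow> 'a gsection" where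
  "hiso s = (THE t. hrel s t)"

lemma hiso_eq: "hrel s t \<Longrightarrow> hiso s = t"
  unfolding hiso_def by (rule the_equality) (use hrel_unique in auto)

text \<open>Constant predicates give surjectivity onto the whole module, single degrees the
  compatibility with the gradings shifted by \<open>k\<close>.\<close>

lemma hiso_image:
  assumes "\<And>d. Y (d + int k) \<longleftrightarrow> Z d"
  shows "hiso ` gsec (- 1) Y = (gsec (int tw) Z :: 'a::field gsection set)"
proof
  show "hiso ` gsec (- 1) Y \<subseteq> (gsec (int tw) Z :: 'a gsection set)"
  proof
    fix t :: "'a gsection" assume "t \<in> hiso ` gsec (- 1) Y"
    then obtain s where s: "s \<in> gsec (- 1) Y" "t = hiso s" by blast
    obtain t' where "t' \<in> gsec (int tw) Z" "hrel s t'" using hrel_left[OF s(1), of Z] assms by blast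
    then show "t \<in> gsec (int tw) Z" by (simp add: s(2) hiso_eq)
  qed
  show "(gsec (int tw) Z :: 'a gsection set) \<subseteq> hiso ` gsec (- 1) Y"
  proof
    fix t :: "'a gsection" assume t: "t \<in> gsec (int tw) Z"
    obtain s where s: "s \<in> gsec (- 1) Y" "hrel s t" using hrel_right[OF t, of Y] assms by blast
    show "t \<in> hiso ` gsec (- 1) Y" by (rule image_eqI[where f = hiso, OF hiso_eq[OF s(2), symmetric] s(1)])
  qed
qed

lemma hrel_hiso: "s \<in> gsec (- 1) Y \<Longrightarrow> hrel s (hiso s)"
  using hrel_left[of s Y "\<lambda>_. True"] hiso_eq by auto

theorem hiso_iso:
  "hiso \<in> module_iso (M_module n k (- 1)) (M_module n k (int tw)) (carrier (B_ring n k :: 'a::field gsection ring))"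
proof -
  let ?M = "M_module n k (- 1) :: ('a gsection, 'a gsection) module"
  let ?N = "M_module n k (int tw) :: ('a gsection, 'a gsection) module"
  have rel: "hrel s (hiso s)" if "s \<in> carrier ?M" for s
    using that unfolding carrier_M_module by (rule hrel_hiso)
  have "inj_on hiso (carrier ?M)"
    by (rule inj_onI) (use hrel_unique[OF rel rel] in blast)
  moreover have "hiso ` carrier ?M = carrier ?N"
    unfolding carrier_M_module by (rule hiso_image) simp
  moreover have "hiso (gadd n k s t) = gadd n k (hiso s) (hiso t)" if "s \<in> carrier ?M" "t \<in> carrier ?M" for s t
    by (rule hiso_eq[OF hrel_add[OF rel[OF that(1)] rel[OF that(2)]]])
  moreover have "hiso (gmult n k b s) = gmult n k b (hiso s)"
    if "b \<in> carrier (B_ring n k)" "s \<in> carrier ?M" for b s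
  proof -
    have "b \<in> gsec 0 (\<lambda>_. True)" using that(1) by (simp add: B_ring_def global_sections_eq)
    then show ?thesis by (rule hiso_eq[OF hrel_mult[OF rel[OF that(2)]]])
  qed
  ultimately show ?thesis by (simp add: module_iso_def bij_betw_def M_module_def)
qed

lemma hiso_generators:
  assumes "s \<in> carrier (M_piece n k (- 1) (int k))"
  shows "hiso s = gpoly n k (hermite n k (generator_ident n k s))"
  using assms
proof (rule M_piece_minus_one_cases)
  fix w assume w: "w \<in> carrier (ext_module k (n - k))" "s = sec_of (const_fun w)"
  show ?thesis unfolding w(2) generator_ident_sec_of[OF w(1)] by (rule hiso_eq[OF hrel_generator[OF w(1)]])
qed

end

section \<open>Generation in a single degree\<close>

context secant begin

text \<open>The forms \<open>L_j\<close> are homogeneous of y-degree 1, so the ideal contains the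
  graded parts of its elements.\<close>

lemma rel_ideal_y_part:
  assumes "p \<in> rel_ideal n k I"
  shows "mono_part {u. deg_y (snd u) = e} p \<in> rel_ideal n k I"
proof -
  from assms obtain a where p: "p = (\<Sum>j<m. a j * lin_form k j)" and a: "\<forall>j<m. a j \<in> loc n k I"
    unfolding rel_ideal_eq[OF kn] by (rule ideal_spanE)
  have "mono_part {u. deg_y (snd u) = e} (a j * lin_form k j) = mono_part {u. deg_y (snd u) = e - 1} (a j) * lin_form k j" for j
  proof -
    have "v + u \<in> {u. deg_y (snd u) = e} \<longleftrightarrow> u \<in> {u. deg_y (snd u) = e - 1}"
      if "v \<in> keys (lin_form k j :: 'a bipoly)" for u v
      using that by (elim keys_lin_formE) (auto simp: deg_y_add)
    then show ?thesis
      using mono_part_mult[of "lin_form k j" "a j" "{u. deg_y (snd u) = e}" "{u. deg_y (snd u) = e - 1}"]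
      by (simp add: mult.commute)
  qed
  then have "mono_part {u. deg_y (snd u) = e} p = (\<Sum>j<m. mono_part {u. deg_y (snd u) = e - 1} (a j) * lin_form k j)"
    by (simp add: p mono_part_sum del: sum.lessThan_Suc)
  also have "\<dots> \<in> rel_ideal n k I"
    unfolding rel_ideal_eq[OF kn]
    by (rule ideal_spanI) (use a in \<open>auto simp: loc_iff keys_mono_part\<close>)
  finally show ?thesis .
qed

text \<open>Comparing the parts of y-degree \<open>e\<close> of the representatives on each chart
  removes \<open>h\<close>. This shows that generators stay independent modulo higher
  degrees.\<close>

lemma gsec_graded_inj:
  assumes s: "s \<in> gsec r (\<lambda>d. d = e)" and t: "t \<in> gsec r (\<lambda>d. d = e)" and h: "h \<in> gsec r (\<lambda>d. d > e)"
    and eq: "s = gadd n k h t"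
  shows "s = t"
proof -
  obtain f where f: "s = mk_section f" "compatible f" "\<forall>i\<le>k. keys (f i) \<subseteq> term_keys r (\<lambda>d. d = e) 0" using s by (rule gsecE)
  obtain g where g: "t = mk_section g" "compatible g" "\<forall>i\<le>k. keys (g i) \<subseteq> term_keys r (\<lambda>d. d = e) 0" using t by (rule gsecE)
  obtain p where p: "h = mk_section p" "compatible p" "\<forall>i\<le>k. keys (p i) \<subseteq> term_keys r (\<lambda>d. d > e) 0" using h by (rule gsecE)
  have rel: "f i - (p i + g i) \<in> rel_ideal n k {i}" if "i \<le> k" for i
    using eq that unfolding f(1) g(1) p(1) gadd_mk_section[OF p(2) g(2)]
      mk_section_eq_iff[OF f(2) compatible_add[OF p(2) g(2)]] by blast
  have "f i - g i \<in> rel_ideal n k {i}" if i: "i \<le> k" for i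
  proof -
    let ?U = "{u. deg_y (snd u) = e}"
    have "mono_part ?U (f i) = f i" "mono_part ?U (g i) = g i"
      using f(3) g(3) i by (auto intro!: mono_part_id simp: term_keys_def)
    moreover have "mono_part ?U (p i) = 0"
      using p(3) i by (intro mono_part_eq_0) (auto simp: term_keys_def)
    ultimately have "mono_part ?U (f i - (p i + g i)) = f i - g i"
      by (simp add: mono_part_diff mono_part_add)
    with rel_ideal_y_part[OF rel[OF i], of e] show ?thesis by simp
  qed
  then show ?thesis unfolding f(1) g(1) using mk_section_eq_iff[OF f(2) g(2)] by blast
qed

lemma gsec_subset: "gsec r Y \<subseteq> gsec r (\<lambda>_. True)"
  using gsec_mono[of _ r Y "\<lambda>_. True"] by auto

lemma gsec_uminus:
  assumes "s \<in> gsec r Y"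
  shows "\<ominus>\<^bsub>M_module n k r\<^esub> s \<in> gsec r (Y :: int \<Rightarrow> bool)"
proof -
  obtain f where f: "s = mk_section f" "compatible f" "\<forall>i\<le>k. keys (f i) \<subseteq> term_keys r Y 0"
    using assms by (rule gsecE)
  interpret module "B_ring n k" "M_module n k r" by (rule M_module_module[OF kn])
  have c: "compatible (\<lambda>i. - f i)"
    using compatible_diff[OF compatible_const[OF loc_ring_closed(4)] f(2)] by simp
  have t: "mk_section (\<lambda>i. - f i) \<in> gsec r Y"
    by (rule gsecI[OF c]) (use f(3) in simp)
  have "mk_section (\<lambda>i. - f i) \<in> carrier (M_module n k r)" "s \<in> carrier (M_module n k r)"
    unfolding carrier_M_module by (rule subsetD[OF gsec_subset t], rule subsetD[OF gsec_subset assms])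
  moreover have "mk_section (\<lambda>i. - f i) \<oplus>\<^bsub>M_module n k r\<^esub> s = \<zero>\<^bsub>M_module n k r\<^esub>"
    by (simp add: M_module_def f(1) gadd_mk_section[OF c f(2)] gpoly_mk_section)
  ultimately have "\<ominus>\<^bsub>M_module n k r\<^esub> s = mk_section (\<lambda>i. - f i)" using minus_equality by blast
  with t show ?thesis by simp
qed

lemma carrier_B_ring: "carrier (B_ring n k) = gsec 0 (\<lambda>d. d \<ge> 0)"
proof -
  have "term_keys 0 (\<lambda>d. d \<ge> 0) 0 = term_keys 0 (\<lambda>_. True) 0" by (auto simp: term_keys_def deg_y_nonneg)
  then show ?thesis by (simp add: B_ring_def global_sections_eq gsec_def)
qed

lemma gsec_submodule:
  "submodule (gsec r (\<lambda>d. d > e)) (B_ring n k) (M_module n k r)"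
proof -
  interpret module "B_ring n k" "M_module n k r" by (rule M_module_module[OF kn])
  show ?thesis
  proof (rule submoduleI)
    show "gsec r (\<lambda>d. d > e) \<subseteq> carrier (M_module n k r)"
      unfolding carrier_M_module by (rule gsec_subset)
    show "\<zero>\<^bsub>M_module n k r\<^esub> \<in> gsec r (\<lambda>d. d > e)" by (simp add: M_module_def gsec_0)
    show "\<ominus>\<^bsub>M_module n k r\<^esub> a \<in> gsec r (\<lambda>d. d > e)" if "a \<in> gsec r (\<lambda>d. d > e)" for a
      by (rule gsec_uminus[OF that])
    show "a \<oplus>\<^bsub>M_module n k r\<^esub> b \<in> gsec r (\<lambda>d. d > e)" if "a \<in> gsec r (\<lambda>d. d > e)" "b \<in> gsec r (\<lambda>d. d > e)" for a b
      using gsec_add[OF that] by (simp add: M_module_def)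
    show "b \<odot>\<^bsub>M_module n k r\<^esub> s \<in> gsec r (\<lambda>d. d > e)" if "b \<in> carrier (B_ring n k)" "s \<in> gsec r (\<lambda>d. d > e)" for b s
      using gsec_mult[OF that(1)[unfolded carrier_B_ring] that(2), of "\<lambda>d. d > e"] by (simp add: M_module_def)
  qed
qed

text \<open>The assumption alone suffices: it bounds all y-degrees below by \<open>e\<close>, so
  that the irrelevant part lies in degrees above \<open>e\<close> and meets the generators
  trivially, and it splits every section into a generator and an element of the irrelevant
  part.\<close>

lemma generated_in_degreeI:
  assumes gen: "\<And>s. s \<in> gsec r (\<lambda>_. True) \<Longrightarrow> ygen (gsec r (\<lambda>d. d = e)) (\<lambda>_. True) (s :: 'a::field gsection)"
  shows "generated_in_degree TYPE('a) n k r e"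
proof -
  let ?M = "M_module n k r :: ('a gsection, 'a gsection) module" and ?B = "B_ring n k :: 'a gsection ring"
  let ?V = "gsec r (\<lambda>d. d = e) :: 'a gsection set"
  define H where "H = (irrelevant_part n k r :: 'a gsection set)"
  define G where "G = {gmult n k b s | b s d. d > 0 \<and> b \<in> carrier (M_piece n k 0 d) \<and> s \<in> (global_sections n k r :: 'a gsection set)}"
  interpret M: module ?B ?M by (rule M_module_module[OF kn])
  have VM: "?V \<subseteq> carrier ?M" unfolding carrier_M_module by (rule gsec_subset)
  have B: "gpoly n k (single (0, b) 1) \<in> carrier ?B" if "keys b \<subseteq> {0..n}" for b
    using gpoly_single_y[OF that] unfolding carrier_B_ring by (rule gsec_mono) (simp add: deg_y_nonneg)
  have M_ops: "gadd n k = add ?M" "gmult n k = smult ?M" "gpoly n k 0 = zero ?M" by (simp_all add: M_module_def)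
  have span: "module_span ?B ?M ?V = carrier ?M"
  proof
    show "module_span ?B ?M ?V \<subseteq> carrier ?M"
      unfolding module_span_def using M.carrier_is_submodule VM by blast
    have "s \<in> N" if s: "s \<in> carrier ?M" and N: "submodule N ?B ?M" "?V \<subseteq> N" for s N
    proof -
      have "ygen ?V (\<lambda>_. True) s" using s gen unfolding carrier_M_module by blast
      then show ?thesis
      proof (induction rule: ygen.induct)
        case ygen_0
        show ?case unfolding M_ops using subgroup.one_closed[OF submodule.axioms(1)[OF N(1)]] by simp
      next
        case (ygen_step v b s)
        have "v \<in> N" using ygen_step.hyps(1) N(2) by blast
        then show ?case
          unfolding M_ops
          by (intro M.submoduleE(5)[OF N(1)] M.submoduleE(4)[OF N(1)] B ygen_step.hyps(2) ygen_step.IH)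
      qed
    qed
    then show "carrier ?M \<subseteq> module_span ?B ?M ?V" unfolding module_span_def by blast
  qed
  have H_sub: "H \<subseteq> gsec r (\<lambda>d. d > e)"
  proof -
    have "x \<in> gsec r (\<lambda>d. d > e)" if x: "x \<in> G" for x
    proof -
      obtain b s d where x: "x = gmult n k b s" "d > 0" "b \<in> gsec 0 (\<lambda>e. e = d)" "s \<in> gsec r (\<lambda>_. True)"
        using x unfolding G_def carrier_M_piece global_sections_eq by blast
      have "s \<in> gsec r (\<lambda>d. d \<ge> e)" by (rule ygen_gsec[OF gen[OF x(4)] order_refl]) simp
      from gsec_mult[OF x(3) this, of "\<lambda>d. d > e"] show ?thesis using x(1,2) by simp
    qed
    then have "G \<subseteq> gsec r (\<lambda>d. d > e)" by blast
    then show ?thesis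
      unfolding H_def irrelevant_part_def module_span_def G_def[symmetric] using gsec_submodule by blast
  qed
  have H: "submodule H ?B ?M"
  proof (rule M.submoduleI)
    have mem: "x \<in> H \<longleftrightarrow> (\<forall>N. submodule N ?B ?M \<and> G \<subseteq> N \<longrightarrow> x \<in> N)" for x
      unfolding H_def irrelevant_part_def module_span_def G_def[symmetric] by blast
    show "H \<subseteq> carrier ?M" unfolding carrier_M_module by (rule order_trans[OF H_sub gsec_subset])
    show "\<zero>\<^bsub>?M\<^esub> \<in> H"
      unfolding mem using subgroup.one_closed[OF submodule.axioms(1)] by fastforce
    show "\<ominus>\<^bsub>?M\<^esub> a \<in> H" if "a \<in> H" for a using that M.submoduleE(3) unfolding mem by blast
    show "a \<oplus>\<^bsub>?M\<^esub> b \<in> H" if "a \<in> H" "b \<in> H" for a b using that M.submoduleE(5) unfolding mem by blast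
    show "b \<odot>\<^bsub>?M\<^esub> a \<in> H" if "b \<in> carrier ?B" "a \<in> H" for a b using that M.submoduleE(4) unfolding mem by blast
  qed
  have G_H: "G \<subseteq> H"
    unfolding H_def irrelevant_part_def module_span_def G_def[symmetric] by blast
  have HM: "H \<subseteq> carrier ?M" by (rule M.submoduleE(1)[OF H])
  have H0: "\<zero>\<^bsub>?M\<^esub> \<in> H" using subgroup.one_closed[OF submodule.axioms(1)[OF H]] by simp
  have coset: "H +>\<^bsub>?M\<^esub> s = {h \<oplus>\<^bsub>?M\<^esub> s | h. h \<in> H}" for s by (auto simp: a_r_coset_def')
  have inj: "inj_on (\<lambda>s. H +>\<^bsub>?M\<^esub> s) ?V"
  proof (rule inj_onI)
    fix s t assume s: "s \<in> ?V" and t: "t \<in> ?V" and eq: "H +>\<^bsub>?M\<^esub> s = H +>\<^bsub>?M\<^esub> t"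
    have "\<zero>\<^bsub>?M\<^esub> \<oplus>\<^bsub>?M\<^esub> s \<in> H +>\<^bsub>?M\<^esub> s" using H0 unfolding coset by blast
    then have "s \<in> H +>\<^bsub>?M\<^esub> t" using s VM unfolding eq by (simp add: subsetD)
    then obtain h where h: "h \<in> H" "s = gadd n k h t" unfolding coset M_ops by blast
    show "s = t" by (rule gsec_graded_inj[OF s t _ h(2)]) (use h(1) H_sub in blast)
  qed
  have decomp: "\<exists>v\<in>?V. \<exists>h\<in>H. s = h \<oplus>\<^bsub>?M\<^esub> v" if s: "s \<in> carrier ?M" for s
  proof -
    have "ygen ?V (\<lambda>_. True) s" using s gen unfolding carrier_M_module by blast
    then show ?thesis
    proof (induction rule: ygen.induct)
      case ygen_0
      have "gpoly n k 0 = \<zero>\<^bsub>?M\<^esub> \<oplus>\<^bsub>?M\<^esub> gpoly n k 0" unfolding M_ops by simp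
      then show ?case using gsec_0 H0 by blast
    next
      case (ygen_step v b s)
      let ?y = "gpoly n k (single (0, b) 1)"
      obtain w h where w: "w \<in> ?V" "h \<in> H" "s = h \<oplus>\<^bsub>?M\<^esub> w" using ygen_step.IH by blast
      have c: "v \<in> carrier ?M" "w \<in> carrier ?M" "h \<in> carrier ?M" using ygen_step.hyps(1) w VM HM by blast+
      show ?case
      \<comment> \<open>A summand with trivial monomial is a generator and joins \<open>w\<close>;
        every other summand has a coefficient of positive degree and joins \<open>h\<close>.\<close>
      proof (cases "b = 0")
        case True
        have "?y = one ?B" by (simp add: True B_ring_def flip: zero_prod_def)
        then have "gadd n k (gmult n k ?y v) s = h \<oplus>\<^bsub>?M\<^esub> (v \<oplus>\<^bsub>?M\<^esub> w)"
          unfolding M_ops w(3) using c by (simp add: M.a_lcomm)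
        moreover have "v \<oplus>\<^bsub>?M\<^esub> w \<in> ?V"
          using gsec_add[OF ygen_step.hyps(1) w(1)] by (simp add: M_ops)
        ultimately show ?thesis using w(2) by blast
      next
        case False
        then have "deg_y b > 0" using deg_y_nonneg[of b] deg_y_eq_0_iff[of b] by linarith
        moreover have "?y \<in> carrier (M_piece n k 0 (deg_y b))"
          unfolding carrier_M_piece by (rule gpoly_single_y[OF ygen_step.hyps(2)])
        moreover have "v \<in> global_sections n k r" using c(1) by (simp add: M_module_def)
        ultimately have y: "gmult n k ?y v \<in> H" using G_H unfolding G_def by blast
        then have "gadd n k (gmult n k ?y v) s = (gmult n k ?y v \<oplus>\<^bsub>?M\<^esub> h) \<oplus>\<^bsub>?M\<^esub> w"
          unfolding w(3) using c HM by (simp add: M_ops M.a_assoc subsetD)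
        moreover have "gmult n k ?y v \<oplus>\<^bsub>?M\<^esub> h \<in> H" by (rule M.submoduleE(5)[OF H y w(2)])
        ultimately show ?thesis using w(1) by blast
      qed
    qed
  qed
  have "(\<lambda>s. H +>\<^bsub>?M\<^esub> s) ` ?V = a_rcosets\<^bsub>?M\<^esub> H"
  proof
    show "(\<lambda>s. H +>\<^bsub>?M\<^esub> s) ` ?V \<subseteq> a_rcosets\<^bsub>?M\<^esub> H"
      using VM unfolding A_RCOSETS_def' a_r_coset_def' by blast
    show "a_rcosets\<^bsub>?M\<^esub> H \<subseteq> (\<lambda>s. H +>\<^bsub>?M\<^esub> s) ` ?V"
    proof
      fix X assume "X \<in> a_rcosets\<^bsub>?M\<^esub> H"
      then obtain s where s: "s \<in> carrier ?M" "X = H +>\<^bsub>?M\<^esub> s"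
        unfolding A_RCOSETS_def' coset by (auto simp: coset)
      obtain v h where v: "v \<in> ?V" "h \<in> H" "s = h \<oplus>\<^bsub>?M\<^esub> v" using decomp[OF s(1)] by blast
      have c: "v \<in> carrier ?M" "h \<in> carrier ?M" using v VM HM by blast+
      have "H +>\<^bsub>?M\<^esub> s = H +>\<^bsub>?M\<^esub> v"
      proof
        show "H +>\<^bsub>?M\<^esub> s \<subseteq> H +>\<^bsub>?M\<^esub> v"
        proof
          fix x assume "x \<in> H +>\<^bsub>?M\<^esub> s"
          then obtain h' where h': "h' \<in> H" "x = h' \<oplus>\<^bsub>?M\<^esub> s" unfolding coset by blast
          have "x = (h' \<oplus>\<^bsub>?M\<^esub> h) \<oplus>\<^bsub>?M\<^esub> v" using h' HM c by (simp add: v(3) M.a_assoc subsetD)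
          then show "x \<in> H +>\<^bsub>?M\<^esub> v" unfolding coset using M.submoduleE(5)[OF H h'(1) v(2)] by blast
        qed
        show "H +>\<^bsub>?M\<^esub> v \<subseteq> H +>\<^bsub>?M\<^esub> s"
        proof
          fix x assume "x \<in> H +>\<^bsub>?M\<^esub> v"
          then obtain h' where h': "h' \<in> H" "x = h' \<oplus>\<^bsub>?M\<^esub> v" unfolding coset by blast
          have m: "\<ominus>\<^bsub>?M\<^esub> h \<in> H" by (rule M.submoduleE(3)[OF H v(2)])
          have "h' \<in> carrier ?M" using h'(1) HM by blast
          then have "x = (h' \<oplus>\<^bsub>?M\<^esub> \<ominus>\<^bsub>?M\<^esub> h) \<oplus>\<^bsub>?M\<^esub> s"
            using c by (simp add: h'(2) v(3) M.a_assoc M.r_neg1)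
          then show "x \<in> H +>\<^bsub>?M\<^esub> s" unfolding coset using M.submoduleE(5)[OF H h'(1) m] by blast
        qed
      qed
      with v(1) s(2) show "X \<in> (\<lambda>s. H +>\<^bsub>?M\<^esub> s) ` ?V" by blast
    qed
  qed
  with inj have "bij_betw (\<lambda>s. H +>\<^bsub>?M\<^esub> s) ?V (a_rcosets\<^bsub>?M\<^esub> H)" by (simp add: bij_betw_def)
  with span show ?thesis
    unfolding generated_in_degree_def Let_def carrier_M_piece H_def by blast
qed

end

theorem theorem5p1:
  fixes n k :: nat
  assumes "1 \<le> k" and "2 * k \<le> n + 1"
  shows
    "generated_in_degree TYPE('a::alg_closed_field) n k (- 1) (int k)
   \<and> generated_in_degree TYPE('a) n k (int (n + 1 - 2 * k)) 0
   \<and> (\<forall>s \<in> carrier (M_piece n k (- 1) (int k) :: ('a, 'a gsection) module).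
        \<exists>!w. generator_rel n k s w)
   \<and> generator_ident n k \<in>
       module_iso (M_piece n k (- 1) (int k)) (ext_module k (n - k)) (UNIV :: 'a set)
   \<and> gpoly n k \<in>
       module_iso (sym_divided_module k (n + 1 - 2 * k)) (M_piece n k (int (n + 1 - 2 * k)) 0)
         (UNIV :: 'a set)
   \<and> hermite n k \<in>
       module_iso (ext_module k (n - k)) (sym_divided_module k (n + 1 - 2 * k)) (UNIV :: 'a set)
   \<and> (\<exists>\<phi> \<in> module_iso (M_module n k (- 1)) (M_module n k (int (n + 1 - 2 * k)))
            (carrier (B_ring n k :: 'a gsection ring)).
        (\<forall>d. \<phi> ` carrier (M_piece n k (- 1) (d + int k))
               = carrier (M_piece n k (int (n + 1 - 2 * k)) d))
      \<and> (\<forall>s \<in> carrier (M_piece n k (- 1) (int k)).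
            \<phi> s = gpoly n k (hermite n k (generator_ident n k s))))"
proof -
  interpret secant n k using assms by unfold_locales
  note q = tw_def[symmetric]
  show ?thesis
  proof (intro conjI)
    show "generated_in_degree TYPE('a) n k (- 1) (int k)"
      by (rule generated_in_degreeI) (rule gsec_minus_one_ygen)
    show "generated_in_degree TYPE('a) n k (int (n + 1 - 2 * k)) 0"
      by (rule generated_in_degreeI) (rule gsec_nonneg_ygen)
    show "\<forall>s \<in> carrier (M_piece n k (- 1) (int k) :: ('a, 'a gsection) module). \<exists>!w. generator_rel n k s w"
      using generator_rel_ex1 by blast
    show "\<exists>\<phi> \<in> module_iso (M_module n k (- 1)) (M_module n k (int (n + 1 - 2 * k)))
            (carrier (B_ring n k :: 'a gsection ring)).
        (\<forall>d. \<phi> ` carrier (M_piece n k (- 1) (d + int k))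
               = carrier (M_piece n k (int (n + 1 - 2 * k)) d))
      \<and> (\<forall>s \<in> carrier (M_piece n k (- 1) (int k)).
            \<phi> s = gpoly n k (hermite n k (generator_ident n k s)))"
      unfolding q
    proof (intro bexI[OF _ hiso_iso] conjI allI ballI)
      show "hiso ` carrier (M_piece n k (- 1) (d + int k)) = carrier (M_piece n k (int tw) d)" for d
        unfolding carrier_M_piece by (rule hiso_image) simp
      show "hiso s = gpoly n k (hermite n k (generator_ident n k s))" if "s \<in> carrier (M_piece n k (- 1) (int k))" for s
        by (rule hiso_generators[OF that])
    qed
  qed (rule generator_ident_iso gpoly_iso hermite_iso)+
qed

end
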